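(* Assume conditions (C1), (C2), (C3) stated in the context hold. Under the null hypothesis $H_0:\ \psi_{ij}=0$ for all $1\le i<j\le n$, for every $t\in\mathbb R$, as $(n,p)\to\infty$, $$\mathbb P\big(\hat T_{n,p}-4\log n+\log\log n\le t\big)\to\exp\Big(-\frac1{\sqrt{8\pi}}\exp\Big(-\frac t2\Big)\Big).$$
   Context: Setting: $p=p_n$, and all parameters may depend on $n,p$. The $p\times n$ data matrix $\mathbf X=(\boldsymbol X_1,\ldots,\boldsymbol X_n)$ with columns $\boldsymbol X_i=(X_{i1},\ldots,X_{ip})'$ is matrix-variate normal, $\mathbf X\sim N(\boldsymbol\mu\mathbf 1',\boldsymbol\Sigma\otimes\boldsymbol\Psi)$, meaning $\mathrm{vec}(\mathbf X')\sim N(\mathrm{vec}(\mathbf 1\boldsymbol\mu'),\boldsymbol\Sigma\otimes\boldsymbol\Psi)$; equivalently the $X_{ik}$ are jointly Gaussian with $\mathbb E X_{ik}=\mu_k$ and $\mathrm{Cov}(X_{ik},X_{jl})=\psi_{ij}\sigma_{kl}$. Here $\boldsymbol\Sigma=(\sigma_{kl})_{p\times p}$ and $\boldsymbol\Psi=(\psi_{ij})_{n\times n}$ are covariance matrices with $\psi_{ii}=1$ for all $i$. Constants do not depend on $n,p$. $\|\cdot\|_{\mathrm F}$ is the Frobenius norm, $a\wedge b=\min(a,b)$. Conditions: (C1) $c^{-1}\le\lambda_{\min}(\boldsymbol\Sigma)\le\lambda_{\max}(\boldsymbol\Sigma)\le c$ and $c^{-1}\le\lambda_{\min}(\boldsymbol\Psi)\le\lambda_{\max}(\boldsymbol\Psi)\le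 c$ for some constant $c>0$. (C2) For some $0<\tau<2$ and a constant $C$, $\sum_{k=1}^n|\psi_{ik}|^\tau\le C$ for all $1\le i\le n$ and $\sum_{k=1}^p|\sigma_{jk}|^\tau\le C$ for all $1\le j\le p$. (C3) $p>cn$ for some constant $c>0$, and $p=\exp(o(n^\gamma))$ with $\gamma=(1-\epsilon)\wedge(\frac2\tau-1)$ for some $\epsilon>0$ (with $\tau$ from (C2)). Test statistic: $\bar X_k=\frac1n\sum_{i=1}^nX_{ik}$; $\hat\psi_{ij}=\frac1p\sum_{k=1}^p(X_{ik}-\bar X_k)(X_{jk}-\bar X_k)$ for $1\le i,j\le n$; $\hat\sigma_{ij}=\frac1{n-1}\sum_{k=1}^n(X_{ki}-\bar X_i)(X_{kj}-\bar X_j)$ and $\hat\rho_{ij}=\hat\sigma_{ij}/\sqrt{\hat\sigma_{ii}\hat\sigma_{jj}}$ for $1\le i,j\le p$; $\hat{\boldsymbol\Sigma}=(\hat\sigma_{ij})_{p\times p}$; $\hat{\boldsymbol\Psi}=\big(\frac{p}{\mathrm{tr}(\hat{\boldsymbol\Sigma})}\hat\psi_{ij}\big)_{n\times n}$; $\hat B_n=\frac1n\big(\|\hat{\boldsymbol\Psi}\|_{\mathrm F}^2-\frac1p(\mathrm{tr}(\hat{\boldsymbol\Psi}))^2\big)$. Fix any constant $\delta_0>\sqrt2$; $\hat{\boldsymbol\Sigma}_{thr}=(\hat\sigma_{ij,thr})_{p\times p}$ has $\hat\sigma_{ii,thr}=\hat\sigma_{ii}$ and, for $i\ne j$, $\hat\sigma_{ij,thr}=\hat\sigma_{ij}\,I\big\{\frac{|\hat\rho_{ij}|}{1-\hat\rho_{ij}^2}\ge\delta_0\sqrt{\frac{\hat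 B_n\log p}{n}}\big\}$. Set $\hat A_p=\frac{p\|\hat{\boldsymbol\Sigma}_{thr}\|_{\mathrm F}^2}{(\mathrm{tr}(\hat{\boldsymbol\Sigma}_{thr}))^2}$, $T_{ij}=\hat\psi_{ij}+\frac1{np}\sum_{k=1}^p\hat\sigma_{kk}$ and $$\hat T_{n,p}=\frac{p}{\hat A_p}\max_{1\le i<j\le n}\frac{T_{ij}^2}{\hat\psi_{ii}\hat\psi_{jj}}.$$ *)

theory Defs
  imports "HOL-Probability.Probability" "HOL-Library.Landau_Symbols"
    "Jordan_Normal_Form.Spectral_Radius"
begin

text \<open>Indices are 0-based: observations \<open>i < n\<close>, coordinates \<open>k < p\<close>.\<close>

subsection \<open>Matrices\<close>

definition covariance_matrix :: "nat \<Rightarrow> real mat \<Rightarrow> bool" where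
  "covariance_matrix m A \<longleftrightarrow> A \<in> carrier_mat m m \<and> transpose_mat A = A \<and>
     (\<forall>v \<in> carrier_vec m. 0 \<le> scalar_prod v (A *\<^sub>v v))"

definition lambda_min :: "real mat \<Rightarrow> real" where
  "lambda_min A = Min (spectrum A)"

definition lambda_max :: "real mat \<Rightarrow> real" where
  "lambda_max A = Max (spectrum A)"

definition mat_trace :: "real mat \<Rightarrow> real" where
  "mat_trace A = (\<Sum>i<dim_row A. A $$ (i, i))"

definition frobenius_norm :: "real mat \<Rightarrow> real" where
  "frobenius_norm A = sqrt (\<Sum>i<dim_row A. \<Sum>j<dim_col A. (A $$ (i, j))\<^sup>2)"

subsection \<open>Gaussian random matrices\<close>

definition covariance :: "'w measure \<Rightarrow> ('w \<Rightarrow> real) \<Rightarrow> ('w \<Rightarrow> real) \<Rightarrow> real" where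
  "covariance M Y Z = (LINT \<omega>|M.
     (Y \<omega> - (LINT \<omega>'|M. Y \<omega>')) * (Z \<omega> - (LINT \<omega>'|M. Z \<omega>')))"

text \<open>Point masses count as normal, with variance 0.\<close>

definition normal_variable :: "'w measure \<Rightarrow> ('w \<Rightarrow> real) \<Rightarrow> bool" where
  "normal_variable M Y \<longleftrightarrow> Y \<in> borel_measurable M \<and>
     ((\<exists>m. AE \<omega> in M. Y \<omega> = m) \<or>
      (\<exists>m s. 0 < s \<and> distributed M lborel Y (\<lambda>x. ennreal (normal_density m s x))))"

definition jointly_gaussian :: "'w measure \<Rightarrow> 'i set \<Rightarrow> ('i \<Rightarrow> 'w \<Rightarrow> real) \<Rightarrow> bool" where
  "jointly_gaussian M I Y \<longleftrightarrow> (\<forall>a. normal_variable M (\<lambda>\<omega>. \<Sum>i\<in>I. a i * Y i \<omega>))"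

text \<open>\<open>X \<sim> N(\<mu> 1', \<Sigma> \<otimes> \<Psi>)\<close> for a random \<open>p \<times> n\<close> matrix, the columns being the observations;
  the entry \<open>X\<^sub>i\<^sub>k\<close> (coordinate \<open>k\<close> of observation \<open>i\<close>) is therefore \<open>X \<omega> $$ (k, i)\<close>.\<close>

definition matrix_normal ::
  "'w measure \<Rightarrow> nat \<Rightarrow> nat \<Rightarrow> ('w \<Rightarrow> real mat) \<Rightarrow> (nat \<Rightarrow> real) \<Rightarrow> real mat \<Rightarrow> real mat \<Rightarrow> bool"
where
  "matrix_normal M p n X \<mu> \<Sigma> \<Psi> \<longleftrightarrow>
     (\<forall>\<omega>\<in>space M. X \<omega> \<in> carrier_mat p n) \<and>
     jointly_gaussian M ({..<p} \<times> {..<n}) (\<lambda>q \<omega>. X \<omega> $$ q) \<and>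
     (\<forall>k<p. \<forall>i<n. (LINT \<omega>|M. X \<omega> $$ (k, i)) = \<mu> k) \<and>
     (\<forall>k<p. \<forall>l<p. \<forall>i<n. \<forall>j<n.
        covariance M (\<lambda>\<omega>. X \<omega> $$ (k, i)) (\<lambda>\<omega>. X \<omega> $$ (l, j)) = \<Psi> $$ (i, j) * \<Sigma> $$ (k, l))"

subsection \<open>The test statistic, as a function of the data matrix\<close>

definition sample_mean :: "real mat \<Rightarrow> nat \<Rightarrow> real" where
  "sample_mean x k = (\<Sum>i<dim_col x. x $$ (k, i)) / real (dim_col x)"

definition psi_hat :: "real mat \<Rightarrow> nat \<Rightarrow> nat \<Rightarrow> real" where
  "psi_hat x i j = (\<Sum>k<dim_row x.
     (x $$ (k, i) - sample_mean x k) * (x $$ (k, j) - sample_mean x k)) / real (dim_row x)"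

definition sigma_hat :: "real mat \<Rightarrow> nat \<Rightarrow> nat \<Rightarrow> real" where
  "sigma_hat x i j = (\<Sum>k<dim_col x.
     (x $$ (i, k) - sample_mean x i) * (x $$ (j, k) - sample_mean x j)) / (real (dim_col x) - 1)"

definition rho_hat :: "real mat \<Rightarrow> nat \<Rightarrow> nat \<Rightarrow> real" where
  "rho_hat x i j = sigma_hat x i j / sqrt (sigma_hat x i i * sigma_hat x j j)"

definition Sigma_hat :: "real mat \<Rightarrow> real mat" where
  "Sigma_hat x = mat (dim_row x) (dim_row x) (\<lambda>(i, j). sigma_hat x i j)"

definition Psi_hat :: "real mat \<Rightarrow> real mat" where
  "Psi_hat x = mat (dim_col x) (dim_col x)
     (\<lambda>(i, j). real (dim_row x) / mat_trace (Sigma_hat x) * psi_hat x i j)"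

definition B_hat :: "real mat \<Rightarrow> real" where
  "B_hat x = ((frobenius_norm (Psi_hat x))\<^sup>2 - (mat_trace (Psi_hat x))\<^sup>2 / real (dim_row x))
     / real (dim_col x)"

text \<open>Degenerate values follow the HOL conventions: \<open>B_hat x < 0\<close> gives a negative
  threshold, and a sample correlation of modulus 1 gives \<open>1 / 0 = 0\<close>.\<close>

definition Sigma_hat_thr :: "real \<Rightarrow> real mat \<Rightarrow> real mat" where
  "Sigma_hat_thr \<delta>\<^sub>0 x = mat (dim_row x) (dim_row x) (\<lambda>(i, j).
     if i = j \<or> \<bar>rho_hat x i j\<bar> / (1 - (rho_hat x i j)\<^sup>2)
                  \<ge> \<delta>\<^sub>0 * sqrt (B_hat x * ln (real (dim_row x)) / real (dim_col x))
     then sigma_hat x i j else 0)"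

definition A_hat :: "real \<Rightarrow> real mat \<Rightarrow> real" where
  "A_hat \<delta>\<^sub>0 x = real (dim_row x) * (frobenius_norm (Sigma_hat_thr \<delta>\<^sub>0 x))\<^sup>2
     / (mat_trace (Sigma_hat_thr \<delta>\<^sub>0 x))\<^sup>2"

definition T_entry :: "real mat \<Rightarrow> nat \<Rightarrow> nat \<Rightarrow> real" where
  "T_entry x i j = psi_hat x i j
     + (\<Sum>k<dim_row x. sigma_hat x k k) / (real (dim_col x) * real (dim_row x))"

definition T_hat :: "real \<Rightarrow> real mat \<Rightarrow> real" where
  "T_hat \<delta>\<^sub>0 x = real (dim_row x) / A_hat \<delta>\<^sub>0 x *
     Max ((\<lambda>(i, j). (T_entry x i j)\<^sup>2 / (psi_hat x i i * psi_hat x j j))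
            ` {(i, j). i < j \<and> j < dim_col x})"

end

theory Submission
  imports Defs "HOL-Real_Asymp.Real_Asymp"
begin

text \<open>
  Under the null hypothesis the columns of \<open>X - \<mu> 1'\<close> are independent \<open>N(0, \<Sigma>)\<close> vectors, and up to errors
  of smaller order \<open>p T\<^sub>i\<^sub>j\<close> is the inner product \<open>W\<^sub>i\<^sub>j\<close> of columns \<open>i\<close> and \<open>j\<close>, the correction in \<open>T\<^sub>i\<^sub>j\<close>
  cancelling the bias of the centring. In an eigenbasis of \<open>\<Sigma>\<close>, \<open>W\<^sub>i\<^sub>j = (\<Sum>m. d\<^sub>m G\<^sub>m\<^sub>i G\<^sub>m\<^sub>j)\<close> with independent
  standard normal \<open>G\<^sub>m\<^sub>i\<close>; conditionally on column \<open>i\<close> it is centred normal with variance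
  \<open>V\<^sub>i = (\<Sum>m. d\<^sub>m\<^sup>2 G\<^sub>m\<^sub>i\<^sup>2)\<close>, which concentrates at the squared Frobenius norm of \<open>\<Sigma>\<close>. Adding the columns one at
  a time, the probability that column \<open>j\<close> creates no new exceedance of a level with tail probability \<open>q\<close> is
  \<open>1 - j q\<close> up to a Bonferroni error, so that no exceedance among \<open>n\<close> columns has probability close to
  \<open>(\<Prod>j<n. 1 - j q) \<approx> exp (- n\<^sup>2 q / 2)\<close>, and Mills' ratio gives the constant. The thresholded estimator is
  consistent for the Frobenius norm because the sparsity condition controls the entries of \<open>\<Sigma>\<close> above the threshold,
  while few small entries are kept: only this count needs a large-deviation bound with the sharp constant, which is
  where \<open>\<delta>\<^sub>0 > sqrt 2\<close> enters.
\<close>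

section \<open>Spectral decomposition of real symmetric matrices\<close>

text \<open>Conditionally on one column the inner products are exactly normal, so Mills' ratio
  applies without moderate deviation theory. What must be small is the relative error of V_i: with p
  > c' n it is of order n^(-1/4), which still vanishes after multiplication by the squared level,
  about 4 log n. Exceedances of pairs that share column j are not independent, but given column j
  they are; this keeps the Bonferroni error at the order n^3 q^2 with q of order n^(-2). The
  constant sqrt 2 comes from counting: up to p n^(\<epsilon>/2) tiny entries may survive
  thresholding, each contributing only O(log p / n), so a tail of 1/p per entry is enough, and
  exp(-(\<delta>^2/2) log p) provides it for \<delta> > sqrt 2. A union bound over all p^2 entries
  would ask for \<delta> > 2. The threshold must therefore not be underestimated:
  \<open>B_hat\<close> is bounded below by a constant close to 1, because its off-diagonal part
  outweighs the subtracted term by Cauchy-Schwarz between trace and Frobenius norm. From above a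
  constant bound does.\<close>

definition dotp :: "nat \<Rightarrow> (nat \<Rightarrow> real) \<Rightarrow> (nat \<Rightarrow> real) \<Rightarrow> real" where
  "dotp p x y = (\<Sum>k<p. x k * y k)"

definition mat_app :: "nat \<Rightarrow> (nat \<Rightarrow> nat \<Rightarrow> real) \<Rightarrow> (nat \<Rightarrow> real) \<Rightarrow> nat \<Rightarrow> real" where
  "mat_app p A x k = (\<Sum>l<p. A k l * x l)"

lemma dotp_commute: "dotp p x y = dotp p y x"
  by (simp add: dotp_def mult.commute)

lemma dotp_add_left: "dotp p (\<lambda>k. x k + y k) z = dotp p x z + dotp p y z"
  by (simp add: dotp_def sum.distrib algebra_simps)

lemma dotp_add_right: "dotp p z (\<lambda>k. x k + y k) = dotp p z x + dotp p z y"
  by (simp add: dotp_def sum.distrib algebra_simps)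

lemma dotp_scale_left: "dotp p (\<lambda>k. c * x k) z = c * dotp p x z"
  by (simp add: dotp_def sum_distrib_left algebra_simps)

lemma dotp_scale_right: "dotp p z (\<lambda>k. c * x k) = c * dotp p z x"
  by (simp add: dotp_def sum_distrib_left algebra_simps)

lemma dotp_diff_left: "dotp p (\<lambda>k. x k - y k) z = dotp p x z - dotp p y z"
  by (simp add: dotp_def sum_subtractf algebra_simps)



lemmas dotp_linear = dotp_add_left dotp_add_right dotp_scale_left dotp_scale_right
  dotp_diff_left

lemma dotp_cong: "(\<And>k. k < p \<Longrightarrow> x k = x' k) \<Longrightarrow> (\<And>k. k < p \<Longrightarrow> y k = y' k) \<Longrightarrow> dotp p x y = dotp p x' y'"
  by (simp add: dotp_def)

lemma dotp_self_ge_0: "dotp p x x \<ge> 0"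
  by (simp add: dotp_def sum_nonneg)

lemma dotp_self_eq_0: "dotp p x x = 0 \<Longrightarrow> k < p \<Longrightarrow> x k = 0"
  unfolding dotp_def by (subst (asm) sum_nonneg_eq_0_iff) auto

lemma mat_app_add: "mat_app p A (\<lambda>k. x k + y k) = (\<lambda>k. mat_app p A x k + mat_app p A y k)"
  by (auto simp: mat_app_def sum.distrib algebra_simps)

lemma mat_app_scale: "mat_app p A (\<lambda>k. c * x k) = (\<lambda>k. c * mat_app p A x k)"
  by (auto simp: mat_app_def sum_distrib_left algebra_simps)

lemma dotp_mat_app:
  assumes "\<And>k l. k < p \<Longrightarrow> l < p \<Longrightarrow> A k l = A l k"
  shows "dotp p (mat_app p A x) y = dotp p x (mat_app p A y)"
proof -
  have "dotp p (mat_app p A x) y = (\<Sum>k<p. \<Sum>l<p. A k l * x l * y k)"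
    by (simp add: dotp_def mat_app_def sum_distrib_right)
  also have "\<dots> = (\<Sum>l<p. \<Sum>k<p. A k l * x l * y k)" by (rule sum.swap)
  also have "\<dots> = (\<Sum>l<p. \<Sum>k<p. x l * (A l k * y k))"
    by (intro sum.cong refl) (use assms in auto)
  finally show ?thesis by (simp add: dotp_def mat_app_def sum_distrib_left)
qed

definition orthonormal :: "nat \<Rightarrow> nat \<Rightarrow> (nat \<Rightarrow> nat \<Rightarrow> real) \<Rightarrow> bool" where
  "orthonormal p j u \<longleftrightarrow> (\<forall>m<j. \<forall>m'<j. dotp p (u m) (u m') = (if m = m' then 1 else 0))"

text \<open>\<open>r\<close> is the k-th unit vector minus its orthogonal projection onto the span
  of the family, so it is orthogonal to the family and Pythagoras gives its length. These lengths do
  all the dimension counting below.\<close>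

lemma orthonormal_residual:
  assumes u: "orthonormal p j u" and k: "k < p"
  defines "r \<equiv> \<lambda>l. (if l = k then 1 else 0) - (\<Sum>m<j. u m k * u m l)"
  shows "m < j \<Longrightarrow> dotp p r (u m) = 0"
    and "dotp p r r = 1 - (\<Sum>m<j. (u m k)\<^sup>2)"
proof -
  have delta: "dotp p (\<lambda>l. if l = k then 1 else 0) x = x k" for x
    using k by (simp add: dotp_def if_distrib[of "\<lambda>a. a * _"] sum.delta cong: if_cong)
  have lin: "dotp p (\<lambda>l. \<Sum>m<j. u m k * u m l) x = (\<Sum>m<j. u m k * dotp p (u m) x)" for x
  proof -
    have "dotp p (\<lambda>l. \<Sum>m<j. u m k * u m l) x = (\<Sum>l<p. \<Sum>m<j. u m k * (u m l * x l))"
      by (simp add: dotp_def sum_distrib_right mult.assoc)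
    also have "\<dots> = (\<Sum>m<j. \<Sum>l<p. u m k * (u m l * x l))" by (rule sum.swap)
    finally show ?thesis by (simp add: dotp_def sum_distrib_left)
  qed
  have r: "dotp p r x = x k - (\<Sum>m<j. u m k * dotp p (u m) x)" for x
    unfolding r_def by (simp add: dotp_diff_left delta lin)
  show orth: "dotp p r (u m) = 0" if "m < j" for m
  proof -
    have "(\<Sum>m'<j. u m' k * dotp p (u m') (u m)) = (\<Sum>m'<j. if m' = m then u m k else 0)"
      by (intro sum.cong refl) (use u that in \<open>auto simp: orthonormal_def\<close>)
    then show ?thesis using that by (simp add: r)
  qed
  have "dotp p r r = r k - (\<Sum>m<j. u m k * dotp p (u m) r)" by (rule r)
  also have "(\<Sum>m<j. u m k * dotp p (u m) r) = 0"
    using orth by (simp add: dotp_commute)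
  finally show "dotp p r r = 1 - (\<Sum>m<j. (u m k)\<^sup>2)" by (simp add: r_def power2_eq_square)
qed

lemma orthonormal_sum_squares:
  assumes "orthonormal p j u"
  shows "(\<Sum>k<p. \<Sum>m<j. (u m k)\<^sup>2) = real j"
proof -
  have "(\<Sum>k<p. \<Sum>m<j. (u m k)\<^sup>2) = (\<Sum>m<j. \<Sum>k<p. (u m k)\<^sup>2)" by (rule sum.swap)
  also have "\<dots> = (\<Sum>m<j. 1)"
    by (intro sum.cong refl) (use assms in \<open>auto simp: orthonormal_def dotp_def power2_eq_square\<close>)
  finally show ?thesis by simp
qed

text \<open>Summed over k, the squared lengths of the projections of the unit vectors give j, the
  trace of the projection. As j < p, some unit vector lies outside the span, and its residual is the
  required vector.\<close>

lemma orthonormal_complement: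
  assumes u: "orthonormal p j u" and j: "j < p"
  obtains r where "\<And>m. m < j \<Longrightarrow> dotp p r (u m) = 0" "dotp p r r > 0"
proof -
  have "\<exists>k<p. (\<Sum>m<j. (u m k)\<^sup>2) \<noteq> 1"
  proof (rule ccontr)
    assume "\<not> ?thesis"
    then have "(\<Sum>k<p. \<Sum>m<j. (u m k)\<^sup>2) = real p" by simp
    with orthonormal_sum_squares[OF u] j show False by simp
  qed
  then obtain k where k: "k < p" "(\<Sum>m<j. (u m k)\<^sup>2) \<noteq> 1" by blast
  show ?thesis
  proof (rule that)
    let ?r = "\<lambda>l. (if l = k then 1 else 0) - (\<Sum>m<j. u m k * u m l)"
    show "dotp p ?r (u m) = 0" if "m < j" for m by (rule orthonormal_residual(1)[OF u k(1) that])
    show "dotp p ?r ?r > 0"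
      using orthonormal_residual(2)[OF u k(1)] k(2) dotp_self_ge_0[of p ?r] by linarith
  qed
qed

text \<open>For j = p the same count leaves total squared length 0 for the p residuals, so each of
  them vanishes: orthonormal rows of a square matrix force orthonormal columns.\<close>

lemma orthonormal_complete:
  assumes u: "orthonormal p p u" and k: "k < p" and l: "l < p"
  shows "(\<Sum>m<p. u m k * u m l) = (if l = k then 1 else 0)"
proof -
  have "(\<Sum>k<p. 1 - (\<Sum>m<p. (u m k)\<^sup>2)) = 0"
    using orthonormal_sum_squares[OF u] by (simp add: sum_subtractf)
  moreover have "1 - (\<Sum>m<p. (u m k)\<^sup>2) \<ge> 0" if "k < p" for k
    by (subst orthonormal_residual(2)[OF u that, symmetric]) (rule dotp_self_ge_0)
  ultimately have "1 - (\<Sum>m<p. (u m k)\<^sup>2) = 0"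
    using k by (subst (asm) sum_nonneg_eq_0_iff) auto
  then have "(if l = k then 1 else 0) - (\<Sum>m<p. u m k * u m l) = 0"
    using orthonormal_residual(2)[OF u k] dotp_self_eq_0 l by fastforce
  then show ?thesis by simp
qed

text \<open>With the coordinates from \<open>p\<close> on fixed at 0, the set is a closed part of a
  product of compact intervals, so Tychonoff applies. Vectors as functions let one type serve all
  dimensions.\<close>

lemma compact_unit_sphere_orthogonal:
  "compact {v :: nat \<Rightarrow> real. (\<forall>k\<ge>p. v k = 0) \<and> dotp p v v = 1 \<and> (\<forall>m<j. dotp p v (u m) = 0)}"
    (is "compact ?K")
proof -
  define B where "B = PiE UNIV (\<lambda>k. if k < p then {-1..1::real} else {0})"
  have "compactin (product_topology (\<lambda>i::nat. euclideanreal) UNIV) B"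
    unfolding B_def by (subst compactin_PiE) auto
  then have "compact B" by (simp add: euclidean_product_topology)
  have cont: "continuous_on UNIV (\<lambda>v::nat \<Rightarrow> real. v k)" for k
    by (rule continuous_on_product_coordinates)
  have "closed {v. dotp p v v = 1}" "closed {v. dotp p v (u m) = 0}" for m
    unfolding dotp_def by (intro closed_Collect_eq continuous_intros cont)+
  then have "closed ({v. dotp p v v = 1} \<inter> (\<Inter>m\<in>{..<j}. {v. dotp p v (u m) = 0}))"
    by (intro closed_Int closed_INT) auto
  with \<open>compact B\<close> have "compact (B \<inter> ({v. dotp p v v = 1} \<inter> (\<Inter>m\<in>{..<j}. {v. dotp p v (u m) = 0})))"
    by (rule compact_Int_closed)
  also have "B \<inter> ({v. dotp p v v = 1} \<inter> (\<Inter>m\<in>{..<j}. {v. dotp p v (u m) = 0})) = ?K"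
  proof -
    have "\<bar>v k\<bar> \<le> 1" if "dotp p v v = 1" "k < p" for v k
    proof -
      have "v k * v k \<le> dotp p v v"
        unfolding dotp_def by (rule member_le_sum) (use that in auto)
      then show ?thesis using that by (simp add: power2_eq_square[symmetric] abs_square_le_1)
    qed
    note bnd = this
    have B: "v \<in> B \<longleftrightarrow> (\<forall>k<p. \<bar>v k\<bar> \<le> 1) \<and> (\<forall>k\<ge>p. v k = 0)" for v
      by (auto simp: B_def PiE_UNIV_domain Pi_iff abs_le_iff minus_le_iff not_less split: if_splits)
    show ?thesis using bnd by (auto simp: B)
  qed
  finally show ?thesis .
qed

text \<open>First-order condition at a minimum: near t = 0 the linear term dominates the quadratic
  one.\<close>

lemma quadratic_nonneg_imp_zero:
  fixes a b :: real
  assumes "\<And>t. 0 \<le> 2 * t * a + t\<^sup>2 * b"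
  shows "a = 0"
proof (rule ccontr)
  assume a: "a \<noteq> 0"
  define B where "B = \<bar>b\<bar> + 1"
  have B: "B > 0" "b < B" by (auto simp: B_def)
  have "0 \<le> 2 * (-a/B) * a + (-a/B)\<^sup>2 * b" by (rule assms)
  also have "\<dots> = a\<^sup>2 / B\<^sup>2 * (b - 2 * B)" using B by (simp add: field_simps power2_eq_square)
  also have "\<dots> < 0" using a B by (intro mult_pos_neg) auto
  finally show False by simp
qed

text \<open>A minimiser \<open>v\<close> of the quadratic form over the unit vectors orthogonal to
  the earlier eigenvectors is itself an eigenvector: the residual \<open>w\<close> of the eigenvalue
  equation stays in that orthogonal complement, which \<open>A\<close> preserves, and moving from
  \<open>v\<close> in direction \<open>w\<close> would lower the form unless \<open>w\<close> is
  0.\<close>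

lemma symmetric_eigenvector_extend:
  assumes sym: "\<And>k l. k < p \<Longrightarrow> l < p \<Longrightarrow> A k l = A l k"
    and u: "orthonormal p j u" and j: "j < p"
    and eig: "\<And>m k. m < j \<Longrightarrow> k < p \<Longrightarrow> mat_app p A (u m) k = d m * u m k"
  shows "\<exists>v e. dotp p v v = 1 \<and> (\<forall>m<j. dotp p v (u m) = 0) \<and> (\<forall>k<p. mat_app p A v k = e * v k)"
proof -
  define K where "K = {v :: nat \<Rightarrow> real. (\<forall>k\<ge>p. v k = 0) \<and> dotp p v v = 1 \<and> (\<forall>m<j. dotp p v (u m) = 0)}"
  define Q where "Q v = dotp p v (mat_app p A v)" for v
  \<comment> \<open>Cutting off the coordinates from \<open>p\<close> on changes no inner product
    and no value of \<open>A\<close>, but membership in \<open>K\<close> demands it.\<close>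
  define res where "res x k = (if k < p then x k else 0)" for x :: "nat \<Rightarrow> real" and k
  have res: "dotp p (res x) y = dotp p x y" "dotp p y (res x) = dotp p y x"
    "mat_app p A (res x) = mat_app p A x" for x y
    by (auto simp: dotp_def res_def mat_app_def)
  have normK: "res (\<lambda>k. c * x k) \<in> K"
    if "c\<^sup>2 * dotp p x x = 1" "\<And>m. m < j \<Longrightarrow> dotp p x (u m) = 0" for x c
    unfolding K_def using that by (auto simp: res dotp_linear power2_eq_square) (simp add: res_def)
  have compK: "compact K" unfolding K_def by (rule compact_unit_sphere_orthogonal)
  obtain r where r: "\<And>m. m < j \<Longrightarrow> dotp p r (u m) = 0" "dotp p r r > 0"
    using orthonormal_complement[OF u j] by blast
  have neK: "K \<noteq> {}" using normK[of "1 / sqrt (dotp p r r)" r] r by (auto simp: power_divide)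
  have "continuous_on K Q"
    unfolding Q_def dotp_def mat_app_def
    by (intro continuous_intros continuous_on_subset[OF continuous_on_product_coordinates]) auto
  then obtain v where v: "v \<in> K" "\<And>w. w \<in> K \<Longrightarrow> Q v \<le> Q w"
    using continuous_attains_inf[OF compK neK] by blast
  \<comment> \<open>Homogeneous form of minimality, so that perturbations of \<open>v\<close> can be
    used without normalising them.\<close>
  have min: "Q v * dotp p w w \<le> Q w" if "\<And>m. m < j \<Longrightarrow> dotp p w (u m) = 0" for w
  proof (cases "dotp p w w = 0")
    case True
    then show ?thesis using dotp_self_eq_0[OF True] by (simp add: Q_def dotp_def)
  next
    case False
    then have pos: "dotp p w w > 0" using dotp_self_ge_0[of p w] by linarith
    define c where "c = 1 / sqrt (dotp p w w)"
    have c: "c\<^sup>2 = 1 / dotp p w w" using pos by (simp add: c_def power_divide)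
    have "Q v \<le> Q (res (\<lambda>k. c * w k))" by (intro v normK that) (use c pos in auto)
    also have "\<dots> = Q w / dotp p w w"
      unfolding Q_def using c by (simp add: res dotp_linear mat_app_scale power2_eq_square mult.assoc[symmetric])
    finally show ?thesis using pos by (simp add: field_simps)
  qed
  define w where "w k = mat_app p A v k - Q v * v k" for k
  have vu: "dotp p v (u m) = 0" if "m < j" for m using v(1) that by (auto simp: K_def)
  have v1: "dotp p v v = 1" using v(1) by (auto simp: K_def)
  have wu: "dotp p w (u m) = 0" if "m < j" for m
  proof -
    have "dotp p (mat_app p A v) (u m) = dotp p v (mat_app p A (u m))"
      by (rule dotp_mat_app) (rule sym)
    also have "\<dots> = dotp p v (\<lambda>k. d m * u m k)"
      by (rule dotp_cong) (use eig that in auto)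
    finally have "dotp p (mat_app p A v) (u m) = 0" using vu[OF that] by (simp add: dotp_linear)
    then show ?thesis using vu[OF that] unfolding w_def by (simp add: dotp_linear)
  qed
  \<comment> \<open>Minimality at v + t w. The terms with the inner product of v and w cancel, and
    the derivative at t = 0 is twice the squared length of w.\<close>
  have "0 \<le> 2 * t * dotp p w w + t\<^sup>2 * (Q w - Q v * dotp p w w)" for t
  proof -
    have "Q v * dotp p (\<lambda>k. v k + t * w k) (\<lambda>k. v k + t * w k) \<le> Q (\<lambda>k. v k + t * w k)"
      by (rule min) (use vu wu in \<open>simp add: dotp_linear\<close>)
    moreover have "dotp p w (mat_app p A v) = dotp p w w + Q v * dotp p w v"
    proof -
      have "dotp p w (mat_app p A v) = dotp p w (\<lambda>k. w k + Q v * v k)"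
        by (rule dotp_cong) (auto simp: w_def)
      then show ?thesis by (simp add: dotp_linear)
    qed
    moreover have "dotp p v (mat_app p A w) = dotp p w (mat_app p A v)"
      using dotp_mat_app[of p A v w] sym by (simp add: dotp_commute)
    moreover have "Q (\<lambda>k. v k + t * w k) = Q v + t * dotp p v (mat_app p A w) + t * dotp p w (mat_app p A v) + t\<^sup>2 * Q w"
      unfolding Q_def by (simp add: mat_app_add mat_app_scale dotp_linear algebra_simps power2_eq_square)
    moreover have "dotp p (\<lambda>k. v k + t * w k) (\<lambda>k. v k + t * w k) = 1 + 2 * t * dotp p w v + t\<^sup>2 * dotp p w w"
      using v1 dotp_commute[of p v w] by (simp add: dotp_linear algebra_simps power2_eq_square)
    ultimately show ?thesis by (simp add: algebra_simps)
  qed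
  then have "dotp p w w = 0" by (rule quadratic_nonneg_imp_zero)
  then have "mat_app p A v k = Q v * v k" if "k < p" for k
    using dotp_self_eq_0[of p w k] that by (simp add: w_def)
  then show ?thesis using v1 vu by blast
qed

theorem symmetric_spectral_decomposition:
  assumes sym: "\<And>k l. k < p \<Longrightarrow> l < p \<Longrightarrow> A k l = A l k"
  obtains u d where "orthonormal p p u"
    "\<And>m k. m < p \<Longrightarrow> k < p \<Longrightarrow> mat_app p A (u m) k = d m * u m k"
    "\<And>a b. a < p \<Longrightarrow> b < p \<Longrightarrow> A a b = (\<Sum>m<p. d m * u m a * u m b)"
proof -
  have "\<exists>u d. orthonormal p j u \<and> (\<forall>m<j. \<forall>k<p. mat_app p A (u m) k = d m * u m k)" if "j \<le> p" for j
    using that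
  proof (induction j)
    case 0
    then show ?case by (simp add: orthonormal_def)
  next
    case (Suc j)
    then obtain u d where ud: "orthonormal p j u" "\<And>m k. m < j \<Longrightarrow> k < p \<Longrightarrow> mat_app p A (u m) k = d m * u m k"
      by auto
    have j: "j < p" using Suc.prems by simp
    obtain v e where ve: "dotp p v v = 1" "\<forall>m<j. dotp p v (u m) = 0"
      "\<forall>k<p. mat_app p A v k = e * v k"
      using symmetric_eigenvector_extend[where A = A, OF sym ud(1) j ud(2)] by blast
    have "orthonormal p (Suc j) (u(j := v))"
      using ud(1) ve by (auto simp: orthonormal_def less_Suc_eq dotp_commute)
    moreover have "\<forall>m<Suc j. \<forall>k<p. mat_app p A ((u(j := v)) m) k = (d(j := e)) m * (u(j := v)) m k"
      using ud(2) ve by (auto simp: less_Suc_eq)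
    ultimately show ?case by blast
  qed
  then obtain u d where ud: "orthonormal p p u" "\<And>m k. m < p \<Longrightarrow> k < p \<Longrightarrow> mat_app p A (u m) k = d m * u m k"
    by (meson order_refl)
  have "A a b = (\<Sum>m<p. d m * u m a * u m b)" if a: "a < p" and b: "b < p" for a b
  proof -
    \<comment> \<open>The identity matrix is inserted and then expanded in the eigenvectors by
      \<open>orthonormal_complete\<close>.\<close>
    have "A a b = (\<Sum>l<p. A a l * (if l = b then 1 else 0))" using b by (simp add: if_distrib[of "\<lambda>x. _ * x"] cong: if_cong)
    also have "\<dots> = (\<Sum>l<p. \<Sum>m<p. A a l * u m l * u m b)"
      by (intro sum.cong refl, subst orthonormal_complete[OF ud(1) b, symmetric])
        (auto simp: sum_distrib_left algebra_simps)
    also have "\<dots> = (\<Sum>m<p. \<Sum>l<p. A a l * u m l * u m b)" by (rule sum.swap)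
    also have "\<dots> = (\<Sum>m<p. mat_app p A (u m) a * u m b)"
      by (simp add: mat_app_def sum_distrib_right)
    also have "\<dots> = (\<Sum>m<p. d m * u m a * u m b)"
      using ud(2) a by simp
    finally show ?thesis .
  qed
  with ud show ?thesis by (rule that)
qed

text \<open>Connects the decomposition with \<open>lambda_min\<close> and \<open>lambda_max\<close>,
  the extreme elements of \<open>spectrum\<close>: unit length makes \<open>v\<close> a genuine
  eigenvector.\<close>

lemma eigenvalue_in_spectrum:
  fixes S :: "real mat"
  assumes S: "S \<in> carrier_mat p p" and v: "dotp p v v = 1"
    and eig: "\<And>k. k < p \<Longrightarrow> mat_app p (\<lambda>a b. S $$ (a, b)) v k = e * v k"
  shows "e \<in> spectrum S"
proof -
  have "vec p v \<noteq> 0\<^sub>v p"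
  proof
    assume "vec p v = 0\<^sub>v p"
    then have "\<And>k. k < p \<Longrightarrow> v k = 0" by (metis index_vec index_zero_vec(1))
    then show False using v by (simp add: dotp_def)
  qed
  moreover have "S *\<^sub>v vec p v = e \<cdot>\<^sub>v vec p v"
  proof (rule eq_vecI)
    fix k assume "k < dim_vec (e \<cdot>\<^sub>v vec p v)"
    then have k: "k < p" by simp
    have "(S *\<^sub>v vec p v) $ k = (\<Sum>l<p. S $$ (k, l) * v l)"
      using S k by (simp add: scalar_prod_def atLeast0LessThan)
    then show "(S *\<^sub>v vec p v) $ k = (e \<cdot>\<^sub>v vec p v) $ k" using eig[OF k] k by (simp add: mat_app_def)
  qed (use S in auto)
  moreover have "vec p v \<in> carrier_vec p" by simp
  ultimately have "eigenvalue S e" using S unfolding eigenvalue_def eigenvector_def by blast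
  then show ?thesis by (simp add: spectrum_def)
qed

section \<open>Standard Gaussian families\<close>

text \<open>Encoded by the joint characteristic function: closure under linear maps with orthonormal
  rows is then a computation with squares, while independence and normal marginals follow once and
  for all from uniqueness.\<close>

definition (in prob_space) std_gauss :: "'i set \<Rightarrow> ('i \<Rightarrow> 'a \<Rightarrow> real) \<Rightarrow> bool" where
  "std_gauss I G \<longleftrightarrow> finite I \<and> (\<forall>q\<in>I. G q \<in> borel_measurable M) \<and>
     (\<forall>b. expectation (\<lambda>\<omega>. iexp (\<Sum>q\<in>I. b q * G q \<omega>)) = of_real (exp (- (\<Sum>q\<in>I. (b q)\<^sup>2) / 2)))"

lemma iexp_add: "iexp (x + y) = iexp x * iexp y"
  by (simp add: exp_add algebra_simps)

lemma mult_iexp_add: "a * iexp (x + y) = a * iexp y * iexp x"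
  unfolding iexp_add by (rule mult.left_commute[of a, unfolded mult.commute[of _ "a * _"]])

lemma prob_space_std_normal: "prob_space std_normal_distribution"
  by (rule prob_space_normal_density) simp

lemma (in prob_space) integrable_bounded_complex:
  fixes f :: "'a \<Rightarrow> complex"
  assumes "f \<in> borel_measurable M" "\<And>\<omega>. cmod (f \<omega>) \<le> B"
  shows "integrable M f"
  using assms by (intro integrable_const_bound[of _ B]) auto

lemma (in prob_space) distr_eq_std_normal:
  assumes [measurable]: "Y \<in> borel_measurable M"
    and "\<And>s. expectation (\<lambda>\<omega>. iexp (s * Y \<omega>)) = of_real (exp (- s\<^sup>2 / 2))"
  shows "distr M borel Y = std_normal_distribution"
proof (rule Levy_uniqueness)
  show "real_distribution (distr M borel Y)" by simp
  show "real_distribution std_normal_distribution" by (rule real_dist_normal_dist)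
  show "char (distr M borel Y) = char std_normal_distribution"
  proof
    fix s
    have "char (distr M borel Y) s = expectation (\<lambda>\<omega>. iexp (s * Y \<omega>))"
      unfolding char_def by (subst integral_distr) auto
    then show "char (distr M borel Y) s = char std_normal_distribution s"
      by (simp only: assms(2) char_std_normal_distribution)
  qed
qed

text \<open>Adding 2 to the weight makes it a positive density, to which uniqueness of characteristic
  functions applies.\<close>

lemma (in prob_space) real_weight_std_normal:
  assumes [measurable]: "Y \<in> borel_measurable M" "u \<in> borel_measurable M" "A \<in> sets borel"
    and u: "\<And>\<omega>. \<bar>u \<omega>\<bar> \<le> 1"
    and Y: "\<And>s. expectation (\<lambda>\<omega>. iexp (s * Y \<omega>)) = of_real (exp (- s\<^sup>2 / 2))"
    and w: "\<And>s. expectation (\<lambda>\<omega>. of_real (u \<omega>) * iexp (s * Y \<omega>)) = of_real (\<kappa> * exp (- s\<^sup>2 / 2))"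
  shows "expectation (\<lambda>\<omega>. u \<omega> * indicator A (Y \<omega>)) = \<kappa> * measure std_normal_distribution A"
proof -
  have intu: "integrable M u" using u by (intro integrable_const_bound[of _ 1]) auto
  have inti: "integrable M (\<lambda>\<omega>. iexp (s * Y \<omega>))" for s
    by (intro integrable_bounded_complex[of _ 1]) auto
  have intui: "integrable M (\<lambda>\<omega>. of_real (u \<omega>) * iexp (s * Y \<omega>))" for s
    using u by (intro integrable_bounded_complex[of _ 1]) (auto simp: norm_mult)
  have k: "expectation u = \<kappa>"
  proof -
    have "complex_of_real (expectation u) = complex_of_real \<kappa>" using w[of 0] by simp
    then show ?thesis by (simp only: of_real_eq_iff)
  qed
  have "\<bar>expectation u\<bar> \<le> 1"
  proof -
    have "\<bar>expectation u\<bar> \<le> expectation (\<lambda>\<omega>. \<bar>u \<omega>\<bar>)" by (rule integral_abs_bound)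
    also have "\<dots> \<le> expectation (\<lambda>_. 1)" using intu u by (intro integral_mono) auto
    finally show ?thesis by (simp add: prob_space)
  qed
  then have pos: "2 + \<kappa> > 0" using k by linarith
  \<comment> \<open>\<open>g\<close> is nonnegative since |u| \<le> 1 and has mean 1 since \<kappa>
    is the mean of \<open>u\<close>. Under the density \<open>g\<close> the characteristic function
    of \<open>Y\<close> is again the standard normal one; comparing the law of \<open>Y\<close>
    under both measures isolates the term with \<open>u\<close>.\<close>
  define g where "g \<omega> = (2 + u \<omega>) / (2 + \<kappa>)" for \<omega>
  have [measurable]: "g \<in> borel_measurable M" by (simp add: g_def[abs_def])
  have g0: "g \<omega> \<ge> 0" for \<omega> using u[of \<omega>] pos by (simp add: g_def abs_le_iff)
  have intg: "integrable M g" unfolding g_def using intu by auto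
  have "expectation g = 1" unfolding g_def using intu pos k prob_space by simp
  then have "emeasure (density M (\<lambda>\<omega>. ennreal (g \<omega>))) (space M) = 1"
    by (simp add: emeasure_density nn_integral_eq_integral[OF intg] g0 cong: nn_integral_cong_simp)
  then interpret g: prob_space "density M (\<lambda>\<omega>. ennreal (g \<omega>))" by (intro prob_spaceI) simp
  have "g.expectation (\<lambda>\<omega>. iexp (s * Y \<omega>)) = of_real (exp (- s\<^sup>2 / 2))" for s
  proof -
    have "g.expectation (\<lambda>\<omega>. iexp (s * Y \<omega>)) = expectation (\<lambda>\<omega>. g \<omega> *\<^sub>R iexp (s * Y \<omega>))"
      by (subst integral_density) (auto simp: g0)
    also have "\<dots> = expectation (\<lambda>\<omega>. (2 * iexp (s * Y \<omega>) + of_real (u \<omega>) * iexp (s * Y \<omega>)) / of_real (2 + \<kappa>))"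
      by (intro Bochner_Integration.integral_cong refl)
        (simp add: g_def scaleR_conv_of_real algebra_simps)
    also have "\<dots> = (2 * of_real (exp (- s\<^sup>2 / 2)) + of_real (\<kappa> * exp (- s\<^sup>2 / 2))) / of_real (2 + \<kappa>)"
      using inti[of s] intui[of s] by (simp add: Y w del: of_real_mult of_real_add)
    also have "\<dots> = of_real ((2 + \<kappa>) * exp (- s\<^sup>2 / 2) / (2 + \<kappa>))"
      by (simp add: algebra_simps)
    finally show ?thesis using pos by simp
  qed
  then have D: "distr (density M (\<lambda>\<omega>. ennreal (g \<omega>))) borel Y = std_normal_distribution"
    by (intro g.distr_eq_std_normal) auto
  have ind1: "expectation (\<lambda>\<omega>. indicator A (Y \<omega>)) = measure std_normal_distribution A"
  proof -
    have "expectation (\<lambda>\<omega>. indicator A (Y \<omega>)) = measure (distr M borel Y) A"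
      by (subst integral_distr[symmetric, of _ M borel]) auto
    then show ?thesis by (simp add: distr_eq_std_normal[OF _ Y])
  qed
  have "measure std_normal_distribution A = measure (distr (density M (\<lambda>\<omega>. ennreal (g \<omega>))) borel Y) A"
    by (simp add: D)
  also have "\<dots> = g.expectation (\<lambda>\<omega>. indicator A (Y \<omega>))"
    by (subst integral_distr[symmetric, of _ _ borel]) auto
  also have "\<dots> = expectation (\<lambda>\<omega>. g \<omega> * indicator A (Y \<omega>))"
    by (subst integral_density) (auto simp: g0)
  also have "\<dots> = expectation (\<lambda>\<omega>. (2 * indicator A (Y \<omega>) + u \<omega> * indicator A (Y \<omega>)) / (2 + \<kappa>))"
    by (intro Bochner_Integration.integral_cong refl) (simp add: g_def algebra_simps add_divide_distrib)
  also have "\<dots> = (2 * measure std_normal_distribution A + expectation (\<lambda>\<omega>. u \<omega> * indicator A (Y \<omega>))) / (2 + \<kappa>)"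
  proof -
    have i1: "integrable M (\<lambda>\<omega>. indicator A (Y \<omega>) :: real)"
      by (intro integrable_const_bound[of _ 1]) auto
    have "integrable M (\<lambda>\<omega>. u \<omega> * indicator A (Y \<omega>))"
      using u by (intro integrable_const_bound[of _ 1]) (auto simp: abs_mult indicator_def)
    with i1 show ?thesis by (simp add: ind1)
  qed
  finally show ?thesis using pos by (simp add: field_simps)
qed

text \<open>Complex weights arise because the induction below keeps the characters of the remaining
  coordinates inside the weight. Conjugating the hypothesis at -s gives it for \<open>cnj w\<close>
  with \<open>cnj \<kappa>\<close>, hence for the real and imaginary parts.\<close>

lemma (in prob_space) complex_weight_std_normal:
  fixes w :: "'a \<Rightarrow> complex"
  assumes [measurable]: "Y \<in> borel_measurable M" "w \<in> borel_measurable M" "A \<in> sets borel"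
    and b: "\<And>\<omega>. cmod (w \<omega>) \<le> 1"
    and Y: "\<And>s. expectation (\<lambda>\<omega>. iexp (s * Y \<omega>)) = of_real (exp (- s\<^sup>2 / 2))"
    and w: "\<And>s. expectation (\<lambda>\<omega>. w \<omega> * iexp (s * Y \<omega>)) = \<kappa> * of_real (exp (- s\<^sup>2 / 2))"
  shows "expectation (\<lambda>\<omega>. w \<omega> * of_real (indicator A (Y \<omega>))) = \<kappa> * of_real (measure std_normal_distribution A)"
proof -
  have intw: "integrable M (\<lambda>\<omega>. w \<omega> * iexp (s * Y \<omega>))" "integrable M (\<lambda>\<omega>. cnj (w \<omega>) * iexp (s * Y \<omega>))" for s
  proof -
    have [measurable]: "cnj \<in> borel_measurable borel"
      by (intro borel_measurable_continuous_onI continuous_intros)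
    show "integrable M (\<lambda>\<omega>. w \<omega> * iexp (s * Y \<omega>))" "integrable M (\<lambda>\<omega>. cnj (w \<omega>) * iexp (s * Y \<omega>))"
      using b by (intro integrable_bounded_complex[of _ 1]; auto simp: norm_mult)+
  qed
  have cnj: "expectation (\<lambda>\<omega>. cnj (w \<omega>) * iexp (s * Y \<omega>)) = cnj \<kappa> * of_real (exp (- s\<^sup>2 / 2))" for s
  proof -
    have "expectation (\<lambda>\<omega>. cnj (w \<omega>) * iexp (s * Y \<omega>)) = expectation (\<lambda>\<omega>. cnj (w \<omega> * iexp ((-s) * Y \<omega>)))"
      by (intro Bochner_Integration.integral_cong refl) (simp add: exp_cnj)
    also have "\<dots> = cnj (expectation (\<lambda>\<omega>. w \<omega> * iexp ((-s) * Y \<omega>)))"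
      by (rule integral_bounded_linear[OF bounded_linear_cnj intw(1)])
    also have "\<dots> = cnj \<kappa> * of_real (exp (- s\<^sup>2 / 2))" unfolding w by simp
    finally show ?thesis .
  qed
  have re: "expectation (\<lambda>\<omega>. of_real (Re (w \<omega>)) * iexp (s * Y \<omega>)) = of_real (Re \<kappa> * exp (- s\<^sup>2 / 2))" for s
  proof -
    have "expectation (\<lambda>\<omega>. of_real (Re (w \<omega>)) * iexp (s * Y \<omega>)) =
        expectation (\<lambda>\<omega>. (w \<omega> * iexp (s * Y \<omega>) + cnj (w \<omega>) * iexp (s * Y \<omega>)) / 2)"
      by (intro Bochner_Integration.integral_cong refl) (auto simp: complex_eq_iff algebra_simps)
    also have "\<dots> = (\<kappa> + cnj \<kappa>) / 2 * of_real (exp (- s\<^sup>2 / 2))"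
      unfolding integral_divide_zero Bochner_Integration.integral_add[OF intw] w cnj
      by (simp add: algebra_simps)
    finally show ?thesis by (simp add: complex_add_cnj)
  qed
  have im: "expectation (\<lambda>\<omega>. of_real (Im (w \<omega>)) * iexp (s * Y \<omega>)) = of_real (Im \<kappa> * exp (- s\<^sup>2 / 2))" for s
  proof -
    have "expectation (\<lambda>\<omega>. of_real (Im (w \<omega>)) * iexp (s * Y \<omega>)) =
        expectation (\<lambda>\<omega>. (w \<omega> * iexp (s * Y \<omega>) - cnj (w \<omega>) * iexp (s * Y \<omega>)) / (2 * \<i>))"
      by (intro Bochner_Integration.integral_cong refl) (auto simp: complex_eq_iff algebra_simps Re_divide Im_divide)
    also have "\<dots> = (\<kappa> - cnj \<kappa>) / (2 * \<i>) * of_real (exp (- s\<^sup>2 / 2))"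
      unfolding integral_divide_zero Bochner_Integration.integral_diff[OF intw] w cnj
      by (simp add: algebra_simps)
    also have "(\<kappa> - cnj \<kappa>) / (2 * \<i>) = of_real (Im \<kappa>)" by (simp add: complex_eq_iff Re_divide Im_divide)
    finally show ?thesis by simp
  qed
  have R: "expectation (\<lambda>\<omega>. Re (w \<omega>) * indicator A (Y \<omega>)) = Re \<kappa> * measure std_normal_distribution A"
    using b abs_Re_le_cmod order_trans by (intro real_weight_std_normal Y re) (auto, blast)
  have I: "expectation (\<lambda>\<omega>. Im (w \<omega>) * indicator A (Y \<omega>)) = Im \<kappa> * measure std_normal_distribution A"
    using b abs_Im_le_cmod order_trans by (intro real_weight_std_normal Y im) (auto, blast)
  have int: "integrable M (\<lambda>\<omega>. w \<omega> * of_real (indicator A (Y \<omega>)))"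
    using b by (auto intro!: integrable_bounded_complex[of _ 1] simp: norm_mult indicator_def)
  show ?thesis
    using R I integral_Re[OF int] integral_Im[OF int] by (simp add: complex_eq_iff)
qed

text \<open>Interpolates between the characteristic function (J empty) and the probability of a
  product set (J = I). One coordinate at a time moves from the exponential to an indicator, all
  other factors forming the bounded weight of \<open>complex_weight_std_normal\<close>.\<close>

lemma (in prob_space) std_gauss_mixed:
  assumes G: "std_gauss I G" and J: "J \<subseteq> I" and A: "\<And>q. q \<in> I \<Longrightarrow> A q \<in> sets borel"
  shows "expectation (\<lambda>\<omega>. of_real (\<Prod>q\<in>J. indicator (A q) (G q \<omega>)) * iexp (\<Sum>q\<in>I-J. b q * G q \<omega>)) =
    of_real ((\<Prod>q\<in>J. measure std_normal_distribution (A q)) * exp (- (\<Sum>q\<in>I-J. (b q)\<^sup>2) / 2))"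
proof -
  have fin: "finite I" using G by (simp add: std_gauss_def)
  have meas [measurable]: "G q \<in> borel_measurable M" if "q \<in> I" for q using G that by (simp add: std_gauss_def)
  have "finite J" using J fin by (rule finite_subset)
  then show ?thesis using J
  proof (induction J arbitrary: b)
    case empty
    then show ?case using G by (simp add: std_gauss_def)
  next
    case (insert r J)
    then have r: "r \<in> I" "r \<notin> J" "J \<subseteq> I" by auto
    note [measurable] = meas[OF r(1)] A[OF r(1)]
    have IJ: "I - J = insert r (I - insert r J)" "r \<notin> I - insert r J" using r by auto
    have finIJ: "finite (I - insert r J)" using fin by simp
    have upd: "(\<Sum>q\<in>I-J. (b(r := s)) q * G q \<omega>) = s * G r \<omega> + (\<Sum>q\<in>I - insert r J. b q * G q \<omega>)"
      "(\<Sum>q\<in>I-J. ((b(r := s)) q)\<^sup>2) = s\<^sup>2 + (\<Sum>q\<in>I - insert r J. (b q)\<^sup>2)" for s \<omega>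
      unfolding IJ(1) sum.insert[OF finIJ IJ(2)] by (auto intro!: sum.cong)
    define w where "w \<omega> = of_real (\<Prod>q\<in>J. indicator (A q) (G q \<omega>)) * iexp (\<Sum>q\<in>I - insert r J. b q * G q \<omega>)" for \<omega>
    have wm[measurable]: "w \<in> borel_measurable M"
    proof -
      have "(\<lambda>\<omega>. indicator (A q) (G q \<omega>) :: real) \<in> borel_measurable M" if "q \<in> J" for q
        by (rule measurable_compose[OF meas borel_measurable_indicator[OF A]]) (use that r in auto)
      moreover have "(\<lambda>\<omega>. b q * G q \<omega>) \<in> borel_measurable M" if "q \<in> I" for q
        using meas[OF that] by measurable
      ultimately show ?thesis unfolding w_def
        by (intro borel_measurable_times borel_measurable_of_real borel_measurable_prod
            measurable_compose[OF _ borel_measurable_exp] borel_measurable_sum borel_measurable_const) auto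
    qed
    have wb: "cmod (w \<omega>) \<le> 1" for \<omega>
    proof -
      have "0 \<le> (\<Prod>q\<in>J. indicator (A q) (G q \<omega>) :: real)" "(\<Prod>q\<in>J. indicator (A q) (G q \<omega>) :: real) \<le> 1"
        by (auto intro!: prod_nonneg prod_le_1)
      then show ?thesis by (simp add: w_def norm_mult norm_of_real del: of_real_prod)
    qed
    have Y: "expectation (\<lambda>\<omega>. iexp (s * G r \<omega>)) = of_real (exp (- s\<^sup>2 / 2))" for s
    proof -
      have eq: "(\<Sum>q\<in>I. (if q = r then s else 0) * G q \<omega>) = s * G r \<omega>" "(\<Sum>q\<in>I. (if q = r then s else 0)\<^sup>2) = s\<^sup>2" for \<omega>
        using r fin by (simp_all add: if_distrib[of "\<lambda>x. x * _"] if_distrib[of "\<lambda>x. x\<^sup>2"] cong: if_cong)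
      show ?thesis
        using G[unfolded std_gauss_def, THEN conjunct2, THEN conjunct2, THEN spec[of _ "\<lambda>q. if q = r then s else 0"]]
        unfolding eq .
    qed
    define \<kappa> where "\<kappa> = (\<Prod>q\<in>J. measure std_normal_distribution (A q)) * exp (- (\<Sum>q\<in>I - insert r J. (b q)\<^sup>2) / 2)"
    \<comment> \<open>The induction hypothesis holds for all coefficients; setting that of
      \<open>r\<close> to \<open>s\<close> makes it the weight hypothesis for every
      \<open>s\<close>.\<close>
    have W: "expectation (\<lambda>\<omega>. w \<omega> * iexp (s * G r \<omega>)) = of_real \<kappa> * of_real (exp (- s\<^sup>2 / 2))" for s
    proof -
      have "expectation (\<lambda>\<omega>. w \<omega> * iexp (s * G r \<omega>)) =
        expectation (\<lambda>\<omega>. of_real (\<Prod>q\<in>J. indicator (A q) (G q \<omega>)) * iexp (\<Sum>q\<in>I-J. (b(r := s)) q * G q \<omega>))"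
      proof (rule Bochner_Integration.integral_cong[OF refl])
        fix \<omega>
        show "w \<omega> * iexp (s * G r \<omega>) =
          of_real (\<Prod>q\<in>J. indicator (A q) (G q \<omega>)) * iexp (\<Sum>q\<in>I-J. (b(r := s)) q * G q \<omega>)"
          unfolding upd(1) w_def by (rule mult_iexp_add[symmetric])
      qed
      also have "\<dots> = of_real ((\<Prod>q\<in>J. measure std_normal_distribution (A q)) * exp (- (\<Sum>q\<in>I-J. ((b(r := s)) q)\<^sup>2) / 2))"
        using insert.IH[of "b(r := s)"] r by blast
      also have "\<dots> = of_real \<kappa> * of_real (exp (- s\<^sup>2 / 2))"
        unfolding upd \<kappa>_def of_real_mult[symmetric] mult.assoc exp_add[symmetric] by (simp add: field_simps)
      finally show ?thesis .
    qed
    have "expectation (\<lambda>\<omega>. w \<omega> * of_real (indicator (A r) (G r \<omega>))) = of_real \<kappa> * of_real (measure std_normal_distribution (A r))"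
      by (rule complex_weight_std_normal[OF _ _ _ wb Y W]) auto
    also have "(\<lambda>\<omega>. w \<omega> * of_real (indicator (A r) (G r \<omega>))) =
      (\<lambda>\<omega>. of_real (\<Prod>q\<in>insert r J. indicator (A q) (G q \<omega>)) * iexp (\<Sum>q\<in>I - insert r J. b q * G q \<omega>))"
      using insert.hyps by (auto simp: w_def mult_ac)
    finally show ?case using insert.hyps by (simp add: \<kappa>_def mult_ac)
  qed
qed

lemma (in prob_space) std_gauss_prob:
  assumes G: "std_gauss I G" and A: "\<And>q. q \<in> I \<Longrightarrow> A q \<in> sets borel"
  shows "prob {\<omega>\<in>space M. \<forall>q\<in>I. G q \<omega> \<in> A q} = (\<Prod>q\<in>I. measure std_normal_distribution (A q))"
proof -
  have fin: "finite I" using G by (simp add: std_gauss_def)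
  have meas: "G q \<in> borel_measurable M" if "q \<in> I" for q using G that by (simp add: std_gauss_def)
  have set: "{\<omega>\<in>space M. \<forall>q\<in>I. G q \<omega> \<in> A q} \<in> sets M"
    by (intro sets.sets_Collect_finite_All fin) (use meas A measurable_sets_Collect in \<open>auto intro!: measurable_sets_Collect\<close>)
  have ind: "(\<Prod>q\<in>I. indicator (A q) (G q \<omega>)) = (indicator {\<omega>\<in>space M. \<forall>q\<in>I. G q \<omega> \<in> A q} \<omega> :: real)"
    if "\<omega> \<in> space M" for \<omega>
  proof (cases "\<forall>q\<in>I. G q \<omega> \<in> A q")
    case True
    then show ?thesis using that by simp
  next
    case False
    then obtain q where q: "q \<in> I" "G q \<omega> \<notin> A q" by blast
    then have "(\<Prod>q\<in>I. indicator (A q) (G q \<omega>)) = (0 :: real)"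
      using fin by (intro prod_zero bexI[of _ q]) auto
    then show ?thesis using q by (subst indicator_simps(2)[of \<omega>]) auto
  qed
  have "expectation (\<lambda>\<omega>. of_real (\<Prod>q\<in>I. indicator (A q) (G q \<omega>)) :: complex) =
    expectation (\<lambda>\<omega>. of_real (indicator {\<omega>\<in>space M. \<forall>q\<in>I. G q \<omega> \<in> A q} \<omega>))"
    by (intro Bochner_Integration.integral_cong refl) (simp only: ind)
  also have "\<dots> = of_real (prob {\<omega>\<in>space M. \<forall>q\<in>I. G q \<omega> \<in> A q})"
    using set by (simp only: integral_complex_of_real) simp
  finally have "complex_of_real (prob {\<omega>\<in>space M. \<forall>q\<in>I. G q \<omega> \<in> A q}) =
    of_real (\<Prod>q\<in>I. measure std_normal_distribution (A q))"
    using std_gauss_mixed[OF G order_refl A, where b = "\<lambda>_. 0"] by (simp del: of_real_prod)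
  then show ?thesis by (simp only: of_real_eq_iff)
qed

lemma (in prob_space) std_gauss_indep_vars:
  assumes G: "std_gauss I G"
  shows "indep_vars (\<lambda>_. borel) G I"
    and "q \<in> I \<Longrightarrow> distr M borel (G q) = std_normal_distribution"
proof -
  interpret N: prob_space std_normal_distribution by (rule prob_space_std_normal)
  have N1: "measure std_normal_distribution UNIV = 1" using N.prob_space by simp
  have fin: "finite I" using G by (simp add: std_gauss_def)
  have meas: "G q \<in> borel_measurable M" if "q \<in> I" for q using G that by (simp add: std_gauss_def)
  have sub: "prob {\<omega>\<in>space M. \<forall>q\<in>J. G q \<omega> \<in> A q} = (\<Prod>q\<in>J. measure std_normal_distribution (A q))"
    if J: "J \<subseteq> I" "\<And>q. q \<in> J \<Longrightarrow> A q \<in> sets borel" for J A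
  proof -
    define B where "B q = (if q \<in> J then A q else UNIV)" for q
    have "prob {\<omega>\<in>space M. \<forall>q\<in>I. G q \<omega> \<in> B q} = (\<Prod>q\<in>I. measure std_normal_distribution (B q))"
      by (rule std_gauss_prob[OF G]) (use J in \<open>auto simp: B_def\<close>)
    also have "\<dots> = (\<Prod>q\<in>J. measure std_normal_distribution (A q))"
      using J fin N1 by (intro prod.mono_neutral_cong_right) (auto simp: B_def)
    also have "{\<omega>\<in>space M. \<forall>q\<in>I. G q \<omega> \<in> B q} = {\<omega>\<in>space M. \<forall>q\<in>J. G q \<omega> \<in> A q}"
      using J by (auto simp: B_def)
    finally show ?thesis .
  qed
  show d: "distr M borel (G q) = std_normal_distribution" if "q \<in> I" for q
  proof (rule measure_eqI)
    fix A assume "A \<in> sets (distr M borel (G q))"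
    then have A: "A \<in> sets borel" by simp
    have "prob {\<omega>\<in>space M. G q \<omega> \<in> A} = measure std_normal_distribution A"
      using sub[of "{q}" "\<lambda>_. A"] that A by simp
    moreover have "{\<omega>\<in>space M. G q \<omega> \<in> A} = G q -` A \<inter> space M" by auto
    ultimately show "emeasure (distr M borel (G q)) A = emeasure std_normal_distribution A"
      using A meas[OF that] by (simp add: emeasure_distr emeasure_eq_measure N.emeasure_eq_measure)
  qed simp
  show "indep_vars (\<lambda>_. borel) G I"
    unfolding indep_vars_def2
  proof (intro conjI ballI indep_setsI)
    show "G q \<in> borel_measurable M" if "q \<in> I" for q by (rule meas[OF that])
    show "{G q -` A \<inter> space M |A. A \<in> sets borel} \<subseteq> events" if "q \<in> I" for q
      using meas[OF that] by auto
    fix A J assume J: "J \<noteq> {}" "J \<subseteq> I" "finite J" and A: "\<forall>j\<in>J. A j \<in> {G j -` B \<inter> space M |B. B \<in> sets borel}"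
    then have "\<forall>j\<in>J. \<exists>B. A j = G j -` B \<inter> space M \<and> B \<in> sets borel" by blast
    then obtain B where B: "\<And>j. j \<in> J \<Longrightarrow> A j = G j -` B j \<inter> space M" "\<And>j. j \<in> J \<Longrightarrow> B j \<in> sets borel"
      by metis
    have "(\<Inter>j\<in>J. A j) = {\<omega>\<in>space M. \<forall>q\<in>J. G q \<omega> \<in> B q}"
      using J(1) B(1) by auto
    then have "prob (\<Inter>j\<in>J. A j) = (\<Prod>q\<in>J. measure std_normal_distribution (B q))"
      using sub[OF J(2) B(2)] by simp
    also have "\<dots> = (\<Prod>j\<in>J. prob (A j))"
    proof (intro prod.cong refl)
      fix j assume j: "j \<in> J"
      have "A j = {\<omega>\<in>space M. \<forall>q\<in>{j}. G q \<omega> \<in> B q}" using B(1)[OF j] by auto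
      then show "measure std_normal_distribution (B j) = prob (A j)"
        using sub[of "{j}" B] j J(2) B(2) by auto
    qed
    finally show "prob (\<Inter>j\<in>J. A j) = (\<Prod>j\<in>J. prob (A j))" .
  qed
qed

text \<open>Rotation invariance: a linear form in \<open>H\<close> with coefficients
  \<open>b\<close> is a form in \<open>G\<close> whose coefficient vector has the same Euclidean
  length, and the characteristic function depends on that length alone. Projections of columns,
  normalised rows, and sums and differences of rows are all obtained in this way.\<close>

lemma (in prob_space) std_gauss_orthonormal:
  assumes G: "std_gauss I G" and J: "finite J"
    and c: "\<And>r r'. r \<in> J \<Longrightarrow> r' \<in> J \<Longrightarrow> (\<Sum>q\<in>I. c r q * c r' q) = (if r = r' then 1 else 0)"
    and H: "\<And>r \<omega>. r \<in> J \<Longrightarrow> \<omega> \<in> space M \<Longrightarrow> H r \<omega> = (\<Sum>q\<in>I. c r q * G q \<omega>)"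
  shows "std_gauss J H"
  unfolding std_gauss_def
proof (intro conjI ballI allI J)
  have fin: "finite I" using G by (simp add: std_gauss_def)
  show "H r \<in> borel_measurable M" if "r \<in> J" for r
  proof -
    have "(\<lambda>\<omega>. \<Sum>q\<in>I. c r q * G q \<omega>) \<in> borel_measurable M"
      using G by (intro borel_measurable_sum borel_measurable_times) (auto simp: std_gauss_def)
    then show ?thesis by (subst measurable_cong[OF H[OF that]])
  qed
  fix b
  have eq: "(\<Sum>r\<in>J. b r * H r \<omega>) = (\<Sum>q\<in>I. (\<Sum>r\<in>J. b r * c r q) * G q \<omega>)" if "\<omega> \<in> space M" for \<omega>
  proof -
    have "(\<Sum>r\<in>J. b r * H r \<omega>) = (\<Sum>r\<in>J. \<Sum>q\<in>I. b r * c r q * G q \<omega>)"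
      using that by (intro sum.cong refl) (simp add: H sum_distrib_left mult.assoc)
    also have "\<dots> = (\<Sum>q\<in>I. \<Sum>r\<in>J. b r * c r q * G q \<omega>)" by (rule sum.swap)
    finally show ?thesis by (simp add: sum_distrib_right)
  qed
  have sq: "(\<Sum>q\<in>I. (\<Sum>r\<in>J. b r * c r q)\<^sup>2) = (\<Sum>r\<in>J. (b r)\<^sup>2)"
  proof -
    have "(\<Sum>q\<in>I. (\<Sum>r\<in>J. b r * c r q)\<^sup>2) = (\<Sum>q\<in>I. \<Sum>r\<in>J. \<Sum>r'\<in>J. b r * b r' * (c r q * c r' q))"
      by (simp add: power2_eq_square sum_product algebra_simps)
    also have "\<dots> = (\<Sum>r\<in>J. \<Sum>q\<in>I. \<Sum>r'\<in>J. b r * b r' * (c r q * c r' q))" by (rule sum.swap)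
    also have "\<dots> = (\<Sum>r\<in>J. \<Sum>r'\<in>J. b r * b r' * (\<Sum>q\<in>I. c r q * c r' q))"
      by (intro sum.cong refl, subst sum.swap) (simp add: sum_distrib_left)
    also have "\<dots> = (\<Sum>r\<in>J. \<Sum>r'\<in>J. if r = r' then b r * b r' else 0)"
      by (intro sum.cong refl) (simp add: c)
    also have "\<dots> = (\<Sum>r\<in>J. (b r)\<^sup>2)" using J by (simp add: power2_eq_square)
    finally show ?thesis .
  qed
  have "expectation (\<lambda>\<omega>. iexp (\<Sum>r\<in>J. b r * H r \<omega>)) = expectation (\<lambda>\<omega>. iexp (\<Sum>q\<in>I. (\<Sum>r\<in>J. b r * c r q) * G q \<omega>))"
    by (intro Bochner_Integration.integral_cong refl) (simp only: eq)
  also have "\<dots> = of_real (exp (- (\<Sum>q\<in>I. (\<Sum>r\<in>J. b r * c r q)\<^sup>2) / 2))"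
    using G[unfolded std_gauss_def, THEN conjunct2, THEN conjunct2, THEN spec[of _ "\<lambda>q. \<Sum>r\<in>J. b r * c r q"]] .
  finally show "expectation (\<lambda>\<omega>. iexp (\<Sum>r\<in>J. b r * H r \<omega>)) = of_real (exp (- (\<Sum>r\<in>J. (b r)\<^sup>2) / 2))"
    by (simp only: sq)
qed

section \<open>Tail bounds\<close>

definition normal_tail :: "real \<Rightarrow> real" where
  "normal_tail z = measure std_normal_distribution {x. z < \<bar>x\<bar>}"

lemma normal_tail_nonneg: "0 \<le> normal_tail z"
  by (simp add: normal_tail_def)

lemma normal_tail_le_1: "normal_tail z \<le> 1"
proof -
  interpret N: prob_space std_normal_distribution by (rule prob_space_std_normal)
  show ?thesis by (simp add: normal_tail_def)
qed

lemma normal_tail_antimono: "y \<le> z \<Longrightarrow> normal_tail z \<le> normal_tail y"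
proof -
  interpret N: prob_space std_normal_distribution by (rule prob_space_std_normal)
  assume "y \<le> z"
  then show ?thesis unfolding normal_tail_def by (intro N.finite_measure_mono) auto
qed

lemma emeasure_std_normal_atLeast:
  "emeasure std_normal_distribution {x. z < \<bar>x\<bar>} = 2 * (\<integral>\<^sup>+x. ennreal (std_normal_density x) * indicator {z..} x \<partial>lborel)"
  if z: "z > 0"
proof -
  have "emeasure std_normal_distribution {x. z < \<bar>x\<bar>} =
      (\<integral>\<^sup>+x. ennreal (std_normal_density x) * indicator {x. z < \<bar>x\<bar>} x \<partial>lborel)"
    by (subst emeasure_density) auto
  also have "\<dots> = (\<integral>\<^sup>+x. ennreal (std_normal_density x) * indicator {z<..} x + ennreal (std_normal_density x) * indicator {z<..} (-x) \<partial>lborel)"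
    by (intro nn_integral_cong) (use z in \<open>auto simp: indicator_def abs_if\<close>)
  also have "\<dots> = (\<integral>\<^sup>+x. ennreal (std_normal_density x) * indicator {z<..} x \<partial>lborel) +
      (\<integral>\<^sup>+x. ennreal (std_normal_density x) * indicator {z<..} (-x) \<partial>lborel)"
    by (subst nn_integral_add) auto
  also have "(\<integral>\<^sup>+x. ennreal (std_normal_density x) * indicator {z<..} (-x) \<partial>lborel) =
      (\<integral>\<^sup>+x. ennreal (std_normal_density x) * indicator {z<..} x \<partial>lborel)"
    by (subst nn_integral_real_affine[where c = "-1" and t = 0]) (auto simp: std_normal_density_def)
  also have "(\<integral>\<^sup>+x. ennreal (std_normal_density x) * indicator {z<..} x \<partial>lborel) =
      (\<integral>\<^sup>+x. ennreal (std_normal_density x) * indicator {z..} x \<partial>lborel)"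
    by (intro nn_integral_cong_AE AE_I[where N = "{z}"]) (auto simp: indicator_def)
  finally show ?thesis by (simp add: mult_2)
qed

text \<open>With \<phi> the standard normal density, -\<phi>(x)/x has derivative \<phi>(x)(1 +
  1/x^2), so the integral of the latter over the ray from z is exactly \<phi>(z)/z; on that ray the
  factor lies between 1 and 1 + 1/z^2.\<close>

lemma normal_tail_bounds:
  assumes z: "z > 0"
  shows "normal_tail z \<le> 2 * std_normal_density z / z"
    and "2 * std_normal_density z / (z * (1 + 1 / z\<^sup>2)) \<le> normal_tail z"
proof -
  interpret N: prob_space std_normal_distribution by (rule prob_space_std_normal)
  let ?\<phi> = std_normal_density
  have der: "((\<lambda>x. - (?\<phi> x / x)) has_real_derivative ?\<phi> x * (1 + 1 / x\<^sup>2)) (at x)" if "x \<ge> z" for x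
  proof -
    define c where "c = 1 / sqrt (2 * pi)"
    have eq: "?\<phi> = (\<lambda>x. c * exp (- x\<^sup>2 / 2))" by (rule ext) (simp add: std_normal_density_def c_def)
    show ?thesis unfolding eq using that z
      by (auto intro!: derivative_eq_intros simp: field_simps power2_eq_square)
  qed
  have lim: "((\<lambda>x. - (?\<phi> x / x)) \<longlongrightarrow> 0) at_top"
    unfolding std_normal_density_def by real_asymp
  define I where "I = (\<integral>\<^sup>+x. ennreal (?\<phi> x) * indicator {z..} x \<partial>lborel)"
  have FTC: "(\<integral>\<^sup>+x. ennreal (?\<phi> x * (1 + 1 / x\<^sup>2)) * indicator {z..} x \<partial>lborel) = ennreal (?\<phi> z / z)"
    by (subst nn_integral_FTC_atLeast[OF _ der _ lim]) (auto)
  have I1: "I \<le> ennreal (?\<phi> z / z)"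
    unfolding FTC[symmetric] I_def
    by (intro nn_integral_mono mult_right_mono ennreal_leI mult_left_le[of _ "_ :: real"]) (auto simp: field_simps)
  have I2: "ennreal (?\<phi> z / z) \<le> ennreal (1 + 1 / z\<^sup>2) * I"
  proof -
    have "ennreal (?\<phi> x * (1 + 1 / x\<^sup>2)) * indicator {z..} x \<le> ennreal (1 + 1 / z\<^sup>2) * (ennreal (?\<phi> x) * indicator {z..} x)" for x
    proof (cases "x \<ge> z")
      case True
      then have "?\<phi> x * (1 + 1 / x\<^sup>2) \<le> (1 + 1 / z\<^sup>2) * ?\<phi> x"
        using z by (subst mult.commute, intro mult_right_mono add_left_mono divide_left_mono power_mono) auto
      then have "ennreal (?\<phi> x * (1 + 1 / x\<^sup>2)) \<le> ennreal ((1 + 1 / z\<^sup>2) * ?\<phi> x)" by (rule ennreal_leI)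
      then show ?thesis using True z by (simp add: ennreal_mult)
    qed auto
    then show ?thesis
      unfolding FTC[symmetric] I_def by (subst nn_integral_cmult[symmetric]) (auto intro!: nn_integral_mono)
  qed
  have tail: "ennreal (normal_tail z) = 2 * I"
    unfolding normal_tail_def N.emeasure_eq_measure[symmetric] I_def by (rule emeasure_std_normal_atLeast[OF z])
  have two: "2 * ennreal a = ennreal (2 * a)" if "a \<ge> 0" for a
    unfolding mult_2 by (rule ennreal_plus[OF that that, symmetric])
  have "ennreal (normal_tail z) \<le> 2 * ennreal (?\<phi> z / z)" unfolding tail by (intro mult_left_mono I1) auto
  also have "\<dots> = ennreal (2 * ?\<phi> z / z)" using z by (subst two) auto
  finally show "normal_tail z \<le> 2 * ?\<phi> z / z" using z by (subst (asm) ennreal_le_iff) auto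
  have "ennreal (2 * ?\<phi> z / z) = 2 * ennreal (?\<phi> z / z)" using z by (subst two) auto
  also have "\<dots> \<le> 2 * (ennreal (1 + 1 / z\<^sup>2) * I)" by (intro mult_left_mono I2) auto
  also have "\<dots> = ennreal (1 + 1 / z\<^sup>2) * ennreal (normal_tail z)" by (simp add: tail mult_ac)
  also have "\<dots> = ennreal ((1 + 1 / z\<^sup>2) * normal_tail z)" by (simp add: ennreal_mult normal_tail_nonneg)
  finally have "2 * ?\<phi> z / z \<le> (1 + 1 / z\<^sup>2) * normal_tail z"
    by (subst (asm) ennreal_le_iff) (simp add: normal_tail_nonneg)
  moreover have "1 + 1 / z\<^sup>2 > 0" by (simp add: add_pos_nonneg)
  ultimately have "2 * ?\<phi> z / z / (1 + 1 / z\<^sup>2) \<le> normal_tail z"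
    by (subst pos_divide_le_eq) (auto simp only: mult.commute)
  then show "2 * ?\<phi> z / (z * (1 + 1 / z\<^sup>2)) \<le> normal_tail z"
    by (simp only: divide_divide_eq_left)
qed

lemma (in prob_space) std_gauss_linear_tail:
  assumes G: "std_gauss I G" and v: "(\<Sum>q\<in>I. (c q)\<^sup>2) = v" and v0: "v > 0"
  shows "prob {\<omega>\<in>space M. x < \<bar>\<Sum>q\<in>I. c q * G q \<omega>\<bar>} = normal_tail (x / sqrt v)"
proof -
  define H where "H r \<omega> = (\<Sum>q\<in>I. (c q / sqrt v) * G q \<omega>)" for r :: unit and \<omega>
  have "(\<Sum>q\<in>I. (c q / sqrt v) * (c q / sqrt v)) = (\<Sum>q\<in>I. (c q)\<^sup>2) / v"
    using v0 by (simp add: power2_eq_square sum_divide_distrib)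
  then have "std_gauss {()} H"
    by (intro std_gauss_orthonormal[OF G, of _ "\<lambda>_ q. c q / sqrt v"]) (use v v0 in \<open>auto simp: H_def\<close>)
  then have D: "distr M borel (H ()) = std_normal_distribution" "H () \<in> borel_measurable M"
    using std_gauss_indep_vars(2)[of "{()}" H "()"] by (auto simp: std_gauss_def)
  have eq: "(\<Sum>q\<in>I. c q * G q \<omega>) = sqrt v * H () \<omega>" for \<omega>
    using v0 by (simp add: H_def sum_distrib_left)
  have "normal_tail (x / sqrt v) = measure (distr M borel (H ())) {z. x / sqrt v < \<bar>z\<bar>}"
    by (simp add: normal_tail_def D)
  also have "\<dots> = prob (H () -` {z. x / sqrt v < \<bar>z\<bar>} \<inter> space M)"
    by (rule measure_distr) (use D in auto)
  also have "H () -` {z. x / sqrt v < \<bar>z\<bar>} \<inter> space M = {\<omega>\<in>space M. x < \<bar>\<Sum>q\<in>I. c q * G q \<omega>\<bar>}"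
    using v0 by (auto simp: eq abs_mult field_simps)
  finally show ?thesis by simp
qed

text \<open>Completing the square: up to the constant on the right, the integrand against Lebesgue
  measure is the density of a normal variable with variance 1/(1 - 2y).\<close>

lemma nn_integral_exp_square_std_normal:
  assumes y: "y < 1 / 2"
  shows "(\<integral>\<^sup>+x. ennreal (exp (y * (x\<^sup>2 - 1))) \<partial>std_normal_distribution) = ennreal (exp (-y) / sqrt (1 - 2 * y))"
proof -
  define \<sigma> where "\<sigma> = 1 / sqrt (1 - 2 * y)"
  have s: "\<sigma> > 0" "\<sigma>\<^sup>2 = 1 / (1 - 2 * y)" using y by (simp_all add: \<sigma>_def power_divide)
  have eq: "std_normal_density x * exp (y * (x\<^sup>2 - 1)) = exp (-y) * \<sigma> * normal_density 0 \<sigma> x" for x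
  proof -
    have "- x\<^sup>2 / 2 + y * (x\<^sup>2 - 1) = - y + (- x\<^sup>2 / (2 * \<sigma>\<^sup>2))"
      using y unfolding s by (simp add: field_simps)
    then have e: "exp (- x\<^sup>2 / 2) * exp (y * (x\<^sup>2 - 1)) = exp (-y) * exp (- x\<^sup>2 / (2 * \<sigma>\<^sup>2))"
      by (simp add: exp_add[symmetric])
    have "sqrt (2 * pi * \<sigma>\<^sup>2) = sqrt (2 * pi) * \<sigma>" using s(1) by (simp add: real_sqrt_mult)
    then show ?thesis using e s(1) by (simp add: normal_density_def field_simps)
  qed
  have "(\<integral>\<^sup>+x. ennreal (exp (y * (x\<^sup>2 - 1))) \<partial>std_normal_distribution) =
    (\<integral>\<^sup>+x. ennreal (std_normal_density x * exp (y * (x\<^sup>2 - 1))) \<partial>lborel)"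
    by (subst nn_integral_density) (auto simp: ennreal_mult)
  also have "\<dots> = (\<integral>\<^sup>+x. ennreal (exp (-y) * \<sigma>) * ennreal (normal_density 0 \<sigma> x) \<partial>lborel)"
    unfolding eq using s by (intro nn_integral_cong) (simp add: ennreal_mult)
  also have "\<dots> = ennreal (exp (-y) * \<sigma>) * (\<integral>\<^sup>+x. ennreal (normal_density 0 \<sigma> x) \<partial>lborel)"
    by (rule nn_integral_cmult) auto
  also have "(\<integral>\<^sup>+x. ennreal (normal_density 0 \<sigma> x) \<partial>lborel) = 1"
    by (subst nn_integral_eq_integral) (use s in auto)
  finally show ?thesis by (simp add: \<sigma>_def)
qed

text \<open>The logarithm of the left side starts with y^2, so only the factor 1 + 4\<delta> is
  given away. The slack \<open>f\<close> vanishes at 0, and its derivative is 2x times a nonnegative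
  factor, so 0 is its minimum on the interval.\<close>

lemma exp_square_mgf_bound:
  fixes y \<delta> :: real
  assumes y: "\<bar>y\<bar> \<le> \<delta>" and d: "\<delta> \<le> 1 / 4"
  shows "exp (-y) / sqrt (1 - 2 * y) \<le> exp (y\<^sup>2 * (1 + 4 * \<delta>))"
proof -
  define f where "f x = x\<^sup>2 * (1 + 4 * \<delta>) + x + ln (1 - 2 * x) / 2" for x :: real
  have der: "(f has_real_derivative 2 * x * ((1 + 4 * \<delta>) - 1 / (1 - 2 * x))) (at x)" if "\<bar>x\<bar> \<le> \<delta>" for x
  proof -
    have "1 - 2 * x > 0" using that d by (auto simp: abs_le_iff)
    then show ?thesis unfolding f_def
      by (auto intro!: derivative_eq_intros simp: field_simps power2_eq_square)
  qed
  \<comment> \<open>Holds because (1 + 4\<delta>)(1 - 2\<delta>) \<ge> 1 for 0 \<le> \<delta> \<le>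
    1/4.\<close>
  have sgn: "(1 + 4 * \<delta>) - 1 / (1 - 2 * x) \<ge> 0" if "\<bar>x\<bar> \<le> \<delta>" for x
  proof -
    have pos: "1 - 2 * x > 0" using that d by (auto simp: abs_le_iff)
    have "1 \<le> (1 + 4 * \<delta>) * (1 - 2 * \<delta>)"
    proof -
      have "0 \<le> \<delta> * (1 - 4 * \<delta>)" using y d by (intro mult_nonneg_nonneg) auto
      then show ?thesis by (simp add: algebra_simps)
    qed
    also have "\<dots> \<le> (1 + 4 * \<delta>) * (1 - 2 * x)" using that y by (intro mult_left_mono) auto
    finally show ?thesis using pos by (simp add: field_simps)
  qed
  have "f 0 \<le> f y"
  proof (cases "y \<ge> 0")
    case True
    show ?thesis
      by (rule DERIV_nonneg_imp_nondecreasing[OF True])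
        (use y in \<open>auto intro!: exI[of _ "2 * _ * ((1 + 4 * \<delta>) - 1 / (1 - 2 * _))"] der mult_nonneg_nonneg sgn simp: abs_le_iff\<close>)
  next
    case False
    then have "y \<le> 0" by simp
    then show ?thesis
    proof (rule DERIV_nonpos_imp_nonincreasing)
      fix x assume "y \<le> x" "x \<le> 0"
      then have x: "\<bar>x\<bar> \<le> \<delta>" "2 * x \<le> 0" using y by auto
      show "\<exists>d. DERIV f x :> d \<and> d \<le> 0"
        using der[OF x(1)] mult_nonpos_nonneg[OF x(2) sgn[OF x(1)]] by blast
    qed
  qed
  then have "- y - ln (1 - 2 * y) / 2 \<le> y\<^sup>2 * (1 + 4 * \<delta>)" by (simp add: f_def)
  then have "exp (- y - ln (1 - 2 * y) / 2) \<le> exp (y\<^sup>2 * (1 + 4 * \<delta>))" by simp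
  moreover have "exp (- y - ln (1 - 2 * y) / 2) = exp (-y) / sqrt (1 - 2 * y)"
  proof -
    have pos: "1 - 2 * y > 0" using y d by (auto simp: abs_le_iff)
    have "exp (ln (1 - 2 * y) / 2) = sqrt (1 - 2 * y)"
      using pos by (simp add: ln_sqrt[symmetric])
    then show ?thesis by (simp add: exp_diff)
  qed
  ultimately show ?thesis by simp
qed

text \<open>The constant \<open>1 + 4 * \<delta>\<close> is close to the Gaussian one; the thresholding estimate needs this.\<close>

lemma (in prob_space) std_gauss_chernoff:
  assumes G: "std_gauss I G" and aA: "\<And>q. q \<in> I \<Longrightarrow> \<bar>a q\<bar> \<le> A"
    and S: "(\<Sum>q\<in>I. (a q)\<^sup>2) \<le> S" "S > 0" and d: "0 < \<delta>" "\<delta> \<le> 1 / 4"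
    and x: "0 \<le> x" "x * A \<le> 2 * S * \<delta>"
  shows "prob {\<omega>\<in>space M. x \<le> (\<Sum>q\<in>I. a q * ((G q \<omega>)\<^sup>2 - 1))} \<le> exp (- x\<^sup>2 / (4 * (1 + 4 * \<delta>) * S))"
proof -
  define \<kappa> where "\<kappa> = 1 + 4 * \<delta>"
  \<comment> \<open>The minimiser of the exponent -l x + l^2 \<kappa> S. The hypothesis on
    \<open>x * A\<close> keeps every \<open>l * a q\<close> in the range of
    \<open>exp_square_mgf_bound\<close>.\<close>
  define l where "l = x / (2 * \<kappa> * S)"
  have k: "\<kappa> > 1" using d by (simp add: \<kappa>_def)
  have l0: "l \<ge> 0" using x S k by (simp add: l_def)
  have la: "\<bar>l * a q\<bar> \<le> \<delta>" if "q \<in> I" for q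
  proof -
    have "\<bar>l * a q\<bar> \<le> l * A" using l0 aA[OF that] by (simp add: abs_mult mult_left_mono)
    also have "\<dots> \<le> \<delta>"
    proof -
      have "l * A = x * A / (2 * S) / \<kappa>" by (simp add: l_def)
      also have "\<dots> \<le> \<delta> / \<kappa>" using x S k by (intro divide_right_mono) (auto simp: field_simps)
      also have "\<dots> \<le> \<delta>" using k d by (simp add: field_simps)
      finally show ?thesis .
    qed
    finally show ?thesis .
  qed
  have fin: "finite I" using G by (simp add: std_gauss_def)
  have meas: "G q \<in> borel_measurable M" if "q \<in> I" for q using G that by (simp add: std_gauss_def)
  define f where "f q \<omega> = ennreal (exp (l * a q * ((G q \<omega>)\<^sup>2 - 1)))" for q \<omega>
  have fm: "f q \<in> borel_measurable M" if "q \<in> I" for q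
    unfolding f_def using meas[OF that] by measurable
  have ind: "indep_vars (\<lambda>_. borel) f I"
    unfolding f_def by (rule indep_vars_compose2[OF std_gauss_indep_vars(1)[OF G]]) measurable
  have int: "(\<integral>\<^sup>+\<omega>. f q \<omega> \<partial>M) \<le> ennreal (exp ((l * a q)\<^sup>2 * \<kappa>))" if q: "q \<in> I" for q
  proof -
    have lt: "l * a q < 1 / 2" using la[OF q] d by (auto simp: abs_le_iff)
    have "(\<integral>\<^sup>+\<omega>. f q \<omega> \<partial>M) = (\<integral>\<^sup>+z. ennreal (exp (l * a q * (z\<^sup>2 - 1))) \<partial>distr M borel (G q))"
      unfolding f_def by (subst nn_integral_distr) (use meas[OF q] in auto)
    also have "\<dots> = ennreal (exp (- (l * a q)) / sqrt (1 - 2 * (l * a q)))"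
      unfolding std_gauss_indep_vars(2)[OF G q] by (rule nn_integral_exp_square_std_normal[OF lt])
    also have "\<dots> \<le> ennreal (exp ((l * a q)\<^sup>2 * \<kappa>))"
      unfolding \<kappa>_def by (intro ennreal_leI exp_square_mgf_bound la q d)
    finally show ?thesis .
  qed
  let ?Y = "\<lambda>\<omega>. \<Sum>q\<in>I. a q * ((G q \<omega>)\<^sup>2 - 1)"
  have Ym: "?Y \<in> borel_measurable M"
    using meas by (intro borel_measurable_sum borel_measurable_times borel_measurable_diff borel_measurable_power) auto
  have prod: "(\<Prod>q\<in>I. f q \<omega>) = ennreal (exp (l * ?Y \<omega>))" for \<omega>
    unfolding f_def by (subst prod_ennreal) (auto simp: exp_sum[OF fin, symmetric] sum_distrib_left mult.assoc)
  have "emeasure M {\<omega>\<in>space M. x \<le> ?Y \<omega>} \<le> emeasure M {\<omega>\<in>space M. 1 \<le> ennreal (exp (- l * x)) * ennreal (exp (l * ?Y \<omega>))}"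
  proof (rule emeasure_mono)
    show "{\<omega>\<in>space M. x \<le> ?Y \<omega>} \<subseteq> {\<omega>\<in>space M. 1 \<le> ennreal (exp (- l * x)) * ennreal (exp (l * ?Y \<omega>))}"
    proof safe
      fix \<omega> assume "x \<le> ?Y \<omega>"
      then have "l * x \<le> l * ?Y \<omega>" using l0 by (intro mult_left_mono)
      then show "1 \<le> ennreal (exp (- l * x)) * ennreal (exp (l * ?Y \<omega>))"
        by (simp add: ennreal_mult[symmetric] exp_add[symmetric])
    qed
    show "{\<omega>\<in>space M. 1 \<le> ennreal (exp (- l * x)) * ennreal (exp (l * ?Y \<omega>))} \<in> events"
      using Ym by measurable
  qed
  also have "\<dots> \<le> ennreal (exp (- l * x)) * (\<integral>\<^sup>+\<omega>. ennreal (exp (l * ?Y \<omega>)) \<partial>M)"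
    using nn_integral_Markov_inequality[of "\<lambda>\<omega>. ennreal (exp (l * ?Y \<omega>))" "space M" M "ennreal (exp (- l * x))"] Ym
    by (simp cong: nn_integral_cong)
  also have "(\<integral>\<^sup>+\<omega>. ennreal (exp (l * ?Y \<omega>)) \<partial>M) = (\<Prod>q\<in>I. \<integral>\<^sup>+\<omega>. f q \<omega> \<partial>M)"
    unfolding prod[symmetric] by (rule indep_vars_nn_integral[OF fin ind]) auto
  also have "\<dots> \<le> (\<Prod>q\<in>I. ennreal (exp ((l * a q)\<^sup>2 * \<kappa>)))"
    using fin int by (induction I) (auto intro!: mult_mono)
  also have "\<dots> = ennreal (exp (l\<^sup>2 * \<kappa> * (\<Sum>q\<in>I. (a q)\<^sup>2)))"
    by (subst prod_ennreal) (auto simp: exp_sum[OF fin, symmetric] sum_distrib_left power_mult_distrib mult_ac)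
  also have "\<dots> \<le> ennreal (exp (l\<^sup>2 * \<kappa> * S))"
    using S k by (intro ennreal_leI) (auto intro!: mult_left_mono)
  finally have "emeasure M {\<omega>\<in>space M. x \<le> ?Y \<omega>} \<le> ennreal (exp (- l * x)) * ennreal (exp (l\<^sup>2 * \<kappa> * S))"
    by (simp add: mult_left_mono)
  also have "\<dots> = ennreal (exp (- x\<^sup>2 / (4 * \<kappa> * S)))"
  proof -
    have "- l * x + l\<^sup>2 * \<kappa> * S = - x\<^sup>2 / (4 * \<kappa> * S)"
      using S k by (simp add: l_def field_simps power2_eq_square)
    then show ?thesis by (simp add: ennreal_mult[symmetric] exp_add[symmetric])
  qed
  finally show ?thesis by (simp add: emeasure_eq_measure \<kappa>_def)
qed

lemma (in prob_space) std_gauss_chernoff_abs: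
  assumes G: "std_gauss I G" and aA: "\<And>q. q \<in> I \<Longrightarrow> \<bar>a q\<bar> \<le> A"
    and S: "(\<Sum>q\<in>I. (a q)\<^sup>2) \<le> S" "S > 0" and d: "0 < \<delta>" "\<delta> \<le> 1 / 4"
    and x: "0 \<le> x" "x * A \<le> 2 * S * \<delta>"
  shows "prob {\<omega>\<in>space M. x \<le> \<bar>\<Sum>q\<in>I. a q * ((G q \<omega>)\<^sup>2 - 1)\<bar>} \<le> 2 * exp (- x\<^sup>2 / (4 * (1 + 4 * \<delta>) * S))"
proof -
  let ?Y = "\<lambda>a \<omega>. \<Sum>q\<in>I. a q * ((G q \<omega>)\<^sup>2 - 1)"
  have meas: "G q \<in> borel_measurable M" if "q \<in> I" for q using G that by (simp add: std_gauss_def)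
  have Ym[measurable]: "?Y a \<in> borel_measurable M" for a
    using meas by (intro borel_measurable_sum borel_measurable_times borel_measurable_diff borel_measurable_power) auto
  have neg: "?Y (\<lambda>q. - a q) \<omega> = - ?Y a \<omega>" for \<omega> by (simp add: sum_negf)
  have "prob {\<omega>\<in>space M. x \<le> \<bar>?Y a \<omega>\<bar>} \<le> prob ({\<omega>\<in>space M. x \<le> ?Y a \<omega>} \<union> {\<omega>\<in>space M. x \<le> ?Y (\<lambda>q. - a q) \<omega>})"
    unfolding neg by (intro finite_measure_mono) auto
  also have "\<dots> \<le> prob {\<omega>\<in>space M. x \<le> ?Y a \<omega>} + prob {\<omega>\<in>space M. x \<le> ?Y (\<lambda>q. - a q) \<omega>}"
    by (rule measure_Un_le) measurable
  also have "prob {\<omega>\<in>space M. x \<le> ?Y a \<omega>} \<le> exp (- x\<^sup>2 / (4 * (1 + 4 * \<delta>) * S))"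
    by (rule std_gauss_chernoff[OF G aA S d x])
  also have "prob {\<omega>\<in>space M. x \<le> ?Y (\<lambda>q. - a q) \<omega>} \<le> exp (- x\<^sup>2 / (4 * (1 + 4 * \<delta>) * S))"
    by (rule std_gauss_chernoff[OF G _ _ S(2) d x]) (use aA S in auto)
  finally show ?thesis by simp
qed

text \<open>Stands in for conditioning on \<open>X\<close>: the two components use different sample
  points, so inside the inner probability \<open>X \<omega>\<close> is a constant and exact Gaussian
  tails apply.\<close>

lemma (in prob_space) indep_var_prob_fubini:
  assumes ind: "indep_var S X T Y" and E: "E \<in> sets (S \<Otimes>\<^sub>M T)"
  shows "(\<lambda>\<omega>. prob {\<omega>'\<in>space M. (X \<omega>, Y \<omega>') \<in> E}) \<in> borel_measurable M"
    and "prob {\<omega>\<in>space M. (X \<omega>, Y \<omega>) \<in> E} = expectation (\<lambda>\<omega>. prob {\<omega>'\<in>space M. (X \<omega>, Y \<omega>') \<in> E})"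
proof -
  have X[measurable]: "X \<in> measurable M S" and Y[measurable]: "Y \<in> measurable M T"
    using indep_var_rv1[OF ind] indep_var_rv2[OF ind] .
  interpret DX: prob_space "distr M S X" by (rule prob_space_distr) simp
  interpret DY: prob_space "distr M T Y" by (rule prob_space_distr) simp
  have sec: "Pair x -` E \<in> sets T" for x using E by (rule sets_Pair1)
  have inner: "measure (distr M T Y) (Pair x -` E) = prob {\<omega>'\<in>space M. (x, Y \<omega>') \<in> E}" for x
  proof -
    have "Y -` (Pair x -` E) \<inter> space M = {\<omega>'\<in>space M. (x, Y \<omega>') \<in> E}" by auto
    then show ?thesis using measure_distr[OF Y sec] by simp
  qed
  have m: "(\<lambda>x. emeasure (distr M T Y) (Pair x -` E)) \<in> borel_measurable (distr M S X)"
    by (rule DY.measurable_emeasure_Pair) (use E in simp)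
  have m': "(\<lambda>x. measure (distr M T Y) (Pair x -` E)) \<in> borel_measurable S"
    using m unfolding measure_def by measurable
  show meas: "(\<lambda>\<omega>. prob {\<omega>'\<in>space M. (X \<omega>, Y \<omega>') \<in> E}) \<in> borel_measurable M"
    unfolding inner[symmetric] by (rule measurable_compose[OF X m'])
  have "ennreal (prob {\<omega>\<in>space M. (X \<omega>, Y \<omega>) \<in> E}) = emeasure (distr M (S \<Otimes>\<^sub>M T) (\<lambda>\<omega>. (X \<omega>, Y \<omega>))) E"
    using E by (subst emeasure_distr) (auto simp: emeasure_eq_measure vimage_def Int_def conj_commute)
  also have "\<dots> = emeasure (distr M S X \<Otimes>\<^sub>M distr M T Y) E"
    using ind by (simp add: indep_var_distribution_eq)
  also have "\<dots> = (\<integral>\<^sup>+x. emeasure (distr M T Y) (Pair x -` E) \<partial>distr M S X)"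
    by (rule DY.emeasure_pair_measure_alt) (use E in simp)
  also have "\<dots> = (\<integral>\<^sup>+x. ennreal (measure (distr M T Y) (Pair x -` E)) \<partial>distr M S X)"
    by (simp add: DY.emeasure_eq_measure)
  also have "\<dots> = (\<integral>\<^sup>+\<omega>. ennreal (prob {\<omega>'\<in>space M. (X \<omega>, Y \<omega>') \<in> E}) \<partial>M)"
    by (subst nn_integral_distr) (use m' in \<open>auto simp: inner\<close>)
  also have "\<dots> = ennreal (expectation (\<lambda>\<omega>. prob {\<omega>'\<in>space M. (X \<omega>, Y \<omega>') \<in> E}))"
    by (rule nn_integral_eq_integral) (auto intro!: integrable_const_bound[of _ 1] meas)
  finally show "prob {\<omega>\<in>space M. (X \<omega>, Y \<omega>) \<in> E} = expectation (\<lambda>\<omega>. prob {\<omega>'\<in>space M. (X \<omega>, Y \<omega>') \<in> E})"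
    by (subst (asm) ennreal_inj) (auto intro!: Bochner_Integration.integral_nonneg)
qed

section \<open>Maxima of inner products of Gaussian columns\<close>

definition gram :: "nat \<Rightarrow> (nat \<Rightarrow> real) \<Rightarrow> (nat \<times> nat \<Rightarrow> real) \<Rightarrow> nat \<Rightarrow> nat \<Rightarrow> real" where
  "gram p d g i j = (\<Sum>k<p. d k * g (k, i) * g (k, j))"

text \<open>The variance of \<open>gram p d g i j\<close> over a standard Gaussian column
  \<open>j\<close> with column \<open>i\<close> held fixed.\<close>

definition cond_var :: "nat \<Rightarrow> (nat \<Rightarrow> real) \<Rightarrow> (nat \<times> nat \<Rightarrow> real) \<Rightarrow> nat \<Rightarrow> real" where
  "cond_var p d g i = (\<Sum>k<p. (d k * g (k, i))\<^sup>2)"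

text \<open>The probability that a centred normal variable of variance \<open>v\<close> exceeds
  \<open>x\<close> in modulus. For v = 0 this is a point mass at 0, hence the value 0 for x \<ge> 0;
  vanishing coefficient vectors are then no exception.\<close>

definition cond_tail :: "real \<Rightarrow> real \<Rightarrow> real" where
  "cond_tail x v = (if v > 0 then normal_tail (x / sqrt v) else 0)"

lemma cond_tail_bounds: "0 \<le> cond_tail x v" "cond_tail x v \<le> 1"
  by (simp_all add: cond_tail_def normal_tail_nonneg normal_tail_le_1)

lemma cond_tail_mono:
  assumes "0 \<le> x" "v \<le> w"
  shows "cond_tail x v \<le> cond_tail x w"
proof (cases "v > 0")
  case True
  then have "x / sqrt w \<le> x / sqrt v" using assms by (intro divide_left_mono) auto
  then show ?thesis using True assms by (auto simp: cond_tail_def intro: normal_tail_antimono)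
qed (simp add: cond_tail_bounds cond_tail_def normal_tail_nonneg)

lemma cond_tail_measurable [measurable]:
  assumes "0 \<le> x" shows "cond_tail x \<in> borel_measurable borel"
  by (intro borel_measurable_mono monoI cond_tail_mono assms)

lemma (in prob_space) std_gauss_subfamily:
  assumes "std_gauss I G" "finite J" "\<And>r. r \<in> J \<Longrightarrow> \<phi> r \<in> I" "inj_on \<phi> J"
  shows "std_gauss J (\<lambda>r. G (\<phi> r))"
proof -
  have fin: "finite I" using assms by (simp add: std_gauss_def)
  show ?thesis
  proof (rule std_gauss_orthonormal[OF assms(1,2), of "\<lambda>r q. if q = \<phi> r then 1 else 0"])
    fix r r' assume r: "r \<in> J" "r' \<in> J"
    have "(\<Sum>q\<in>I. (if q = \<phi> r then 1 else 0) * (if q = \<phi> r' then 1 else 0)) =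
      (\<Sum>q\<in>I. if q = \<phi> r then (if \<phi> r = \<phi> r' then 1 else 0) else (0::real))"
      by (intro sum.cong) auto
    also have "\<dots> = (if r = r' then 1 else 0)" using fin assms(3,4) r by (auto simp: inj_on_def)
    finally show "(\<Sum>q\<in>I. (if q = \<phi> r then 1 else 0) * (if q = \<phi> r' then 1 else 0)) = (if r = r' then 1 else (0::real))" .
  next
    fix r \<omega> assume "r \<in> J"
    have "(\<Sum>q\<in>I. (if q = \<phi> r then 1 else 0) * G q \<omega>) = (\<Sum>q\<in>I. if q = \<phi> r then G q \<omega> else 0)"
      by (intro sum.cong) auto
    then show "G (\<phi> r) \<omega> = (\<Sum>q\<in>I. (if q = \<phi> r then 1 else 0) * G q \<omega>)"
      using fin assms(3)[OF \<open>r \<in> J\<close>] by simp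
  qed
qed

text \<open>Adding \<open>F m\<close> loses its overlap with the earlier union, at most m c. The
  number of pairs is rounded up to m^2.\<close>

lemma (in prob_space) bonferroni_lower:
  assumes F: "\<And>i. i < m \<Longrightarrow> F i \<in> events"
    and c: "\<And>a b. a < b \<Longrightarrow> b < m \<Longrightarrow> prob (F a \<inter> F b) \<le> c" and c0: "0 \<le> c"
  shows "(\<Sum>i<m. prob (F i)) - real m ^ 2 * c \<le> prob (\<Union>i<m. F i)"
  using F c
proof (induction m)
  case 0
  then show ?case by simp
next
  case (Suc m)
  let ?U = "\<Union>i<m. F i"
  have U: "?U \<in> events" "F m \<in> events" using Suc.prems(1) by auto
  have "prob (?U \<inter> F m) = prob (\<Union>i<m. F i \<inter> F m)" by (intro arg_cong[where f = prob]) auto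
  also have "\<dots> \<le> (\<Sum>i<m. prob (F i \<inter> F m))"
    using Suc.prems(1) by (intro measure_UNION_le) auto
  also have "\<dots> \<le> (\<Sum>i<m. c)" by (intro sum_mono Suc.prems(2)) auto
  finally have 1: "prob (?U \<inter> F m) \<le> real m * c" by simp
  have "(\<Union>i<Suc m. F i) = ?U \<union> F m" by (auto simp: less_Suc_eq)
  then have "prob (\<Union>i<Suc m. F i) = prob ?U + prob (F m) - prob (?U \<inter> F m)"
    using measure_Un3[of ?U M "F m"] U by (simp add: fmeasurable_eq_sets)
  moreover have "(\<Sum>i<m. prob (F i)) - real m ^ 2 * c \<le> prob ?U"
    by (rule Suc.IH) (use Suc.prems in auto)
  moreover have "real m ^ 2 * c + real m * c \<le> real (Suc m) ^ 2 * c"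
    using c0 by (subst distrib_right[symmetric], intro mult_right_mono) (auto simp: power2_eq_square algebra_simps)
  ultimately show ?case using 1 by simp
qed

locale gaussian_columns = prob_space M for M :: "'a measure" +
  fixes p n :: nat and d :: "nat \<Rightarrow> real" and G :: "nat \<times> nat \<Rightarrow> 'a \<Rightarrow> real"
  assumes G: "std_gauss ({..<p} \<times> {..<n}) G"
begin

abbreviation Gs :: "'a \<Rightarrow> nat \<times> nat \<Rightarrow> real" where "Gs \<omega> \<equiv> \<lambda>q. G q \<omega>"

lemma G_measurable: "k < p \<Longrightarrow> i < n \<Longrightarrow> G (k, i) \<in> borel_measurable M"
  using G by (auto simp: std_gauss_def)

lemma gram_measurable: "i < n \<Longrightarrow> j < n \<Longrightarrow> (\<lambda>\<omega>. gram p d (Gs \<omega>) i j) \<in> borel_measurable M"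
  unfolding gram_def using G_measurable by (intro borel_measurable_sum borel_measurable_times) auto

lemma cond_var_measurable: "i < n \<Longrightarrow> (\<lambda>\<omega>. cond_var p d (Gs \<omega>) i) \<in> borel_measurable M"
  unfolding cond_var_def using G_measurable by (intro borel_measurable_sum borel_measurable_power borel_measurable_times) auto

lemma column_std_gauss: "j < n \<Longrightarrow> std_gauss {..<p} (\<lambda>k. G (k, j))"
  by (rule std_gauss_subfamily[OF G, where \<phi> = "\<lambda>k. (k, j)"]) (auto simp: inj_on_def)

lemma column_tail:
  assumes j: "j < n" and x: "0 \<le> x"
  shows "prob {\<omega>\<in>space M. x < \<bar>\<Sum>k<p. c k * G (k, j) \<omega>\<bar>} = cond_tail x (\<Sum>k<p. (c k)\<^sup>2)"
proof (cases "(\<Sum>k<p. (c k)\<^sup>2) = 0")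
  case True
  then have "\<forall>k<p. c k = 0" by (subst (asm) sum_nonneg_eq_0_iff) auto
  then show ?thesis using True x by (simp add: cond_tail_def)
next
  case False
  then have "(\<Sum>k<p. (c k)\<^sup>2) > 0" by (simp add: sum_nonneg less_le)
  then show ?thesis using std_gauss_linear_tail[OF column_std_gauss[OF j], of c _ x] by (simp add: cond_tail_def)
qed

lemma two_columns_tail:
  assumes ab: "a < n" "b < n" "a \<noteq> b" and x: "0 \<le> x"
  shows "prob {\<omega>\<in>space M. x < \<bar>\<Sum>k<p. c k * G (k, a) \<omega>\<bar> \<and> x < \<bar>\<Sum>k<p. c k * G (k, b) \<omega>\<bar>} =
    (cond_tail x (\<Sum>k<p. (c k)\<^sup>2))\<^sup>2"
proof (cases "(\<Sum>k<p. (c k)\<^sup>2) = 0")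
  case True
  then have "\<forall>k<p. c k = 0" by (subst (asm) sum_nonneg_eq_0_iff) auto
  then show ?thesis using True x by (simp add: cond_tail_def)
next
  case False
  define v where "v = (\<Sum>k<p. (c k)\<^sup>2)"
  have v: "v > 0" using False by (simp add: v_def sum_nonneg less_le)
  define H where "H r \<omega> = (\<Sum>k<p. (c k / sqrt v) * G (k, r) \<omega>)" for r \<omega>
  \<comment> \<open>The coefficients of \<open>H r\<close> in the full family: the unit vector
    \<open>c / sqrt v\<close> placed in column \<open>r\<close>. Different columns have disjoint
    supports, hence orthogonality.\<close>
  define e where "e r q = (if snd q = r then c (fst q) / sqrt v else 0)" for r :: nat and q :: "nat \<times> nat"
  have cart: "(\<Sum>q\<in>{..<p}\<times>{..<n}. f q) = (\<Sum>k<p. \<Sum>i<n. f (k, i))" for f :: "nat \<times> nat \<Rightarrow> real"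
    by (simp add: sum.cartesian_product)
  have "std_gauss {a, b} H"
  proof (rule std_gauss_orthonormal[OF G, of _ e])
    fix r r' assume r: "r \<in> {a, b}" "r' \<in> {a, b}"
    have "(\<Sum>q\<in>{..<p}\<times>{..<n}. e r q * e r' q) =
      (\<Sum>k<p. \<Sum>i<n. if i = r then (if r = r' then (c k)\<^sup>2 / v else 0) else 0)"
      unfolding cart using v by (intro sum.cong refl) (auto simp: e_def power2_eq_square)
    also have "\<dots> = (if r = r' then 1 else 0)"
      using r ab v by (auto simp: sum_divide_distrib[symmetric] v_def[symmetric])
    finally show "(\<Sum>q\<in>{..<p}\<times>{..<n}. e r q * e r' q) = (if r = r' then 1 else 0)" .
  next
    fix r \<omega> assume r: "r \<in> {a, b}"
    have "(\<Sum>q\<in>{..<p}\<times>{..<n}. e r q * G q \<omega>) = (\<Sum>k<p. \<Sum>i<n. if i = r then c k / sqrt v * G (k, i) \<omega> else 0)"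
      unfolding cart by (intro sum.cong refl) (auto simp: e_def)
    then show "H r \<omega> = (\<Sum>q\<in>{..<p}\<times>{..<n}. e r q * G q \<omega>)" using r ab by (auto simp: H_def)
  qed simp
  then have "prob {\<omega>\<in>space M. \<forall>r\<in>{a, b}. H r \<omega> \<in> {z. x / sqrt v < \<bar>z\<bar>}} = (\<Prod>r\<in>{a, b}. normal_tail (x / sqrt v))"
    unfolding normal_tail_def by (rule std_gauss_prob) auto
  moreover have "(\<Sum>k<p. c k * G (k, r) \<omega>) = sqrt v * H r \<omega>" for r \<omega>
    using v by (simp add: H_def sum_distrib_left)
  ultimately have "prob {\<omega>\<in>space M. x < \<bar>\<Sum>k<p. c k * G (k, a) \<omega>\<bar> \<and> x < \<bar>\<Sum>k<p. c k * G (k, b) \<omega>\<bar>} =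
      normal_tail (x / sqrt v) * normal_tail (x / sqrt v)"
    using v ab by (simp add: abs_mult pos_divide_less_eq mult.commute)
  then show ?thesis
    unfolding v_def[symmetric] using v by (simp add: cond_tail_def power2_eq_square)
qed

lemma columns_indep:
  assumes "A \<inter> B = {}" "A \<subseteq> {..<n}" "B \<subseteq> {..<n}"
  shows "indep_var (PiM ({..<p} \<times> A) (\<lambda>_. borel)) (\<lambda>\<omega>. restrict (Gs \<omega>) ({..<p} \<times> A))
    (PiM ({..<p} \<times> B) (\<lambda>_. borel)) (\<lambda>\<omega>. restrict (Gs \<omega>) ({..<p} \<times> B))"
  by (rule indep_var_restrict[OF std_gauss_indep_vars(1)[OF G]]) (use assms in auto)

lemma coordinate_measurable_pair:
  "q \<in> A \<Longrightarrow> (\<lambda>z. fst z q) \<in> borel_measurable (PiM A (\<lambda>_. borel :: real measure) \<Otimes>\<^sub>M N)"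
  "q \<in> A \<Longrightarrow> (\<lambda>z. snd z q) \<in> borel_measurable (N \<Otimes>\<^sub>M PiM A (\<lambda>_. borel :: real measure))"
  by (rule measurable_compose[OF measurable_fst], simp)
     (rule measurable_compose[OF measurable_snd], simp)

text \<open>The columns before \<open>j\<close> are held fixed. This decides membership in
  \<open>B\<close> and turns the inner product into a linear form in the fresh column
  \<open>j\<close>, with variance \<open>cond_var\<close> of column \<open>i\<close>.\<close>

lemma gram_tail_past:
  assumes ij: "i < j" "j < n" and x: "0 \<le> x"
    and B: "B \<in> sets (PiM ({..<p} \<times> {..<j}) (\<lambda>_. borel))"
  shows "prob {\<omega>\<in>space M. restrict (Gs \<omega>) ({..<p} \<times> {..<j}) \<in> B \<and> x < \<bar>gram p d (Gs \<omega>) i j\<bar>} =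
    expectation (\<lambda>\<omega>. indicator B (restrict (Gs \<omega>) ({..<p} \<times> {..<j})) * cond_tail x (cond_var p d (Gs \<omega>) i))"
proof -
  let ?S = "PiM ({..<p} \<times> {..<j}) (\<lambda>_. borel :: real measure)"
  let ?T = "PiM ({..<p} \<times> {j}) (\<lambda>_. borel :: real measure)"
  let ?X = "\<lambda>\<omega>. restrict (Gs \<omega>) ({..<p} \<times> {..<j})"
  let ?Y = "\<lambda>\<omega>. restrict (Gs \<omega>) ({..<p} \<times> {j})"
  define E where "E = {z \<in> space (?S \<Otimes>\<^sub>M ?T). fst z \<in> B \<and> x < \<bar>\<Sum>k<p. d k * fst z (k, i) * snd z (k, j)\<bar>}"
  have "(\<lambda>z. \<Sum>k<p. d k * fst z (k, i) * snd z (k, j)) \<in> borel_measurable (?S \<Otimes>\<^sub>M ?T)"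
    using ij by (intro borel_measurable_sum borel_measurable_times coordinate_measurable_pair) auto
  then have E: "E \<in> sets (?S \<Otimes>\<^sub>M ?T)" unfolding E_def using B by measurable
  have ind: "indep_var ?S ?X ?T ?Y" by (rule columns_indep) (use ij in auto)
  have sp: "(?X \<omega>, ?Y \<omega>') \<in> space (?S \<Otimes>\<^sub>M ?T)" for \<omega> \<omega>' by (simp add: space_pair_measure space_PiM)
  have "prob {\<omega>\<in>space M. ?X \<omega> \<in> B \<and> x < \<bar>gram p d (Gs \<omega>) i j\<bar>} = prob {\<omega>\<in>space M. (?X \<omega>, ?Y \<omega>) \<in> E}"
    using ij sp by (intro arg_cong[where f = prob]) (auto simp: E_def gram_def)
  also have "\<dots> = expectation (\<lambda>\<omega>. prob {\<omega>'\<in>space M. (?X \<omega>, ?Y \<omega>') \<in> E})"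
    by (rule indep_var_prob_fubini(2)[OF ind E])
  finally have main: "prob {\<omega>\<in>space M. ?X \<omega> \<in> B \<and> x < \<bar>gram p d (Gs \<omega>) i j\<bar>} = expectation (\<lambda>\<omega>. prob {\<omega>'\<in>space M. (?X \<omega>, ?Y \<omega>') \<in> E})" .
  have inner: "prob {\<omega>'\<in>space M. (?X \<omega>, ?Y \<omega>') \<in> E} = indicator B (?X \<omega>) * cond_tail x (cond_var p d (Gs \<omega>) i)" for \<omega>
  proof (cases "?X \<omega> \<in> B")
    case True
    then have "{\<omega>'\<in>space M. (?X \<omega>, ?Y \<omega>') \<in> E} = {\<omega>'\<in>space M. x < \<bar>\<Sum>k<p. (d k * G (k, i) \<omega>) * G (k, j) \<omega>'\<bar>}"
      using sp ij by (auto simp: E_def)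
    then show ?thesis using True column_tail[OF ij(2) x, of "\<lambda>k. d k * G (k, i) \<omega>"] by (simp add: cond_var_def)
  next
    case False
    then have e: "{\<omega>'\<in>space M. (?X \<omega>, ?Y \<omega>') \<in> E} = {}" by (auto simp: E_def)
    show ?thesis unfolding e using False by simp
  qed
  show ?thesis using main unfolding inner .
qed

text \<open>Now the later column \<open>j\<close> is held fixed: both inner products become linear
  forms with the same coefficients in the independent columns \<open>a\<close> and \<open>b\<close>,
  whence the square.\<close>

lemma gram_tail_pair:
  assumes ab: "a < j" "b < j" "a \<noteq> b" and j: "j < n" and x: "0 \<le> x"
  shows "prob {\<omega>\<in>space M. x < \<bar>gram p d (Gs \<omega>) a j\<bar> \<and> x < \<bar>gram p d (Gs \<omega>) b j\<bar>} =
    expectation (\<lambda>\<omega>. (cond_tail x (cond_var p d (Gs \<omega>) j))\<^sup>2)"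
proof -
  let ?S = "PiM ({..<p} \<times> {j}) (\<lambda>_. borel :: real measure)"
  let ?T = "PiM ({..<p} \<times> {..<j}) (\<lambda>_. borel :: real measure)"
  let ?X = "\<lambda>\<omega>. restrict (Gs \<omega>) ({..<p} \<times> {j})"
  let ?Y = "\<lambda>\<omega>. restrict (Gs \<omega>) ({..<p} \<times> {..<j})"
  define E where "E = {z \<in> space (?S \<Otimes>\<^sub>M ?T). x < \<bar>\<Sum>k<p. d k * fst z (k, j) * snd z (k, a)\<bar> \<and>
    x < \<bar>\<Sum>k<p. d k * fst z (k, j) * snd z (k, b)\<bar>}"
  have "(\<lambda>z. \<Sum>k<p. d k * fst z (k, j) * snd z (k, r)) \<in> borel_measurable (?S \<Otimes>\<^sub>M ?T)" if "r < j" for r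
    using that by (intro borel_measurable_sum borel_measurable_times coordinate_measurable_pair) auto
  from this[OF ab(1)] this[OF ab(2)] have E: "E \<in> sets (?S \<Otimes>\<^sub>M ?T)" unfolding E_def by measurable
  have ind: "indep_var ?S ?X ?T ?Y" by (rule columns_indep) (use j in auto)
  have sp: "(?X \<omega>, ?Y \<omega>') \<in> space (?S \<Otimes>\<^sub>M ?T)" for \<omega> \<omega>' by (simp add: space_pair_measure space_PiM)
  have gr: "gram p d g r j = (\<Sum>k<p. d k * g (k, j) * g (k, r))" for g r by (simp add: gram_def mult_ac)
  have "prob {\<omega>\<in>space M. x < \<bar>gram p d (Gs \<omega>) a j\<bar> \<and> x < \<bar>gram p d (Gs \<omega>) b j\<bar>} = prob {\<omega>\<in>space M. (?X \<omega>, ?Y \<omega>) \<in> E}"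
    using ab sp by (intro arg_cong[where f = prob]) (auto simp: E_def gr)
  also have "\<dots> = expectation (\<lambda>\<omega>. prob {\<omega>'\<in>space M. (?X \<omega>, ?Y \<omega>') \<in> E})"
    by (rule indep_var_prob_fubini(2)[OF ind E])
  finally have main: "prob {\<omega>\<in>space M. x < \<bar>gram p d (Gs \<omega>) a j\<bar> \<and> x < \<bar>gram p d (Gs \<omega>) b j\<bar>} = expectation (\<lambda>\<omega>. prob {\<omega>'\<in>space M. (?X \<omega>, ?Y \<omega>') \<in> E})" .
  have inner: "prob {\<omega>'\<in>space M. (?X \<omega>, ?Y \<omega>') \<in> E} = (cond_tail x (cond_var p d (Gs \<omega>) j))\<^sup>2" for \<omega>
  proof -
    have "{\<omega>'\<in>space M. (?X \<omega>, ?Y \<omega>') \<in> E} = {\<omega>'\<in>space M. x < \<bar>\<Sum>k<p. (d k * G (k, j) \<omega>) * G (k, a) \<omega>'\<bar> \<and>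
      x < \<bar>\<Sum>k<p. (d k * G (k, j) \<omega>) * G (k, b) \<omega>'\<bar>}"
      using sp ab by (auto simp: E_def)
    then show ?thesis
      using two_columns_tail[of a b x "\<lambda>k. d k * G (k, j) \<omega>"] ab j x by (simp add: cond_var_def)
  qed
  show ?thesis using main unfolding inner .
qed

definition no_exceed :: "real \<Rightarrow> nat \<Rightarrow> 'a set" where
  "no_exceed x j = {\<omega>\<in>space M. \<forall>b<j. \<forall>a<b. \<bar>gram p d (Gs \<omega>) a b\<bar> \<le> x}"

text \<open>\<open>F i\<close> says that the pair (i, j) exceeds while no earlier pair does. The
  probability lost with column \<open>j\<close> is that of the union of the \<open>F i\<close>,
  enclosed between the Bonferroni bound and the sum. Each \<open>F i\<close> has probability q times
  that of no earlier exceedance, up to \<delta> + \<beta>: the conditional tail is within \<delta>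
  of q unless the conditional variance is off, an event of probability at most \<beta>.\<close>

lemma no_exceed_step:
  fixes q \<delta> \<beta> :: real
  assumes j: "j < n" and x: "0 \<le> x" and q: "0 \<le> q" "q \<le> 1"
    and bad: "\<And>i. i < n \<Longrightarrow> prob {\<omega>\<in>space M. y < \<bar>cond_var p d (Gs \<omega>) i - \<tau>\<bar>} \<le> \<beta>"
    and good: "\<And>v. \<bar>v - \<tau>\<bar> \<le> y \<Longrightarrow> \<bar>cond_tail x v - q\<bar> \<le> \<delta>" and d0: "0 \<le> \<delta>"
  shows "\<bar>prob (no_exceed x (Suc j)) - (1 - real j * q) * prob (no_exceed x j)\<bar> \<le>
      real j * (\<delta> + \<beta>) + (real j)\<^sup>2 * ((q + \<delta>)\<^sup>2 + \<beta>)"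
proof -
  define h where "h i \<omega> = cond_tail x (cond_var p d (Gs \<omega>) i)" for i \<omega>
  have hm: "h i \<in> borel_measurable M" if "i < n" for i
    unfolding h_def by (rule measurable_compose[OF cond_var_measurable[OF that] cond_tail_measurable[OF x]])
  have h01: "0 \<le> h i \<omega>" "h i \<omega> \<le> 1" for i \<omega> by (simp_all add: h_def cond_tail_bounds)
  let ?bad = "\<lambda>i. {\<omega>\<in>space M. y < \<bar>cond_var p d (Gs \<omega>) i - \<tau>\<bar>}"
  have badm: "?bad i \<in> events" if "i < n" for i using cond_var_measurable[OF that] by measurable
  have hq: "\<bar>h i \<omega> - q\<bar> \<le> \<delta> + indicator (?bad i) \<omega>" if "\<omega> \<in> space M" for i \<omega>
  proof (cases "\<omega> \<in> ?bad i")
    case True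
    then show ?thesis using q h01[of i \<omega>] d0 by auto
  next
    case False
    then show ?thesis using good that by (auto simp: h_def)
  qed
  have hq2: "(h i \<omega>)\<^sup>2 \<le> (q + \<delta>)\<^sup>2 + indicator (?bad i) \<omega>" if "\<omega> \<in> space M" for i \<omega>
  proof (cases "\<omega> \<in> ?bad i")
    case True
    then show ?thesis using h01[of i \<omega>] by (simp add: power_le_one add_increasing)
  next
    case False
    then have "h i \<omega> \<le> q + \<delta>" using hq[OF that, of i] by simp
    then show ?thesis using False h01[of i \<omega>] by (simp add: power_mono)
  qed
  let ?X = "\<lambda>\<omega>. restrict (Gs \<omega>) ({..<p} \<times> {..<j})"
  let ?S = "PiM ({..<p} \<times> {..<j}) (\<lambda>_. borel :: real measure)"
  \<comment> \<open>Absence of exceedance as a set of configurations of the first \<open>j\<close>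
    columns, the form required by \<open>gram_tail_past\<close>.\<close>
  define B where "B = {g \<in> space ?S. \<forall>b\<in>{..<j}. \<forall>a\<in>{..<b}. \<bar>gram p d g a b\<bar> \<le> x}"
  have B: "B \<in> sets ?S"
    unfolding B_def
  proof (intro sets.sets_Collect_finite_All)
    fix b a assume "b \<in> {..<j}" "a \<in> {..<b}"
    then have "(\<lambda>g. gram p d g a b) \<in> borel_measurable ?S" unfolding gram_def
      by (intro borel_measurable_sum borel_measurable_times measurable_component_singleton) auto
    then show "{g \<in> space ?S. \<bar>gram p d g a b\<bar> \<le> x} \<in> sets ?S" by measurable
  qed auto
  have Xm: "?X \<in> measurable M ?S"
    using j by (intro measurable_restrict) (auto intro: G_measurable)
  have gX: "gram p d (?X \<omega>) a b = gram p d (Gs \<omega>) a b" if "a < j" "b < j" for a b \<omega>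
    using that by (simp add: gram_def)
  have AX: "no_exceed x j = {\<omega>\<in>space M. ?X \<omega> \<in> B}"
    unfolding no_exceed_def B_def using gX by (auto simp: space_PiM)
  have A: "no_exceed x j \<in> events"
    unfolding AX using measurable_sets[OF Xm B] by (simp add: vimage_def Int_def conj_commute)
  define F where "F i = no_exceed x j \<inter> {\<omega>\<in>space M. x < \<bar>gram p d (Gs \<omega>) i j\<bar>}" for i
  have Em: "{\<omega>\<in>space M. x < \<bar>gram p d (Gs \<omega>) i j\<bar>} \<in> events" if "i < n" for i
    using gram_measurable[OF that j] by measurable
  have F: "F i \<in> events" if "i < j" for i unfolding F_def using A Em that j by auto
  have split: "no_exceed x (Suc j) = no_exceed x j - (\<Union>i<j. F i)"
    unfolding no_exceed_def F_def All_less_Suc by (auto simp: not_less)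
  have P1: "prob (no_exceed x (Suc j)) = prob (no_exceed x j) - prob (\<Union>i<j. F i)"
    unfolding split by (intro finite_measure_Diff A sets.finite_UN F) (auto simp: F_def)
  have PF: "\<bar>prob (F i) - q * prob (no_exceed x j)\<bar> \<le> \<delta> + \<beta>" if i: "i < j" for i
  proof -
    have iN: "i < n" using i j by simp
    let ?I = "\<lambda>\<omega>. indicator (no_exceed x j) \<omega> :: real"
    have "prob (F i) = prob {\<omega>\<in>space M. ?X \<omega> \<in> B \<and> x < \<bar>gram p d (Gs \<omega>) i j\<bar>}"
      by (intro arg_cong[where f = prob]) (auto simp: F_def AX)
    also have "\<dots> = expectation (\<lambda>\<omega>. indicator B (?X \<omega>) * h i \<omega>)"
      unfolding h_def by (rule gram_tail_past[OF i j x B])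
    also have "\<dots> = expectation (\<lambda>\<omega>. ?I \<omega> * h i \<omega>)"
      by (intro Bochner_Integration.integral_cong refl) (auto simp: AX indicator_def)
    finally have PF: "prob (F i) = expectation (\<lambda>\<omega>. ?I \<omega> * h i \<omega>)" .
    have i1: "integrable M (\<lambda>\<omega>. ?I \<omega> * h i \<omega>)"
      using hm[OF iN] A h01[of i] by (intro integrable_const_bound[of _ 1]) (auto simp: indicator_def)
    have i2: "integrable M ?I" using A by (intro integrable_const_bound[of _ 1]) auto
    have i3: "integrable M (\<lambda>\<omega>. indicator (?bad i) \<omega> :: real)" using badm[OF iN] by (intro integrable_const_bound[of _ 1]) auto
    have "prob (F i) - q * prob (no_exceed x j) = expectation (\<lambda>\<omega>. ?I \<omega> * h i \<omega> - q * ?I \<omega>)"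
      using i1 i2 A by (simp add: PF Bochner_Integration.integral_diff)
    also have "\<bar>\<dots>\<bar> \<le> expectation (\<lambda>\<omega>. \<bar>?I \<omega> * h i \<omega> - q * ?I \<omega>\<bar>)" by (rule integral_abs_bound)
    also have "\<dots> \<le> expectation (\<lambda>\<omega>. \<delta> + indicator (?bad i) \<omega>)"
    proof (rule integral_mono)
      show "\<bar>?I \<omega> * h i \<omega> - q * ?I \<omega>\<bar> \<le> \<delta> + indicator (?bad i) \<omega>" if "\<omega> \<in> space M" for \<omega>
        using hq[OF that, of i] d0 by (auto simp: indicator_def)
    qed (use i1 i2 i3 in auto)
    also have "\<dots> = \<delta> + prob (?bad i)" using i3 badm[OF iN] by (simp add: prob_space)
    finally show ?thesis using bad[OF iN] by simp
  qed
  have PP: "prob (F a \<inter> F b) \<le> (q + \<delta>)\<^sup>2 + \<beta>" if "a < b" "b < j" for a b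
  proof -
    have iN: "a < n" "b < n" using that j by auto
    have "prob (F a \<inter> F b) \<le> prob {\<omega>\<in>space M. x < \<bar>gram p d (Gs \<omega>) a j\<bar> \<and> x < \<bar>gram p d (Gs \<omega>) b j\<bar>}"
      unfolding F_def using gram_measurable[OF iN(1) j] gram_measurable[OF iN(2) j]
      by (intro finite_measure_mono) auto
    also have "\<dots> = expectation (\<lambda>\<omega>. (h j \<omega>)\<^sup>2)"
      unfolding h_def by (rule gram_tail_pair) (use that j x in auto)
    also have "\<dots> \<le> expectation (\<lambda>\<omega>. (q + \<delta>)\<^sup>2 + indicator (?bad j) \<omega>)"
    proof (rule integral_mono)
      show "integrable M (\<lambda>\<omega>. (h j \<omega>)\<^sup>2)"
        using hm[OF j] h01[of j] by (intro integrable_const_bound[of _ 1]) (auto simp: power_le_one)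
      show "integrable M (\<lambda>\<omega>. (q + \<delta>)\<^sup>2 + indicator (?bad j) \<omega>)"
        using badm[OF j] by (intro Bochner_Integration.integrable_add integrable_const integrable_const_bound[of _ 1]) auto
    qed (rule hq2)
    also have "\<dots> = (q + \<delta>)\<^sup>2 + prob (?bad j)"
      using badm[OF j] by (subst Bochner_Integration.integral_add) (auto intro!: integrable_const_bound[of _ 1] simp: prob_space)
    finally show ?thesis using bad[OF j] by simp
  qed
  have up: "prob (\<Union>i<j. F i) \<le> (\<Sum>i<j. prob (F i))" using F by (intro measure_UNION_le) auto
  have c0: "0 \<le> (q + \<delta>)\<^sup>2 + \<beta>"
    using order_trans[OF measure_nonneg bad[OF j]] by simp
  have lo: "(\<Sum>i<j. prob (F i)) - (real j)\<^sup>2 * ((q + \<delta>)\<^sup>2 + \<beta>) \<le> prob (\<Union>i<j. F i)"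
    by (rule bonferroni_lower[OF F PP c0])
  have "\<bar>(\<Sum>i<j. prob (F i)) - real j * q * prob (no_exceed x j)\<bar> = \<bar>\<Sum>i<j. prob (F i) - q * prob (no_exceed x j)\<bar>"
    by (simp add: sum_subtractf mult.assoc)
  also have "\<dots> \<le> (\<Sum>i<j. \<bar>prob (F i) - q * prob (no_exceed x j)\<bar>)" by (rule sum_abs)
  also have "\<dots> \<le> (\<Sum>i<j. \<delta> + \<beta>)" by (intro sum_mono PF) auto
  finally have "\<bar>(\<Sum>i<j. prob (F i)) - real j * q * prob (no_exceed x j)\<bar> \<le> real j * (\<delta> + \<beta>)" by simp
  moreover have "0 \<le> (real j)\<^sup>2 * ((q + \<delta>)\<^sup>2 + \<beta>)"
    using c0 by simp
  ultimately show "\<bar>prob (no_exceed x (Suc j)) - (1 - real j * q) * prob (no_exceed x j)\<bar> \<le>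
      real j * (\<delta> + \<beta>) + (real j)\<^sup>2 * ((q + \<delta>)\<^sup>2 + \<beta>)"
    using up lo unfolding P1 by (simp add: left_diff_distrib abs_le_iff)
qed

text \<open>The factors 1 - m q of the recursion lie between 0 and 1, so the errors of the n steps
  add up without being amplified.\<close>

lemma no_exceed_prob:
  fixes q \<delta> \<beta> :: real
  assumes x: "0 \<le> x" and q: "0 \<le> q" "real n * q \<le> 1"
    and bad: "\<And>i. i < n \<Longrightarrow> prob {\<omega>\<in>space M. y < \<bar>cond_var p d (Gs \<omega>) i - \<tau>\<bar>} \<le> \<beta>"
    and good: "\<And>v. \<bar>v - \<tau>\<bar> \<le> y \<Longrightarrow> \<bar>cond_tail x v - q\<bar> \<le> \<delta>" and d0: "0 \<le> \<delta>"
  shows "\<bar>prob (no_exceed x n) - (\<Prod>j<n. 1 - real j * q)\<bar> \<le>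
    (real n)\<^sup>2 * (\<delta> + \<beta>) + (real n)^3 * ((q + \<delta>)\<^sup>2 + \<beta>)"
proof (cases "n = 0")
  case True
  then show ?thesis by (simp add: no_exceed_def prob_space)
next
  case False
  have b0: "0 \<le> \<beta>" using bad[of 0] False measure_nonneg by (meson order_trans zero_less_iff_neq_zero)
  have q1: "q \<le> 1" using q False by (metis One_nat_def Suc_leI mult_left_mono mult_cancel_right2 mult.commute of_nat_1 of_nat_le_iff order_trans zero_less_iff_neq_zero)
  define e where "e = real n * (\<delta> + \<beta>) + (real n)\<^sup>2 * ((q + \<delta>)\<^sup>2 + \<beta>)"
  have "\<bar>prob (no_exceed x m) - (\<Prod>j<m. 1 - real j * q)\<bar> \<le> real m * e" if "m \<le> n" for m
    using that
  proof (induction m)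
    case 0
    then show ?case by (simp add: no_exceed_def prob_space)
  next
    case (Suc m)
    have jq: "0 \<le> 1 - real m * q" "1 - real m * q \<le> 1"
    proof -
      have "real m * q \<le> real n * q" using Suc.prems q by (intro mult_right_mono) auto
      then show "0 \<le> 1 - real m * q" using q by simp
    qed (use q in simp)
    have "\<bar>prob (no_exceed x (Suc m)) - (1 - real m * q) * prob (no_exceed x m)\<bar> \<le>
      real m * (\<delta> + \<beta>) + (real m)\<^sup>2 * ((q + \<delta>)\<^sup>2 + \<beta>)"
      by (rule no_exceed_step[OF _ x q(1) q1 bad good d0]) (use Suc.prems in auto)
    also have "\<dots> \<le> e"
      unfolding e_def using Suc.prems b0 d0 by (intro add_mono mult_right_mono power_mono) auto
    finally have 1: "\<bar>prob (no_exceed x (Suc m)) - (1 - real m * q) * prob (no_exceed x m)\<bar> \<le> e" .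
    have "\<bar>(1 - real m * q) * (prob (no_exceed x m) - (\<Prod>j<m. 1 - real j * q))\<bar> \<le>
      1 * \<bar>prob (no_exceed x m) - (\<Prod>j<m. 1 - real j * q)\<bar>"
      unfolding abs_mult using jq by (intro mult_right_mono) auto
    also have "\<dots> \<le> real m * e" using Suc by simp
    finally have "\<bar>(1 - real m * q) * prob (no_exceed x m) - (\<Prod>j<Suc m. 1 - real j * q)\<bar> \<le> real m * e"
      by (simp add: right_diff_distrib mult.commute)
    with 1 show ?case by (simp add: distrib_right)
  qed
  from this[of n] show ?thesis by (simp add: e_def power2_eq_square power3_eq_cube algebra_simps)
qed

end

section \<open>Limits: the normal tail at the critical level, the product, and the no-exceedance
  probability\<close>

lemma normal_tail_asymptotic:
  fixes z :: "nat \<Rightarrow> real"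
  assumes pos: "eventually (\<lambda>n. z n > 0) sequentially"
    and z: "(\<lambda>n. (z n)\<^sup>2 - (4 * ln (real n) - ln (ln (real n)))) \<longlonglongrightarrow> t"
  shows "(\<lambda>n. (real n)\<^sup>2 * normal_tail (z n)) \<longlonglongrightarrow> exp (- t / 2) / sqrt (2 * pi)"
proof -
  define e where "e n = (z n)\<^sup>2 - (4 * ln (real n) - ln (ln (real n)))" for n
  have e: "e \<longlonglongrightarrow> t" using z by (simp add: e_def[abs_def])
  have z2: "(z n)\<^sup>2 = 4 * ln (real n) - ln (ln (real n)) + e n" for n by (simp add: e_def)
  have ratio: "(\<lambda>n. (z n)\<^sup>2 / ln (real n)) \<longlonglongrightarrow> 4"
  proof -
    have "(\<lambda>n. (4 * ln (real n) - ln (ln (real n))) / ln (real n)) \<longlonglongrightarrow> 4" by real_asymp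
    moreover have "(\<lambda>n. e n * (1 / ln (real n))) \<longlonglongrightarrow> t * 0"
      by (intro tendsto_mult e) real_asymp
    ultimately have "(\<lambda>n. (4 * ln (real n) - ln (ln (real n))) / ln (real n) + e n * (1 / ln (real n))) \<longlonglongrightarrow> 4 + t * 0"
      by (rule tendsto_add)
    then show ?thesis by (simp add: z2 add_divide_distrib)
  qed
  have inf: "filterlim (\<lambda>n. (z n)\<^sup>2) at_top sequentially"
  proof -
    have "filterlim (\<lambda>n. (z n)\<^sup>2 / ln (real n) * ln (real n)) at_top sequentially"
      by (rule filterlim_tendsto_pos_mult_at_top[OF ratio]) (simp, real_asymp)
    then show ?thesis
      by (rule filterlim_cong[THEN iffD1, rotated -1, OF _ refl refl])
        (use eventually_gt_at_top[of 1] in \<open>eventually_elim, simp\<close>)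
  qed
  have inv: "(\<lambda>n. 1 / (z n)\<^sup>2) \<longlonglongrightarrow> 0"
    using tendsto_inverse_0_at_top[OF inf] by (simp add: inverse_eq_divide)
  \<comment> \<open>The Mills upper bound times n^2. Here exp(-z^2/2) equals n^(-2) sqrt(ln n)
    exp(-e/2), while z is asymptotically 2 sqrt(ln n): the log log term of the level is there to
    cancel the factor 1/z.\<close>
  define U where "U n = (real n)\<^sup>2 * (2 * std_normal_density (z n) / z n)" for n
  have U: "U \<longlonglongrightarrow> exp (- t / 2) / sqrt (2 * pi)"
  proof -
    have "(\<lambda>n. 2 / sqrt (2 * pi) * exp (- e n / 2) / sqrt ((z n)\<^sup>2 / ln (real n))) \<longlonglongrightarrow> 2 / sqrt (2 * pi) * exp (- t / 2) / sqrt 4"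
      by (intro tendsto_intros e ratio) auto
    moreover have "eventually (\<lambda>n. 2 / sqrt (2 * pi) * exp (- e n / 2) / sqrt ((z n)\<^sup>2 / ln (real n)) = U n) sequentially"
      using pos eventually_gt_at_top[of 2]
    proof eventually_elim
      case (elim n)
      have ln: "ln (real n) > 0" using elim by simp
      have "exp (- (z n)\<^sup>2 / 2) = exp (ln (ln (real n)) / 2) * exp (- e n / 2) / exp (2 * ln (real n))"
        by (simp add: z2 exp_add[symmetric] exp_diff[symmetric] diff_divide_distrib add_divide_distrib)
      also have "exp (ln (ln (real n)) / 2) = sqrt (ln (real n))"
        using ln by (simp add: ln_sqrt[symmetric])
      also have "exp (2 * ln (real n)) = (real n)\<^sup>2"
        using elim by (simp add: exp_double power2_eq_square)
      finally show ?case using elim ln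
        by (simp add: U_def std_normal_density_def real_sqrt_divide field_simps)
    qed
    ultimately show ?thesis by (simp add: tendsto_cong)
  qed
  have L: "(\<lambda>n. U n / (1 + 1 / (z n)\<^sup>2)) \<longlonglongrightarrow> exp (- t / 2) / sqrt (2 * pi)"
    using tendsto_divide[OF U tendsto_add[OF tendsto_const inv, of 1]] by simp
  show ?thesis
  proof (rule tendsto_sandwich[OF _ _ L U])
    show "eventually (\<lambda>n. U n / (1 + 1 / (z n)\<^sup>2) \<le> (real n)\<^sup>2 * normal_tail (z n)) sequentially"
      using pos
    proof eventually_elim
      case (elim n)
      have "U n / (1 + 1 / (z n)\<^sup>2) = (real n)\<^sup>2 * (2 * std_normal_density (z n) / (z n * (1 + 1 / (z n)\<^sup>2)))"
        by (simp add: U_def)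
      also have "\<dots> \<le> (real n)\<^sup>2 * normal_tail (z n)"
        by (intro mult_left_mono normal_tail_bounds(2) elim) auto
      finally show ?case .
    qed
    show "eventually (\<lambda>n. (real n)\<^sup>2 * normal_tail (z n) \<le> U n) sequentially"
      using pos by eventually_elim (unfold U_def, intro mult_left_mono normal_tail_bounds(1), auto)
  qed
qed

lemma sum_lessThan_real: "(\<Sum>j<n. real j) = real n * (real n - 1) / 2"
  by (induction n) (auto simp: field_simps)

text \<open>With x = j q, each factor lies between exp(-x - 2x^2) and exp(-x) once x \<le> 1/2. The
  linear terms add up to n(n-1)q/2, which tends to L/2; the quadratic ones are at most
  \<open>R\<close>, which vanishes.\<close>

lemma prod_one_minus_limit:
  fixes q :: "nat \<Rightarrow> real"
  assumes q0: "\<And>n. 0 \<le> q n" and q: "(\<lambda>n. (real n)\<^sup>2 * q n) \<longlonglongrightarrow> L"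
  shows "(\<lambda>n. \<Prod>j<n. 1 - real j * q n) \<longlonglongrightarrow> exp (- L / 2)"
proof -
  have nq: "(\<lambda>n. real n * q n) \<longlonglongrightarrow> 0"
  proof -
    have "(\<lambda>n. 1 / real n * ((real n)\<^sup>2 * q n)) \<longlonglongrightarrow> 0 * L" by (intro tendsto_mult q) real_asymp
    moreover have "eventually (\<lambda>n. 1 / real n * ((real n)\<^sup>2 * q n) = real n * q n) sequentially"
      using eventually_gt_at_top[of 0] by eventually_elim (simp add: power2_eq_square)
    ultimately show ?thesis by (auto intro: Lim_transform_eventually)
  qed
  define S where "S n = real n * (real n - 1) / 2 * q n" for n
  have S: "S \<longlonglongrightarrow> L / 2"
  proof -
    have "(\<lambda>n. ((real n)\<^sup>2 * q n - real n * q n) / 2) \<longlonglongrightarrow> (L - 0) / 2" by (intro tendsto_intros q nq) auto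
    then show ?thesis by (simp add: S_def[abs_def] power2_eq_square algebra_simps)
  qed
  have Ssum: "(\<Sum>j<n. real j * q n) = S n" for n
    by (simp add: S_def sum_lessThan_real sum_distrib_right[symmetric])
  define R where "R n = 2 * (((real n)\<^sup>2 * q n) * (real n * q n))" for n
  have R: "R \<longlonglongrightarrow> 0"
    unfolding R_def[abs_def] using tendsto_mult[OF tendsto_const[of 2] tendsto_mult[OF q nq]] by simp
  have small: "eventually (\<lambda>n. real n * q n < 1 / 2) sequentially"
    using nq by (rule order_tendstoD) simp
  have jq: "0 \<le> real j * q n" "real j * q n \<le> real n * q n" if "j < n" for j n
    using that q0[of n] by (auto intro: mult_right_mono)
  have U: "(\<lambda>n. exp (- S n)) \<longlonglongrightarrow> exp (- L / 2)" using S by (auto intro!: tendsto_eq_intros)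
  have Lo: "(\<lambda>n. exp (- S n - R n)) \<longlonglongrightarrow> exp (- L / 2)" using S R by (auto intro!: tendsto_eq_intros)
  show ?thesis
  proof (rule tendsto_sandwich[OF _ _ Lo U])
    show "eventually (\<lambda>n. exp (- S n - R n) \<le> (\<Prod>j<n. 1 - real j * q n)) sequentially"
      using small
    proof eventually_elim
      case (elim n)
      have "- S n - R n \<le> (\<Sum>j<n. - (real j * q n) - 2 * (real j * q n)\<^sup>2)"
      proof -
        have "(\<Sum>j<n. (real j * q n)\<^sup>2) \<le> (\<Sum>j<n. (real n * q n)\<^sup>2)"
          using jq by (intro sum_mono power_mono) auto
        then have "2 * (\<Sum>j<n. (real j * q n)\<^sup>2) \<le> R n" by (simp add: R_def power2_eq_square mult_ac)
        then show ?thesis by (simp add: sum_subtractf sum_negf Ssum sum_distrib_left[symmetric])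
      qed
      then have "exp (- S n - R n) \<le> (\<Prod>j<n. exp (- (real j * q n) - 2 * (real j * q n)\<^sup>2))"
        by (simp add: exp_sum[symmetric])
      also have "\<dots> \<le> (\<Prod>j<n. 1 - real j * q n)"
      proof (intro prod_mono conjI)
        fix j assume "j \<in> {..<n}"
        then have j: "0 \<le> real j * q n" "real j * q n \<le> 1 / 2" using jq[of j n] elim by auto
        then show "exp (- (real j * q n) - 2 * (real j * q n)\<^sup>2) \<le> 1 - real j * q n"
          using ln_one_minus_pos_lower_bound[of "real j * q n"]
          by (subst ln_ge_iff[symmetric]) auto
      qed simp
      finally show ?case .
    qed
    show "eventually (\<lambda>n. (\<Prod>j<n. 1 - real j * q n) \<le> exp (- S n)) sequentially"
      using small
    proof eventually_elim
      case (elim n)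
      have "(\<Prod>j<n. 1 - real j * q n) \<le> (\<Prod>j<n. exp (- (real j * q n)))"
      proof (intro prod_mono conjI)
        fix j assume "j \<in> {..<n}"
        then show "0 \<le> 1 - real j * q n" using jq[of j n] elim by auto
        show "1 - real j * q n \<le> exp (- (real j * q n))" using exp_ge_add_one_self[of "- (real j * q n)"] by simp
      qed
      also have "\<dots> = exp (- S n)" by (simp add: exp_sum[symmetric] sum_negf Ssum)
      finally show ?case .
    qed
  qed
qed

lemma (in gaussian_columns) cond_var_concentration:
  assumes i: "i < n" and c: "c > 0" "\<And>k. k < p \<Longrightarrow> \<bar>d k\<bar> \<le> c" and p: "p > 0"
    and x: "0 \<le> x" "2 * x \<le> real p * c\<^sup>2"
  shows "prob {\<omega>\<in>space M. x \<le> \<bar>cond_var p d (Gs \<omega>) i - (\<Sum>k<p. (d k)\<^sup>2)\<bar>} \<le> 2 * exp (- x\<^sup>2 / (8 * real p * c ^ 4))"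
proof -
  have eq: "cond_var p d (Gs \<omega>) i - (\<Sum>k<p. (d k)\<^sup>2) = (\<Sum>k<p. (d k)\<^sup>2 * ((G (k, i) \<omega>)\<^sup>2 - 1))" for \<omega>
    by (simp add: cond_var_def sum_subtractf power_mult_distrib algebra_simps)
  have d2: "\<bar>(d k)\<^sup>2\<bar> \<le> c\<^sup>2" if "k < p" for k using power_mono[OF c(2)[OF that] abs_ge_zero, of 2] by simp
  have "(\<Sum>k<p. ((d k)\<^sup>2)\<^sup>2) \<le> (\<Sum>k<p. c ^ 4)"
  proof (rule sum_mono)
    fix k assume "k \<in> {..<p}"
    then have "(d k)\<^sup>2 \<le> c\<^sup>2" using d2[of k] by (simp only: abs_power2 lessThan_iff)
    then have "((d k)\<^sup>2)\<^sup>2 \<le> (c\<^sup>2)\<^sup>2" by (rule power_mono) (rule zero_le_power2)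
    then show "((d k)\<^sup>2)\<^sup>2 \<le> c ^ 4" by simp
  qed
  then have S: "(\<Sum>k<p. ((d k)\<^sup>2)\<^sup>2) \<le> real p * c ^ 4" by simp
  \<comment> \<open>Chernoff with \<delta> = 1/4, whence 8 = 4(1 + 4\<delta>) in the exponent; a
    sharp constant matters only for the thresholding count.\<close>
  have "x * c\<^sup>2 \<le> 2 * (real p * c ^ 4) * (1 / 4)"
    using mult_right_mono[OF x(2), of "c\<^sup>2"] by (simp add: power2_eq_square power4_eq_xxxx algebra_simps)
  then have "prob {\<omega>\<in>space M. x \<le> \<bar>\<Sum>k<p. (d k)\<^sup>2 * ((G (k, i) \<omega>)\<^sup>2 - 1)\<bar>} \<le> 2 * exp (- x\<^sup>2 / (4 * (1 + 4 * (1 / 4)) * (real p * c ^ 4)))"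
    using S p c(1) x(1) d2 by (intro std_gauss_chernoff_abs[OF column_std_gauss[OF i], of _ "c\<^sup>2"]) auto
  then show ?thesis unfolding eq by (simp add: mult_ac)
qed

theorem no_exceed_limit:
  fixes M :: "nat \<Rightarrow> 'a measure"
  assumes gc: "\<And>n. n \<ge> 2 \<Longrightarrow> gaussian_columns (M n) (p n) n (G n)"
    and c: "c > 0" and d: "\<And>n k. n \<ge> 2 \<Longrightarrow> k < p n \<Longrightarrow> inverse c \<le> d n k \<and> d n k \<le> c"
    and p: "c' > 0" "\<And>n. n \<ge> 2 \<Longrightarrow> c' * real n < real (p n)"
  shows "(\<lambda>n. measure (M n) (gaussian_columns.no_exceed (M n) (p n) (d n) (G n)
      (sqrt ((4 * ln (real n) - ln (ln (real n)) + t) * (\<Sum>k<p n. (d n k)\<^sup>2))) n))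
    \<longlonglongrightarrow> exp (- (1 / sqrt (8 * pi)) * exp (- t / 2))"
proof -
  define Y where "Y n = 4 * ln (real n) - ln (ln (real n)) + t" for n
  define \<tau> where "\<tau> n = (\<Sum>k<p n. (d n k)\<^sup>2)" for n
  \<comment> \<open>\<open>r\<close> bounds the relative deviation of the conditional variance: sqrt
    p n^(1/4) against \<tau> \<ge> p/c^2, with p > c' n. Then \<delta> is the resulting spread of
    the conditional tail, and \<beta> bounds the probability of a larger deviation.\<close>
  define r where "r n = c\<^sup>2 / sqrt c' * real n powr (-1/4)" for n
  define q where "q n = normal_tail (sqrt (Y n))" for n
  define \<delta> where "\<delta> n = normal_tail (sqrt (Y n / (1 + r n))) - normal_tail (sqrt (Y n / (1 - r n)))" for n
  define \<beta> where "\<beta> n = 2 * exp (- sqrt (real n) / (8 * c ^ 4))" for n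
  have cpos: "c\<^sup>2 / sqrt c' > 0" using c p by simp
  have Ypos: "eventually (\<lambda>n. Y n > 0) sequentially" unfolding Y_def by real_asymp
  have r1: "eventually (\<lambda>n. r n < 1) sequentially" unfolding r_def by real_asymp
  have r0: "eventually (\<lambda>n. r n > 0) sequentially" unfolding r_def
    using eventually_gt_at_top[of 0] by eventually_elim (use cpos in \<open>intro mult_pos_pos, auto\<close>)
  \<comment> \<open>A relative change \<open>r\<close> of the variance moves the squared level by
    about 4 r ln n, which vanishes. So the tails at the centre and at both ends of the range have
    the same limit after scaling by n^2, and n^2 \<delta> tends to 0.\<close>
  have lim: "(\<lambda>n. (real n)\<^sup>2 * normal_tail (sqrt (Y n / (1 + s * r n)))) \<longlonglongrightarrow> exp (- t / 2) / sqrt (2 * pi)"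
    if s: "s \<in> {-1, 0, 1}" for s
  proof (rule normal_tail_asymptotic)
    have pos: "eventually (\<lambda>n. Y n / (1 + s * r n) > 0) sequentially"
      using Ypos r1 r0 by eventually_elim (use s in auto)
    then show "eventually (\<lambda>n. sqrt (Y n / (1 + s * r n)) > 0) sequentially" by simp
    have "(\<lambda>n. Y n / (1 + s * r n) - (4 * ln (real n) - ln (ln (real n)))) \<longlonglongrightarrow> t"
      unfolding Y_def r_def by real_asymp
    then show "(\<lambda>n. (sqrt (Y n / (1 + s * r n)))\<^sup>2 - (4 * ln (real n) - ln (ln (real n)))) \<longlonglongrightarrow> t"
      by (rule Lim_transform_eventually) (use pos in \<open>eventually_elim, simp\<close>)
  qed
  have q: "(\<lambda>n. (real n)\<^sup>2 * q n) \<longlonglongrightarrow> exp (- t / 2) / sqrt (2 * pi)"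
    using lim[of 0] by (simp add: q_def)
  have dl: "(\<lambda>n. (real n)\<^sup>2 * \<delta> n) \<longlonglongrightarrow> 0"
    using tendsto_diff[OF lim[of 1] lim[of "-1"]] by (simp add: \<delta>_def right_diff_distrib)
  have prod: "(\<lambda>n. \<Prod>j<n. 1 - real j * q n) \<longlonglongrightarrow> exp (- (1 / sqrt (8 * pi)) * exp (- t / 2))"
  proof -
    have "sqrt (8 * pi) = sqrt (4 * (2 * pi))" by simp
    also have "\<dots> = sqrt 4 * sqrt (2 * pi)" by (rule real_sqrt_mult)
    finally have "- (exp (- t / 2) / sqrt (2 * pi)) / 2 = - (1 / sqrt (8 * pi)) * exp (- t / 2)" by simp
    then show ?thesis using prod_one_minus_limit[OF _ q] by (simp add: q_def normal_tail_nonneg)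
  qed
  define E where "E n = (real n)\<^sup>2 * (\<delta> n + \<beta> n) + (real n)^3 * ((q n + \<delta> n)\<^sup>2 + \<beta> n)" for n
  \<comment> \<open>The term n^3 (q + \<delta>)^2 is 1/n times the square of a convergent sequence,
    and \<beta> decays like exp(-const sqrt n), which beats all powers of n.\<close>
  have E: "E \<longlonglongrightarrow> 0"
  proof -
    have b: "(\<lambda>n. ((real n)\<^sup>2 + (real n)^3) * \<beta> n) \<longlonglongrightarrow> 0" unfolding \<beta>_def using c by real_asymp
    have qd: "(\<lambda>n. (1 / real n) * ((real n)\<^sup>2 * q n + (real n)\<^sup>2 * \<delta> n)\<^sup>2) \<longlonglongrightarrow> 0 * (exp (- t / 2) / sqrt (2 * pi) + 0)\<^sup>2"
      by (intro tendsto_intros q dl)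
    have "(\<lambda>n. (real n)\<^sup>2 * \<delta> n + ((real n)\<^sup>2 + (real n)^3) * \<beta> n +
        (1 / real n) * ((real n)\<^sup>2 * q n + (real n)\<^sup>2 * \<delta> n)\<^sup>2) \<longlonglongrightarrow> 0 + 0 + 0 * (exp (- t / 2) / sqrt (2 * pi) + 0)\<^sup>2"
      by (intro tendsto_add dl b qd)
    then have "(\<lambda>n. (real n)\<^sup>2 * \<delta> n + ((real n)\<^sup>2 + (real n)^3) * \<beta> n +
        (1 / real n) * ((real n)\<^sup>2 * q n + (real n)\<^sup>2 * \<delta> n)\<^sup>2) \<longlonglongrightarrow> 0" by simp
    then show ?thesis
    proof (rule Lim_transform_eventually)
      show "eventually (\<lambda>n. (real n)\<^sup>2 * \<delta> n + ((real n)\<^sup>2 + (real n)^3) * \<beta> n +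
        (1 / real n) * ((real n)\<^sup>2 * q n + (real n)\<^sup>2 * \<delta> n)\<^sup>2 = E n) sequentially"
        using eventually_gt_at_top[of 0] by eventually_elim (simp add: E_def field_simps power2_eq_square power3_eq_cube)
    qed
  qed
  have nq: "eventually (\<lambda>n. real n * q n \<le> 1) sequentially"
  proof -
    have "(\<lambda>n. 1 / real n * ((real n)\<^sup>2 * q n)) \<longlonglongrightarrow> 0 * (exp (- t / 2) / sqrt (2 * pi))"
      by (intro tendsto_mult q) real_asymp
    then have "eventually (\<lambda>n. 1 / real n * ((real n)\<^sup>2 * q n) < 1) sequentially" by (intro order_tendstoD(2)[of _ 0]) auto
    then show ?thesis using eventually_gt_at_top[of 0] by eventually_elim (simp add: power2_eq_square)
  qed
  have dev: "eventually (\<lambda>n. 2 * real n powr (1/4) \<le> sqrt (c' * real n) * c\<^sup>2) sequentially"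
    using c p(1) by real_asymp
  have bound: "eventually (\<lambda>n. \<bar>measure (M n) (gaussian_columns.no_exceed (M n) (p n) (d n) (G n) (sqrt (Y n * \<tau> n)) n) -
      (\<Prod>j<n. 1 - real j * q n)\<bar> \<le> E n) sequentially"
    using Ypos r1 r0 nq dev eventually_ge_at_top[of 2]
  proof eventually_elim
    case (elim n)
    interpret gaussian_columns "M n" "p n" n "d n" "G n" by (rule gc) (use elim in simp)
    have n: "n \<ge> 2" using elim by simp
    have pn: "real (p n) > c' * real n" "p n > 0"
      using p(2)[OF n] p(1) n by (auto, metis mult_pos_pos of_nat_0_less_iff order_less_trans gr0I of_nat_0 less_le_trans zero_less_numeral)
    define y where "y = sqrt (real (p n)) * real n powr (1/4)"
    have y2: "y\<^sup>2 = real (p n) * sqrt (real n)"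
    proof -
      have "(real n powr (1/4))\<^sup>2 = sqrt (real n)" using n by (simp add: powr_power powr_half_sqrt)
      then show ?thesis by (simp add: y_def power_mult_distrib)
    qed
    have tau: "\<tau> n \<ge> real (p n) / c\<^sup>2"
    proof -
      have "(\<Sum>k<p n. (inverse c)\<^sup>2) \<le> \<tau> n" unfolding \<tau>_def
        using d[OF n] c by (intro sum_mono power_mono) auto
      then show ?thesis by (simp add: field_simps power2_eq_square)
    qed
    have tau0: "\<tau> n > 0" using tau pn c by (meson divide_pos_pos less_le_trans of_nat_0_less_iff zero_less_power)
    have yr: "y \<le> r n * \<tau> n"
    proof -
      have s: "sqrt (real (p n)) \<ge> sqrt c' * sqrt (real n)" using pn by (simp add: real_sqrt_mult[symmetric])
      have pw: "real n powr (1/4) = real n powr (-1/4) * sqrt (real n)"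
        using n by (simp add: powr_half_sqrt[symmetric] powr_add[symmetric])
      have "y = real n powr (-1/4) / sqrt c' * sqrt (real (p n)) * (sqrt c' * sqrt (real n))"
        using p(1) by (simp add: y_def pw)
      also have "\<dots> \<le> real n powr (-1/4) / sqrt c' * sqrt (real (p n)) * sqrt (real (p n))"
        using p(1) s by (intro mult_left_mono) auto
      also have "\<dots> = r n * (real (p n) / c\<^sup>2)" using c by (simp add: r_def)
      also have "\<dots> \<le> r n * \<tau> n" using tau elim by (intro mult_left_mono) auto
      finally show ?thesis .
    qed
    have "2 * y \<le> real (p n) * c\<^sup>2"
    proof -
      have "2 * y \<le> sqrt (real (p n)) * (sqrt (c' * real n) * c\<^sup>2)"
        using elim(5) unfolding y_def by (metis mult.left_commute mult_left_mono real_sqrt_ge_zero of_nat_0_le_iff)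
      also have "\<dots> \<le> sqrt (real (p n)) * (sqrt (real (p n)) * c\<^sup>2)"
        using pn by (intro mult_left_mono mult_right_mono) auto
      finally show ?thesis by (simp add: mult.assoc[symmetric])
    qed
    note y = this
    have bad: "prob {\<omega>\<in>space (M n). y < \<bar>cond_var (p n) (d n) (Gs \<omega>) i - \<tau> n\<bar>} \<le> \<beta> n" if i: "i < n" for i
    proof -
      have "prob {\<omega>\<in>space (M n). y < \<bar>cond_var (p n) (d n) (Gs \<omega>) i - \<tau> n\<bar>} \<le>
        prob {\<omega>\<in>space (M n). y \<le> \<bar>cond_var (p n) (d n) (Gs \<omega>) i - \<tau> n\<bar>}"
        using cond_var_measurable[OF i] by (intro finite_measure_mono) auto
      also have "\<dots> \<le> 2 * exp (- y\<^sup>2 / (8 * real (p n) * c ^ 4))"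
        unfolding \<tau>_def
      proof (rule cond_var_concentration[OF i c _ pn(2) _ y])
        show "\<bar>d n k\<bar> \<le> c" if "k < p n" for k
        proof -
          have "0 < inverse c" using c by simp
          then show ?thesis using d[OF n that] by linarith
        qed
      qed (simp add: y_def)
      also have "\<dots> = \<beta> n" using pn by (simp add: y2 \<beta>_def)
      finally show ?thesis .
    qed
    have good: "\<bar>cond_tail (sqrt (Y n * \<tau> n)) v - q n\<bar> \<le> \<delta> n" if v: "\<bar>v - \<tau> n\<bar> \<le> y" for v
    proof -
      let ?x = "sqrt (Y n * \<tau> n)"
      have ct: "cond_tail ?x ((1 + s) * \<tau> n) = normal_tail (sqrt (Y n / (1 + s)))" if "s > -1" for s
      proof -
        have "?x / sqrt ((1 + s) * \<tau> n) = sqrt (Y n / (1 + s))"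
          using tau0 that by (simp add: real_sqrt_divide[symmetric])
        then show ?thesis using tau0 that by (simp add: cond_tail_def)
      qed
      have v': "(1 + - r n) * \<tau> n \<le> v" "v \<le> (1 + r n) * \<tau> n" using v yr by (auto simp: algebra_simps)
      have x0: "0 \<le> ?x" using tau0 elim by simp
      have A: "normal_tail (sqrt (Y n / (1 - r n))) \<le> cond_tail ?x v"
        using cond_tail_mono[OF x0 v'(1)] ct[of "- r n"] elim by simp
      have B: "cond_tail ?x v \<le> normal_tail (sqrt (Y n / (1 + r n)))"
        using cond_tail_mono[OF x0 v'(2)] ct[of "r n"] elim by simp
      have C: "normal_tail (sqrt (Y n / (1 - r n))) \<le> q n" "q n \<le> normal_tail (sqrt (Y n / (1 + r n)))"
        unfolding q_def using elim by (auto intro!: normal_tail_antimono simp: field_simps)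
      show ?thesis using A B C unfolding \<delta>_def by linarith
    qed
    have d0: "0 \<le> \<delta> n" using good[of "\<tau> n"] by (auto simp: y_def)
    show ?case unfolding E_def
      by (rule no_exceed_prob[OF _ _ elim(4) bad good d0]) (use elim tau0 in \<open>auto simp: q_def normal_tail_nonneg\<close>)
  qed
  have "(\<lambda>n. measure (M n) (gaussian_columns.no_exceed (M n) (p n) (d n) (G n) (sqrt (Y n * \<tau> n)) n) -
      (\<Prod>j<n. 1 - real j * q n)) \<longlonglongrightarrow> 0"
    by (rule Lim_null_comparison[OF _ E]) (use bound in simp)
  from tendsto_add[OF this prod] show ?thesis by (simp add: Y_def \<tau>_def)
qed

section \<open>The Gaussian data matrix\<close>

text \<open>The characteristic function is stated at argument 1 for the centred variable: multiples
  of linear combinations are again linear combinations, so nothing is lost. The case of a point mass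
  fits the formula with variance 0.\<close>

lemma (in prob_space) normal_variable_facts:
  assumes T: "normal_variable M T"
  shows "T \<in> borel_measurable M" "integrable M T" "integrable M (\<lambda>\<omega>. (T \<omega> - expectation T)\<^sup>2)"
    and "expectation (\<lambda>\<omega>. iexp (T \<omega> - expectation T)) = of_real (exp (- covariance M T T / 2))"
proof -
  show Tm[measurable]: "T \<in> borel_measurable M" using T by (simp add: normal_variable_def)
  have "integrable M T \<and> integrable M (\<lambda>\<omega>. (T \<omega> - expectation T)\<^sup>2) \<and>
    expectation (\<lambda>\<omega>. iexp (T \<omega> - expectation T)) = of_real (exp (- covariance M T T / 2))"
    using T unfolding normal_variable_def
  proof (elim conjE disjE exE)
    fix m assume m: "AE \<omega> in M. T \<omega> = m"
    have i: "integrable M T" by (rule integrable_const_bound[of _ "\<bar>m\<bar>"]) (use m in \<open>auto elim: AE_mp\<close>)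
    have "expectation T = expectation (\<lambda>_. m)" by (rule integral_cong_AE) (use m in auto)
    then have e: "expectation T = m" by (simp add: prob_space)
    have i2: "integrable M (\<lambda>\<omega>. (T \<omega> - m)\<^sup>2)" by (rule integrable_const_bound[of _ 0]) (use m in \<open>auto elim: AE_mp\<close>)
    have "covariance M T T = expectation (\<lambda>_. 0)"
      unfolding covariance_def e by (rule integral_cong_AE) (use m in \<open>auto elim: AE_mp\<close>)
    moreover have "expectation (\<lambda>\<omega>. iexp (T \<omega> - m)) = expectation (\<lambda>_. 1)"
      by (rule integral_cong_AE) (use m in \<open>auto elim: AE_mp\<close>)
    ultimately show ?thesis using i i2 e by (simp add: prob_space)
  next
    fix m s :: real assume s: "0 < s" and D: "distributed M lborel T (\<lambda>x. ennreal (normal_density m s x))"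
    have e: "expectation T = m" by (rule normal_distributed_expectation[OF s D])
    have v: "covariance M T T = s\<^sup>2"
      using normal_distributed_variance[OF s D] by (simp add: covariance_def power2_eq_square)
    have i: "integrable M T"
      using distributed_integrable[OF D, of "\<lambda>x. x"] integrable_normal_moment_nz_1[OF s, of m] by simp
    have i2: "integrable M (\<lambda>\<omega>. (T \<omega> - m)\<^sup>2)"
      using distributed_integrable[OF D, of "\<lambda>x. (x - m)\<^sup>2"] integrable_normal_moment[OF s, of m 2] by simp
    have "distributed M lborel (\<lambda>\<omega>. (T \<omega> - m) / s) std_normal_density"
      using normal_standard_normal_convert[OF s] D by blast
    then have D': "distr M borel (\<lambda>\<omega>. (T \<omega> - m) / s) = std_normal_distribution"
      unfolding distributed_def by (metis distr_cong sets_lborel)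
    have "expectation (\<lambda>\<omega>. iexp (T \<omega> - m)) = expectation (\<lambda>\<omega>. iexp (s * ((T \<omega> - m) / s)))"
      using s by simp
    also have "\<dots> = (CLINT x|distr M borel (\<lambda>\<omega>. (T \<omega> - m) / s). iexp (s * x))"
      by (subst integral_distr) auto
    also have "\<dots> = of_real (exp (- s\<^sup>2 / 2))"
      unfolding D' using fun_cong[OF char_std_normal_distribution, of s] by (simp only: char_def)
    finally show ?thesis using i i2 e v by simp
  qed
  then show "integrable M T" "integrable M (\<lambda>\<omega>. (T \<omega> - expectation T)\<^sup>2)"
    "expectation (\<lambda>\<omega>. iexp (T \<omega> - expectation T)) = of_real (exp (- covariance M T T / 2))" by auto
qed

lemma (in prob_space) covariance_sum:
  fixes Y :: "'i \<Rightarrow> 'a \<Rightarrow> real"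
  assumes I: "finite I" and m: "\<And>q. q \<in> I \<Longrightarrow> Y q \<in> borel_measurable M" and i: "\<And>q. q \<in> I \<Longrightarrow> integrable M (Y q)"
    and sq: "\<And>q. q \<in> I \<Longrightarrow> integrable M (\<lambda>\<omega>. (Y q \<omega> - expectation (Y q))\<^sup>2)"
  shows "covariance M (\<lambda>\<omega>. \<Sum>q\<in>I. a q * Y q \<omega>) (\<lambda>\<omega>. \<Sum>q\<in>I. a q * Y q \<omega>) =
    (\<Sum>q\<in>I. \<Sum>r\<in>I. a q * a r * covariance M (Y q) (Y r))"
proof -
  define C where "C q \<omega> = Y q \<omega> - expectation (Y q)" for q \<omega>
  have E: "expectation (\<lambda>\<omega>. \<Sum>q\<in>I. a q * Y q \<omega>) = (\<Sum>q\<in>I. a q * expectation (Y q))"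
    using i by (simp add: Bochner_Integration.integral_sum)
  have CC: "integrable M (\<lambda>\<omega>. C q \<omega> * C r \<omega>)" if qr: "q \<in> I" "r \<in> I" for q r
  proof (rule Bochner_Integration.integrable_bound)
    show "integrable M (\<lambda>\<omega>. (C q \<omega>)\<^sup>2 + (C r \<omega>)\<^sup>2)" unfolding C_def using sq qr by auto
    show "(\<lambda>\<omega>. C q \<omega> * C r \<omega>) \<in> borel_measurable M" unfolding C_def using m qr by auto
    have "\<bar>x * y\<bar> \<le> x\<^sup>2 + y\<^sup>2" for x y :: real
    proof -
      have "0 \<le> (\<bar>x\<bar> - \<bar>y\<bar>)\<^sup>2" "0 \<le> \<bar>x\<bar> * \<bar>y\<bar>" by auto
      then show ?thesis unfolding power2_diff abs_mult power2_abs by linarith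
    qed
    then show "AE \<omega> in M. norm (C q \<omega> * C r \<omega>) \<le> norm ((C q \<omega>)\<^sup>2 + (C r \<omega>)\<^sup>2)" by auto
  qed
  have "(\<Sum>q\<in>I. a q * Y q \<omega>) - (\<Sum>q\<in>I. a q * expectation (Y q)) = (\<Sum>q\<in>I. a q * C q \<omega>)" for \<omega>
    by (simp add: C_def sum_subtractf right_diff_distrib)
  then have "covariance M (\<lambda>\<omega>. \<Sum>q\<in>I. a q * Y q \<omega>) (\<lambda>\<omega>. \<Sum>q\<in>I. a q * Y q \<omega>) =
      expectation (\<lambda>\<omega>. (\<Sum>q\<in>I. a q * C q \<omega>) * (\<Sum>q\<in>I. a q * C q \<omega>))"
    unfolding covariance_def E by simp
  also have "\<dots> = expectation (\<lambda>\<omega>. \<Sum>q\<in>I. \<Sum>r\<in>I. a q * a r * (C q \<omega> * C r \<omega>))"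
    by (simp add: sum_product mult_ac)
  also have "\<dots> = (\<Sum>q\<in>I. \<Sum>r\<in>I. a q * a r * expectation (\<lambda>\<omega>. C q \<omega> * C r \<omega>))"
    using CC by (subst Bochner_Integration.integral_sum, force, intro sum.cong refl,
        subst Bochner_Integration.integral_sum) auto
  finally show ?thesis by (simp add: covariance_def C_def)
qed

lemma sum_cartesian_real:
  "(\<Sum>q\<in>{..<p}\<times>{..<n}. f q) = (\<Sum>k<p. \<Sum>i<n. f (k, i))" for f :: "nat \<times> nat \<Rightarrow> real"
  by (simp add: sum.cartesian_product)

lemma orthonormal_expand:
  assumes "orthonormal p p u" "a < p"
  shows "(\<Sum>m<p. u m a * (\<Sum>b<p. u m b * z b)) = z a"
proof -
  have "(\<Sum>m<p. u m a * (\<Sum>b<p. u m b * z b)) = (\<Sum>m<p. \<Sum>b<p. u m a * u m b * z b)"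
    by (simp add: sum_distrib_left mult.assoc)
  also have "\<dots> = (\<Sum>b<p. (\<Sum>m<p. u m a * u m b) * z b)"
    by (subst sum.swap) (simp add: sum_distrib_right)
  also have "\<dots> = (\<Sum>b<p. if b = a then z b else 0)"
    by (intro sum.cong refl) (simp add: orthonormal_complete[OF assms])
  finally show ?thesis using assms by simp
qed

lemma orthonormal_sum_eq:
  assumes "orthonormal p p u" "m < p"
  shows "(\<Sum>a<p. (\<Sum>m'<p. f m' * u m' a) * u m a) = f m"
proof -
  have "(\<Sum>a<p. (\<Sum>m'<p. f m' * u m' a) * u m a) = (\<Sum>a<p. \<Sum>m'<p. f m' * (u m' a * u m a))"
    by (simp add: sum_distrib_right mult.assoc)
  also have "\<dots> = (\<Sum>m'<p. f m' * dotp p (u m') (u m))"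
    by (subst sum.swap) (simp add: dotp_def sum_distrib_left)
  also have "\<dots> = (\<Sum>m'<p. if m' = m then f m' else 0)"
    using assms by (intro sum.cong refl) (auto simp: orthonormal_def)
  finally show ?thesis using assms by simp
qed

text \<open>A linear form in the whitened variables is a centred linear form \<open>T\<close> in the
  data, hence normal by joint Gaussianity. The eigenvectors diagonalise its variance, which comes
  out as the squared length of \<open>b\<close>.\<close>

lemma (in prob_space) whitened_std_gauss:
  fixes Y :: "nat \<times> nat \<Rightarrow> 'a \<Rightarrow> real"
  assumes Y: "jointly_gaussian M ({..<p} \<times> {..<n}) Y"
    and mu: "\<And>k i. k < p \<Longrightarrow> i < n \<Longrightarrow> expectation (Y (k, i)) = \<mu> k"
    and cov: "\<And>k l i j. k < p \<Longrightarrow> l < p \<Longrightarrow> i < n \<Longrightarrow> j < n \<Longrightarrow>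
      covariance M (Y (k, i)) (Y (l, j)) = (if i = j then \<Sum>m<p. d m * u m k * u m l else 0)"
    and u: "orthonormal p p u" and d: "\<And>m. m < p \<Longrightarrow> d m > 0"
  shows "std_gauss ({..<p} \<times> {..<n}) (\<lambda>(m, i) \<omega>. (\<Sum>a<p. u m a * (Y (a, i) \<omega> - \<mu> a)) / sqrt (d m))"
proof -
  define I where "I = {..<p} \<times> {..<n}"
  have fin: "finite I" by (simp add: I_def)
  define G where "G = (\<lambda>(m, i) \<omega>. (\<Sum>a<p. u m a * (Y (a, i) \<omega> - \<mu> a)) / sqrt (d m))"
  have nv: "normal_variable M (\<lambda>\<omega>. \<Sum>q\<in>I. \<alpha> q * Y q \<omega>)" for \<alpha>
    using Y unfolding jointly_gaussian_def I_def by blast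
  have Yq: "normal_variable M (Y q)" if "q \<in> I" for q
  proof -
    have "(\<Sum>r\<in>I. (if r = q then 1 else 0) * Y r \<omega>) = Y q \<omega>" for \<omega>
    proof -
      have "(\<Sum>r\<in>I. (if r = q then 1 else 0) * Y r \<omega>) = (\<Sum>r\<in>I. if r = q then Y r \<omega> else 0)"
        by (intro sum.cong) auto
      then show ?thesis using fin that by simp
    qed
    then show ?thesis using nv[of "\<lambda>r. if r = q then 1 else 0"] by simp
  qed
  note Yf = normal_variable_facts[OF Yq]
  have Ym: "Y (a, i) \<in> borel_measurable M" if "a < p" "i < n" for a i
    using Yf(1)[of "(a, i)"] that by (simp add: I_def)
  have main: "expectation (\<lambda>\<omega>. iexp (\<Sum>q\<in>I. b q * G q \<omega>)) = of_real (exp (- (\<Sum>q\<in>I. (b q)\<^sup>2) / 2))" for b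
  proof -
    \<comment> \<open>The coefficients of the same form in the original coordinates:
      \<open>b\<close> scaled by 1 / sqrt d and rotated back by the eigenvectors.\<close>
    define \<alpha> where "\<alpha> = (\<lambda>(a, i). \<Sum>m<p. b (m, i) / sqrt (d m) * u m a)"
    define T where "T \<omega> = (\<Sum>q\<in>I. \<alpha> q * Y q \<omega>)" for \<omega>
    have "normal_variable M T" unfolding T_def by (rule nv)
    note Tf = normal_variable_facts[OF this]
    have ET: "expectation T = (\<Sum>q\<in>I. \<alpha> q * \<mu> (fst q))"
    proof -
      have "expectation T = (\<Sum>q\<in>I. \<alpha> q * expectation (Y q))"
        unfolding T_def using Yf(2) by (simp add: Bochner_Integration.integral_sum)
      also have "\<dots> = (\<Sum>q\<in>I. \<alpha> q * \<mu> (fst q))"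
        by (intro sum.cong refl) (auto simp: I_def mu)
      finally show ?thesis .
    qed
    have eq: "(\<Sum>q\<in>I. b q * G q \<omega>) = T \<omega> - expectation T" for \<omega>
    proof -
      have "T \<omega> - expectation T = (\<Sum>q\<in>I. \<alpha> q * (Y q \<omega> - \<mu> (fst q)))"
        by (simp add: T_def ET sum_subtractf right_diff_distrib)
      also have "\<dots> = (\<Sum>i<n. \<Sum>a<p. \<Sum>m<p. b (m, i) / sqrt (d m) * u m a * (Y (a, i) \<omega> - \<mu> a))"
        unfolding I_def sum_cartesian_real by (subst sum.swap) (simp add: \<alpha>_def sum_distrib_right)
      also have "\<dots> = (\<Sum>i<n. \<Sum>m<p. \<Sum>a<p. b (m, i) / sqrt (d m) * u m a * (Y (a, i) \<omega> - \<mu> a))"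
        by (intro sum.cong refl sum.swap)
      also have "\<dots> = (\<Sum>i<n. \<Sum>m<p. b (m, i) * G (m, i) \<omega>)"
        by (simp add: G_def sum_distrib_left sum_divide_distrib mult_ac)
      also have "\<dots> = (\<Sum>q\<in>I. b q * G q \<omega>)" unfolding I_def sum_cartesian_real by (rule sum.swap)
      finally show ?thesis by simp
    qed
    have "covariance M T T = (\<Sum>q\<in>I. \<Sum>r\<in>I. \<alpha> q * \<alpha> r * covariance M (Y q) (Y r))"
      unfolding T_def by (rule covariance_sum[OF fin Yf(1-3)])
    also have "\<dots> = (\<Sum>a<p. \<Sum>i<n. \<Sum>c<p. \<Sum>j<n. if j = i then \<alpha> (a, i) * \<alpha> (c, i) * (\<Sum>m<p. d m * u m a * u m c) else 0)"
      unfolding I_def sum_cartesian_real by (intro sum.cong refl) (auto simp: cov)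
    also have "\<dots> = (\<Sum>a<p. \<Sum>i<n. \<Sum>c<p. \<alpha> (a, i) * \<alpha> (c, i) * (\<Sum>m<p. d m * u m a * u m c))"
      by (intro sum.cong refl) simp
    also have "\<dots> = (\<Sum>i<n. \<Sum>a<p. \<Sum>c<p. \<Sum>m<p. d m * ((\<alpha> (a, i) * u m a) * (\<alpha> (c, i) * u m c)))"
      by (subst sum.swap) (simp add: sum_distrib_left mult_ac)
    also have "\<dots> = (\<Sum>i<n. \<Sum>m<p. \<Sum>a<p. \<Sum>c<p. d m * ((\<alpha> (a, i) * u m a) * (\<alpha> (c, i) * u m c)))"
    proof (rule sum.cong[OF refl])
      fix i
      let ?f = "\<lambda>a c m. d m * ((\<alpha> (a, i) * u m a) * (\<alpha> (c, i) * u m c))"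
      have "(\<Sum>a<p. \<Sum>c<p. \<Sum>m<p. ?f a c m) = (\<Sum>a<p. \<Sum>m<p. \<Sum>c<p. ?f a c m)"
        by (rule sum.cong[OF refl], rule sum.swap)
      also have "\<dots> = (\<Sum>m<p. \<Sum>a<p. \<Sum>c<p. ?f a c m)" by (rule sum.swap)
      finally show "(\<Sum>a<p. \<Sum>c<p. \<Sum>m<p. ?f a c m) = (\<Sum>m<p. \<Sum>a<p. \<Sum>c<p. ?f a c m)" .
    qed
    also have "\<dots> = (\<Sum>i<n. \<Sum>m<p. d m * (\<Sum>a<p. \<alpha> (a, i) * u m a)\<^sup>2)"
      by (simp only: power2_eq_square sum_product) (simp only: sum_distrib_left)
    also have "\<dots> = (\<Sum>i<n. \<Sum>m<p. (b (m, i))\<^sup>2)"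
    proof (intro sum.cong refl)
      fix i m assume "m \<in> {..<p}"
      then have "(\<Sum>a<p. \<alpha> (a, i) * u m a) = b (m, i) / sqrt (d m)" "d m > 0"
        using orthonormal_sum_eq[OF u, of m "\<lambda>m. b (m, i) / sqrt (d m)"] d by (auto simp: \<alpha>_def)
      then show "d m * (\<Sum>a<p. \<alpha> (a, i) * u m a)\<^sup>2 = (b (m, i))\<^sup>2" by (simp add: power_divide)
    qed
    also have "\<dots> = (\<Sum>q\<in>I. (b q)\<^sup>2)" unfolding I_def sum_cartesian_real by (rule sum.swap)
    finally have v: "covariance M T T = (\<Sum>q\<in>I. (b q)\<^sup>2)" .
    show ?thesis unfolding eq Tf(4) v ..
  qed
  have "std_gauss I G"
    unfolding std_gauss_def
  proof (intro conjI ballI allI fin main)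
    fix q assume "q \<in> I"
    then show "G q \<in> borel_measurable M"
      by (auto simp: I_def G_def intro!: borel_measurable_divide borel_measurable_sum borel_measurable_times borel_measurable_diff Ym)
  qed
  then show ?thesis unfolding I_def G_def .
qed

text \<open>\<open>whitening p S u d\<close>: the columns of \<open>u\<close> are orthonormal eigenvectors of \<open>S\<close>, with eigenvalues \<open>d\<close>.\<close>

definition whitening :: "nat \<Rightarrow> (nat \<Rightarrow> nat \<Rightarrow> real) \<Rightarrow> (nat \<Rightarrow> nat \<Rightarrow> real) \<Rightarrow> (nat \<Rightarrow> real) \<Rightarrow> bool" where
  "whitening p S u d \<longleftrightarrow> orthonormal p p u \<and> (\<forall>a<p. \<forall>b<p. S a b = (\<Sum>m<p. d m * u m a * u m b))"

lemma whitening_exists: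
  assumes S: "covariance_matrix p S"
  obtains u d where "whitening p (\<lambda>a b. S $$ (a, b)) u d"
    "\<And>m. m < p \<Longrightarrow> lambda_min S \<le> d m \<and> d m \<le> lambda_max S"
proof -
  have carr: "S \<in> carrier_mat p p" and tr: "transpose_mat S = S" using S by (auto simp: covariance_matrix_def)
  have sym: "S $$ (k, l) = S $$ (l, k)" if "k < p" "l < p" for k l
    using arg_cong[OF tr, of "\<lambda>A. A $$ (k, l)"] that carr by simp
  obtain u d where ud: "orthonormal p p u"
    "\<And>m k. m < p \<Longrightarrow> k < p \<Longrightarrow> mat_app p (\<lambda>a b. S $$ (a, b)) (u m) k = d m * u m k"
    "\<And>a b. a < p \<Longrightarrow> b < p \<Longrightarrow> S $$ (a, b) = (\<Sum>m<p. d m * u m a * u m b)"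
    using symmetric_spectral_decomposition[of p "\<lambda>a b. S $$ (a, b)"] sym by blast
  have spec: "d m \<in> spectrum S" if "m < p" for m
    by (rule eigenvalue_in_spectrum[OF carr, of "u m"]) (use ud that in \<open>auto simp: orthonormal_def\<close>)
  have "lambda_min S \<le> d m \<and> d m \<le> lambda_max S" if "m < p" for m
    unfolding lambda_min_def lambda_max_def using spec[OF that] card_finite_spectrum(1)[OF carr] by auto
  then show ?thesis using ud by (intro that[of u d]) (auto simp: whitening_def)
qed

text \<open>The columns \<open>z\<close> are the Gaussian columns stretched by sqrt d and then
  rotated; the rotation preserves inner products and the stretching leaves the weights d.\<close>

lemma whitening_gram:
  assumes w: "whitening p S u d" and d: "\<And>m. m < p \<Longrightarrow> d m > 0"
    and z: "\<And>a i. a < p \<Longrightarrow> z a i = (\<Sum>m<p. sqrt (d m) * u m a * g (m, i))"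
  shows "(\<Sum>a<p. z a i * z a j) = gram p d g i j"
proof -
  have u: "orthonormal p p u" using w by (simp add: whitening_def)
  have "(\<Sum>a<p. z a i * z a j) = (\<Sum>a<p. \<Sum>m<p. z a i * (sqrt (d m) * u m a * g (m, j)))"
    by (simp add: z sum_distrib_left)
  also have "\<dots> = (\<Sum>m<p. sqrt (d m) * g (m, j) * (\<Sum>a<p. z a i * u m a))"
    by (subst sum.swap) (simp add: sum_distrib_left mult_ac)
  also have "\<dots> = (\<Sum>m<p. sqrt (d m) * g (m, j) * (sqrt (d m) * g (m, i)))"
  proof (intro sum.cong refl arg_cong2[where f = "(*)"])
    fix m assume "m \<in> {..<p}"
    then have "(\<Sum>a<p. (\<Sum>m'<p. (sqrt (d m') * g (m', i)) * u m' a) * u m a) = sqrt (d m) * g (m, i)"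
      by (intro orthonormal_sum_eq[OF u]) simp
    moreover have "z a i = (\<Sum>m'<p. (sqrt (d m') * g (m', i)) * u m' a)" if "a < p" for a
      unfolding z[OF that] by (intro sum.cong refl) (simp only: mult_ac)
    ultimately show "(\<Sum>a<p. z a i * u m a) = sqrt (d m) * g (m, i)" by simp
  qed
  also have "\<dots> = gram p d g i j"
  proof -
    have eq: "sqrt (d m) * g (m, j) * (sqrt (d m) * g (m, i)) = d m * g (m, i) * g (m, j)" if "m < p" for m
    proof -
      have "sqrt (d m) * g (m, j) * (sqrt (d m) * g (m, i)) = (sqrt (d m) * sqrt (d m)) * g (m, i) * g (m, j)"
        by (simp only: mult_ac)
      then show ?thesis using d[OF that] by simp
    qed
    show ?thesis unfolding gram_def by (rule sum.cong[OF refl], rule eq) simp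
  qed
  finally show ?thesis .
qed

text \<open>Orthonormality of the eigenvectors removes the mixed terms. This identifies the centre
  of the conditional variances with the quantity that thresholding estimates.\<close>

lemma whitening_frobenius:
  assumes w: "whitening p S u d"
  shows "(\<Sum>a<p. \<Sum>b<p. (S a b)\<^sup>2) = (\<Sum>m<p. (d m)\<^sup>2)"
proof -
  have u: "orthonormal p p u" using w by (simp add: whitening_def)
  have "(\<Sum>a<p. \<Sum>b<p. (S a b)\<^sup>2) = (\<Sum>a<p. \<Sum>b<p. \<Sum>m<p. \<Sum>l<p. d m * d l * (u m a * u l a) * (u m b * u l b))"
    using w by (simp add: whitening_def power2_eq_square sum_product mult_ac)
  also have "\<dots> = (\<Sum>a<p. \<Sum>m<p. \<Sum>b<p. \<Sum>l<p. d m * d l * (u m a * u l a) * (u m b * u l b))"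
    by (rule sum.cong[OF refl], rule sum.swap)
  also have "\<dots> = (\<Sum>a<p. \<Sum>m<p. \<Sum>l<p. \<Sum>b<p. d m * d l * (u m a * u l a) * (u m b * u l b))"
    by (rule sum.cong[OF refl], rule sum.cong[OF refl], rule sum.swap)
  also have "\<dots> = (\<Sum>a<p. \<Sum>m<p. \<Sum>l<p. d m * d l * (u m a * u l a) * dotp p (u m) (u l))"
    by (simp add: dotp_def sum_distrib_left)
  also have "\<dots> = (\<Sum>a<p. \<Sum>m<p. \<Sum>l<p. if l = m then d m * d m * (u m a * u m a) else 0)"
    using u by (intro sum.cong refl) (auto simp: orthonormal_def)
  also have "\<dots> = (\<Sum>a<p. \<Sum>m<p. d m * d m * (u m a * u m a))" by simp
  also have "\<dots> = (\<Sum>m<p. d m * d m * dotp p (u m) (u m))"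
    by (subst sum.swap) (simp add: dotp_def sum_distrib_left)
  also have "\<dots> = (\<Sum>m<p. (d m)\<^sup>2)" using u by (simp add: orthonormal_def power2_eq_square)
  finally show ?thesis .
qed

section \<open>Concentration events\<close>

lemma sum_Times: "(\<Sum>q\<in>A\<times>B. f q) = (\<Sum>k\<in>A. \<Sum>i\<in>B. f (k, i))"
  by (simp add: sum.cartesian_product)

lemma normal_tail_le_exp:
  assumes "z \<ge> 1" shows "normal_tail z \<le> exp (- z\<^sup>2 / 2)"
proof -
  have "2 \<le> sqrt (2 * pi)" using pi_ge_two by (intro real_le_rsqrt) (simp add: power2_eq_square)
  then have "2 * 1 \<le> sqrt (2 * pi) * z" using assms by (intro mult_mono) auto
  then have "2 / sqrt (2 * pi) / z \<le> 1" using assms by (simp add: pos_divide_le_eq mult.commute)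
  then have "(2 / sqrt (2 * pi) / z) * exp (- z\<^sup>2 / 2) \<le> exp (- z\<^sup>2 / 2)" by (intro mult_left_le_one_le) (use assms in auto)
  moreover have "normal_tail z \<le> 2 * std_normal_density z / z" by (rule normal_tail_bounds(1)) (use assms in auto)
  ultimately show ?thesis by (simp add: std_normal_density_def)
qed

context gaussian_columns
begin

lemma gram_diagonal_concentration:
  assumes i: "i < n" and c: "c > 0" "\<And>k. k < p \<Longrightarrow> \<bar>d k\<bar> \<le> c" and p: "p > 0"
    and x: "0 \<le> x" "2 * x \<le> real p * c"
  shows "prob {\<omega>\<in>space M. x \<le> \<bar>gram p d (Gs \<omega>) i i - (\<Sum>k<p. d k)\<bar>} \<le> 2 * exp (- x\<^sup>2 / (8 * real p * c\<^sup>2))"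
proof -
  have eq: "gram p d (Gs \<omega>) i i - (\<Sum>k<p. d k) = (\<Sum>k<p. d k * ((G (k, i) \<omega>)\<^sup>2 - 1))" for \<omega>
    by (simp add: gram_def sum_subtractf power2_eq_square algebra_simps)
  have "(\<Sum>k<p. (d k)\<^sup>2) \<le> (\<Sum>k<p. c\<^sup>2)"
    using c by (intro sum_mono) (simp add: abs_le_square_iff[symmetric])
  then have S: "(\<Sum>k<p. (d k)\<^sup>2) \<le> real p * c\<^sup>2" by simp
  have "x * c \<le> 2 * (real p * c\<^sup>2) * (1 / 4)"
    unfolding power2_eq_square using mult_right_mono[OF x(2) less_imp_le[OF c(1)]] by linarith
  then have "prob {\<omega>\<in>space M. x \<le> \<bar>\<Sum>k<p. d k * ((G (k, i) \<omega>)\<^sup>2 - 1)\<bar>} \<le> 2 * exp (- x\<^sup>2 / (4 * (1 + 4 * (1 / 4)) * (real p * c\<^sup>2)))"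
    using S p c x(1) by (intro std_gauss_chernoff_abs[OF column_std_gauss[OF i], of _ c]) auto
  then show ?thesis unfolding eq by (simp add: mult_ac)
qed

lemma columns_split:
  assumes i: "i < n"
  shows "indep_var (PiM ({..<p} \<times> {i}) (\<lambda>_. borel)) (\<lambda>\<omega>. restrict (Gs \<omega>) ({..<p} \<times> {i}))
    (PiM ({..<p} \<times> ({..<n} - {i})) (\<lambda>_. borel)) (\<lambda>\<omega>. restrict (Gs \<omega>) ({..<p} \<times> ({..<n} - {i})))"
  by (rule columns_indep) (use i in auto)

text \<open>With column \<open>i\<close> held fixed, the sum is a single linear form in the other
  columns with variance (n - 1) times \<open>cond_var\<close>; outside the exceptional event this is
  at most 2 n \<tau>. These row sums carry the effect of the centring.\<close>

lemma gram_row_sum_tail: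
  assumes i: "i < n" and x: "0 \<le> x" and \<tau>: "\<tau> > 0" and n: "n \<ge> 2"
  shows "prob {\<omega>\<in>space M. x < \<bar>\<Sum>l\<in>{..<n} - {i}. gram p d (Gs \<omega>) i l\<bar>} \<le>
    normal_tail (x / sqrt (2 * real n * \<tau>)) + prob {\<omega>\<in>space M. \<tau> \<le> \<bar>cond_var p d (Gs \<omega>) i - \<tau>\<bar>}"
proof -
  define J where "J = {..<n} - {i}"
  have cJ: "card J = n - 1" "finite J" using i by (simp_all add: J_def)
  let ?S = "PiM ({..<p} \<times> {i}) (\<lambda>_. borel :: real measure)"
  let ?T = "PiM ({..<p} \<times> J) (\<lambda>_. borel :: real measure)"
  let ?X = "\<lambda>\<omega>. restrict (Gs \<omega>) ({..<p} \<times> {i})"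
  let ?Y = "\<lambda>\<omega>. restrict (Gs \<omega>) ({..<p} \<times> J)"
  define E where "E = {z \<in> space (?S \<Otimes>\<^sub>M ?T). x < \<bar>\<Sum>l\<in>J. \<Sum>k<p. d k * fst z (k, i) * snd z (k, l)\<bar>}"
  have "(\<lambda>z. \<Sum>l\<in>J. \<Sum>k<p. d k * fst z (k, i) * snd z (k, l)) \<in> borel_measurable (?S \<Otimes>\<^sub>M ?T)"
    by (intro borel_measurable_sum borel_measurable_times coordinate_measurable_pair) auto
  then have E: "E \<in> sets (?S \<Otimes>\<^sub>M ?T)" unfolding E_def by measurable
  have ind: "indep_var ?S ?X ?T ?Y" unfolding J_def by (rule columns_split[OF i])
  have sp: "(?X \<omega>, ?Y \<omega>') \<in> space (?S \<Otimes>\<^sub>M ?T)" for \<omega> \<omega>' by (simp add: space_pair_measure space_PiM)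
  have XY: "{\<omega>'\<in>space M. (?X \<omega>, ?Y \<omega>') \<in> E} = {\<omega>'\<in>space M. x < \<bar>\<Sum>q\<in>{..<p}\<times>J. (d (fst q) * G (fst q, i) \<omega>) * G q \<omega>'\<bar>}" for \<omega>
  proof -
    have "(\<Sum>l\<in>J. \<Sum>k<p. d k * ?X \<omega> (k, i) * ?Y \<omega>' (k, l)) = (\<Sum>q\<in>{..<p}\<times>J. (d (fst q) * G (fst q, i) \<omega>) * G q \<omega>')" for \<omega>'
    proof -
      have "(\<Sum>q\<in>{..<p}\<times>J. (d (fst q) * G (fst q, i) \<omega>) * G q \<omega>') = (\<Sum>k<p. \<Sum>l\<in>J. (d k * G (k, i) \<omega>) * G (k, l) \<omega>')"
        by (simp add: sum_Times)
      then show ?thesis by (subst sum.swap) simp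
    qed
    then show ?thesis using sp by (auto simp: E_def)
  qed
  have inner: "prob {\<omega>'\<in>space M. (?X \<omega>, ?Y \<omega>') \<in> E} \<le> cond_tail x (real n * cond_var p d (Gs \<omega>) i)" for \<omega>
  proof -
    let ?c = "\<lambda>q. d (fst q) * G (fst q, i) \<omega>"
    have v: "(\<Sum>q\<in>{..<p}\<times>J. (?c q)\<^sup>2) = real (n - 1) * cond_var p d (Gs \<omega>) i"
    proof -
      have "(\<Sum>q\<in>{..<p}\<times>J. (?c q)\<^sup>2) = (\<Sum>k<p. \<Sum>l\<in>J. (d k * G (k, i) \<omega>)\<^sup>2)"
        by (simp add: sum_Times)
      then show ?thesis by (simp add: cond_var_def cJ sum_distrib_left)
    qed
    have Gsub: "std_gauss ({..<p}\<times>J) G"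
      using std_gauss_subfamily[OF G, of "{..<p}\<times>J" "\<lambda>q. q"] cJ by (auto simp: J_def)
    have "prob {\<omega>'\<in>space M. x < \<bar>\<Sum>q\<in>{..<p}\<times>J. ?c q * G q \<omega>'\<bar>} = cond_tail x (\<Sum>q\<in>{..<p}\<times>J. (?c q)\<^sup>2)"
    proof (cases "(\<Sum>q\<in>{..<p}\<times>J. (?c q)\<^sup>2) = 0")
      case True
      have "?c q = 0" if "q \<in> {..<p}\<times>J" for q
        using True that cJ by (subst (asm) sum_nonneg_eq_0_iff) auto
      then have "(\<Sum>q\<in>{..<p}\<times>J. ?c q * G q \<omega>') = 0" for \<omega>' by (intro sum.neutral) auto
      then show ?thesis unfolding True using x by (simp add: cond_tail_def)
    next
      case False
      then have "(\<Sum>q\<in>{..<p}\<times>J. (?c q)\<^sup>2) > 0" by (simp add: sum_nonneg less_le)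
      then show ?thesis using std_gauss_linear_tail[OF Gsub refl, of ?c x] by (simp add: cond_tail_def)
    qed
    also have "\<dots> \<le> cond_tail x (real n * cond_var p d (Gs \<omega>) i)"
      unfolding v by (intro cond_tail_mono x mult_right_mono) (auto simp: cond_var_def sum_nonneg)
    finally show ?thesis unfolding XY .
  qed
  let ?bad = "{\<omega>\<in>space M. \<tau> \<le> \<bar>cond_var p d (Gs \<omega>) i - \<tau>\<bar>}"
  have bad: "?bad \<in> events" using cond_var_measurable[OF i] by measurable
  have "prob {\<omega>\<in>space M. x < \<bar>\<Sum>l\<in>J. gram p d (Gs \<omega>) i l\<bar>} = prob {\<omega>\<in>space M. (?X \<omega>, ?Y \<omega>) \<in> E}"
    using sp by (intro arg_cong[where f = prob]) (auto simp: E_def gram_def)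
  also have "\<dots> = expectation (\<lambda>\<omega>. prob {\<omega>'\<in>space M. (?X \<omega>, ?Y \<omega>') \<in> E})"
    by (rule indep_var_prob_fubini(2)[OF ind E])
  also have "\<dots> \<le> expectation (\<lambda>\<omega>. normal_tail (x / sqrt (2 * real n * \<tau>)) + indicator ?bad \<omega>)"
  proof (rule integral_mono)
    show "integrable M (\<lambda>\<omega>. prob {\<omega>'\<in>space M. (?X \<omega>, ?Y \<omega>') \<in> E})"
      using indep_var_prob_fubini(1)[OF ind E] by (intro integrable_const_bound[of _ 1]) auto
    show "integrable M (\<lambda>\<omega>. normal_tail (x / sqrt (2 * real n * \<tau>)) + indicator ?bad \<omega>)"
      using bad by (intro Bochner_Integration.integrable_add integrable_const integrable_const_bound[of _ 1]) auto
    fix \<omega> assume w: "\<omega> \<in> space M"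
    show "prob {\<omega>'\<in>space M. (?X \<omega>, ?Y \<omega>') \<in> E} \<le> normal_tail (x / sqrt (2 * real n * \<tau>)) + indicator ?bad \<omega>"
    proof (cases "\<omega> \<in> ?bad")
      case True
      then show ?thesis by (simp add: add_increasing normal_tail_nonneg)
    next
      case False
      then have "cond_var p d (Gs \<omega>) i \<le> 2 * \<tau>" using w by auto
      then have "cond_tail x (real n * cond_var p d (Gs \<omega>) i) \<le> cond_tail x (real n * (2 * \<tau>))"
        by (intro cond_tail_mono x mult_left_mono) auto
      also have "\<dots> = normal_tail (x / sqrt (2 * real n * \<tau>))"
        using \<tau> n by (simp add: cond_tail_def mult_ac)
      finally show ?thesis using False inner[of \<omega>] by simp
    qed
  qed
  also have "\<dots> = normal_tail (x / sqrt (2 * real n * \<tau>)) + prob ?bad"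
    using bad by (subst Bochner_Integration.integral_add) (auto intro!: integrable_const_bound[of _ 1] simp: prob_space)
  finally show ?thesis unfolding J_def .
qed

text \<open>With column \<open>i\<close> held fixed, the inner products divided by sqrt v are n - 1
  independent standard normals, so the sum is v times a chi-square variable. Deviations are measured
  relative to v, which makes the bound uniform over the fixed column; for v = 0 the strict
  inequality is never met.\<close>

lemma gram_row_squares:
  assumes i: "i < n" and \<eta>: "0 < \<eta>" "\<eta> \<le> 1 / 2" and n: "n \<ge> 2"
  shows "prob {\<omega>\<in>space M. \<eta> * real (n - 1) * cond_var p d (Gs \<omega>) i <
      \<bar>(\<Sum>l\<in>{..<n} - {i}. (gram p d (Gs \<omega>) i l)\<^sup>2) - real (n - 1) * cond_var p d (Gs \<omega>) i\<bar>} \<le>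
    2 * exp (- \<eta>\<^sup>2 * real (n - 1) / 8)"
proof -
  define J where "J = {..<n} - {i}"
  have cJ: "card J = n - 1" "finite J" using i by (simp_all add: J_def)
  let ?S = "PiM ({..<p} \<times> {i}) (\<lambda>_. borel :: real measure)"
  let ?T = "PiM ({..<p} \<times> J) (\<lambda>_. borel :: real measure)"
  let ?X = "\<lambda>\<omega>. restrict (Gs \<omega>) ({..<p} \<times> {i})"
  let ?Y = "\<lambda>\<omega>. restrict (Gs \<omega>) ({..<p} \<times> J)"
  let ?V = "\<lambda>z. \<Sum>k<p. (d k * fst z (k, i))\<^sup>2"
  define E where "E = {z \<in> space (?S \<Otimes>\<^sub>M ?T). \<eta> * real (n - 1) * ?V z <
    \<bar>(\<Sum>l\<in>J. (\<Sum>k<p. d k * fst z (k, i) * snd z (k, l))\<^sup>2) - real (n - 1) * ?V z\<bar>}"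
  have "(\<lambda>z. \<Sum>l\<in>J. (\<Sum>k<p. d k * fst z (k, i) * snd z (k, l))\<^sup>2) \<in> borel_measurable (?S \<Otimes>\<^sub>M ?T)"
    "?V \<in> borel_measurable (?S \<Otimes>\<^sub>M ?T)"
    by (intro borel_measurable_sum borel_measurable_times borel_measurable_power coordinate_measurable_pair borel_measurable_const; auto)+
  then have E: "E \<in> sets (?S \<Otimes>\<^sub>M ?T)" unfolding E_def by measurable
  have ind: "indep_var ?S ?X ?T ?Y" unfolding J_def by (rule columns_split[OF i])
  have sp: "(?X \<omega>, ?Y \<omega>') \<in> space (?S \<Otimes>\<^sub>M ?T)" for \<omega> \<omega>' by (simp add: space_pair_measure space_PiM)
  have inner: "prob {\<omega>'\<in>space M. (?X \<omega>, ?Y \<omega>') \<in> E} \<le> 2 * exp (- \<eta>\<^sup>2 * real (n - 1) / 8)" for \<omega>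
  proof -
    define c where "c k = d k * G (k, i) \<omega>" for k
    define v where "v = (\<Sum>k<p. (c k)\<^sup>2)"
    have XY: "{\<omega>'\<in>space M. (?X \<omega>, ?Y \<omega>') \<in> E} = {\<omega>'\<in>space M. \<eta> * real (n - 1) * v <
      \<bar>(\<Sum>l\<in>J. (\<Sum>k<p. c k * G (k, l) \<omega>')\<^sup>2) - real (n - 1) * v\<bar>}"
      using sp by (auto simp: E_def c_def v_def)
    show ?thesis
    proof (cases "v = 0")
      case True
      then have "\<forall>k<p. c k = 0" unfolding v_def by (subst (asm) sum_nonneg_eq_0_iff) auto
      then have e: "{\<omega>'\<in>space M. (?X \<omega>, ?Y \<omega>') \<in> E} = {}" unfolding XY using True by simp
      show ?thesis unfolding e by simp
    next
      case False
      then have v: "v > 0" by (simp add: v_def sum_nonneg less_le)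
      define H where "H l \<omega>' = (\<Sum>k<p. (c k / sqrt v) * G (k, l) \<omega>')" for l \<omega>'
      define e where "e l q = (if snd q = l then c (fst q) / sqrt v else 0)" for l :: nat and q :: "nat \<times> nat"
      have H: "std_gauss J H"
      proof (rule std_gauss_orthonormal[OF G cJ(2), of e])
        fix r r' assume r: "r \<in> J" "r' \<in> J"
        have "(\<Sum>q\<in>{..<p}\<times>{..<n}. e r q * e r' q) =
          (\<Sum>k<p. \<Sum>i<n. if i = r then (if r = r' then (c k)\<^sup>2 / v else 0) else 0)"
          unfolding sum_cartesian_real using v by (intro sum.cong refl) (auto simp: e_def power2_eq_square)
        also have "\<dots> = (if r = r' then 1 else 0)"
          using r v by (auto simp: sum_divide_distrib[symmetric] v_def[symmetric] J_def)
        finally show "(\<Sum>q\<in>{..<p}\<times>{..<n}. e r q * e r' q) = (if r = r' then 1 else 0)" .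
      next
        fix r \<omega> assume r: "r \<in> J"
        have "(\<Sum>q\<in>{..<p}\<times>{..<n}. e r q * G q \<omega>) = (\<Sum>k<p. \<Sum>i<n. if i = r then c k / sqrt v * G (k, i) \<omega> else 0)"
          unfolding sum_cartesian_real by (intro sum.cong refl) (auto simp: e_def)
        then show "H r \<omega> = (\<Sum>q\<in>{..<p}\<times>{..<n}. e r q * G q \<omega>)" using r by (auto simp: H_def J_def)
      qed
      have Hm: "H l \<in> borel_measurable M" if "l \<in> J" for l using H that by (simp add: std_gauss_def)
      have eq: "(\<Sum>k<p. c k * G (k, l) \<omega>')\<^sup>2 = v * (H l \<omega>')\<^sup>2" for l \<omega>'
      proof -
        have "(\<Sum>k<p. c k * G (k, l) \<omega>') = sqrt v * H l \<omega>'" using v by (simp add: H_def sum_distrib_left)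
        then show ?thesis using v by (simp add: power_mult_distrib)
      qed
      have "prob {\<omega>'\<in>space M. (?X \<omega>, ?Y \<omega>') \<in> E} \<le> prob {\<omega>'\<in>space M. \<eta> * real (n - 1) \<le> \<bar>\<Sum>l\<in>J. 1 * ((H l \<omega>')\<^sup>2 - 1)\<bar>}"
      proof (rule finite_measure_mono)
        have "(\<lambda>\<omega>'. \<Sum>l\<in>J. 1 * ((H l \<omega>')\<^sup>2 - 1)) \<in> borel_measurable M"
          using Hm by (intro borel_measurable_sum borel_measurable_times borel_measurable_diff borel_measurable_power) auto
        then show "{\<omega>'\<in>space M. \<eta> * real (n - 1) \<le> \<bar>\<Sum>l\<in>J. 1 * ((H l \<omega>')\<^sup>2 - 1)\<bar>} \<in> events" by measurable
        show "{\<omega>'\<in>space M. (?X \<omega>, ?Y \<omega>') \<in> E} \<subseteq> {\<omega>'\<in>space M. \<eta> * real (n - 1) \<le> \<bar>\<Sum>l\<in>J. 1 * ((H l \<omega>')\<^sup>2 - 1)\<bar>}"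
          unfolding XY
        proof safe
          fix \<omega>'
          assume "\<eta> * real (n - 1) * v < \<bar>(\<Sum>l\<in>J. (\<Sum>k<p. c k * G (k, l) \<omega>')\<^sup>2) - real (n - 1) * v\<bar>"
          also have "(\<Sum>l\<in>J. (\<Sum>k<p. c k * G (k, l) \<omega>')\<^sup>2) - real (n - 1) * v = (\<Sum>l\<in>J. 1 * ((H l \<omega>')\<^sup>2 - 1)) * v"
            unfolding eq by (simp add: sum_subtractf cJ right_diff_distrib sum_distrib_left[symmetric] mult.commute)
          finally show "\<eta> * real (n - 1) \<le> \<bar>\<Sum>l\<in>J. 1 * ((H l \<omega>')\<^sup>2 - 1)\<bar>" using v by (simp add: abs_mult)
        qed
      qed
      also have "\<dots> \<le> 2 * exp (- (\<eta> * real (n - 1))\<^sup>2 / (4 * (1 + 4 * (1 / 4)) * real (n - 1)))"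
      proof (rule std_gauss_chernoff_abs[OF H, of _ 1])
        show "\<eta> * real (n - 1) * 1 \<le> 2 * real (n - 1) * (1 / 4)"
          using mult_right_mono[OF \<eta>(2), of "real (n - 1)"] by simp
      qed (use \<eta> n cJ in auto)
      also have "- (\<eta> * real (n - 1))\<^sup>2 / (4 * (1 + 4 * (1 / 4)) * real (n - 1)) = - \<eta>\<^sup>2 * real (n - 1) / 8"
        using n by (simp add: field_simps power2_eq_square)
      finally show ?thesis .
    qed
  qed
  have "prob {\<omega>\<in>space M. \<eta> * real (n - 1) * cond_var p d (Gs \<omega>) i <
      \<bar>(\<Sum>l\<in>J. (gram p d (Gs \<omega>) i l)\<^sup>2) - real (n - 1) * cond_var p d (Gs \<omega>) i\<bar>} = prob {\<omega>\<in>space M. (?X \<omega>, ?Y \<omega>) \<in> E}"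
    using sp by (intro arg_cong[where f = prob]) (auto simp: E_def gram_def cond_var_def)
  also have "\<dots> = expectation (\<lambda>\<omega>. prob {\<omega>'\<in>space M. (?X \<omega>, ?Y \<omega>') \<in> E})"
    by (rule indep_var_prob_fubini(2)[OF ind E])
  also have "\<dots> \<le> expectation (\<lambda>\<omega>. 2 * exp (- \<eta>\<^sup>2 * real (n - 1) / 8))"
    using indep_var_prob_fubini(1)[OF ind E] inner
    by (intro integral_mono integrable_const) (auto intro!: integrable_const_bound[of _ 1])
  finally show ?thesis unfolding J_def by (simp add: prob_space)
qed

text \<open>A product of two correlated Gaussians is a weighted difference of squares of two independent ones,
  with weights \<open>(1 \<plusminus> r) / 2\<close>.\<close>

lemma row_product_concentration:
  assumes a: "(\<Sum>k<p. (\<alpha> k)\<^sup>2) = 1" and b: "(\<Sum>k<p. (\<beta> k)\<^sup>2) = 1" and r: "(\<Sum>k<p. \<alpha> k * \<beta> k) = r" "\<bar>r\<bar> < 1"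
    and n: "n > 0" and \<delta>: "0 < \<delta>" "\<delta> \<le> 1 / 4" and x: "0 \<le> x" "x \<le> \<delta>"
  shows "prob {\<omega>\<in>space M. x * real n \<le> \<bar>(\<Sum>i<n. (\<Sum>k<p. \<alpha> k * G (k, i) \<omega>) * (\<Sum>k<p. \<beta> k * G (k, i) \<omega>)) - real n * r\<bar>}
    \<le> 2 * exp (- real n * x\<^sup>2 / (2 * (1 + 4 * \<delta>) * (1 + r\<^sup>2)))"
proof -
  \<comment> \<open>The squared length of \<alpha> + s \<beta> for s = 1 and s = -1, positive as |r|
    < 1. Sum and difference are orthogonal because \<alpha> and \<beta> both have length 1.\<close>
  define w where "w s = 2 * (1 + s * r)" for s :: real
  have w: "w 1 > 0" "w (-1) > 0" using r by (auto simp: w_def)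
  define I where "I = {1, -1 :: real} \<times> {..<n}"
  define e :: "real \<times> nat \<Rightarrow> nat \<times> nat \<Rightarrow> real" where "e = (\<lambda>(s, i) q. if snd q = i then (\<alpha> (fst q) + s * \<beta> (fst q)) / sqrt (w s) else 0)"
  define H :: "real \<times> nat \<Rightarrow> 'a \<Rightarrow> real" where "H = (\<lambda>(s, i) \<omega>. (\<Sum>k<p. (\<alpha> k + s * \<beta> k) / sqrt (w s) * G (k, i) \<omega>))"
  have H: "std_gauss I H"
  proof (rule std_gauss_orthonormal[OF G, of _ e])
    show "finite I" by (simp add: I_def)
    fix h h' assume h: "h \<in> I" "h' \<in> I"
    obtain s i s' i' where hh: "h = (s, i)" "h' = (s', i')" by (cases h; cases h')
    have s: "s \<in> {1, -1}" "s' \<in> {1, -1}" "i < n" "i' < n" using h hh by (auto simp: I_def)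
    have "(\<Sum>q\<in>{..<p}\<times>{..<n}. e h q * e h' q) =
      (\<Sum>k<p. \<Sum>j<n. if j = i then (if i = i' then ((\<alpha> k)\<^sup>2 + (s + s') * (\<alpha> k * \<beta> k) + s * s' * (\<beta> k)\<^sup>2) / (sqrt (w s) * sqrt (w s')) else 0) else 0)"
      unfolding sum_cartesian_real hh
    proof (intro sum.cong refl)
      fix k j
      have prod: "(\<alpha> k + s * \<beta> k) / sqrt (w s) * ((\<alpha> k + s' * \<beta> k) / sqrt (w s')) =
        ((\<alpha> k)\<^sup>2 + (s + s') * (\<alpha> k * \<beta> k) + s * s' * (\<beta> k)\<^sup>2) / (sqrt (w s) * sqrt (w s'))"
        unfolding times_divide_times_eq
        by (rule arg_cong2[where f = "(/)", OF _ refl]) (simp add: power2_eq_square algebra_simps)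
      show "e (s, i) (k, j) * e (s', i') (k, j) = (if j = i then (if i = i' then
        ((\<alpha> k)\<^sup>2 + (s + s') * (\<alpha> k * \<beta> k) + s * s' * (\<beta> k)\<^sup>2) / (sqrt (w s) * sqrt (w s')) else 0) else 0)"
        by (cases "j = i"; cases "i = i'") (simp_all only: prod e_def prod.case fst_conv snd_conv if_True if_False mult_zero_left mult_zero_right simp_thms)
    qed
    also have "\<dots> = (if i = i' then (1 + (s + s') * r + s * s') / (sqrt (w s) * sqrt (w s')) else 0)"
      using s by (simp add: sum_divide_distrib[symmetric] sum.distrib sum_distrib_left[symmetric] a b r(1))
    also have "\<dots> = (if h = h' then 1 else 0)"
      using s w by (auto simp: hh) (auto simp: w_def)
    finally show "(\<Sum>q\<in>{..<p}\<times>{..<n}. e h q * e h' q) = (if h = h' then 1 else 0)" .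
  next
    fix h \<omega> assume h: "h \<in> I"
    obtain s i where hh: "h = (s, i)" by (cases h)
    have "(\<Sum>q\<in>{..<p}\<times>{..<n}. e h q * G q \<omega>) = (\<Sum>k<p. \<Sum>j<n. if j = i then (\<alpha> k + s * \<beta> k) / sqrt (w s) * G (k, i) \<omega> else 0)"
      unfolding sum_cartesian_real hh by (intro sum.cong refl) (auto simp: e_def)
    then show "H h \<omega> = (\<Sum>q\<in>{..<p}\<times>{..<n}. e h q * G q \<omega>)" using h hh by (auto simp: H_def I_def)
  qed
  define f where "f = (\<lambda>(s, i :: nat). s * w s / 4)"
  have sumI: "(\<Sum>q\<in>I. g q) = (\<Sum>i<n. g (1, i) + g (-1, i))" for g :: "real \<times> nat \<Rightarrow> real"
  proof -
    have "(\<Sum>q\<in>I. g q) = (\<Sum>s\<in>{1,-1}. \<Sum>i<n. g (s, i))" unfolding I_def by (rule sum_Times)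
    then show ?thesis by (simp add: sum.distrib)
  qed
  have key: "(\<Sum>i<n. (\<Sum>k<p. \<alpha> k * G (k, i) \<omega>) * (\<Sum>k<p. \<beta> k * G (k, i) \<omega>)) - real n * r = (\<Sum>q\<in>I. f q * ((H q \<omega>)\<^sup>2 - 1))" for \<omega>
  proof -
    have "(\<Sum>q\<in>I. f q * ((H q \<omega>)\<^sup>2 - 1)) = (\<Sum>i<n. (\<Sum>k<p. \<alpha> k * G (k, i) \<omega>) * (\<Sum>k<p. \<beta> k * G (k, i) \<omega>) - r)"
      unfolding sumI
    proof (intro sum.cong refl)
      fix i
      let ?a = "\<Sum>k<p. \<alpha> k * G (k, i) \<omega>" and ?b = "\<Sum>k<p. \<beta> k * G (k, i) \<omega>"
      have Hs: "w s * (H (s, i) \<omega>)\<^sup>2 = (?a + s * ?b)\<^sup>2" if "w s > 0" for s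
      proof -
        have "H (s, i) \<omega> = (\<Sum>k<p. (\<alpha> k * G (k, i) \<omega> + s * (\<beta> k * G (k, i) \<omega>)) / sqrt (w s))"
          by (simp add: H_def distrib_right mult.assoc)
        also have "\<dots> = (?a + s * ?b) / sqrt (w s)"
          by (simp only: sum_divide_distrib[symmetric] sum.distrib sum_distrib_left)
        finally have "H (s, i) \<omega> = (?a + s * ?b) / sqrt (w s)" .
        then show ?thesis using that by (simp add: power_divide)
      qed
      have "f (1, i) * ((H (1, i) \<omega>)\<^sup>2 - 1) + f (-1, i) * ((H (-1, i) \<omega>)\<^sup>2 - 1) =
        (w 1 * (H (1, i) \<omega>)\<^sup>2 - w (-1) * (H (-1, i) \<omega>)\<^sup>2 - (w 1 - w (-1))) / 4"
        by (simp add: f_def algebra_simps diff_divide_distrib)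
      also have "\<dots> = ?a * ?b - r" unfolding Hs[OF w(1)] Hs[OF w(2)] by (simp add: w_def power2_eq_square field_simps)
      finally show "f (1, i) * ((H (1, i) \<omega>)\<^sup>2 - 1) + f (-1, i) * ((H (-1, i) \<omega>)\<^sup>2 - 1) = ?a * ?b - r" .
    qed
    then show ?thesis by (simp add: sum_subtractf)
  qed
  \<comment> \<open>The weights (1 + r)/2 and -(1 - r)/2 contribute (1 + r^2)/2 per column: this is
    the source of 1 + r^2 in the exponent, close to 1 for nearly uncorrelated rows.\<close>
  have S: "(\<Sum>q\<in>I. (f q)\<^sup>2) = real n * (1 + r\<^sup>2) / 2"
    unfolding sumI by (simp add: f_def w_def power2_eq_square field_simps)
  have r2: "1 + r\<^sup>2 > 0" by (simp add: add_pos_nonneg)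
  have "prob {\<omega>\<in>space M. x * real n \<le> \<bar>\<Sum>q\<in>I. f q * ((H q \<omega>)\<^sup>2 - 1)\<bar>} \<le>
    2 * exp (- (x * real n)\<^sup>2 / (4 * (1 + 4 * \<delta>) * (real n * (1 + r\<^sup>2) / 2)))"
  proof (rule std_gauss_chernoff_abs[OF H, of _ 1])
    show "\<bar>f q\<bar> \<le> 1" if "q \<in> I" for q using that r(2) by (auto simp: I_def f_def w_def)
    show "(\<Sum>q\<in>I. (f q)\<^sup>2) \<le> real n * (1 + r\<^sup>2) / 2" by (simp add: S)
    show "x * real n * 1 \<le> 2 * (real n * (1 + r\<^sup>2) / 2) * \<delta>"
    proof -
      have "x * real n \<le> \<delta> * real n" using x by (intro mult_right_mono) auto
      also have "\<dots> \<le> \<delta> * real n * (1 + r\<^sup>2)"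
        using mult_left_mono[of 1 "1 + r\<^sup>2" "\<delta> * real n"] \<delta> by simp
      also have "\<dots> = 2 * (real n * (1 + r\<^sup>2) / 2) * \<delta>" by simp
      finally show ?thesis by simp
    qed
  qed (use n x \<delta> r2 in auto)
  also have "- (x * real n)\<^sup>2 / (4 * (1 + 4 * \<delta>) * (real n * (1 + r\<^sup>2) / 2)) = - real n * x\<^sup>2 / (2 * (1 + 4 * \<delta>) * (1 + r\<^sup>2))"
  proof -
    have eq: "4 * (1 + 4 * \<delta>) * (real n * (1 + r\<^sup>2) / 2) = real n * (2 * (1 + 4 * \<delta>) * (1 + r\<^sup>2))"
      by (simp add: algebra_simps)
    have "- (x * real n)\<^sup>2 / (real n * D) = - real n * x\<^sup>2 / D" for D
      using n by (simp add: power2_eq_square)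
    then show ?thesis unfolding eq .
  qed
  finally show ?thesis unfolding key .
qed

text \<open>The case of a row paired with itself, where r = 1 and the difference used in
  \<open>row_product_concentration\<close> degenerates.\<close>

lemma row_square_concentration:
  assumes a: "(\<Sum>k<p. (\<alpha> k)\<^sup>2) = 1" and n: "n > 0" and x: "0 \<le> x" "2 * x \<le> 1"
  shows "prob {\<omega>\<in>space M. x * real n \<le> \<bar>(\<Sum>i<n. (\<Sum>k<p. \<alpha> k * G (k, i) \<omega>)\<^sup>2) - real n\<bar>} \<le> 2 * exp (- real n * x\<^sup>2 / 8)"
proof -
  define H where "H i \<omega> = (\<Sum>k<p. \<alpha> k * G (k, i) \<omega>)" for i \<omega>
  define e where "e i q = (if snd q = i then \<alpha> (fst q) else 0)" for i :: nat and q :: "nat \<times> nat"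
  have H: "std_gauss {..<n} H"
  proof (rule std_gauss_orthonormal[OF G, of _ e])
    fix i i' assume h: "i \<in> {..<n}" "i' \<in> {..<n}"
    have "(\<Sum>q\<in>{..<p}\<times>{..<n}. e i q * e i' q) = (\<Sum>k<p. \<Sum>j<n. if j = i then (if i = i' then (\<alpha> k)\<^sup>2 else 0) else 0)"
      unfolding sum_cartesian_real by (intro sum.cong refl) (auto simp: e_def power2_eq_square)
    also have "\<dots> = (if i = i' then 1 else 0)" using h a by auto
    finally show "(\<Sum>q\<in>{..<p}\<times>{..<n}. e i q * e i' q) = (if i = i' then 1 else 0)" .
  next
    fix i \<omega> assume h: "i \<in> {..<n}"
    have "(\<Sum>q\<in>{..<p}\<times>{..<n}. e i q * G q \<omega>) = (\<Sum>k<p. \<Sum>j<n. if j = i then \<alpha> k * G (k, i) \<omega> else 0)"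
      unfolding sum_cartesian_real by (intro sum.cong refl) (auto simp: e_def)
    then show "H i \<omega> = (\<Sum>q\<in>{..<p}\<times>{..<n}. e i q * G q \<omega>)" using h by (auto simp: H_def)
  qed simp
  have "prob {\<omega>\<in>space M. x * real n \<le> \<bar>\<Sum>i<n. 1 * ((H i \<omega>)\<^sup>2 - 1)\<bar>} \<le> 2 * exp (- (x * real n)\<^sup>2 / (4 * (1 + 4 * (1 / 4)) * real n))"
    using n x by (intro std_gauss_chernoff_abs[OF H, of _ 1]) auto
  also have "- (x * real n)\<^sup>2 / (4 * (1 + 4 * (1 / 4)) * real n) = - real n * x\<^sup>2 / 8" using n by (simp add: power2_eq_square)
  finally show ?thesis by (simp add: H_def sum_subtractf)
qed

lemma row_sum_tail:
  assumes a: "(\<Sum>k<p. (\<alpha> k)\<^sup>2) = 1" and n: "n > 0"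
  shows "prob {\<omega>\<in>space M. x * sqrt (real n) < \<bar>\<Sum>i<n. \<Sum>k<p. \<alpha> k * G (k, i) \<omega>\<bar>} = normal_tail x"
proof -
  have eq: "(\<Sum>i<n. \<Sum>k<p. \<alpha> k * G (k, i) \<omega>) = (\<Sum>q\<in>{..<p}\<times>{..<n}. \<alpha> (fst q) * G q \<omega>)" for \<omega>
    unfolding sum_cartesian_real by (subst sum.swap) simp
  have v: "(\<Sum>q\<in>{..<p}\<times>{..<n}. (\<alpha> (fst q))\<^sup>2) = real n"
    unfolding sum_cartesian_real using a by (simp add: sum_distrib_left[symmetric])
  show ?thesis unfolding eq using std_gauss_linear_tail[OF G v] n by simp
qed

end

section \<open>The test statistic in terms of inner products of the centred columns\<close>

text \<open>A deterministic setting: one data matrix with its deviations \<open>z\<close> from the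
  mean. Algebra and perturbation bounds hold for each realisation; probability enters later, through
  the event on which their hypotheses hold.\<close>

locale centred_data =
  fixes p n :: nat and x :: "real mat" and \<mu> :: "nat \<Rightarrow> real" and z :: "nat \<Rightarrow> nat \<Rightarrow> real"
  assumes x: "x \<in> carrier_mat p n" and n2: "n \<ge> 2" and p1: "p \<ge> 1"
    and entry: "\<And>k i. k < p \<Longrightarrow> i < n \<Longrightarrow> x $$ (k, i) = \<mu> k + z k i"
begin

definition W :: "nat \<Rightarrow> nat \<Rightarrow> real" where "W i j = (\<Sum>k<p. z k i * z k j)"
definition R :: "nat \<Rightarrow> real" where "R i = (\<Sum>l\<in>{..<n} - {i}. W i l)"
definition S :: "nat \<Rightarrow> nat \<Rightarrow> real" where "S a b = (\<Sum>i<n. z a i * z b i)"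
definition rs :: "nat \<Rightarrow> real" where "rs a = (\<Sum>i<n. z a i)"
definition trS :: real where "trS = (\<Sum>k<p. sigma_hat x k k)"
definition P :: "nat \<Rightarrow> nat \<Rightarrow> real" where "P i j = real p * psi_hat x i j"
text \<open>By \<open>W_row\<close> the sum of all entries of \<open>W\<close>, and by
  \<open>sum_rs_square\<close> the squared length of the vector of row sums.\<close>

definition Tot :: real where "Tot = (\<Sum>i<n. W i i + R i)"

lemma dims [simp]: "dim_row x = p" "dim_col x = n"
  using x by auto

lemma W_row: "i < n \<Longrightarrow> (\<Sum>l<n. W i l) = W i i + R i"
  unfolding R_def by (subst sum.remove[of _ i]) auto

lemma centred_entry:
  assumes "k < p" "i < n"
  shows "x $$ (k, i) - sample_mean x k = z k i - rs k / real n"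
proof -
  have "sample_mean x k = (\<Sum>i<n. \<mu> k + z k i) / real n"
    using assms by (simp add: sample_mean_def entry)
  then show ?thesis using assms n2 by (simp add: entry sum.distrib add_divide_distrib rs_def)
qed

lemma sum_row: "i < n \<Longrightarrow> (\<Sum>k<p. z k i * rs k) = W i i + R i"
proof -
  assume "i < n"
  have "(\<Sum>k<p. z k i * rs k) = (\<Sum>k<p. \<Sum>l<n. z k i * z k l)" by (simp add: rs_def sum_distrib_left)
  also have "\<dots> = (\<Sum>l<n. W i l)" unfolding W_def by (rule sum.swap)
  finally show ?thesis using W_row[OF \<open>i < n\<close>] by simp
qed

lemma sum_rs_square: "(\<Sum>k<p. (rs k)\<^sup>2) = Tot"
proof -
  have "(\<Sum>k<p. (rs k)\<^sup>2) = (\<Sum>k<p. \<Sum>i<n. z k i * rs k)"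
    by (simp add: power2_eq_square rs_def[symmetric] sum_distrib_right[symmetric])
  also have "\<dots> = (\<Sum>i<n. \<Sum>k<p. z k i * rs k)" by (rule sum.swap)
  finally show ?thesis by (simp add: sum_row Tot_def)
qed

lemma P_eq:
  assumes "i < n" "j < n"
  shows "P i j = W i j - (W i i + R i + W j j + R j) / real n + Tot / (real n)\<^sup>2"
proof -
  have "P i j = (\<Sum>k<p. (z k i - rs k / real n) * (z k j - rs k / real n))"
    using assms p1 by (simp add: P_def psi_hat_def centred_entry)
  also have "\<dots> = (\<Sum>k<p. z k i * z k j - (z k i * rs k + z k j * rs k) / real n + (rs k)\<^sup>2 / (real n)\<^sup>2)"
    by (intro sum.cong refl) (simp add: algebra_simps power2_eq_square add_divide_distrib)
  also have "\<dots> = W i j - ((\<Sum>k<p. z k i * rs k) + (\<Sum>k<p. z k j * rs k)) / real n + (\<Sum>k<p. (rs k)\<^sup>2) / (real n)\<^sup>2"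
    by (simp add: W_def sum.distrib sum_subtractf sum_divide_distrib[symmetric])
  finally show ?thesis using assms by (simp add: sum_row sum_rs_square add_ac)
qed

lemma sigma_hat_eq:
  assumes "a < p" "b < p"
  shows "sigma_hat x a b = (S a b - rs a * rs b / real n) / (real n - 1)"
proof -
  have "(\<Sum>k<n. (x $$ (a, k) - sample_mean x a) * (x $$ (b, k) - sample_mean x b)) =
      (\<Sum>k<n. z a k * z b k - (z a k * rs b + rs a * z b k) / real n + rs a * rs b / (real n)\<^sup>2)"
    using assms by (intro sum.cong refl) (simp add: centred_entry algebra_simps power2_eq_square add_divide_distrib)
  also have "\<dots> = S a b - (rs a * rs b + rs a * rs b) / real n + real n * (rs a * rs b / (real n)\<^sup>2)"
  proof -
    have "(\<Sum>k<n. z a k * rs b) = rs a * rs b" "(\<Sum>k<n. rs a * z b k) = rs a * rs b"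
      by (simp_all add: sum_distrib_right[symmetric] sum_distrib_left[symmetric] rs_def[symmetric])
    then show ?thesis by (simp add: S_def sum.distrib sum_subtractf sum_divide_distrib[symmetric])
  qed
  also have "\<dots> = S a b - rs a * rs b / real n" using n2 by (simp add: power2_eq_square field_simps)
  finally show ?thesis by (simp add: sigma_hat_def)
qed

lemma trS_eq: "trS = ((\<Sum>i<n. W i i) - Tot / real n) / (real n - 1)"
proof -
  have "(\<Sum>k<p. S k k) = (\<Sum>i<n. W i i)" unfolding S_def W_def by (rule sum.swap)
  then show ?thesis
    unfolding trS_def by (simp add: sigma_hat_eq sum_divide_distrib[symmetric] sum_subtractf sum_rs_square power2_eq_square[symmetric])
qed

lemma T_entry_eq: "real p * T_entry x i j = P i j + trS / real n"
  using p1 by (simp add: T_entry_def P_def trS_def distrib_left)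

text \<open>Both sides are the total centred sum of squares, taken over observations or over
  coordinates. Hence the trace of \<open>Psi_hat\<close> is exactly n - 1 whenever
  \<open>trS\<close> is nonzero.\<close>

lemma sum_P_diag: "(\<Sum>i<n. P i i) = (real n - 1) * trS"
proof -
  have "(\<Sum>i<n. P i i) = (\<Sum>i<n. W i i - 2 * (W i i + R i) / real n + Tot / (real n)\<^sup>2)"
    by (intro sum.cong refl) (simp add: P_eq)
  also have "\<dots> = (\<Sum>i<n. W i i) - 2 * Tot / real n + real n * (Tot / (real n)\<^sup>2)"
    by (simp add: sum.distrib sum_subtractf sum_divide_distrib[symmetric] sum_distrib_left[symmetric] Tot_def)
  also have "\<dots> = (\<Sum>i<n. W i i) - Tot / real n" using n2 by (simp add: power2_eq_square field_simps)
  finally show ?thesis using n2 by (simp add: trS_eq)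
qed

lemma Psi_hat_entry: "i < n \<Longrightarrow> j < n \<Longrightarrow> Psi_hat x $$ (i, j) = P i j / trS"
  by (simp add: Psi_hat_def P_def trS_def mat_trace_def Sigma_hat_def)

lemma B_hat_eq:
  assumes "trS \<noteq> 0"
  shows "B_hat x = ((\<Sum>i<n. \<Sum>j<n. (P i j)\<^sup>2) / trS\<^sup>2 - (real n - 1)\<^sup>2 / real p) / real n"
proof -
  have d: "dim_row (Psi_hat x) = n" "dim_col (Psi_hat x) = n" by (simp_all add: Psi_hat_def)
  have "mat_trace (Psi_hat x) = (\<Sum>i<n. P i i) / trS"
    by (simp add: mat_trace_def d Psi_hat_entry sum_divide_distrib)
  then have "mat_trace (Psi_hat x) = real n - 1" using assms by (simp add: sum_P_diag)
  moreover have "(frobenius_norm (Psi_hat x))\<^sup>2 = (\<Sum>i<n. \<Sum>j<n. (P i j)\<^sup>2) / trS\<^sup>2"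
    by (simp add: frobenius_norm_def d Psi_hat_entry sum_nonneg power_divide sum_divide_distrib)
  ultimately show ?thesis by (simp add: B_hat_def)
qed

definition N2 :: "real \<Rightarrow> real" where "N2 \<delta> = (\<Sum>a<p. \<Sum>b<p. (Sigma_hat_thr \<delta> x $$ (a, b))\<^sup>2)"

text \<open>The scale \<open>p / A_hat\<close> equals trS^2 / N2, because thresholding leaves the
  diagonal alone; being nonnegative, it can be moved inside the maximum.\<close>

definition stat :: "real \<Rightarrow> nat \<Rightarrow> nat \<Rightarrow> real" where
  "stat \<delta> i j = trS\<^sup>2 / N2 \<delta> * ((real p * T_entry x i j)\<^sup>2 / (P i i * P j j))"

lemma T_hat_le_iff:
  "T_hat \<delta> x \<le> t \<longleftrightarrow> (\<forall>j<n. \<forall>i<j. stat \<delta> i j \<le> t)"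
proof -
  have d: "dim_row (Sigma_hat_thr \<delta> x) = p" "dim_col (Sigma_hat_thr \<delta> x) = p" by (simp_all add: Sigma_hat_thr_def)
  have tr: "mat_trace (Sigma_hat_thr \<delta> x) = trS"
    by (simp add: mat_trace_def d) (simp add: Sigma_hat_thr_def trS_def)
  have fr: "(frobenius_norm (Sigma_hat_thr \<delta> x))\<^sup>2 = N2 \<delta>"
    by (simp add: frobenius_norm_def d N2_def sum_nonneg)
  have N0: "N2 \<delta> \<ge> 0" by (simp add: N2_def sum_nonneg)
  have c: "real p / A_hat \<delta> x = trS\<^sup>2 / N2 \<delta>"
    using p1 by (simp add: A_hat_def tr fr)
  define f where "f = (\<lambda>(i, j). (T_entry x i j)\<^sup>2 / (psi_hat x i i * psi_hat x j j))"
  have fs: "trS\<^sup>2 / N2 \<delta> * f (i, j) = stat \<delta> i j" for i j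
    using p1 by (simp add: stat_def f_def P_def power_mult_distrib power2_eq_square)
  let ?A = "{(i, j). i < j \<and> j < n}"
  have "?A \<subseteq> {..<n} \<times> {..<n}" by auto
  then have fin: "finite (f ` ?A)" by (intro finite_imageI) (auto intro: finite_subset)
  have "(0, 1) \<in> ?A" using n2 by simp
  then have ne: "f ` ?A \<noteq> {}" by blast
  have "T_hat \<delta> x = trS\<^sup>2 / N2 \<delta> * Max (f ` ?A)"
    by (simp add: T_hat_def c f_def)
  moreover have "trS\<^sup>2 / N2 \<delta> * Max (f ` ?A) \<le> t \<longleftrightarrow> (\<forall>a\<in>f ` ?A. trS\<^sup>2 / N2 \<delta> * a \<le> t)"
  proof
    assume le: "trS\<^sup>2 / N2 \<delta> * Max (f ` ?A) \<le> t"
    show "\<forall>a\<in>f ` ?A. trS\<^sup>2 / N2 \<delta> * a \<le> t"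
    proof
      fix a assume "a \<in> f ` ?A"
      then have "a \<le> Max (f ` ?A)" using fin by simp
      then have "trS\<^sup>2 / N2 \<delta> * a \<le> trS\<^sup>2 / N2 \<delta> * Max (f ` ?A)" using N0 by (intro mult_left_mono) auto
      then show "trS\<^sup>2 / N2 \<delta> * a \<le> t" using le by simp
    qed
  qed (use Max_in[OF fin ne] in auto)
  moreover have "(\<forall>a\<in>f ` ?A. trS\<^sup>2 / N2 \<delta> * a \<le> t) \<longleftrightarrow> (\<forall>j<n. \<forall>i<j. stat \<delta> i j \<le> t)"
    using fs by auto
  ultimately show ?thesis by simp
qed

context
  fixes tr \<nu> \<rho> :: real
  assumes diag: "\<And>i. i < n \<Longrightarrow> \<bar>W i i - tr\<bar> \<le> \<nu>" and off: "\<And>i. i < n \<Longrightarrow> \<bar>R i\<bar> \<le> \<rho>"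
begin

lemma sum_diag_bound: "\<bar>(\<Sum>i<n. W i i) - real n * tr\<bar> \<le> real n * \<nu>"
proof -
  have "\<bar>\<Sum>i<n. W i i - tr\<bar> \<le> (\<Sum>i<n. \<bar>W i i - tr\<bar>)" by (rule sum_abs)
  also have "\<dots> \<le> (\<Sum>i<n. \<nu>)" by (intro sum_mono diag) auto
  finally show ?thesis by (simp add: sum_subtractf)
qed

lemma sum_off_bound: "\<bar>\<Sum>i<n. R i\<bar> \<le> real n * \<rho>"
proof -
  have "\<bar>\<Sum>i<n. R i\<bar> \<le> (\<Sum>i<n. \<bar>R i\<bar>)" by (rule sum_abs)
  also have "\<dots> \<le> (\<Sum>i<n. \<rho>)" by (intro sum_mono off) auto
  finally show ?thesis by simp
qed

lemma Tot_split: "Tot = (\<Sum>i<n. W i i) + (\<Sum>i<n. R i)"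
  by (simp add: Tot_def sum.distrib)

lemma nonneg_bounds: "0 \<le> \<nu>" "0 \<le> \<rho>"
  using diag[of 0] off[of 0] n2 by (auto intro: order_trans[OF abs_ge_zero])

lemma abs_divide_n: "\<bar>y\<bar> \<le> c \<Longrightarrow> \<bar>y / real n\<bar> \<le> c / real n"
  using n2 by (simp add: divide_right_mono)

lemma T_entry_close:
  assumes "i < n" "j < n"
  shows "\<bar>real p * T_entry x i j - W i j\<bar> \<le> (4 * \<nu> + 3 * \<rho>) / real n"
proof -
  define D where "D = (\<Sum>i<n. W i i)"
  define O1 where "O1 = (\<Sum>i<n. R i)"
  let ?n = "real n"
  have n: "?n > 1" using n2 by simp
  have D: "\<bar>D / ?n - tr\<bar> \<le> \<nu>"
  proof -
    have "D / ?n - tr = (D - ?n * tr) / ?n" using n by (simp add: field_simps)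
    then show ?thesis using abs_divide_n[OF sum_diag_bound[folded D_def]] n by simp
  qed
  have O: "\<bar>O1 / ?n\<bar> \<le> \<rho>" using abs_divide_n[OF sum_off_bound[folded O1_def]] n by simp
  have O': "\<bar>O1 / ?n * (1 - 1 / (?n - 1))\<bar> \<le> \<rho>"
  proof -
    have "\<bar>1 - 1 / (?n - 1)\<bar> \<le> 1" using n2 by (auto simp: abs_le_iff field_simps)
    then have "\<bar>O1 / ?n\<bar> * \<bar>1 - 1 / (?n - 1)\<bar> \<le> \<rho> * 1" using O nonneg_bounds(2) by (intro mult_mono) auto
    then show ?thesis by (simp only: abs_mult mult_1_right)
  qed
  \<comment> \<open>After multiplication by n, centring subtracts the two diagonal entries, each
    about \<open>tr\<close>, and adds D/n; the correction trS/n adds D/n once more. All multiples of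
    \<open>tr\<close> cancel and only deviations remain.\<close>
  have "real p * T_entry x i j - W i j =
    (- (W i i - tr) - (W j j - tr) + 2 * (D / ?n - tr) - R i - R j + O1 / ?n * (1 - 1 / (?n - 1))) / ?n"
    unfolding T_entry_eq P_eq[OF assms] trS_eq Tot_split D_def[symmetric] O1_def[symmetric]
    using n by (simp add: divide_simps power2_eq_square) (simp add: algebra_simps)
  also have "\<bar>\<dots>\<bar> \<le> (4 * \<nu> + 3 * \<rho>) / ?n"
  proof (rule abs_divide_n)
    have gen: "\<bar>- a - b + 2 * c - e - f + g\<bar> \<le> 4 * \<nu> + 3 * \<rho>"
      if "\<bar>a\<bar> \<le> \<nu>" "\<bar>b\<bar> \<le> \<nu>" "\<bar>c\<bar> \<le> \<nu>" "\<bar>e\<bar> \<le> \<rho>" "\<bar>f\<bar> \<le> \<rho>" "\<bar>g\<bar> \<le> \<rho>" for a b c e f g :: real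
      using that unfolding abs_le_iff by linarith
    show "\<bar>- (W i i - tr) - (W j j - tr) + 2 * (D / ?n - tr) - R i - R j + O1 / ?n * (1 - 1 / (?n - 1))\<bar> \<le> 4 * \<nu> + 3 * \<rho>"
      by (rule gen[OF diag[OF assms(1)] diag[OF assms(2)] D off[OF assms(1)] off[OF assms(2)] O'])
  qed
  finally show ?thesis .
qed

text \<open>The diagonal entries carry no correction, so the centring bias 3 tr / n stays in the
  bound; relative to \<open>tr\<close> it is of order 1/n.\<close>

lemma P_diag_close:
  assumes "i < n" "tr \<ge> 0"
  shows "\<bar>P i i - tr\<bar> \<le> 4 * \<nu> + 3 * (tr + \<rho>) / real n"
proof -
  define D where "D = (\<Sum>i<n. W i i)"
  define O1 where "O1 = (\<Sum>i<n. R i)"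
  let ?n = "real n"
  have n: "?n > 1" using n2 by simp
  have D: "\<bar>D / ?n\<bar> \<le> tr + \<nu>"
  proof -
    have "\<bar>D\<bar> \<le> ?n * (tr + \<nu>)"
      using sum_diag_bound[folded D_def] mult_nonneg_nonneg[of ?n tr] assms(2) n unfolding distrib_left by linarith
    then show ?thesis using abs_divide_n[of D] n by fastforce
  qed
  have O: "\<bar>O1 / ?n\<bar> \<le> \<rho>" using abs_divide_n[OF sum_off_bound[folded O1_def]] n by simp
  have "P i i - tr = (W i i - tr) + (- 2 * (W i i + R i) + D / ?n + O1 / ?n) / ?n"
    unfolding P_eq[OF assms(1) assms(1)] Tot_split D_def[symmetric] O1_def[symmetric]
    using n by (simp add: power2_eq_square divide_simps) (simp add: algebra_simps)
  moreover have "\<bar>(- 2 * (W i i + R i) + D / ?n + O1 / ?n) / ?n\<bar> \<le> (3 * (tr + \<nu>) + 3 * \<rho>) / ?n"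
  proof (rule abs_divide_n)
    have gen: "\<bar>- 2 * (a + b) + c + e\<bar> \<le> 3 * (tr + \<nu>) + 3 * \<rho>"
      if "\<bar>a - tr\<bar> \<le> \<nu>" "\<bar>b\<bar> \<le> \<rho>" "\<bar>c\<bar> \<le> tr + \<nu>" "\<bar>e\<bar> \<le> \<rho>" for a b c e
      using that assms(2) by (intro abs_leI; (simp only: abs_le_iff)?; elim conjE; simp)
    show "\<bar>- 2 * (W i i + R i) + D / ?n + O1 / ?n\<bar> \<le> 3 * (tr + \<nu>) + 3 * \<rho>"
      by (rule gen[OF diag[OF assms(1)] off[OF assms(1)] D O])
  qed
  ultimately have "\<bar>P i i - tr\<bar> \<le> \<nu> + (3 * (tr + \<nu>) + 3 * \<rho>) / ?n"
    using diag[OF assms(1)] by linarith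
  also have "(3 * (tr + \<nu>) + 3 * \<rho>) / ?n = 3 * (tr + \<rho>) / ?n + 3 * \<nu> / ?n" by (simp add: add_divide_distrib[symmetric] algebra_simps)
  also have "3 * \<nu> / ?n \<le> 3 * \<nu>" using n nonneg_bounds by (simp add: divide_le_eq mult_le_cancel_left1)
  finally show ?thesis by simp
qed

lemma trS_close: "\<bar>trS - tr\<bar> \<le> \<nu> + 2 * \<rho> / real n"
proof -
  define D where "D = (\<Sum>i<n. W i i)"
  define O1 where "O1 = (\<Sum>i<n. R i)"
  let ?n = "real n"
  have n: "?n \<ge> 2" using n2 by simp
  have D: "\<bar>D / ?n - tr\<bar> \<le> \<nu>"
  proof -
    have "D / ?n - tr = (D - ?n * tr) / ?n" using n by (simp add: field_simps)
    then show ?thesis using abs_divide_n[OF sum_diag_bound[folded D_def]] n by simp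
  qed
  have O: "\<bar>O1 / ?n\<bar> \<le> \<rho>" using abs_divide_n[OF sum_off_bound[folded O1_def]] n by simp
  have "trS - tr = (D / ?n - tr) - O1 / ?n / (?n - 1)"
  proof -
    have "D - (D + O1) / ?n = D / ?n * (?n - 1) - O1 / ?n" using n by (simp add: field_simps)
    then show ?thesis unfolding trS_eq Tot_split D_def[symmetric] O1_def[symmetric]
      using n by (simp add: diff_divide_distrib)
  qed
  moreover have "\<bar>O1 / ?n / (?n - 1)\<bar> \<le> \<rho> / (?n - 1)"
    unfolding abs_divide[of "O1 / ?n"] using divide_right_mono[OF O, of "?n - 1"] n by simp
  moreover have "\<rho> / (?n - 1) \<le> 2 * \<rho> / ?n"
  proof -
    have "\<rho> * ?n \<le> \<rho> * (2 * (?n - 1))" using n nonneg_bounds by (intro mult_left_mono) auto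
    then show ?thesis using n by (simp add: frac_le_eq field_simps)
  qed
  ultimately show ?thesis using D by linarith
qed

end

end

section \<open>Lower and upper bounds for the scale factor \<open>B_hat\<close>\<close>

context centred_data
begin

lemma sum_P_split: "(\<Sum>i<n. \<Sum>j<n. (P i j)\<^sup>2) = (\<Sum>i<n. (P i i)\<^sup>2 + (\<Sum>j\<in>{..<n} - {i}. (P i j)\<^sup>2))"
  by (intro sum.cong refl, subst sum.remove[of "{..<n}"]) auto

text \<open>Each row of \<open>P\<close> contributes the square of a diagonal entry near
  \<open>tr\<close> and the squares of the \<open>W i l\<close>, up to the perturbation \<theta>.
  The constants are kept sharp because the bound has to come close to 1 when the error parameters
  are small.\<close>

lemma B_hat_lower:
  assumes tr: "tr > 0" and \<kappa>: "0 \<le> \<kappa>" "\<kappa> \<le> 1 / 2" and \<eta>: "0 < \<eta>" "\<eta> < 1"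
    and P: "\<And>i. i < n \<Longrightarrow> \<bar>P i i - tr\<bar> \<le> \<kappa> * tr" and trS: "\<bar>trS - tr\<bar> \<le> \<kappa> * tr"
    and \<theta>: "\<And>i j. i < n \<Longrightarrow> j < n \<Longrightarrow> i \<noteq> j \<Longrightarrow> \<bar>P i j - W i j\<bar> \<le> \<theta>"
    and lo: "\<And>i. i < n \<Longrightarrow> lo \<le> (\<Sum>l\<in>{..<n} - {i}. (W i l)\<^sup>2)"
  shows "((1 - \<kappa>)\<^sup>2 + ((1 - \<eta>) * lo - real n * \<theta>\<^sup>2 / \<eta>) / tr\<^sup>2) / (1 + \<kappa>)\<^sup>2 - (real n - 1)\<^sup>2 / (real n * real p) \<le> B_hat x"
proof -
  have trS': "0 < trS" "trS \<le> (1 + \<kappa>) * tr"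
  proof -
    have "\<kappa> * tr \<le> 1 / 2 * tr" using \<kappa> tr by (intro mult_right_mono) auto
    then show "0 < trS" using trS[THEN abs_le_D2] tr by linarith
    show "trS \<le> (1 + \<kappa>) * tr" using trS by (simp add: abs_le_iff algebra_simps)
  qed
  \<comment> \<open>Young's inequality: the cross term is split into \<eta> W^2 and e^2/\<eta>, so
    the main term loses only the factor 1 - \<eta>.\<close>
  have sq: "(1 - \<eta>) * (W i j)\<^sup>2 - \<theta>\<^sup>2 / \<eta> \<le> (P i j)\<^sup>2" if "i < n" "j < n" "i \<noteq> j" for i j
  proof -
    define e where "e = P i j - W i j"
    have "0 \<le> (\<eta> * W i j + e)\<^sup>2 / \<eta> + e\<^sup>2" using \<eta> by simp
    also have "\<dots> = (P i j)\<^sup>2 - (1 - \<eta>) * (W i j)\<^sup>2 + e\<^sup>2 / \<eta>"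
      using \<eta> by (simp add: e_def power2_eq_square field_simps)
    finally have "(1 - \<eta>) * (W i j)\<^sup>2 - e\<^sup>2 / \<eta> \<le> (P i j)\<^sup>2" by simp
    moreover have "e\<^sup>2 / \<eta> \<le> \<theta>\<^sup>2 / \<eta>"
      using \<theta>[OF that] \<eta> by (intro divide_right_mono) (auto simp: e_def abs_le_square_iff[symmetric])
    ultimately show ?thesis by simp
  qed
  have row: "(1 - \<kappa>)\<^sup>2 * tr\<^sup>2 + ((1 - \<eta>) * lo - real n * \<theta>\<^sup>2 / \<eta>) \<le> (P i i)\<^sup>2 + (\<Sum>j\<in>{..<n} - {i}. (P i j)\<^sup>2)"
    if i: "i < n" for i
  proof -
    have "(1 - \<kappa>) * tr \<le> P i i" using P[OF i] by (simp add: abs_le_iff algebra_simps)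
    then have "((1 - \<kappa>) * tr)\<^sup>2 \<le> (P i i)\<^sup>2" using \<kappa> tr by (intro power_mono) auto
    moreover have "(1 - \<eta>) * lo - real n * \<theta>\<^sup>2 / \<eta> \<le> (\<Sum>j\<in>{..<n} - {i}. (P i j)\<^sup>2)"
    proof -
      have "(1 - \<eta>) * lo \<le> (1 - \<eta>) * (\<Sum>j\<in>{..<n} - {i}. (W i j)\<^sup>2)" using lo[OF i] \<eta> by (intro mult_left_mono) auto
      moreover have "real (n - 1) * (\<theta>\<^sup>2 / \<eta>) \<le> real n * (\<theta>\<^sup>2 / \<eta>)" using \<eta> by (intro mult_right_mono) auto
      moreover have "(\<Sum>j\<in>{..<n} - {i}. (1 - \<eta>) * (W i j)\<^sup>2 - \<theta>\<^sup>2 / \<eta>) \<le> (\<Sum>j\<in>{..<n} - {i}. (P i j)\<^sup>2)"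
        by (intro sum_mono sq) (use i in auto)
      moreover have "(\<Sum>j\<in>{..<n} - {i}. (1 - \<eta>) * (W i j)\<^sup>2 - \<theta>\<^sup>2 / \<eta>) =
          (1 - \<eta>) * (\<Sum>j\<in>{..<n} - {i}. (W i j)\<^sup>2) - real (n - 1) * (\<theta>\<^sup>2 / \<eta>)"
        using i by (simp add: sum_subtractf sum_distrib_left)
      ultimately show ?thesis by simp
    qed
    ultimately show ?thesis by (simp add: power_mult_distrib)
  qed
  define L where "L = (1 - \<kappa>)\<^sup>2 * tr\<^sup>2 + ((1 - \<eta>) * lo - real n * \<theta>\<^sup>2 / \<eta>)"
  have sumP: "real n * L \<le> (\<Sum>i<n. \<Sum>j<n. (P i j)\<^sup>2)"
  proof -
    have "(\<Sum>i<n. L) \<le> (\<Sum>i<n. (P i i)\<^sup>2 + (\<Sum>j\<in>{..<n} - {i}. (P i j)\<^sup>2))"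
      unfolding L_def by (intro sum_mono row) auto
    then show ?thesis by (simp add: sum_P_split)
  qed
  have "L / ((1 + \<kappa>)\<^sup>2 * tr\<^sup>2) \<le> (\<Sum>i<n. \<Sum>j<n. (P i j)\<^sup>2) / real n / ((1 + \<kappa>)\<^sup>2 * tr\<^sup>2)"
    using sumP n2 by (intro divide_right_mono) (auto simp: field_simps)
  also have "\<dots> \<le> (\<Sum>i<n. \<Sum>j<n. (P i j)\<^sup>2) / real n / trS\<^sup>2"
  proof (intro divide_left_mono)
    have "trS\<^sup>2 \<le> ((1 + \<kappa>) * tr)\<^sup>2" using trS' by (intro power_mono) auto
    then show "trS\<^sup>2 \<le> (1 + \<kappa>)\<^sup>2 * tr\<^sup>2" by (simp add: power_mult_distrib)
  qed (use trS' tr \<kappa> in \<open>auto intro!: divide_nonneg_nonneg sum_nonneg\<close>)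
  finally have "L / ((1 + \<kappa>)\<^sup>2 * tr\<^sup>2) - (real n - 1)\<^sup>2 / (real n * real p) \<le> B_hat x"
    using trS' by (simp add: B_hat_eq diff_divide_distrib mult.commute)
  moreover have "L / ((1 + \<kappa>)\<^sup>2 * tr\<^sup>2) = ((1 - \<kappa>)\<^sup>2 + ((1 - \<eta>) * lo - real n * \<theta>\<^sup>2 / \<eta>) / tr\<^sup>2) / (1 + \<kappa>)\<^sup>2"
  proof -
    have "L / ((1 + \<kappa>)\<^sup>2 * tr\<^sup>2) = L / tr\<^sup>2 / (1 + \<kappa>)\<^sup>2" by (simp add: mult.commute)
    also have "L / tr\<^sup>2 = (1 - \<kappa>)\<^sup>2 + ((1 - \<eta>) * lo - real n * \<theta>\<^sup>2 / \<eta>) / tr\<^sup>2"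
      using tr by (simp add: L_def add_divide_distrib)
    finally show ?thesis .
  qed
  ultimately show ?thesis by simp
qed

text \<open>Crude on purpose: from above, \<open>B_hat\<close> merely limits the size of the entries
  set to zero. With \<kappa> \<le> 1/2 each P i i is at most 3/2 tr and trS at least tr/2, whence 9
  = 4 * 9/4.\<close>

lemma B_hat_upper:
  assumes tr: "tr > 0" and \<kappa>: "0 \<le> \<kappa>" "\<kappa> \<le> 1 / 2"
    and P: "\<And>i. i < n \<Longrightarrow> \<bar>P i i - tr\<bar> \<le> \<kappa> * tr" and trS: "\<bar>trS - tr\<bar> \<le> \<kappa> * tr"
    and \<theta>: "\<And>i j. i < n \<Longrightarrow> j < n \<Longrightarrow> i \<noteq> j \<Longrightarrow> \<bar>P i j - W i j\<bar> \<le> \<theta>"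
    and hi: "\<And>i. i < n \<Longrightarrow> (\<Sum>l\<in>{..<n} - {i}. (W i l)\<^sup>2) \<le> hi"
  shows "B_hat x \<le> 9 + (8 * hi + 8 * real n * \<theta>\<^sup>2) / tr\<^sup>2"
proof -
  have kt: "\<kappa> * tr \<le> 1 / 2 * tr" using \<kappa> tr by (intro mult_right_mono) auto
  have trS': "tr / 2 \<le> trS" using trS kt by (simp add: abs_le_iff)
  have sq: "(P i j)\<^sup>2 \<le> 2 * (W i j)\<^sup>2 + 2 * \<theta>\<^sup>2" if "i < n" "j < n" "i \<noteq> j" for i j
  proof -
    define e where "e = P i j - W i j"
    have "0 \<le> (W i j - e)\<^sup>2" by simp
    then have "(P i j)\<^sup>2 \<le> 2 * (W i j)\<^sup>2 + 2 * e\<^sup>2" by (simp add: e_def power2_eq_square algebra_simps)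
    moreover have "e\<^sup>2 \<le> \<theta>\<^sup>2" using \<theta>[OF that] by (auto simp: e_def abs_le_square_iff[symmetric])
    ultimately show ?thesis by simp
  qed
  have row: "(P i i)\<^sup>2 + (\<Sum>j\<in>{..<n} - {i}. (P i j)\<^sup>2) \<le> (9 / 4) * tr\<^sup>2 + (2 * hi + 2 * real n * \<theta>\<^sup>2)"
    if i: "i < n" for i
  proof -
    have "0 \<le> P i i" "P i i \<le> (3 / 2) * tr"
      using P[OF i, THEN abs_le_D1] P[OF i, THEN abs_le_D2] kt tr by linarith+
    then have "(P i i)\<^sup>2 \<le> ((3 / 2) * tr)\<^sup>2" by (intro power_mono) auto
    then have "(P i i)\<^sup>2 \<le> (9 / 4) * tr\<^sup>2" by (simp add: power_mult_distrib power_divide)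
    moreover have "(\<Sum>j\<in>{..<n} - {i}. (P i j)\<^sup>2) \<le> 2 * hi + 2 * real n * \<theta>\<^sup>2"
    proof -
      have "(\<Sum>j\<in>{..<n} - {i}. (P i j)\<^sup>2) \<le> (\<Sum>j\<in>{..<n} - {i}. 2 * (W i j)\<^sup>2 + 2 * \<theta>\<^sup>2)"
        by (intro sum_mono sq) (use i in auto)
      also have "\<dots> = 2 * (\<Sum>j\<in>{..<n} - {i}. (W i j)\<^sup>2) + real (n - 1) * (2 * \<theta>\<^sup>2)"
        using i by (simp add: sum.distrib sum_distrib_left)
      also have "\<dots> \<le> 2 * hi + real n * (2 * \<theta>\<^sup>2)" using hi[OF i] by (intro add_mono mult_left_mono mult_right_mono) auto
      finally show ?thesis by simp
    qed
    ultimately show ?thesis by simp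
  qed
  define U where "U = (9 / 4) * tr\<^sup>2 + (2 * hi + 2 * real n * \<theta>\<^sup>2)"
  have "(\<Sum>i<n. \<Sum>j<n. (P i j)\<^sup>2) \<le> (\<Sum>i<n. U)"
    unfolding sum_P_split U_def by (intro sum_mono row) auto
  then have sumP: "(\<Sum>i<n. \<Sum>j<n. (P i j)\<^sup>2) \<le> real n * U" by simp
  have U0: "0 \<le> U" unfolding U_def using row[of 0] n2 by (intro order_trans[OF _ row[of 0]]) (auto intro!: add_nonneg_nonneg sum_nonneg)
  have "B_hat x \<le> (\<Sum>i<n. \<Sum>j<n. (P i j)\<^sup>2) / trS\<^sup>2 / real n"
  proof -
    have "trS \<noteq> 0" using trS' tr by linarith
    then show ?thesis unfolding B_hat_eq[OF \<open>trS \<noteq> 0\<close>] by (intro divide_right_mono) auto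
  qed
  also have "\<dots> \<le> real n * U / trS\<^sup>2 / real n" by (intro divide_right_mono sumP) auto
  also have "\<dots> = U / trS\<^sup>2" using n2 by simp
  also have "\<dots> \<le> U / (tr / 2)\<^sup>2"
    using trS' tr U0 by (intro divide_left_mono power_mono) auto
  also have "\<dots> = 9 + (8 * hi + 8 * real n * \<theta>\<^sup>2) / tr\<^sup>2"
    using tr by (simp add: U_def field_simps power2_eq_square)
  finally show ?thesis .
qed

end

lemma square_diff_le:
  fixes a b :: real
  assumes "\<bar>a - b\<bar> \<le> e"
  shows "\<bar>a\<^sup>2 - b\<^sup>2\<bar> \<le> e * (e + 2 * \<bar>b\<bar>)"
proof -
  have "\<bar>a\<^sup>2 - b\<^sup>2\<bar> = \<bar>a - b\<bar> * \<bar>a + b\<bar>" by (simp add: power2_eq_square abs_mult[symmetric] algebra_simps)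
  also have "\<dots> \<le> e * (e + 2 * \<bar>b\<bar>)" using assms by (intro mult_mono) auto
  finally show ?thesis .
qed

section \<open>The thresholded covariance estimator\<close>

context centred_data
begin

definition kept :: "real \<Rightarrow> nat \<Rightarrow> nat \<Rightarrow> bool" where
  "kept \<delta> a b \<longleftrightarrow> \<delta> * sqrt (B_hat x * ln (real p) / real n) \<le> \<bar>rho_hat x a b\<bar> / (1 - (rho_hat x a b)\<^sup>2)"

lemma thr_entry:
  "a < p \<Longrightarrow> b < p \<Longrightarrow> Sigma_hat_thr \<delta> x $$ (a, b) = (if a = b \<or> kept \<delta> a b then sigma_hat x a b else 0)"
  by (simp add: Sigma_hat_thr_def kept_def)

text \<open>Thresholding errs by \<open>O(s |\<sigma>|)\<close> on entries kept although they are not tiny, by \<open>O(s\<^sup>2)\<close> on the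
  few tiny ones kept, and by \<open>\<sigma>\<^sup>2\<close> on those set to zero, which are \<open>O(s)\<close>.\<close>

lemma thresholded_norm_close:
  fixes \<sigma> :: "nat \<Rightarrow> nat \<Rightarrow> real" and \<delta> :: real
  assumes close: "\<And>a b. a < p \<Longrightarrow> b < p \<Longrightarrow> \<bar>sigma_hat x a b - \<sigma> a b\<bar> \<le> K * s"
    and s: "0 < s" "s \<le> 1" "s\<^sup>2 = ln (real p) / real n" and K: "K > 0" and c: "c > 0" and \<delta>: "\<delta> > 0"
    and diag: "\<And>a. a < p \<Longrightarrow> 0 < \<sigma> a a \<and> \<sigma> a a \<le> c"
    and pos: "\<And>a. a < p \<Longrightarrow> 0 < sigma_hat x a a"
    and rho: "\<And>a b. a < p \<Longrightarrow> b < p \<Longrightarrow> a \<noteq> b \<Longrightarrow> (sigma_hat x a b)\<^sup>2 < sigma_hat x a a * sigma_hat x b b"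
    and B: "0 \<le> B_hat x" "B_hat x \<le> b2" and \<eta>: "\<eta> > 0"
    and m: "real (card {(a, b). a < p \<and> b < p \<and> a \<noteq> b \<and> \<bar>\<sigma> a b\<bar> \<le> \<eta> * s \<and> kept \<delta> a b}) \<le> m"
    and \<tau>: "1 \<le> \<tau>" "\<tau> < 2" and C: "\<And>a. a < p \<Longrightarrow> (\<Sum>b<p. \<bar>\<sigma> a b\<bar> powr \<tau>) \<le> C"
  shows "\<bar>N2 \<delta> - (\<Sum>a<p. \<Sum>b<p. (\<sigma> a b)\<^sup>2)\<bar> \<le>
    real p * (K * (K + 2 * c) + ((K * (K / \<eta> + 2)) * \<eta> powr (1 - \<tau>) + (\<delta> * sqrt b2 * (c + K) + K) powr (2 - \<tau>)) * C) * s powr (2 - \<tau>)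
      + m * (K * (K + 2 * \<eta>) * s\<^sup>2)"
proof -
  define t where "t a b = (if a = b \<or> kept \<delta> a b then sigma_hat x a b else 0)" for a b
  define E where "E = {(a, b). a < p \<and> b < p \<and> a \<noteq> b \<and> \<bar>\<sigma> a b\<bar> \<le> \<eta> * s \<and> kept \<delta> a b}"
  \<comment> \<open>Population entries whose estimates are set to zero are at most
    \<open>L1 * s\<close>: the threshold times the scale of the variances, plus the estimation
    error.\<close>
  define L1 where "L1 = \<delta> * sqrt b2 * (c + K) + K"
  define L where "L = (K * (K / \<eta> + 2)) * \<eta> powr (1 - \<tau>) + L1 powr (2 - \<tau>)"
  have b2: "b2 \<ge> 0" using B by simp
  have L1: "L1 > 0" unfolding L1_def using \<delta> b2 c K by (intro add_nonneg_pos) auto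
  have st: "s powr (2 - \<tau>) > 0" using s by simp
  have L0: "(K * (K / \<eta> + 2)) * \<eta> powr (1 - \<tau>) \<ge> 0" "L1 powr (2 - \<tau>) \<ge> 0" using K \<eta> by auto
  have s_le: "s \<le> s powr (2 - \<tau>)"
    using powr_mono'[of "2 - \<tau>" 1 s] s \<tau> by simp
  have N2: "N2 \<delta> = (\<Sum>a<p. \<Sum>b<p. (t a b)\<^sup>2)"
    unfolding N2_def by (intro sum.cong refl) (simp add: thr_entry t_def)
  have entry: "\<bar>(t a b)\<^sup>2 - (\<sigma> a b)\<^sup>2\<bar> \<le> (if a = b then K * (K + 2 * c) * s powr (2 - \<tau>) else 0) +
      L * s powr (2 - \<tau>) * \<bar>\<sigma> a b\<bar> powr \<tau> + (if (a, b) \<in> E then K * (K + 2 * \<eta>) * s\<^sup>2 else 0)"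
    if ab: "a < p" "b < p" for a b
  proof -
    have e0: "\<bar>(sigma_hat x a b)\<^sup>2 - (\<sigma> a b)\<^sup>2\<bar> \<le> K * s * (K * s + 2 * \<bar>\<sigma> a b\<bar>)"
      by (rule square_diff_le[OF close[OF ab]])
    have Ls: "0 \<le> L * s powr (2 - \<tau>) * \<bar>\<sigma> a b\<bar> powr \<tau>" using L0 by (simp add: L_def)
    consider "a = b" | "a \<noteq> b" "(a, b) \<in> E" | "a \<noteq> b" "kept \<delta> a b" "\<eta> * s < \<bar>\<sigma> a b\<bar>" | "a \<noteq> b" "\<not> kept \<delta> a b"
      using ab by (cases "\<bar>\<sigma> a b\<bar> \<le> \<eta> * s") (auto simp: E_def)
    then show ?thesis
    proof cases
      case 1
      have "K * s * (K * s + 2 * \<bar>\<sigma> a b\<bar>) \<le> K * s * (K * 1 + 2 * c)"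
        using 1 K s diag[OF ab(1)] by (intro mult_left_mono add_mono) auto
      also have "\<dots> = K * (K + 2 * c) * s" by simp
      also have "\<dots> \<le> K * (K + 2 * c) * s powr (2 - \<tau>)" using s_le K c by (intro mult_left_mono) auto
      finally have "\<bar>(t a b)\<^sup>2 - (\<sigma> a b)\<^sup>2\<bar> \<le> K * (K + 2 * c) * s powr (2 - \<tau>)"
        using e0 1 by (simp add: t_def)
      then show ?thesis using Ls 1 by (simp add: E_def)
    next
      case 2
      then have k: "kept \<delta> a b" "\<bar>\<sigma> a b\<bar> \<le> \<eta> * s" by (auto simp: E_def)
      have "K * s * (K * s + 2 * \<bar>\<sigma> a b\<bar>) \<le> K * s * (K * s + 2 * (\<eta> * s))"
        using K s k by (intro mult_left_mono add_mono) auto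
      also have "\<dots> = K * (K + 2 * \<eta>) * s\<^sup>2" by (simp add: power2_eq_square algebra_simps)
      finally show ?thesis using e0 2 k Ls by (simp add: t_def)
    next
      case 3
      have s0: "\<bar>\<sigma> a b\<bar> > 0" using 3(3) \<eta> s by (meson less_trans mult_pos_pos)
      have "K * s * (K * s + 2 * \<bar>\<sigma> a b\<bar>) \<le> K * s * (K * (\<bar>\<sigma> a b\<bar> / \<eta>) + 2 * \<bar>\<sigma> a b\<bar>)"
        using 3(3) K s \<eta> by (intro mult_left_mono add_right_mono) (auto simp: field_simps)
      also have "\<dots> = K * (K / \<eta> + 2) * (s * \<bar>\<sigma> a b\<bar>)" by (simp add: field_simps)
      \<comment> \<open>As 1 - \<tau> \<le> 0, |\<sigma>| > \<eta> s gives |\<sigma>|^(1-\<tau>)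
        \<le> (\<eta> s)^(1-\<tau>). This turns s |\<sigma>| into a multiple of s^(2-\<tau>)
        |\<sigma>|^\<tau>, which the row sums control.\<close>
      also have "s * \<bar>\<sigma> a b\<bar> \<le> \<eta> powr (1 - \<tau>) * (s powr (2 - \<tau>) * \<bar>\<sigma> a b\<bar> powr \<tau>)"
      proof -
        have "s * \<bar>\<sigma> a b\<bar> = s * (\<bar>\<sigma> a b\<bar> powr (1 - \<tau>) * \<bar>\<sigma> a b\<bar> powr \<tau>)"
          using s0 by (simp add: powr_add[symmetric])
        also have "\<dots> \<le> s * ((\<eta> * s) powr (1 - \<tau>) * \<bar>\<sigma> a b\<bar> powr \<tau>)"
          using 3(3) s \<eta> \<tau> by (intro mult_left_mono mult_right_mono powr_mono2') auto
        also have "\<dots> = \<eta> powr (1 - \<tau>) * ((s powr 1 * s powr (1 - \<tau>)) * \<bar>\<sigma> a b\<bar> powr \<tau>)"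
          using s \<eta> by (simp add: powr_mult)
        also have "s powr 1 * s powr (1 - \<tau>) = s powr (2 - \<tau>)" unfolding powr_add[symmetric] by simp
        finally show ?thesis .
      qed
      finally have "K * s * (K * s + 2 * \<bar>\<sigma> a b\<bar>) \<le> K * (K / \<eta> + 2) * (\<eta> powr (1 - \<tau>) * (s powr (2 - \<tau>) * \<bar>\<sigma> a b\<bar> powr \<tau>))"
        using K \<eta> by (simp add: mult_left_mono)
      also have "\<dots> \<le> L * s powr (2 - \<tau>) * \<bar>\<sigma> a b\<bar> powr \<tau>"
        unfolding L_def using L0 by (simp add: algebra_simps)
      finally have "\<bar>(t a b)\<^sup>2 - (\<sigma> a b)\<^sup>2\<bar> \<le> L * s powr (2 - \<tau>) * \<bar>\<sigma> a b\<bar> powr \<tau>" using e0 3 by (simp add: t_def)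
      moreover have "(a, b) \<notin> E" using 3 by (simp add: E_def)
      ultimately show ?thesis using 3 by simp
    next
      case 4
      define q where "q = sigma_hat x a a * sigma_hat x b b"
      have q: "q > 0" using pos ab by (simp add: q_def)
      have r2: "(rho_hat x a b)\<^sup>2 < 1"
        using rho[OF ab 4(1)] q by (simp add: rho_hat_def power_divide q_def[symmetric])
      \<comment> \<open>Division by a number in (0, 1] only enlarges, so failing the threshold
        bounds the correlation itself.\<close>
      have "\<bar>rho_hat x a b\<bar> \<le> \<bar>rho_hat x a b\<bar> / (1 - (rho_hat x a b)\<^sup>2)"
        using r2 by (simp add: le_divide_eq mult_left_le)
      also have "\<dots> \<le> \<delta> * sqrt (B_hat x * s\<^sup>2)" using 4(2) s(3) by (simp add: kept_def)
      also have "\<dots> = \<delta> * sqrt (B_hat x) * s" using s(1) by (simp add: real_sqrt_mult)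
      also have "\<dots> \<le> \<delta> * sqrt b2 * s" using B \<delta> s by (intro mult_right_mono mult_left_mono) auto
      finally have r: "\<bar>rho_hat x a b\<bar> \<le> \<delta> * sqrt b2 * s" .
      have qc: "sqrt q \<le> c + K"
      proof -
        have "sigma_hat x a a \<le> c + K" if "a < p" for a
        proof -
          have "K * s \<le> K * 1" using K s by (intro mult_left_mono) auto
          then show ?thesis using close[OF that that] diag[OF that] by (simp add: abs_le_iff)
        qed
        then have "q \<le> (c + K) * (c + K)" unfolding q_def using pos ab c K by (intro mult_mono) (auto simp: less_imp_le)
        then show ?thesis using c K by (intro real_le_lsqrt) (auto simp: power2_eq_square)
      qed
      have "\<bar>sigma_hat x a b\<bar> = \<bar>rho_hat x a b\<bar> * sqrt q" using q by (simp add: rho_hat_def q_def[symmetric] abs_divide)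
      also have "\<dots> \<le> (\<delta> * sqrt b2 * s) * (c + K)" using r qc q by (intro mult_mono) (auto intro: order_trans[OF abs_ge_zero r])
      finally have sb: "\<bar>\<sigma> a b\<bar> \<le> L1 * s" using close[OF ab] unfolding L1_def by (simp add: algebra_simps abs_le_iff)
      have "(\<sigma> a b)\<^sup>2 \<le> L1 powr (2 - \<tau>) * (s powr (2 - \<tau>) * \<bar>\<sigma> a b\<bar> powr \<tau>)"
      proof (cases "\<sigma> a b = 0")
        case False
        then have "(\<sigma> a b)\<^sup>2 = \<bar>\<sigma> a b\<bar> powr (2 - \<tau>) * \<bar>\<sigma> a b\<bar> powr \<tau>"
          by (simp add: powr_add[symmetric] powr_numeral[symmetric])
        also have "\<dots> \<le> (L1 * s) powr (2 - \<tau>) * \<bar>\<sigma> a b\<bar> powr \<tau>"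
          using sb \<tau> by (intro mult_right_mono powr_mono2) auto
        also have "\<dots> = L1 powr (2 - \<tau>) * (s powr (2 - \<tau>) * \<bar>\<sigma> a b\<bar> powr \<tau>)" using L1 s by (simp add: powr_mult)
        finally show ?thesis .
      qed simp
      also have "\<dots> \<le> L * (s powr (2 - \<tau>) * \<bar>\<sigma> a b\<bar> powr \<tau>)"
        using L0 by (intro mult_right_mono) (auto simp: L_def)
      finally have "(\<sigma> a b)\<^sup>2 \<le> L * s powr (2 - \<tau>) * \<bar>\<sigma> a b\<bar> powr \<tau>" by (simp only: mult.assoc)
      then show ?thesis using 4 by (simp add: t_def E_def)
    qed
  qed
  have finE: "finite E" by (rule finite_subset[of _ "{..<p} \<times> {..<p}"]) (auto simp: E_def)
  have "\<bar>N2 \<delta> - (\<Sum>a<p. \<Sum>b<p. (\<sigma> a b)\<^sup>2)\<bar> = \<bar>\<Sum>a<p. \<Sum>b<p. (t a b)\<^sup>2 - (\<sigma> a b)\<^sup>2\<bar>"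
    by (simp add: N2 sum_subtractf)
  also have "\<dots> \<le> (\<Sum>a<p. \<Sum>b<p. \<bar>(t a b)\<^sup>2 - (\<sigma> a b)\<^sup>2\<bar>)"
    by (intro order_trans[OF sum_abs] sum_mono sum_abs)
  also have "\<dots> \<le> (\<Sum>a<p. \<Sum>b<p. (if a = b then K * (K + 2 * c) * s powr (2 - \<tau>) else 0) +
      L * s powr (2 - \<tau>) * \<bar>\<sigma> a b\<bar> powr \<tau> + (if (a, b) \<in> E then K * (K + 2 * \<eta>) * s\<^sup>2 else 0))"
    by (intro sum_mono entry) auto
  also have "\<dots> = real p * (K * (K + 2 * c) * s powr (2 - \<tau>)) + (\<Sum>a<p. L * s powr (2 - \<tau>) * (\<Sum>b<p. \<bar>\<sigma> a b\<bar> powr \<tau>)) +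
      (\<Sum>a<p. \<Sum>b<p. if (a, b) \<in> E then K * (K + 2 * \<eta>) * s\<^sup>2 else 0)"
    by (simp add: sum.distrib sum_distrib_left)
  also have "(\<Sum>a<p. \<Sum>b<p. if (a, b) \<in> E then K * (K + 2 * \<eta>) * s\<^sup>2 else 0) = real (card E) * (K * (K + 2 * \<eta>) * s\<^sup>2)"
  proof -
    have "(\<Sum>a<p. \<Sum>b<p. if (a, b) \<in> E then K * (K + 2 * \<eta>) * s\<^sup>2 else 0) =
      (\<Sum>q\<in>{..<p}\<times>{..<p}. if q \<in> E then K * (K + 2 * \<eta>) * s\<^sup>2 else 0)" by (simp add: sum_Times)
    also have "\<dots> = (\<Sum>q\<in>({..<p}\<times>{..<p}) \<inter> E. K * (K + 2 * \<eta>) * s\<^sup>2)" by (rule sum.inter_restrict[symmetric]) simp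
    also have "({..<p}\<times>{..<p}) \<inter> E = E" by (auto simp: E_def)
    finally show ?thesis by simp
  qed
  also have "(\<Sum>a<p. L * s powr (2 - \<tau>) * (\<Sum>b<p. \<bar>\<sigma> a b\<bar> powr \<tau>)) \<le> (\<Sum>a<p. L * s powr (2 - \<tau>) * C)"
    using L0 by (intro sum_mono mult_left_mono C) (auto simp: L_def)
  also have "real (card E) * (K * (K + 2 * \<eta>) * s\<^sup>2) \<le> m * (K * (K + 2 * \<eta>) * s\<^sup>2)"
    using m K \<eta> unfolding E_def[symmetric] by (intro mult_right_mono) auto
  finally show ?thesis by (simp add: L_def L1_def algebra_simps)
qed

lemma sigma_hat_close:
  fixes \<sigma> :: "nat \<Rightarrow> nat \<Rightarrow> real"
  assumes ab: "a < p" "b < p" and S: "\<bar>S a b - real n * \<sigma> a b\<bar> \<le> K0 * real n * s"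
    and rs: "\<bar>rs a\<bar> \<le> K1 * real n * s" "\<bar>rs b\<bar> \<le> K1 * real n * s" and c: "\<bar>\<sigma> a b\<bar> \<le> c"
    and s: "0 < s" "s \<le> 1" "1 / real n \<le> s\<^sup>2"
  shows "\<bar>sigma_hat x a b - \<sigma> a b\<bar> \<le> (2 * K0 + 2 * c + 2 * K1\<^sup>2) * s"
proof -
  let ?n = "real n"
  have n: "?n \<ge> 2" using n2 by simp
  have eq: "sigma_hat x a b - \<sigma> a b = ((S a b - ?n * \<sigma> a b) + \<sigma> a b - rs a * rs b / ?n) / (?n - 1)"
    unfolding sigma_hat_eq[OF ab] using n by (simp add: field_simps)
  have K1: "0 \<le> K1 * ?n * s" using rs(1) by (rule order_trans[OF abs_ge_zero])
  have "\<bar>rs a * rs b\<bar> \<le> (K1 * ?n * s) * (K1 * ?n * s)" unfolding abs_mult using rs K1 by (intro mult_mono) auto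
  then have "\<bar>rs a * rs b / ?n\<bar> \<le> (K1 * ?n * s) * (K1 * ?n * s) / ?n"
    unfolding abs_divide abs_of_nat by (rule divide_right_mono) simp
  also have "\<dots> = K1\<^sup>2 * ?n * (s * s)" using n by (simp add: power2_eq_square)
  also have "\<dots> \<le> K1\<^sup>2 * ?n * (s * 1)" using s n by (intro mult_left_mono) auto
  finally have r: "\<bar>rs a * rs b / ?n\<bar> \<le> K1\<^sup>2 * ?n * s" by simp
  \<comment> \<open>From 1/n \<le> s^2 and s \<le> 1 follows n s \<ge> 1, so the bounded term caused
    by dividing by n - 1 instead of n is absorbed into c n s.\<close>
  have "1 \<le> ?n * (s * s)" using s n by (simp add: field_simps power2_eq_square)
  also have "\<dots> \<le> ?n * (s * 1)" using s n by (intro mult_left_mono) auto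
  finally have "c * 1 \<le> c * (?n * s)" using c by (intro mult_left_mono) auto
  then have "\<bar>\<sigma> a b\<bar> \<le> c * ?n * s" using c by simp
  then have "\<bar>(S a b - ?n * \<sigma> a b) + \<sigma> a b - rs a * rs b / ?n\<bar> \<le> K0 * ?n * s + c * ?n * s + K1\<^sup>2 * ?n * s"
    using S r by linarith
  also have "\<dots> = (K0 + c + K1\<^sup>2) * s * ?n" by (simp add: algebra_simps)
  finally have "\<bar>sigma_hat x a b - \<sigma> a b\<bar> \<le> (K0 + c + K1\<^sup>2) * s * ?n / (?n - 1)"
    unfolding eq abs_divide using n by (simp add: divide_right_mono)
  also have "\<dots> \<le> (K0 + c + K1\<^sup>2) * s * 2"
  proof -
    have "0 \<le> K0 * ?n * s" using S by (rule order_trans[OF abs_ge_zero])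
    then have "0 \<le> K0" using n s by (simp add: zero_le_mult_iff)
    then have "0 \<le> (K0 + c + K1\<^sup>2) * s" using c s by (intro mult_nonneg_nonneg add_nonneg_nonneg) (auto intro: order_trans[OF abs_ge_zero])
    moreover have "?n / (?n - 1) \<le> 2" using n by (simp add: field_simps)
    ultimately have "(K0 + c + K1\<^sup>2) * s * (?n / (?n - 1)) \<le> (K0 + c + K1\<^sup>2) * s * 2" by (intro mult_left_mono)
    then show ?thesis by simp
  qed
  finally show ?thesis by (simp add: algebra_simps)
qed

text \<open>By contraposition. If the noise stays below \<delta>4 s n in standardised units, the
  sample correlation is at most s A, where A collects the noise \<delta>4, the population part c
  \<eta>, the centring part c K1^2 s, and the factors for n/(n - 1) and for the estimated variances.
  As A is near \<delta>4 + c \<eta> for small s, the quotient stays below \<delta>1 s, hence below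
  the threshold. The factors c convert absolute sizes into multiples of sqrt (\<sigma> a a *
  \<sigma> b b) \<ge> 1/c.\<close>

lemma kept_small_exceeds:
  fixes \<sigma> :: "nat \<Rightarrow> nat \<Rightarrow> real" and \<delta> :: real
  assumes ab: "a < p" "b < p" and k: "kept \<delta> a b" and small: "\<bar>\<sigma> a b\<bar> \<le> \<eta> * s"
    and rs: "\<bar>rs a\<bar> \<le> K1 * real n * s" "\<bar>rs b\<bar> \<le> K1 * real n * s"
    and close: "\<And>a. a < p \<Longrightarrow> \<bar>sigma_hat x a a - \<sigma> a a\<bar> \<le> K * s"
    and diag: "\<And>a. a < p \<Longrightarrow> inverse c \<le> \<sigma> a a" and c: "c > 0"
    and s: "0 < s" "s\<^sup>2 = ln (real p) / real n" and B: "0 \<le> B_hat x" "\<delta>1 \<le> \<delta> * sqrt (B_hat x)" and \<delta>1: "0 \<le> \<delta>1"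
    and Ks: "c * K * s < 1"
    and A: "A = (real n / (real n - 1)) * (\<delta>4 + c * \<eta> + c * K1\<^sup>2 * s) / (1 - c * K * s)" "s * A < 1" "A < \<delta>1 * (1 - (s * A)\<^sup>2)"
    and \<delta>4: "0 \<le> \<delta>4" and \<eta>: "0 \<le> \<eta>"
  shows "\<delta>4 * s * real n * sqrt (\<sigma> a a * \<sigma> b b) \<le> \<bar>S a b - real n * \<sigma> a b\<bar>"
proof (rule ccontr)
  assume "\<not> ?thesis"
  then have less: "\<bar>S a b - real n * \<sigma> a b\<bar> \<le> \<delta>4 * s * real n * sqrt (\<sigma> a a * \<sigma> b b)" by simp
  let ?n = "real n"
  have n: "?n \<ge> 2" using n2 by simp
  define q where "q = sqrt (\<sigma> a a * \<sigma> b b)"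
  have ic: "inverse c > 0" using c by simp
  have q: "inverse c \<le> q"
  proof -
    have "inverse c * inverse c \<le> \<sigma> a a * \<sigma> b b" using diag ab ic by (intro mult_mono) (auto intro: order_trans[OF less_imp_le[OF ic]])
    then show ?thesis unfolding q_def using ic by (intro real_le_rsqrt) (simp add: power2_eq_square)
  qed
  have q0: "q > 0" using q ic by linarith
  have cq: "1 \<le> c * q" using mult_left_mono[OF q, of c] c by simp
  have K1: "0 \<le> K1 * ?n * s" using rs(1) by (rule order_trans[OF abs_ge_zero])
  have low: "(1 - c * K * s) * \<sigma> a a \<le> sigma_hat x a a" if "a < p" for a
  proof -
    have "0 \<le> K * s" using close[OF that] by (rule order_trans[OF abs_ge_zero])
    then have "K * s * 1 \<le> K * s * (c * \<sigma> a a)"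
      using diag[OF that] c mult_left_mono[OF diag[OF that], of c] by (intro mult_left_mono) auto
    then show ?thesis using close[OF that] by (simp add: abs_le_iff algebra_simps)
  qed
  have sd: "0 < \<sigma> a a" if "a < p" for a using diag[OF that] ic by linarith
  have den: "(1 - c * K * s) * q \<le> sqrt (sigma_hat x a a * sigma_hat x b b)"
  proof -
    have "((1 - c * K * s) * \<sigma> a a) * ((1 - c * K * s) * \<sigma> b b) \<le> sigma_hat x a a * sigma_hat x b b"
      using low[OF ab(1)] low[OF ab(2)] Ks sd[OF ab(1)] sd[OF ab(2)]
      by (intro mult_mono) (auto intro: order_trans[OF _ low[OF ab(1)]] simp: less_imp_le)
    moreover have "((1 - c * K * s) * q)\<^sup>2 = ((1 - c * K * s) * \<sigma> a a) * ((1 - c * K * s) * \<sigma> b b)"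
    proof -
      have q2: "q\<^sup>2 = \<sigma> a a * \<sigma> b b" using sd[OF ab(1)] sd[OF ab(2)] by (simp add: q_def)
      show ?thesis by (simp only: power_mult_distrib q2) (simp only: power2_eq_square mult_ac)
    qed
    ultimately show ?thesis by (intro real_le_rsqrt) simp
  qed
  have num: "\<bar>sigma_hat x a b\<bar> \<le> (?n / (?n - 1)) * (s * q * (\<delta>4 + c * \<eta> + c * K1\<^sup>2 * s))"
  proof -
    have "\<bar>rs a * rs b\<bar> \<le> (K1 * ?n * s) * (K1 * ?n * s)" unfolding abs_mult using rs K1 by (intro mult_mono) auto
    then have "\<bar>rs a * rs b / ?n\<bar> \<le> (K1 * ?n * s) * (K1 * ?n * s) / ?n"
      unfolding abs_divide abs_of_nat by (rule divide_right_mono) simp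
    also have "\<dots> = ?n * (K1\<^sup>2 * s * s * 1)" using n by (simp add: power2_eq_square)
    also have "\<dots> \<le> ?n * (K1\<^sup>2 * s * s * (c * q))" using s n cq by (intro mult_left_mono) auto
    finally have r: "\<bar>rs a * rs b / ?n\<bar> \<le> ?n * (K1\<^sup>2 * s * s * (c * q))" .
    have "?n * \<bar>\<sigma> a b\<bar> \<le> ?n * (\<eta> * s * 1)" using small n by (intro mult_left_mono) auto
    also have "\<dots> \<le> ?n * (\<eta> * s * (c * q))" using cq s n \<eta> by (intro mult_left_mono) auto
    finally have sm: "\<bar>?n * \<sigma> a b\<bar> \<le> ?n * (\<eta> * s * (c * q))" by (simp add: abs_mult)
    have "\<bar>S a b - rs a * rs b / ?n\<bar> \<le> \<delta>4 * s * ?n * q + ?n * (\<eta> * s * (c * q)) + ?n * (K1\<^sup>2 * s * s * (c * q))"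
      using less[folded q_def] sm r by linarith
    also have "\<dots> = ?n * (s * q * (\<delta>4 + c * \<eta> + c * K1\<^sup>2 * s))" by (simp add: algebra_simps)
    finally show ?thesis unfolding sigma_hat_eq[OF ab] abs_divide using n by (simp add: divide_right_mono)
  qed
  have D: "0 < (1 - c * K * s) * q" using Ks q0 by simp
  have rho: "\<bar>rho_hat x a b\<bar> \<le> s * A"
  proof -
    have "\<bar>rho_hat x a b\<bar> = \<bar>sigma_hat x a b\<bar> / sqrt (sigma_hat x a a * sigma_hat x b b)"
    proof -
      have "0 < sqrt (sigma_hat x a a * sigma_hat x b b)" using D den by linarith
      then show ?thesis unfolding rho_hat_def abs_divide by (simp only: abs_of_pos)
    qed
    also have "\<dots> \<le> (?n / (?n - 1)) * (s * q * (\<delta>4 + c * \<eta> + c * K1\<^sup>2 * s)) / ((1 - c * K * s) * q)"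
      by (rule frac_le) (use num D den n s q0 c \<eta> \<delta>4 in auto)
    also have "\<dots> = s * A" unfolding A(1) using q0 by simp
    finally show ?thesis .
  qed
  have r2: "(rho_hat x a b)\<^sup>2 \<le> (s * A)\<^sup>2" using rho by (metis abs_ge_zero power2_abs power_mono)
  have sA: "0 \<le> s * A" using rho by (rule order_trans[OF abs_ge_zero])
  have sA1: "(s * A)\<^sup>2 < 1" using A(2) sA by (simp add: power_less_one_iff abs_square_less_1)
  have "\<delta>1 * s \<le> \<delta> * sqrt (B_hat x) * s" using B s by (intro mult_right_mono) auto
  also have "\<dots> = \<delta> * sqrt (B_hat x * s\<^sup>2)" using s(1) by (simp add: real_sqrt_mult)
  also have "\<dots> \<le> \<bar>rho_hat x a b\<bar> / (1 - (rho_hat x a b)\<^sup>2)" using k s(2) by (simp add: kept_def)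
  also have "\<dots> \<le> s * A / (1 - (s * A)\<^sup>2)"
    using rho r2 sA1 sA by (intro frac_le) auto
  finally have "\<delta>1 * s * (1 - (s * A)\<^sup>2) \<le> s * A" using sA1 by (simp add: pos_le_divide_eq)
  then have "s * (\<delta>1 * (1 - (s * A)\<^sup>2)) \<le> s * A" by (simp add: mult_ac)
  then have "\<delta>1 * (1 - (s * A)\<^sup>2) \<le> A" using s by simp
  then show False using A(3) by simp
qed

end

section \<open>The Gaussian model of the data: row statistics and the good event\<close>

locale normal_model = gaussian_columns +
  fixes \<sigma> u :: "nat \<Rightarrow> nat \<Rightarrow> real" and X :: "'a \<Rightarrow> real mat" and \<mu> :: "nat \<Rightarrow> real" and c :: real
  assumes whitening: "whitening p \<sigma> u d" and c1: "c \<ge> 1"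
    and d_bounds: "\<And>m. m < p \<Longrightarrow> inverse c \<le> d m \<and> d m \<le> c"
    and dims: "n \<ge> 2" "p \<ge> 1"
    and X_carrier: "\<And>\<omega>. \<omega> \<in> space M \<Longrightarrow> X \<omega> \<in> carrier_mat p n"
    and X_entry: "\<And>\<omega> a i. \<omega> \<in> space M \<Longrightarrow> a < p \<Longrightarrow> i < n \<Longrightarrow>
      X \<omega> $$ (a, i) = \<mu> a + (\<Sum>m<p. sqrt (d m) * u m a * G (m, i) \<omega>)"
begin

definition Z :: "'a \<Rightarrow> nat \<Rightarrow> nat \<Rightarrow> real" where
  "Z \<omega> a i = (\<Sum>m<p. sqrt (d m) * u m a * G (m, i) \<omega>)"

abbreviation Sz :: "'a \<Rightarrow> nat \<Rightarrow> nat \<Rightarrow> real" where "Sz \<omega> a b \<equiv> (\<Sum>i<n. Z \<omega> a i * Z \<omega> b i)"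
abbreviation rz :: "'a \<Rightarrow> nat \<Rightarrow> real" where "rz \<omega> a \<equiv> (\<Sum>i<n. Z \<omega> a i)"

lemma centred_data_X: "\<omega> \<in> space M \<Longrightarrow> centred_data p n (X \<omega>) \<mu> (Z \<omega>)"
  by unfold_locales (use X_carrier X_entry dims in \<open>auto simp: Z_def\<close>)

lemma d_pos: "m < p \<Longrightarrow> d m > 0"
  using d_bounds[of m] c1 by (auto intro: less_le_trans[of 0 "inverse c"])

lemma d_abs: "m < p \<Longrightarrow> \<bar>d m\<bar> \<le> c"
  using d_bounds[of m] d_pos[of m] by simp

lemma c_pos: "c > 0" using c1 by simp

lemma gram_Z: "(\<Sum>a<p. Z \<omega> a i * Z \<omega> a j) = gram p d (Gs \<omega>) i j"
  by (rule whitening_gram[OF whitening d_pos]) (auto simp: Z_def)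

lemma u_unit: "a < p \<Longrightarrow> (\<Sum>m<p. (u m a)\<^sup>2) = 1"
  using orthonormal_complete[of p u a a] whitening by (simp add: whitening_def power2_eq_square)

lemma u_orth: "a < p \<Longrightarrow> b < p \<Longrightarrow> a \<noteq> b \<Longrightarrow> (\<Sum>m<p. u m a * u m b) = 0"
  using orthonormal_complete[of p u a b] whitening by (simp add: whitening_def)

lemma sigma_eq: "a < p \<Longrightarrow> b < p \<Longrightarrow> \<sigma> a b = (\<Sum>m<p. d m * u m a * u m b)"
  using whitening by (simp add: whitening_def)

lemma quadratic_form_lower:
  "inverse c * (\<Sum>m<p. (f m)\<^sup>2) \<le> (\<Sum>m<p. d m * (f m)\<^sup>2)"
  unfolding sum_distrib_left using d_bounds by (intro sum_mono mult_right_mono) auto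

lemma sigma_diag:
  assumes a: "a < p" shows "inverse c \<le> \<sigma> a a" "\<sigma> a a \<le> c"
proof -
  have eq: "\<sigma> a a = (\<Sum>m<p. d m * (u m a)\<^sup>2)" using sigma_eq[OF a a] by (simp add: power2_eq_square mult.assoc)
  show "inverse c \<le> \<sigma> a a" using quadratic_form_lower[of "\<lambda>m. u m a"] u_unit[OF a] by (simp add: eq)
  have "(\<Sum>m<p. d m * (u m a)\<^sup>2) \<le> (\<Sum>m<p. c * (u m a)\<^sup>2)" using d_bounds by (intro sum_mono mult_right_mono) auto
  then show "\<sigma> a a \<le> c" using u_unit[OF a] by (simp add: eq sum_distrib_left[symmetric])
qed

lemma sigma_diag_pos: "a < p \<Longrightarrow> 0 < \<sigma> a a"
  using sigma_diag(1)[of a] c_pos by (meson inverse_positive_iff_positive less_le_trans)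

text \<open>The coefficient vectors of the standardised rows (\<open>Z_alpha\<close>): they have
  unit length, and their inner products are the population correlations.\<close>

definition \<alpha> :: "nat \<Rightarrow> nat \<Rightarrow> real" where "\<alpha> a m = sqrt (d m) * u m a / sqrt (\<sigma> a a)"

definition r :: "nat \<Rightarrow> nat \<Rightarrow> real" where "r a b = \<sigma> a b / sqrt (\<sigma> a a * \<sigma> b b)"

lemma alpha_inner: assumes "a < p" "b < p" shows "(\<Sum>m<p. \<alpha> a m * \<alpha> b m) = r a b"
proof -
  have "(\<Sum>m<p. \<alpha> a m * \<alpha> b m) = (\<Sum>m<p. d m * u m a * u m b / (sqrt (\<sigma> a a) * sqrt (\<sigma> b b)))"
  proof (rule sum.cong[OF refl])
    fix m assume "m \<in> {..<p}"
    then have "sqrt (d m) * sqrt (d m) = d m" using d_pos[of m] by simp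
    then have "sqrt (d m) * u m a * (sqrt (d m) * u m b) = d m * u m a * u m b" by (metis mult.assoc mult.left_commute)
    then show "\<alpha> a m * \<alpha> b m = d m * u m a * u m b / (sqrt (\<sigma> a a) * sqrt (\<sigma> b b))"
      by (simp add: \<alpha>_def)
  qed
  then show ?thesis using sigma_eq[OF assms] by (simp add: r_def sum_divide_distrib[symmetric] real_sqrt_mult)
qed

lemma r_diag: "a < p \<Longrightarrow> r a a = 1"
  using sigma_diag_pos[of a] by (simp add: r_def real_sqrt_mult)

lemma alpha_unit: "a < p \<Longrightarrow> (\<Sum>m<p. (\<alpha> a m)\<^sup>2) = 1"
  using alpha_inner[of a a] by (simp add: power2_eq_square r_diag)

text \<open>Take the sum and the difference of the two eigenvector coordinate rows, divided by their
  standard deviations. The form with weights d takes the value 2(1 + e r) there, and the least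
  eigenvalue bounds it below by (1/c)(1/\<sigma> a a + 1/\<sigma> b b) \<ge> 2/c^2. Correlations
  thus stay away from 1 uniformly in n, which also survives estimation.\<close>

lemma r_bound:
  assumes ab: "a < p" "b < p" "a \<noteq> b"
  shows "\<bar>r a b\<bar> \<le> 1 - inverse (c\<^sup>2)"
proof -
  have key: "inverse (c\<^sup>2) \<le> 1 + e * r a b" if e: "e = 1 \<or> e = -1" for e :: real
  proof -
    have e2: "e\<^sup>2 = 1" using e by auto
    define f where "f m = u m a / sqrt (\<sigma> a a) + e * (u m b / sqrt (\<sigma> b b))" for m
    have "(\<Sum>m<p. (f m)\<^sup>2) = (\<Sum>m<p. (u m a)\<^sup>2 / \<sigma> a a + (u m b)\<^sup>2 / \<sigma> b b + (2 * e / (sqrt (\<sigma> a a) * sqrt (\<sigma> b b))) * (u m a * u m b))"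
    proof (rule sum.cong[OF refl])
      fix m
      have "(f m)\<^sup>2 = (u m a / sqrt (\<sigma> a a))\<^sup>2 + e\<^sup>2 * (u m b / sqrt (\<sigma> b b))\<^sup>2 + 2 * e * (u m a / sqrt (\<sigma> a a)) * (u m b / sqrt (\<sigma> b b))"
        by (simp add: f_def power2_eq_square algebra_simps)
      then show "(f m)\<^sup>2 = (u m a)\<^sup>2 / \<sigma> a a + (u m b)\<^sup>2 / \<sigma> b b + (2 * e / (sqrt (\<sigma> a a) * sqrt (\<sigma> b b))) * (u m a * u m b)"
        using sigma_diag_pos[OF ab(1)] sigma_diag_pos[OF ab(2)] e2 by (simp add: power_divide)
    qed
    also have "\<dots> = 1 / \<sigma> a a + 1 / \<sigma> b b"
      by (simp add: sum.distrib sum_divide_distrib[symmetric] sum_distrib_left[symmetric] u_unit ab u_orth)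
    finally have F: "(\<Sum>m<p. (f m)\<^sup>2) = 1 / \<sigma> a a + 1 / \<sigma> b b" .
    have "(\<Sum>m<p. d m * (f m)\<^sup>2) = (\<Sum>m<p. (\<alpha> a m + e * \<alpha> b m)\<^sup>2)"
    proof (rule sum.cong[OF refl])
      fix m assume "m \<in> {..<p}"
      then have "d m = (sqrt (d m))\<^sup>2" using d_pos[of m] by simp
      then have "d m * (f m)\<^sup>2 = (sqrt (d m) * f m)\<^sup>2" by (simp add: power_mult_distrib)
      then show "d m * (f m)\<^sup>2 = (\<alpha> a m + e * \<alpha> b m)\<^sup>2" by (simp add: f_def \<alpha>_def algebra_simps)
    qed
    also have "\<dots> = (\<Sum>m<p. (\<alpha> a m)\<^sup>2 + e\<^sup>2 * (\<alpha> b m)\<^sup>2 + 2 * e * (\<alpha> a m * \<alpha> b m))"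
      by (intro sum.cong refl) (simp add: power2_eq_square algebra_simps)
    also have "\<dots> = 1 + e\<^sup>2 + 2 * e * r a b"
      by (simp add: sum.distrib sum_distrib_left[symmetric] alpha_unit alpha_inner ab)
    finally have D: "(\<Sum>m<p. d m * (f m)\<^sup>2) = 2 * (1 + e * r a b)" using e2 by simp
    have inv: "inverse c \<le> 1 / \<sigma> a a" if "a < p" for a
      using sigma_diag(2)[OF that] sigma_diag_pos[OF that] by (simp add: inverse_eq_divide frac_le)
    have "inverse c * (inverse c + inverse c) \<le> inverse c * (1 / \<sigma> a a + 1 / \<sigma> b b)"
      using inv ab c_pos by (intro mult_left_mono add_mono) auto
    also have "\<dots> \<le> 2 * (1 + e * r a b)" using quadratic_form_lower[of f] unfolding F D .
    finally show ?thesis by (simp add: power2_eq_square)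
  qed
  show ?thesis using key[of 1] key[of "-1"] by (simp add: abs_le_iff)
qed

lemma r_less_1: assumes ab: "a < p" "b < p" "a \<noteq> b" shows "\<bar>r a b\<bar> < 1"
proof -
  have "inverse (c\<^sup>2) > 0" using c_pos by simp
  then show ?thesis using r_bound[OF ab] by linarith
qed

lemma Z_alpha: "a < p \<Longrightarrow> Z \<omega> a i = sqrt (\<sigma> a a) * (\<Sum>m<p. \<alpha> a m * G (m, i) \<omega>)"
  using sigma_diag_pos[of a] by (simp add: Z_def \<alpha>_def sum_distrib_left)

lemma Z_measurable: "i < n \<Longrightarrow> (\<lambda>\<omega>. Z \<omega> a i) \<in> borel_measurable M"
  unfolding Z_def by (intro borel_measurable_sum borel_measurable_times borel_measurable_const G_measurable) auto

lemma Sz_measurable: "(\<lambda>\<omega>. Sz \<omega> a b) \<in> borel_measurable M"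
  by (intro borel_measurable_sum borel_measurable_times Z_measurable) auto

lemma rz_measurable: "(\<lambda>\<omega>. rz \<omega> a) \<in> borel_measurable M"
  by (intro borel_measurable_sum Z_measurable) auto

lemma Sz_event:
  assumes ab: "a < p" "b < p"
  shows "x * real n * sqrt (\<sigma> a a * \<sigma> b b) \<le> \<bar>Sz \<omega> a b - real n * \<sigma> a b\<bar> \<longleftrightarrow>
    x * real n \<le> \<bar>(\<Sum>i<n. (\<Sum>m<p. \<alpha> a m * G (m, i) \<omega>) * (\<Sum>m<p. \<alpha> b m * G (m, i) \<omega>)) - real n * r a b\<bar>"
proof -
  define q where "q = sqrt (\<sigma> a a * \<sigma> b b)"
  have q: "q > 0" using sigma_diag_pos ab by (simp add: q_def)
  have "Sz \<omega> a b = q * (\<Sum>i<n. (\<Sum>m<p. \<alpha> a m * G (m, i) \<omega>) * (\<Sum>m<p. \<alpha> b m * G (m, i) \<omega>))"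
    using ab by (simp add: Z_alpha q_def real_sqrt_mult sum_distrib_left mult_ac)
  moreover have "\<sigma> a b = q * r a b" using q by (simp add: r_def q_def[symmetric])
  ultimately have "Sz \<omega> a b - real n * \<sigma> a b = q * ((\<Sum>i<n. (\<Sum>m<p. \<alpha> a m * G (m, i) \<omega>) * (\<Sum>m<p. \<alpha> b m * G (m, i) \<omega>)) - real n * r a b)"
    by (simp add: right_diff_distrib mult_ac)
  then show ?thesis using q unfolding q_def[symmetric] by (simp add: abs_mult mult.commute[of _ q])
qed

lemma Sz_tail_sharp:
  assumes ab: "a < p" "b < p" "a \<noteq> b" and \<delta>: "0 < \<delta>" "\<delta> \<le> 1 / 4" and x: "0 \<le> x" "x \<le> \<delta>"
  shows "prob {\<omega>\<in>space M. x * real n * sqrt (\<sigma> a a * \<sigma> b b) \<le> \<bar>Sz \<omega> a b - real n * \<sigma> a b\<bar>}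
    \<le> 2 * exp (- real n * x\<^sup>2 / (2 * (1 + 4 * \<delta>) * (1 + (r a b)\<^sup>2)))"
  unfolding Sz_event[OF ab(1,2)]
  by (rule row_product_concentration[OF alpha_unit alpha_unit alpha_inner r_less_1 _ \<delta> x]) (use ab dims in auto)

text \<open>Uniform version for all pairs, the diagonal included: \<delta> = 1/4 and r^2 \<le> 1
  bring the denominator to at most 8.\<close>

lemma Sz_tail:
  assumes ab: "a < p" "b < p" and x: "0 \<le> x" "x \<le> 1 / 4"
  shows "prob {\<omega>\<in>space M. x * real n * sqrt (\<sigma> a a * \<sigma> b b) \<le> \<bar>Sz \<omega> a b - real n * \<sigma> a b\<bar>} \<le> 2 * exp (- real n * x\<^sup>2 / 8)"
proof (cases "a = b")
  case True
  show ?thesis unfolding Sz_event[OF ab] using row_square_concentration[OF alpha_unit[OF ab(1)], of x] x dims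
    by (simp add: True r_diag[OF ab(2)] power2_eq_square)
next
  case False
  have "prob {\<omega>\<in>space M. x * real n * sqrt (\<sigma> a a * \<sigma> b b) \<le> \<bar>Sz \<omega> a b - real n * \<sigma> a b\<bar>}
    \<le> 2 * exp (- real n * x\<^sup>2 / (2 * (1 + 4 * (1 / 4)) * (1 + (r a b)\<^sup>2)))"
    by (rule Sz_tail_sharp[OF ab False]) (use x in auto)
  also have "\<dots> \<le> 2 * exp (- real n * x\<^sup>2 / 8)"
  proof -
    have "(r a b)\<^sup>2 \<le> 1" using r_less_1[OF ab False] by (simp add: abs_square_le_1)
    then have "real n * x\<^sup>2 / 8 \<le> real n * x\<^sup>2 / (4 * (1 + (r a b)\<^sup>2))"
      by (intro divide_left_mono) (auto simp: add_pos_nonneg)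
    then show ?thesis by simp
  qed
  finally show ?thesis .
qed

lemma rz_tail:
  assumes a: "a < p"
  shows "prob {\<omega>\<in>space M. x * sqrt (real n) * sqrt (\<sigma> a a) < \<bar>rz \<omega> a\<bar>} = normal_tail x"
proof -
  have q: "sqrt (\<sigma> a a) > 0" using sigma_diag_pos[OF a] by simp
  have "rz \<omega> a = sqrt (\<sigma> a a) * (\<Sum>i<n. \<Sum>m<p. \<alpha> a m * G (m, i) \<omega>)" for \<omega>
    by (simp add: Z_alpha[OF a] sum_distrib_left)
  then have "x * sqrt (real n) * sqrt (\<sigma> a a) < \<bar>rz \<omega> a\<bar> \<longleftrightarrow> x * sqrt (real n) < \<bar>\<Sum>i<n. \<Sum>m<p. \<alpha> a m * G (m, i) \<omega>\<bar>" for \<omega>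
    using q by (simp add: abs_mult mult.commute[of _ "sqrt (\<sigma> a a)"])
  then show ?thesis using row_sum_tail[OF alpha_unit[OF a], of x] dims by simp
qed

text \<open>On the good event, and with suitable parameters, this set contains all tiny entries that
  survive thresholding. It refers to known means, so Gaussian tails apply to it directly.\<close>

definition exceed :: "real \<Rightarrow> real \<Rightarrow> 'a \<Rightarrow> (nat \<times> nat) set" where
  "exceed h y \<omega> = {(a, b). a < p \<and> b < p \<and> a \<noteq> b \<and> \<bar>\<sigma> a b\<bar> \<le> h \<and>
     y * real n * sqrt (\<sigma> a a * \<sigma> b b) \<le> \<bar>Sz \<omega> a b - real n * \<sigma> a b\<bar>}"

text \<open>First moment and Markov: the count is a sum of at most p^2 indicators of mean at most q.
  Bounding the count instead of excluding every exceedance tolerates q of order 1/p.\<close>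

lemma exceed_count:
  assumes m: "m > 0" and q: "\<And>a b. a < p \<Longrightarrow> b < p \<Longrightarrow> a \<noteq> b \<Longrightarrow> \<bar>\<sigma> a b\<bar> \<le> h \<Longrightarrow>
      prob {\<omega>\<in>space M. y * real n * sqrt (\<sigma> a a * \<sigma> b b) \<le> \<bar>Sz \<omega> a b - real n * \<sigma> a b\<bar>} \<le> q" and q0: "0 \<le> q"
  shows "{\<omega>\<in>space M. m < real (card (exceed h y \<omega>))} \<in> events"
    and "prob {\<omega>\<in>space M. m < real (card (exceed h y \<omega>))} \<le> real p ^ 2 * q / m"
proof -
  define A where "A = {(a, b). a < p \<and> b < p \<and> a \<noteq> b \<and> \<bar>\<sigma> a b\<bar> \<le> h}"
  have finA: "finite A" "A \<subseteq> {..<p} \<times> {..<p}" by (rule finite_subset[of _ "{..<p} \<times> {..<p}"]) (auto simp: A_def)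
  define F where "F = (\<lambda>(a, b). {\<omega>\<in>space M. y * real n * sqrt (\<sigma> a a * \<sigma> b b) \<le> \<bar>Sz \<omega> a b - real n * \<sigma> a b\<bar>})"
  have F: "F e \<in> events" for e
    unfolding F_def by (cases e) (use Sz_measurable in \<open>auto intro!: borel_measurable_le\<close>)
  have Fq: "prob (F e) \<le> q" if "e \<in> A" for e using that q by (cases e) (auto simp: F_def A_def)
  have eq: "real (card (exceed h y \<omega>)) = (\<Sum>e\<in>A. indicator (F e) \<omega>)" if "\<omega> \<in> space M" for \<omega>
  proof -
    have "exceed h y \<omega> = {e\<in>A. \<omega> \<in> F e}" using that by (auto simp: exceed_def A_def F_def)
    then show ?thesis using finA by (simp add: indicator_def sum.If_cases Int_def conj_commute)
  qed
  have im: "(\<lambda>\<omega>. \<Sum>e\<in>A. indicator (F e) \<omega> :: real) \<in> borel_measurable M" using F by (intro borel_measurable_sum) auto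
  have set: "{\<omega>\<in>space M. m < real (card (exceed h y \<omega>))} = {\<omega>\<in>space M. m < (\<Sum>e\<in>A. indicator (F e) \<omega>)}"
    using eq by auto
  show "{\<omega>\<in>space M. m < real (card (exceed h y \<omega>))} \<in> events" unfolding set using im by measurable
  have int: "integrable M (\<lambda>\<omega>. \<Sum>e\<in>A. indicator (F e) \<omega> :: real)"
    using F by (intro Bochner_Integration.integrable_sum integrable_const_bound[of _ 1]) auto
  have "prob {\<omega>\<in>space M. m < (\<Sum>e\<in>A. indicator (F e) \<omega>)} \<le> prob {\<omega>\<in>space M. m \<le> (\<Sum>e\<in>A. indicator (F e) \<omega>)}"
    using im by (intro finite_measure_mono) auto
  also have "\<dots> \<le> expectation (\<lambda>\<omega>. \<Sum>e\<in>A. indicator (F e) \<omega>) / m"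
    by (rule integral_Markov_inequality_measure[OF int, of "{}", simplified]) (use m in \<open>auto intro!: sum_nonneg\<close>)
  also have "expectation (\<lambda>\<omega>. \<Sum>e\<in>A. indicator (F e) \<omega>) = (\<Sum>e\<in>A. prob (F e))"
    using F by (subst Bochner_Integration.integral_sum) (auto intro!: integrable_const_bound[of _ 1])
  also have "\<dots> \<le> (\<Sum>e\<in>A. q)" by (intro sum_mono Fq)
  also have "\<dots> \<le> real p ^ 2 * q"
  proof -
    have "card A \<le> card ({..<p} \<times> {..<p})" using finA by (intro card_mono) auto
    then have "real (card A) \<le> real p ^ 2" by (simp add: power2_eq_square flip: of_nat_mult)
    then show ?thesis using q0 by (simp add: mult_right_mono)
  qed
  finally show "prob {\<omega>\<in>space M. m < real (card (exceed h y \<omega>))} \<le> real p ^ 2 * q / m"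
    unfolding set using m by (simp add: divide_right_mono)
qed

abbreviation trd :: real where "trd \<equiv> (\<Sum>m<p. d m)"
abbreviation tau2 :: real where "tau2 \<equiv> (\<Sum>m<p. (d m)\<^sup>2)"

text \<open>The clauses serve, in order: the traces, the conditional variances, the centring errors,
  the off-diagonal part of \<open>B_hat\<close>, the sample covariances, the sample means, and the
  thresholding count. With s^2 = ln p / n, the constants 5 and 3 give exponents 25/8 ln p and 9/2 ln
  p, enough for union bounds over p^2 pairs and p rows.\<close>

definition good :: "real \<Rightarrow> real \<Rightarrow> real \<Rightarrow> real \<Rightarrow> real \<Rightarrow> real \<Rightarrow> real \<Rightarrow> 'a set" where
  "good \<nu> \<rho> \<eta> s h y m = {\<omega>\<in>space M.
     (\<forall>i<n. \<bar>gram p d (Gs \<omega>) i i - trd\<bar> \<le> \<nu>) \<and>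
     (\<forall>i<n. \<bar>cond_var p d (Gs \<omega>) i - tau2\<bar> \<le> \<nu>) \<and>
     (\<forall>i<n. \<bar>\<Sum>l\<in>{..<n} - {i}. gram p d (Gs \<omega>) i l\<bar> \<le> \<rho>) \<and>
     (\<forall>i<n. \<bar>(\<Sum>l\<in>{..<n} - {i}. (gram p d (Gs \<omega>) i l)\<^sup>2) - real (n - 1) * cond_var p d (Gs \<omega>) i\<bar>
        \<le> \<eta> * real (n - 1) * cond_var p d (Gs \<omega>) i) \<and>
     (\<forall>a<p. \<forall>b<p. \<bar>Sz \<omega> a b - real n * \<sigma> a b\<bar> \<le> 5 * s * real n * sqrt (\<sigma> a a * \<sigma> b b)) \<and>
     (\<forall>a<p. \<bar>rz \<omega> a\<bar> \<le> 3 * (s * sqrt (real n)) * sqrt (real n) * sqrt (\<sigma> a a)) \<and>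
     real (card (exceed h y \<omega>)) \<le> m}"

lemma good_complement:
  assumes \<nu>: "0 \<le> \<nu>" "2 * \<nu> \<le> real p" "\<nu> \<le> tau2" and \<rho>: "0 \<le> \<rho>" and \<eta>: "0 < \<eta>" "\<eta> \<le> 1 / 2"
    and s: "0 \<le> s" "20 * s \<le> 1" and m: "m > 0" and y: "0 \<le> y" and \<delta>: "0 < \<delta>" "\<delta> \<le> 1 / 4" "y \<le> \<delta>"
    and h: "\<And>a b. a < p \<Longrightarrow> b < p \<Longrightarrow> a \<noteq> b \<Longrightarrow> \<bar>\<sigma> a b\<bar> \<le> h \<Longrightarrow> (1 + 4 * \<delta>) * (1 + (r a b)\<^sup>2) \<le> L" and L: "L > 0"
  shows "good \<nu> \<rho> \<eta> s h y m \<in> events"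
    and "1 - prob (good \<nu> \<rho> \<eta> s h y m) \<le>
      real n * (6 * exp (- \<nu>\<^sup>2 / (8 * real p * c ^ 4)) + normal_tail (\<rho> / sqrt (2 * real n * tau2)) + 2 * exp (- \<eta>\<^sup>2 * real (n - 1) / 8))
      + (real p)\<^sup>2 * (2 * exp (- real n * (5 * s)\<^sup>2 / 8)) + real p * normal_tail (3 * (s * sqrt (real n)))
      + (real p)\<^sup>2 * (2 * exp (- real n * y\<^sup>2 / (2 * L))) / m"
proof -
  define B1 where "B1 i = {\<omega>\<in>space M. \<nu> < \<bar>gram p d (Gs \<omega>) i i - trd\<bar>}" for i
  define B2 where "B2 i = {\<omega>\<in>space M. \<nu> < \<bar>cond_var p d (Gs \<omega>) i - tau2\<bar>}" for i
  define B3 where "B3 i = {\<omega>\<in>space M. \<rho> < \<bar>\<Sum>l\<in>{..<n} - {i}. gram p d (Gs \<omega>) i l\<bar>}" for i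
  define B4 where "B4 i = {\<omega>\<in>space M. \<eta> * real (n - 1) * cond_var p d (Gs \<omega>) i <
    \<bar>(\<Sum>l\<in>{..<n} - {i}. (gram p d (Gs \<omega>) i l)\<^sup>2) - real (n - 1) * cond_var p d (Gs \<omega>) i\<bar>}" for i
  define B5 where "B5 = (\<lambda>(a, b). {\<omega>\<in>space M. 5 * s * real n * sqrt (\<sigma> a a * \<sigma> b b) < \<bar>Sz \<omega> a b - real n * \<sigma> a b\<bar>})"
  define B6 where "B6 a = {\<omega>\<in>space M. 3 * (s * sqrt (real n)) * sqrt (real n) * sqrt (\<sigma> a a) < \<bar>rz \<omega> a\<bar>}" for a
  define B7 where "B7 = {\<omega>\<in>space M. m < real (card (exceed h y \<omega>))}"
  let ?q = "2 * exp (- real n * y\<^sup>2 / (2 * L))"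
  have q: "prob {\<omega>\<in>space M. y * real n * sqrt (\<sigma> a a * \<sigma> b b) \<le> \<bar>Sz \<omega> a b - real n * \<sigma> a b\<bar>} \<le> ?q"
    if ab: "a < p" "b < p" "a \<noteq> b" "\<bar>\<sigma> a b\<bar> \<le> h" for a b
  proof -
    have "prob {\<omega>\<in>space M. y * real n * sqrt (\<sigma> a a * \<sigma> b b) \<le> \<bar>Sz \<omega> a b - real n * \<sigma> a b\<bar>}
      \<le> 2 * exp (- real n * y\<^sup>2 / (2 * (1 + 4 * \<delta>) * (1 + (r a b)\<^sup>2)))"
      by (rule Sz_tail_sharp[OF ab(1-3) \<delta>(1,2) y \<delta>(3)])
    also have "\<dots> \<le> ?q"
    proof -
      define D where "D = (1 + 4 * \<delta>) * (1 + (r a b)\<^sup>2)"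
      have D: "0 < D" "D \<le> L" using \<delta> h[OF ab] unfolding D_def by (auto intro!: mult_pos_pos add_pos_nonneg)
      then have "real n * y\<^sup>2 / (2 * L) \<le> real n * y\<^sup>2 / (2 * D)" by (intro divide_left_mono) auto
      moreover have "2 * (1 + 4 * \<delta>) * (1 + (r a b)\<^sup>2) = 2 * D" by (simp add: D_def mult.assoc)
      ultimately show ?thesis by simp
    qed
    finally show ?thesis .
  qed
  have m1: "B1 i \<in> events" "B2 i \<in> events" "B3 i \<in> events" "B4 i \<in> events" if i: "i < n" for i
  proof -
    have g: "(\<lambda>\<omega>. gram p d (Gs \<omega>) i l) \<in> borel_measurable M" if "l < n" for l by (rule gram_measurable[OF i that])
    have s1: "(\<lambda>\<omega>. \<Sum>l\<in>{..<n} - {i}. gram p d (Gs \<omega>) i l) \<in> borel_measurable M"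
      "(\<lambda>\<omega>. \<Sum>l\<in>{..<n} - {i}. (gram p d (Gs \<omega>) i l)\<^sup>2) \<in> borel_measurable M"
      by (intro borel_measurable_sum borel_measurable_power g; auto)+
    note [measurable] = g[OF i] s1 cond_var_measurable[OF i]
    show "B1 i \<in> events" "B2 i \<in> events" "B3 i \<in> events" "B4 i \<in> events"
      unfolding B1_def B2_def B3_def B4_def by measurable
  qed
  note [measurable] = Sz_measurable rz_measurable
  have m5: "B5 e \<in> events" for e unfolding B5_def by (cases e) simp
  have m6: "B6 a \<in> events" for a unfolding B6_def by measurable
  have m7: "B7 \<in> events" unfolding B7_def by (rule exceed_count(1)[OF m q]) auto
  have compl: "good \<nu> \<rho> \<eta> s h y m = space M - ((\<Union>i<n. B1 i \<union> B2 i \<union> B3 i \<union> B4 i) \<union> (\<Union>e\<in>{..<p}\<times>{..<p}. B5 e) \<union> (\<Union>a<p. B6 a) \<union> B7)"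
  proof (intro equalityI subsetI)
    fix \<omega> assume g: "\<omega> \<in> good \<nu> \<rho> \<eta> s h y m"
    then have "\<omega> \<notin> B1 i \<union> B2 i \<union> B3 i \<union> B4 i" if "i < n" for i
      using that by (simp add: good_def B1_def B2_def B3_def B4_def not_less)
    moreover have "\<omega> \<notin> B5 e" if "e \<in> {..<p} \<times> {..<p}" for e
      using g that by (cases e) (simp add: good_def B5_def not_less)
    moreover have "\<omega> \<notin> B6 a" if "a < p" for a using g that by (simp add: good_def B6_def not_less)
    moreover have "\<omega> \<notin> B7" "\<omega> \<in> space M" using g by (simp_all add: good_def B7_def not_less)
    ultimately show "\<omega> \<in> space M - ((\<Union>i<n. B1 i \<union> B2 i \<union> B3 i \<union> B4 i) \<union> (\<Union>e\<in>{..<p}\<times>{..<p}. B5 e) \<union> (\<Union>a<p. B6 a) \<union> B7)"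
      by blast
  next
    fix \<omega> assume g: "\<omega> \<in> space M - ((\<Union>i<n. B1 i \<union> B2 i \<union> B3 i \<union> B4 i) \<union> (\<Union>e\<in>{..<p}\<times>{..<p}. B5 e) \<union> (\<Union>a<p. B6 a) \<union> B7)"
    then have w: "\<omega> \<in> space M" by blast
    have "\<omega> \<notin> B1 i \<and> \<omega> \<notin> B2 i \<and> \<omega> \<notin> B3 i \<and> \<omega> \<notin> B4 i" if "i < n" for i using g that by blast
    moreover have "\<omega> \<notin> B5 (a, b)" if "a < p" "b < p" for a b using g that by blast
    moreover have "\<omega> \<notin> B6 a" if "a < p" for a using g that by blast
    moreover have "\<omega> \<notin> B7" using g by blast
    ultimately show "\<omega> \<in> good \<nu> \<rho> \<eta> s h y m"
      using w by (simp add: good_def B1_def B2_def B3_def B4_def B5_def B6_def B7_def not_less)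
  qed
  let ?B = "(\<Union>i<n. B1 i \<union> B2 i \<union> B3 i \<union> B4 i) \<union> (\<Union>e\<in>{..<p}\<times>{..<p}. B5 e) \<union> (\<Union>a<p. B6 a) \<union> B7"
  have mA: "B1 i \<union> B2 i \<union> B3 i \<union> B4 i \<in> events" if "i < n" for i using m1[OF that] by auto
  have mU: "(\<Union>i<n. B1 i \<union> B2 i \<union> B3 i \<union> B4 i) \<in> events" "(\<Union>e\<in>{..<p}\<times>{..<p}. B5 e) \<in> events" "(\<Union>a<p. B6 a) \<in> events"
    using mA m5 m6 by (auto intro!: sets.finite_UN)
  have mB: "?B \<in> events" using mU m7 by auto
  show "good \<nu> \<rho> \<eta> s h y m \<in> events" unfolding compl using mB by auto
  let ?e = "2 * exp (- \<nu>\<^sup>2 / (8 * real p * c ^ 4))"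
  have c24: "c\<^sup>2 \<le> c ^ 4" "1 \<le> c\<^sup>2" using c1 power_increasing[of 2 4 c] power_increasing[of 0 2 c] by auto
  have p0: "p > 0" using dims by simp
  have P2: "prob {\<omega>\<in>space M. \<nu> \<le> \<bar>cond_var p d (Gs \<omega>) i - tau2\<bar>} \<le> ?e" if i: "i < n" for i
  proof (rule cond_var_concentration[OF i c_pos d_abs p0 \<nu>(1)])
    have "real p * 1 \<le> real p * c\<^sup>2" using c24 by (intro mult_left_mono) auto
    then show "2 * \<nu> \<le> real p * c\<^sup>2" using \<nu>(2) by simp
  qed
  have b1: "prob (B1 i) \<le> ?e" if i: "i < n" for i
  proof -
    have "prob (B1 i) \<le> prob {\<omega>\<in>space M. \<nu> \<le> \<bar>gram p d (Gs \<omega>) i i - trd\<bar>}"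
      unfolding B1_def using gram_measurable[OF i i] by (intro finite_measure_mono) auto
    also have "\<dots> \<le> 2 * exp (- \<nu>\<^sup>2 / (8 * real p * c\<^sup>2))"
    proof (rule gram_diagonal_concentration[OF i c_pos d_abs p0 \<nu>(1)])
      have "real p * 1 \<le> real p * c" using c1 by (intro mult_left_mono) auto
      then show "2 * \<nu> \<le> real p * c" using \<nu>(2) by simp
    qed
    also have "\<dots> \<le> ?e" using c24 c_pos p0 by (auto intro!: divide_left_mono mult_left_mono mult_pos_pos)
    finally show ?thesis .
  qed
  have b2: "prob (B2 i) \<le> ?e" if i: "i < n" for i
  proof -
    have "prob (B2 i) \<le> prob {\<omega>\<in>space M. \<nu> \<le> \<bar>cond_var p d (Gs \<omega>) i - tau2\<bar>}"
      unfolding B2_def using cond_var_measurable[OF i] by (intro finite_measure_mono) auto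
    then show ?thesis using P2[OF i] by simp
  qed
  have tau0: "tau2 > 0" 
  proof (rule sum_pos)
    show "0 < (d i)\<^sup>2" if "i \<in> {..<p}" for i using d_pos[of i] that by simp
  qed (use p0 in auto)
  have b3: "prob (B3 i) \<le> normal_tail (\<rho> / sqrt (2 * real n * tau2)) + ?e" if i: "i < n" for i
  proof -
    have "prob (B3 i) \<le> normal_tail (\<rho> / sqrt (2 * real n * tau2)) + prob {\<omega>\<in>space M. tau2 \<le> \<bar>cond_var p d (Gs \<omega>) i - tau2\<bar>}"
      unfolding B3_def by (rule gram_row_sum_tail[OF i \<rho> tau0 dims(1)])
    also have "prob {\<omega>\<in>space M. tau2 \<le> \<bar>cond_var p d (Gs \<omega>) i - tau2\<bar>} \<le> prob {\<omega>\<in>space M. \<nu> \<le> \<bar>cond_var p d (Gs \<omega>) i - tau2\<bar>}"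
      using cond_var_measurable[OF i] \<nu>(3) by (intro finite_measure_mono) auto
    finally show ?thesis using P2[OF i] by simp
  qed
  define E4 where "E4 = 2 * exp (- \<eta>\<^sup>2 * real (n - 1) / 8)"
  have b4: "prob (B4 i) \<le> E4" if i: "i < n" for i
    unfolding B4_def E4_def by (rule gram_row_squares[OF i \<eta> dims(1)])
  \<comment> \<open>\<open>?e\<close> occurs three times: for the diagonal, for the conditional
    variance, and for the exceptional event within the row-sum bound. This gives the 6 in the
    statement.\<close>
  have bA: "prob (B1 i \<union> B2 i \<union> B3 i \<union> B4 i) \<le> 3 * ?e + normal_tail (\<rho> / sqrt (2 * real n * tau2)) + E4"
    if i: "i < n" for i
  proof -
    have "prob (B1 i \<union> B2 i \<union> B3 i \<union> B4 i) \<le> prob (B1 i) + prob (B2 i) + prob (B3 i) + prob (B4 i)"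
      using m1[OF i] by (intro order_trans[OF measure_Un_le] add_right_mono) auto
    then show ?thesis using b1[OF i] b2[OF i] b3[OF i] b4[OF i] by linarith
  qed
  have b5: "prob (B5 e) \<le> 2 * exp (- real n * (5 * s)\<^sup>2 / 8)" if "e \<in> {..<p} \<times> {..<p}" for e
  proof (cases e)
    case (Pair a b)
    have "prob (B5 e) \<le> prob {\<omega>\<in>space M. 5 * s * real n * sqrt (\<sigma> a a * \<sigma> b b) \<le> \<bar>Sz \<omega> a b - real n * \<sigma> a b\<bar>}"
      unfolding B5_def Pair by (intro finite_measure_mono) auto
    also have "\<dots> \<le> 2 * exp (- real n * (5 * s)\<^sup>2 / 8)" using Sz_tail[of a b "5 * s"] that Pair s by simp
    finally show ?thesis .
  qed
  have b6: "prob (B6 a) \<le> normal_tail (3 * (s * sqrt (real n)))" if "a < p" for a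
    unfolding B6_def using rz_tail[OF that, of "3 * (s * sqrt (real n))"] by simp
  have b7: "prob B7 \<le> (real p)\<^sup>2 * ?q / m" unfolding B7_def by (rule exceed_count(2)[OF m q]) auto
  have "1 - prob (good \<nu> \<rho> \<eta> s h y m) = prob ?B" unfolding compl using mB by (simp add: prob_compl)
  also have "\<dots> \<le> prob (\<Union>i<n. B1 i \<union> B2 i \<union> B3 i \<union> B4 i) + prob (\<Union>e\<in>{..<p}\<times>{..<p}. B5 e) + prob (\<Union>a<p. B6 a) + prob B7"
    using mU m7 by (intro order_trans[OF measure_Un_le] add_right_mono) auto
  also have "prob (\<Union>i<n. B1 i \<union> B2 i \<union> B3 i \<union> B4 i) \<le> (\<Sum>i<n. prob (B1 i \<union> B2 i \<union> B3 i \<union> B4 i))"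
    using mA by (intro measure_UNION_le) auto
  also have "\<dots> \<le> (\<Sum>i<n. 3 * ?e + normal_tail (\<rho> / sqrt (2 * real n * tau2)) + E4)"
    by (intro sum_mono bA) auto
  also have "prob (\<Union>e\<in>{..<p}\<times>{..<p}. B5 e) \<le> (\<Sum>e\<in>{..<p}\<times>{..<p}. prob (B5 e))"
    using m5 by (intro measure_UNION_le) auto
  also have "\<dots> \<le> (\<Sum>e\<in>{..<p}\<times>{..<p}. 2 * exp (- real n * (5 * s)\<^sup>2 / 8))" by (intro sum_mono b5)
  also have "prob (\<Union>a<p. B6 a) \<le> (\<Sum>a<p. prob (B6 a))" using m6 by (intro measure_UNION_le) auto
  also have "\<dots> \<le> (\<Sum>a<p. normal_tail (3 * (s * sqrt (real n))))" by (intro sum_mono b6) auto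
  also note b7
  finally show "1 - prob (good \<nu> \<rho> \<eta> s h y m) \<le>
      real n * (6 * exp (- \<nu>\<^sup>2 / (8 * real p * c ^ 4)) + normal_tail (\<rho> / sqrt (2 * real n * tau2)) + 2 * exp (- \<eta>\<^sup>2 * real (n - 1) / 8))
      + (real p)\<^sup>2 * (2 * exp (- real n * (5 * s)\<^sup>2 / 8)) + real p * normal_tail (3 * (s * sqrt (real n)))
      + (real p)\<^sup>2 * ?q / m"
    unfolding E4_def[symmetric] by (simp add: power2_eq_square)
qed

end

section \<open>From relative errors of the ingredients to the test statistic\<close>

lemma mult_le_abs_bound:
  fixes a b :: real assumes "\<bar>a - b\<bar> \<le> k * b" shows "(1 - k) * b \<le> a" "a \<le> (1 + k) * b"
  using assms by (auto simp: abs_le_iff algebra_simps)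

context centred_data
begin

text \<open>Here \<open>tr\<close> and \<open>t0\<close> stand for the trace and the squared
  Frobenius norm of the covariance matrix. Traces and diagonal entries have relative error \<kappa>,
  \<open>N2\<close> has relative error f, and \<open>T_entry\<close> has error e in units of sqrt
  t0; so the statistic is comparable with W^2 / t0 in both directions.\<close>

lemma stat_bounds:
  assumes tr: "tr > 0" and t0: "t0 > 0" and \<kappa>: "0 \<le> \<kappa>" "\<kappa> \<le> 1 / 2" and f: "0 \<le> f" "f \<le> 1 / 2" and e: "0 \<le> e"
    and P: "\<And>i. i < n \<Longrightarrow> \<bar>P i i - tr\<bar> \<le> \<kappa> * tr" and trS: "\<bar>trS - tr\<bar> \<le> \<kappa> * tr"
    and N: "\<bar>N2 \<delta> - t0\<bar> \<le> f * t0" and ij: "i < n" "j < n"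
    and T: "\<bar>real p * T_entry x i j - W i j\<bar> \<le> e * sqrt t0"
  shows "0 \<le> y \<Longrightarrow> \<bar>W i j\<bar> \<le> y * sqrt t0 \<Longrightarrow> stat \<delta> i j \<le> ((1 + \<kappa>) / (1 - \<kappa>))\<^sup>2 / (1 - f) * (y + e)\<^sup>2"
    and "0 \<le> v \<Longrightarrow> stat \<delta> i j \<le> v \<Longrightarrow> \<bar>W i j\<bar> \<le> (e + sqrt (v * (1 + f)) * ((1 + \<kappa>) / (1 - \<kappa>))) * sqrt t0"
proof -
  define k1 where "k1 = 1 - \<kappa>"
  define k2 where "k2 = 1 + \<kappa>"
  have k: "k1 > 0" "k2 > 0" using \<kappa> by (auto simp: k1_def k2_def)
  have Pb: "k1 * tr \<le> P i i" "P i i \<le> k2 * tr" if "i < n" for i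
    using mult_le_abs_bound[OF P[OF that]] by (auto simp: k1_def k2_def)
  have Sb: "k1 * tr \<le> trS" "trS \<le> k2 * tr" using mult_le_abs_bound[OF trS] by (auto simp: k1_def k2_def)
  have Nb: "(1 - f) * t0 \<le> N2 \<delta>" "N2 \<delta> \<le> (1 + f) * t0" using mult_le_abs_bound[OF N] by auto
  have ktr: "k1 * tr > 0" using k tr by simp
  have f1: "1 - f > 0" "1 + f > 0" using f by auto
  have Np: "N2 \<delta> > 0" using Nb(1) mult_pos_pos[OF f1(1) t0] by linarith
  have PP: "(k1 * tr)\<^sup>2 \<le> P i i * P j j" "P i i * P j j \<le> (k2 * tr)\<^sup>2"
    unfolding power2_eq_square using Pb[OF ij(1)] Pb[OF ij(2)] ktr by (auto intro!: mult_mono)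
  have PPp: "P i i * P j j > 0" using PP(1) ktr by (meson less_le_trans zero_less_power)
  have S2: "(k1 * tr)\<^sup>2 \<le> trS\<^sup>2" "trS\<^sup>2 \<le> (k2 * tr)\<^sup>2"
    using Sb ktr by (auto intro!: power_mono)
  define A where "A = real p * T_entry x i j"
  have st: "stat \<delta> i j = trS\<^sup>2 * A\<^sup>2 / (N2 \<delta> * (P i i * P j j))"
    by (simp add: stat_def A_def)
  show "stat \<delta> i j \<le> ((1 + \<kappa>) / (1 - \<kappa>))\<^sup>2 / (1 - f) * (y + e)\<^sup>2"
    if y: "0 \<le> y" "\<bar>W i j\<bar> \<le> y * sqrt t0"
  proof -
    have "\<bar>A\<bar> \<le> (y + e) * sqrt t0" using T y(2) unfolding A_def by (simp add: algebra_simps abs_le_iff)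
    then have "\<bar>A\<bar>\<^sup>2 \<le> ((y + e) * sqrt t0)\<^sup>2" by (intro power_mono) auto
    then have A2: "A\<^sup>2 \<le> (y + e)\<^sup>2 * t0" using t0 by (simp add: power_mult_distrib)
    have "stat \<delta> i j \<le> ((k2 * tr)\<^sup>2 * ((y + e)\<^sup>2 * t0)) / ((1 - f) * t0 * (k1 * tr)\<^sup>2)"
      unfolding st
    proof (rule frac_le)
      show "trS\<^sup>2 * A\<^sup>2 \<le> (k2 * tr)\<^sup>2 * ((y + e)\<^sup>2 * t0)" using S2 A2 by (intro mult_mono) auto
      show "(1 - f) * t0 * (k1 * tr)\<^sup>2 \<le> N2 \<delta> * (P i i * P j j)" using Nb PP f1 t0 Np by (intro mult_mono) auto
    qed (use f1 t0 ktr in \<open>auto intro!: mult_pos_pos\<close>)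
    also have "\<dots> = (k2 / k1)\<^sup>2 / (1 - f) * (y + e)\<^sup>2"
      using tr t0 k f1 by (simp add: power_mult_distrib power_divide)
    finally show ?thesis by (simp add: k1_def k2_def)
  qed
  show "\<bar>W i j\<bar> \<le> (e + sqrt (v * (1 + f)) * ((1 + \<kappa>) / (1 - \<kappa>))) * sqrt t0"
    if v: "0 \<le> v" "stat \<delta> i j \<le> v"
  proof -
    have "trS\<^sup>2 * A\<^sup>2 \<le> v * (N2 \<delta> * (P i i * P j j))"
      using v(2) Np PPp unfolding st by (simp add: pos_divide_le_eq)
    also have "\<dots> \<le> v * ((1 + f) * t0 * (k2 * tr)\<^sup>2)"
      using Nb PP v f1 t0 PPp by (intro mult_left_mono mult_mono) auto
    finally have "(k1 * tr)\<^sup>2 * A\<^sup>2 \<le> v * ((1 + f) * t0 * (k2 * tr)\<^sup>2)"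
      using mult_right_mono[OF S2(1), of "A\<^sup>2"] by simp
    then have "A\<^sup>2 \<le> v * ((1 + f) * t0 * (k2 * tr)\<^sup>2) / (k1 * tr)\<^sup>2"
      using ktr by (subst pos_le_divide_eq) (auto simp: mult.commute)
    also have "\<dots> = v * (1 + f) * (k2 / k1)\<^sup>2 * t0"
      using tr k by (simp add: power_mult_distrib power_divide)
    finally have "sqrt (A\<^sup>2) \<le> sqrt (v * (1 + f) * (k2 / k1)\<^sup>2 * t0)" by (rule real_sqrt_le_mono)
    then have "\<bar>A\<bar> \<le> sqrt (v * (1 + f)) * (k2 / k1) * sqrt t0"
      using k by (simp add: real_sqrt_mult real_sqrt_divide)
    then have "\<bar>W i j\<bar> \<le> e * sqrt t0 + sqrt (v * (1 + f)) * (k2 / k1) * sqrt t0" using T unfolding A_def by linarith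
    then show ?thesis by (simp add: k1_def k2_def distrib_right)
  qed
qed

end

section \<open>Deterministic consequences of the good event\<close>

context normal_model
begin

lemma trd_bounds: "real p / c \<le> trd" "trd \<le> c * real p"
proof -
  have "(\<Sum>m<p. inverse c) \<le> trd" using d_bounds by (intro sum_mono) auto
  then show "real p / c \<le> trd" by (simp add: divide_inverse)
  have "trd \<le> (\<Sum>m<p. c)" using d_bounds by (intro sum_mono) auto
  then show "trd \<le> c * real p" by (simp add: mult.commute)
qed

text \<open>The third bound is Cauchy-Schwarz. It keeps \<open>B_hat\<close> from falling
  asymptotically below 1, whatever the ratio of n to p.\<close>

lemma tau2_bounds: "real p / c\<^sup>2 \<le> tau2" "tau2 \<le> c\<^sup>2 * real p" "trd\<^sup>2 / real p \<le> tau2"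
proof -
  have "(\<Sum>m<p. (inverse c)\<^sup>2) \<le> tau2" using d_bounds c_pos by (intro sum_mono power_mono) auto
  then show "real p / c\<^sup>2 \<le> tau2" by (simp add: divide_inverse power_inverse)
  have "tau2 \<le> (\<Sum>m<p. c\<^sup>2)" using d_bounds d_pos by (intro sum_mono power_mono) (auto simp: less_imp_le)
  then show "tau2 \<le> c\<^sup>2 * real p" by (simp add: mult.commute)
  have "trd\<^sup>2 \<le> tau2 * (\<Sum>m<p. 1\<^sup>2)" using Cauchy_Schwarz_ineq_sum[of d "\<lambda>_. 1" "{..<p}"] by simp
  then show "trd\<^sup>2 / real p \<le> tau2" using dims by (simp add: divide_le_eq)
qed

lemma trd_pos: "trd > 0"
  using trd_bounds(1) c_pos dims by (intro less_le_trans[OF _ trd_bounds(1)]) auto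

lemma tau2_pos: "tau2 > 0"
  using c_pos dims by (intro less_le_trans[OF _ tau2_bounds(1)]) auto

lemma tau2_trd: "tau2 / trd\<^sup>2 \<le> c ^ 4 / real p" "1 / real p \<le> tau2 / trd\<^sup>2"
proof -
  have "tau2 / trd\<^sup>2 \<le> (c\<^sup>2 * real p) / (real p / c)\<^sup>2"
    using tau2_bounds trd_bounds c_pos dims tau2_pos by (intro frac_le power_mono) auto
  also have "\<dots> = c ^ 4 / real p" using c_pos dims by (simp add: power_divide power2_eq_square power4_eq_xxxx)
  finally show "tau2 / trd\<^sup>2 \<le> c ^ 4 / real p" .
  have "0 < trd\<^sup>2" using trd_pos by simp
  then show "1 / real p \<le> tau2 / trd\<^sup>2" using tau2_bounds(3) dims trd_pos by (simp add: field_simps)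
qed

lemma sigma_abs_le: assumes "a < p" "b < p" shows "\<bar>\<sigma> a b\<bar> \<le> c"
proof -
  have q: "sqrt (\<sigma> a a * \<sigma> b b) \<le> c"
  proof (rule real_le_lsqrt)
    show "\<sigma> a a * \<sigma> b b \<le> c\<^sup>2" unfolding power2_eq_square
      using sigma_diag[OF assms(1)] sigma_diag[OF assms(2)] sigma_diag_pos assms c_pos by (intro mult_mono) (auto simp: less_imp_le)
  qed (use c_pos in auto)
  have q0: "sqrt (\<sigma> a a * \<sigma> b b) > 0" using sigma_diag_pos assms by simp
  have "\<bar>r a b\<bar> \<le> 1" using r_less_1[OF assms] r_diag[OF assms(1)] by (cases "a = b") auto
  then have "\<bar>r a b\<bar> * sqrt (\<sigma> a a * \<sigma> b b) \<le> 1 * c" using q q0 by (intro mult_mono) auto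
  moreover have "\<bar>\<sigma> a b\<bar> = \<bar>r a b\<bar> * sqrt (\<sigma> a a * \<sigma> b b)"
    using sigma_diag_pos[OF assms(1)] sigma_diag_pos[OF assms(2)] by (simp add: r_def abs_divide)
  ultimately show ?thesis by simp
qed

context
  fixes \<nu> \<rho> \<eta> s h y m c' \<kappa> e :: real and \<omega>
  assumes good: "\<omega> \<in> good \<nu> \<rho> \<eta> s h y m" and c': "c' > 0" "c' * real n < real p"
    and \<eta>: "0 < \<eta>" "\<eta> \<le> 1 / 2" and \<kappa>: "0 \<le> \<kappa>" "\<kappa> \<le> 1 / 2" and e: "0 \<le> e"
    and k1: "4 * \<nu> + 3 * (trd + \<rho>) / real n \<le> \<kappa> * trd" and k2: "\<nu> + 2 * \<rho> / real n \<le> \<kappa> * trd"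
    and k4: "\<nu> \<le> \<kappa> * tau2" and ke: "(4 * \<nu> + 3 * \<rho>) / real n \<le> e * sqrt tau2"
begin

lemma good_in_space: "\<omega> \<in> space M" using good by (simp add: good_def)

lemma good_W: "centred_data.W p (Z \<omega>) i j = gram p d (Gs \<omega>) i j"
  by (simp add: centred_data.W_def[OF centred_data_X[OF good_in_space]] gram_Z)

lemma good_R: "centred_data.R p n (Z \<omega>) i = (\<Sum>l\<in>{..<n} - {i}. gram p d (Gs \<omega>) i l)"
  by (simp add: centred_data.R_def[OF centred_data_X[OF good_in_space]] good_W)

lemma good_diag_off:
  "i < n \<Longrightarrow> \<bar>centred_data.W p (Z \<omega>) i i - trd\<bar> \<le> \<nu>" "i < n \<Longrightarrow> \<bar>centred_data.R p n (Z \<omega>) i\<bar> \<le> \<rho>"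
  unfolding good_W good_R using good by (auto simp: good_def)

lemma good_P: "i < n \<Longrightarrow> \<bar>centred_data.P p (X \<omega>) i i - trd\<bar> \<le> \<kappa> * trd"
  using centred_data.P_diag_close[OF centred_data_X[OF good_in_space] good_diag_off, of i] trd_pos k1 by (simp add: less_imp_le)

lemma good_trS: "\<bar>centred_data.trS p (X \<omega>) - trd\<bar> \<le> \<kappa> * trd"
  using centred_data.trS_close[OF centred_data_X[OF good_in_space] good_diag_off] k2 by simp

lemma good_T: "i < n \<Longrightarrow> j < n \<Longrightarrow> \<bar>real p * T_entry (X \<omega>) i j - gram p d (Gs \<omega>) i j\<bar> \<le> e * sqrt tau2"
  using centred_data.T_entry_close[OF centred_data_X[OF good_in_space] good_diag_off, of i j] ke by (simp add: good_W)

text \<open>The off-diagonal entries contribute about (n - 1) tau2 / trd^2 \<ge> (n - 1)/p, which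
  offsets the subtracted (n - 1)^2/(n p) up to a factor close to 1; the remainder is controlled by
  n/p < 1/c'. The diagonal then leaves a value near 1. The number \<open>w\<close> accounts for the
  differences between \<open>P\<close> and the inner products.\<close>

lemma good_B_hat:
  defines "w \<equiv> 2 * e\<^sup>2 * c ^ 4 / c' + 8 / real n"
  shows "(1 - \<kappa>)\<^sup>2 / (1 + \<kappa>)\<^sup>2 - (1 - (1 - \<eta>)\<^sup>2 * (1 - \<kappa>) / (1 + \<kappa>)\<^sup>2) / c' - w / \<eta> \<le> B_hat (X \<omega>)"
    and "B_hat (X \<omega>) \<le> 9 + 32 * c ^ 4 / c' + 8 * w"
proof -
  interpret cd: centred_data p n "X \<omega>" \<mu> "Z \<omega>" by (rule centred_data_X[OF good_in_space])
  let ?n = "real n"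
  have n: "?n \<ge> 2" "?n > 0" using dims by auto
  have p: "real p > 0" using dims by simp
  \<comment> \<open>\<open>P\<close> differs from \<open>p * T_entry\<close> by the correction
    trS/n, at most 2 trd / n here; the other summand is the error of \<open>T_entry\<close>.\<close>
  define \<theta> where "\<theta> = e * sqrt tau2 + 2 * trd / ?n"
  have kt: "\<kappa> * trd \<le> 1 / 2 * trd" using \<kappa> trd_pos by (intro mult_right_mono) auto
  have \<theta>: "\<bar>cd.P i j - cd.W i j\<bar> \<le> \<theta>" if "i < n" "j < n" for i j
  proof -
    have "\<bar>cd.trS\<bar> \<le> 2 * trd"
      using good_trS[THEN abs_le_D1] good_trS[THEN abs_le_D2] kt trd_pos by (intro abs_leI) linarith+
    then have "\<bar>cd.trS / ?n\<bar> \<le> 2 * trd / ?n" unfolding abs_divide abs_of_nat by (rule divide_right_mono) simp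
    then show ?thesis using good_T[OF that] cd.T_entry_eq[of i j] unfolding \<theta>_def good_W by linarith
  qed
  have nc: "?n / real p \<le> 1 / c'" using c' p by (simp add: field_simps)
  have ntt: "?n * (tau2 / trd\<^sup>2) \<le> c ^ 4 / c'"
  proof -
    have "?n * (tau2 / trd\<^sup>2) \<le> ?n * (c ^ 4 / real p)" using tau2_trd by (intro mult_left_mono) auto
    also have "\<dots> = c ^ 4 * (?n / real p)" by simp
    also have "\<dots> \<le> c ^ 4 * (1 / c')" using nc c_pos by (intro mult_left_mono) auto
    finally show ?thesis by simp
  qed
  have w: "?n * \<theta>\<^sup>2 / trd\<^sup>2 \<le> w"
  proof -
    have "0 \<le> (e * sqrt tau2 - 2 * trd / ?n)\<^sup>2" by simp
    then have "\<theta>\<^sup>2 \<le> 2 * (e * sqrt tau2)\<^sup>2 + 2 * (2 * trd / ?n)\<^sup>2"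
      unfolding \<theta>_def power2_sum power2_diff by linarith
    also have "\<dots> = 2 * e\<^sup>2 * tau2 + 8 * trd\<^sup>2 / ?n\<^sup>2"
      using tau2_pos by (simp add: power_mult_distrib power_divide)
    finally have "?n * \<theta>\<^sup>2 / trd\<^sup>2 \<le> ?n * (2 * e\<^sup>2 * tau2 + 8 * trd\<^sup>2 / ?n\<^sup>2) / trd\<^sup>2"
      by (intro divide_right_mono mult_left_mono) auto
    also have "\<dots> = 2 * e\<^sup>2 * (?n * (tau2 / trd\<^sup>2)) + 8 / ?n"
      using trd_pos n by (simp add: field_simps power2_eq_square)
    also have "\<dots> \<le> 2 * e\<^sup>2 * (c ^ 4 / c') + 8 / ?n" using ntt by (intro add_right_mono mult_left_mono) auto
    finally show ?thesis by (simp add: w_def)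
  qed
  have V: "\<bar>cond_var p d (Gs \<omega>) i - tau2\<bar> \<le> \<kappa> * tau2" if "i < n" for i
    using good that k4 by (auto simp: good_def intro: order_trans)
  have SQ: "\<bar>(\<Sum>l\<in>{..<n} - {i}. (cd.W i l)\<^sup>2) - real (n - 1) * cond_var p d (Gs \<omega>) i\<bar> \<le> \<eta> * (real (n - 1) * cond_var p d (Gs \<omega>) i)"
    if "i < n" for i
    unfolding good_W using good that by (simp add: good_def mult.assoc)
  have nn: "real (n - 1) = ?n - 1" using n by (simp add: of_nat_diff)
  define lo where "lo = (1 - \<eta>) * ((?n - 1) * ((1 - \<kappa>) * tau2))"
  have lo: "lo \<le> (\<Sum>l\<in>{..<n} - {i}. (cd.W i l)\<^sup>2)" if i: "i < n" for i
  proof -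
    have "lo \<le> (1 - \<eta>) * ((?n - 1) * cond_var p d (Gs \<omega>) i)"
      unfolding lo_def using mult_le_abs_bound(1)[OF V[OF i]] \<eta> n by (intro mult_left_mono) auto
    also have "\<dots> \<le> (\<Sum>l\<in>{..<n} - {i}. (cd.W i l)\<^sup>2)" using mult_le_abs_bound(1)[OF SQ[OF i]] unfolding nn .
    finally show ?thesis .
  qed
  define hi where "hi = 4 * (?n * tau2)"
  have hi: "(\<Sum>l\<in>{..<n} - {i}. (cd.W i l)\<^sup>2) \<le> hi" if i: "i < n" for i
  proof -
    have v: "cond_var p d (Gs \<omega>) i \<le> 2 * tau2"
    proof -
      have "(1 + \<kappa>) * tau2 \<le> 2 * tau2" using \<kappa> tau2_pos by (intro mult_right_mono) auto
      then show ?thesis using mult_le_abs_bound(2)[OF V[OF i]] by linarith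
    qed
    have v0: "0 \<le> cond_var p d (Gs \<omega>) i" by (simp add: cond_var_def sum_nonneg)
    have "(\<Sum>l\<in>{..<n} - {i}. (cd.W i l)\<^sup>2) \<le> (1 + \<eta>) * ((?n - 1) * cond_var p d (Gs \<omega>) i)"
      using mult_le_abs_bound(2)[OF SQ[OF i]] unfolding nn .
    also have "\<dots> \<le> 2 * (?n * (2 * tau2))" using \<eta> n v v0 by (intro mult_mono) auto
    finally show ?thesis by (simp add: hi_def)
  qed
  have "B_hat (X \<omega>) \<le> 9 + (8 * hi + 8 * ?n * \<theta>\<^sup>2) / trd\<^sup>2"
    by (rule cd.B_hat_upper[OF trd_pos \<kappa> good_P good_trS \<theta> hi])
  also have "(8 * hi + 8 * ?n * \<theta>\<^sup>2) / trd\<^sup>2 = 32 * (?n * (tau2 / trd\<^sup>2)) + 8 * (?n * \<theta>\<^sup>2 / trd\<^sup>2)"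
    by (simp add: hi_def add_divide_distrib)
  finally show "B_hat (X \<omega>) \<le> 9 + 32 * c ^ 4 / c' + 8 * w" using ntt w by linarith
  define g where "g = (1 - \<eta>)\<^sup>2 * (1 - \<kappa>) / (1 + \<kappa>)\<^sup>2"
  have g: "0 \<le> g" "g \<le> 1"
  proof -
    have "(1 - \<eta>)\<^sup>2 * (1 - \<kappa>) \<le> 1 * 1" using \<eta> \<kappa> by (intro mult_mono) (auto simp: power_le_one)
    also have "\<dots> \<le> (1 + \<kappa>)\<^sup>2" using \<kappa> by simp
    finally show "g \<le> 1" using \<kappa> by (simp add: g_def divide_le_eq)
    show "0 \<le> g" using \<eta> \<kappa> by (simp add: g_def)
  qed
  have K2: "(1 + \<kappa>)\<^sup>2 \<ge> 1" using \<kappa> by simp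
  have low: "(1 - \<eta>) * lo / trd\<^sup>2 \<ge> (1 - \<eta>)\<^sup>2 * (1 - \<kappa>) * ((?n - 1) / real p)"
  proof -
    have "(1 - \<eta>)\<^sup>2 * (1 - \<kappa>) * ((?n - 1) * (1 / real p)) \<le> (1 - \<eta>)\<^sup>2 * (1 - \<kappa>) * ((?n - 1) * (tau2 / trd\<^sup>2))"
      using tau2_trd(2) \<kappa> n by (intro mult_left_mono) auto
    then show ?thesis by (simp add: lo_def power2_eq_square mult_ac)
  qed
  have "(1 - \<kappa>)\<^sup>2 / (1 + \<kappa>)\<^sup>2 - (1 - g) / c' - w / \<eta> \<le>
    ((1 - \<kappa>)\<^sup>2 + (1 - \<eta>)\<^sup>2 * (1 - \<kappa>) * ((?n - 1) / real p) - w / \<eta>) / (1 + \<kappa>)\<^sup>2 - (?n - 1) / real p"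
  proof -
    have w0: "0 \<le> w" using w by (rule order_trans[rotated]) auto
    have "w / \<eta> / (1 + \<kappa>)\<^sup>2 \<le> w / \<eta> / 1" using w0 \<eta> K2 by (intro divide_left_mono) auto
    moreover have "(1 - g) * ((?n - 1) / real p) \<le> (1 - g) * (1 / c')"
      using g nc p by (intro mult_left_mono order_trans[OF _ nc]) (auto intro: divide_right_mono)
    ultimately show ?thesis
      by (simp add: g_def add_divide_distrib diff_divide_distrib left_diff_distrib)
  qed
  also have "\<dots> \<le> ((1 - \<kappa>)\<^sup>2 + ((1 - \<eta>) * lo - ?n * \<theta>\<^sup>2 / \<eta>) / trd\<^sup>2) / (1 + \<kappa>)\<^sup>2 - (?n - 1)\<^sup>2 / (?n * real p)"
  proof (intro diff_mono divide_right_mono)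
    have "?n * \<theta>\<^sup>2 / \<eta> / trd\<^sup>2 \<le> w / \<eta>" using divide_right_mono[OF w, of \<eta>] \<eta> by (simp add: mult.commute)
    then show "(1 - \<kappa>)\<^sup>2 + (1 - \<eta>)\<^sup>2 * (1 - \<kappa>) * ((?n - 1) / real p) - w / \<eta> \<le> (1 - \<kappa>)\<^sup>2 + ((1 - \<eta>) * lo - ?n * \<theta>\<^sup>2 / \<eta>) / trd\<^sup>2"
      using low by (simp add: diff_divide_distrib)
    have "(?n - 1)\<^sup>2 / (?n * real p) = (?n - 1) / real p * ((?n - 1) / ?n)" by (simp add: power2_eq_square)
    also have "\<dots> \<le> (?n - 1) / real p * 1" using n by (intro mult_left_mono) auto
    finally show "(?n - 1)\<^sup>2 / (?n * real p) \<le> (?n - 1) / real p" by simp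
  qed simp
  also have "\<dots> \<le> B_hat (X \<omega>)"
    by (rule cd.B_hat_lower[OF trd_pos \<kappa> _ _ good_P good_trS \<theta> lo]) (use \<eta> in auto)
  finally show "(1 - \<kappa>)\<^sup>2 / (1 + \<kappa>)\<^sup>2 - (1 - (1 - \<eta>)\<^sup>2 * (1 - \<kappa>) / (1 + \<kappa>)\<^sup>2) / c' - w / \<eta> \<le> B_hat (X \<omega>)"
    by (simp add: g_def)
qed

lemma good_sigma_close:
  assumes s: "0 < s" "s \<le> 1" "1 / real n \<le> s\<^sup>2" and ab: "a < p" "b < p"
  shows "\<bar>sigma_hat (X \<omega>) a b - \<sigma> a b\<bar> \<le> 30 * c * s"
    and "\<bar>centred_data.rs n (Z \<omega>) a\<bar> \<le> 3 * sqrt c * real n * s"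
proof -
  interpret cd: centred_data p n "X \<omega>" \<mu> "Z \<omega>" by (rule centred_data_X[OF good_in_space])
  have rs: "\<bar>cd.rs a\<bar> \<le> 3 * sqrt c * real n * s" if a: "a < p" for a
  proof -
    have "\<bar>cd.rs a\<bar> \<le> 3 * (s * sqrt (real n)) * sqrt (real n) * sqrt (\<sigma> a a)"
      using good a by (simp add: good_def cd.rs_def)
    also have "\<dots> = 3 * s * real n * sqrt (\<sigma> a a)" by simp
    also have "\<dots> \<le> 3 * s * real n * sqrt c" using sigma_diag(2)[OF a] s by (intro mult_left_mono) auto
    finally show ?thesis by (simp add: mult_ac)
  qed
  then show "\<bar>cd.rs a\<bar> \<le> 3 * sqrt c * real n * s" using ab by simp
  have "sqrt (\<sigma> a a * \<sigma> b b) \<le> c"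
  proof (rule real_le_lsqrt)
    show "\<sigma> a a * \<sigma> b b \<le> c\<^sup>2" unfolding power2_eq_square
      using sigma_diag[OF ab(1)] sigma_diag[OF ab(2)] sigma_diag_pos ab c_pos by (intro mult_mono) (auto simp: less_imp_le)
  qed (use c_pos in auto)
  then have "5 * s * real n * sqrt (\<sigma> a a * \<sigma> b b) \<le> 5 * s * real n * c" using s by (intro mult_left_mono) auto
  then have S: "\<bar>cd.S a b - real n * \<sigma> a b\<bar> \<le> (5 * c) * real n * s"
  proof -
    have "\<bar>cd.S a b - real n * \<sigma> a b\<bar> \<le> 5 * s * real n * sqrt (\<sigma> a a * \<sigma> b b)"
      unfolding cd.S_def using good ab by (simp add: good_def)
    also note \<open>5 * s * real n * sqrt (\<sigma> a a * \<sigma> b b) \<le> 5 * s * real n * c\<close>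
    finally show ?thesis by (simp only: mult_ac)
  qed
  have "\<bar>sigma_hat (X \<omega>) a b - \<sigma> a b\<bar> \<le> (2 * (5 * c) + 2 * c + 2 * (3 * sqrt c)\<^sup>2) * s"
    by (rule cd.sigma_hat_close[where \<sigma> = \<sigma>, OF ab S rs[OF ab(1)] rs[OF ab(2)] sigma_abs_le[OF ab] s])
  also have "2 * (5 * c) + 2 * c + 2 * (3 * sqrt c)\<^sup>2 = 30 * c" using c_pos by (simp add: power_mult_distrib)
  finally show "\<bar>sigma_hat (X \<omega>) a b - \<sigma> a b\<bar> \<le> 30 * c * s" .
qed

lemma good_thresholded_norm:
  fixes \<eta>6 \<delta>0 \<delta>1 \<delta>4 \<tau> C b2 A :: real
  assumes s: "0 < s" "s \<le> 1" "1 / real n \<le> s\<^sup>2" "s\<^sup>2 = ln (real p) / real n" and \<delta>0: "\<delta>0 > 0" and \<delta>1: "0 \<le> \<delta>1" and \<delta>4: "0 \<le> \<delta>4"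
    and \<eta>6: "\<eta>6 > 0" and h: "h = \<eta>6 * s" and y: "y = \<delta>4 * s"
    and B: "0 \<le> B_hat (X \<omega>)" "\<delta>1 \<le> \<delta>0 * sqrt (B_hat (X \<omega>))" "B_hat (X \<omega>) \<le> b2"
    and Ks: "60 * c ^ 4 * s < 1"
    and A: "A = (real n / (real n - 1)) * (\<delta>4 + c * \<eta>6 + c * (3 * sqrt c)\<^sup>2 * s) / (1 - c * (30 * c) * s)" "s * A < 1" "A < \<delta>1 * (1 - (s * A)\<^sup>2)"
    and \<tau>: "1 \<le> \<tau>" "\<tau> < 2" and C: "\<And>a. a < p \<Longrightarrow> (\<Sum>b<p. \<bar>\<sigma> a b\<bar> powr \<tau>) \<le> C"
  defines "K \<equiv> 30 * c"
  shows "\<bar>centred_data.N2 p (X \<omega>) \<delta>0 - tau2\<bar> \<le>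
    real p * (K * (K + 2 * c) + ((K * (K / \<eta>6 + 2)) * \<eta>6 powr (1 - \<tau>) + (\<delta>0 * sqrt b2 * (c + K) + K) powr (2 - \<tau>)) * C) * s powr (2 - \<tau>)
      + m * (K * (K + 2 * \<eta>6) * s\<^sup>2)"
proof -
  interpret cd: centred_data p n "X \<omega>" \<mu> "Z \<omega>" by (rule centred_data_X[OF good_in_space])
  note close = good_sigma_close(1)[OF s(1-3)]
  note rs = good_sigma_close(2)[OF s(1-3)]
  have c2: "c\<^sup>2 \<le> c ^ 4" "1 \<le> c\<^sup>2" using c1 power_increasing[of 2 4 c] power_increasing[of 0 2 c] by auto
  have Ks2: "60 * c\<^sup>2 * s < 1"
  proof -
    have "60 * c\<^sup>2 * s \<le> 60 * c ^ 4 * s" using c2 s by (intro mult_right_mono mult_left_mono) auto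
    then show ?thesis using Ks by linarith
  qed
  have Ks1: "30 * c * s < inverse c"
  proof -
    have "c * (30 * c * s) < 1" using Ks2 s by (simp add: power2_eq_square mult_ac)
    then show ?thesis using c_pos by (simp add: field_simps)
  qed
  have pos: "0 < sigma_hat (X \<omega>) a a" if a: "a < p" for a
    using close[OF a a] sigma_diag(1)[OF a] Ks1 by (simp add: abs_le_iff)
  \<comment> \<open>Population correlations are at most 1 - c^(-2). Estimation changes the numerator
    and both variances by a relative amount k = 30 c^2 s at most, and 2 k < c^(-2) by the assumption
    on \<open>60 * c ^ 4 * s\<close>. So sample correlations stay below 1 and the quotient in the
    thresholding rule is never a division by 0.\<close>
  have rho: "(sigma_hat (X \<omega>) a b)\<^sup>2 < sigma_hat (X \<omega>) a a * sigma_hat (X \<omega>) b b"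
    if ab: "a < p" "b < p" "a \<noteq> b" for a b
  proof -
    define q where "q = sqrt (\<sigma> a a * \<sigma> b b)"
    define k where "k = 30 * c\<^sup>2 * s"
    have ic: "inverse c > 0" using c_pos by simp
    have q: "inverse c \<le> q"
    proof -
      have "inverse c * inverse c \<le> \<sigma> a a * \<sigma> b b"
        using sigma_diag(1) ab ic by (intro mult_mono) (auto intro: order_trans[OF less_imp_le[OF ic]])
      then show ?thesis unfolding q_def using ic by (intro real_le_rsqrt) (simp add: power2_eq_square)
    qed
    have q0: "q > 0" using q ic by linarith
    have cq: "1 \<le> c * q" using mult_left_mono[OF q, of c] c_pos by simp
    have "30 * c * s * 1 \<le> 30 * c * s * (c * q)" using cq s c_pos by (intro mult_left_mono) auto
    then have kq: "30 * c * s \<le> k * q" by (simp add: k_def power2_eq_square mult_ac)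
    have "\<bar>\<sigma> a b\<bar> = \<bar>r a b\<bar> * q" using q0 by (simp add: r_def q_def[symmetric] abs_divide)
    also have "\<dots> \<le> (1 - inverse (c\<^sup>2)) * q" using r_bound[OF ab] q0 by (intro mult_right_mono) auto
    finally have sb: "\<bar>\<sigma> a b\<bar> \<le> (1 - inverse (c\<^sup>2)) * q" .
    have "\<bar>sigma_hat (X \<omega>) a b\<bar> \<le> \<bar>\<sigma> a b\<bar> + 30 * c * s" using close[OF ab(1,2)] by linarith
    then have up: "\<bar>sigma_hat (X \<omega>) a b\<bar> \<le> (1 - inverse (c\<^sup>2) + k) * q"
      using sb kq unfolding distrib_right by linarith
    have low: "(1 - k) * \<sigma> a a \<le> sigma_hat (X \<omega>) a a" if "a < p" for a
    proof -
      have "30 * c * s * 1 \<le> 30 * c * s * (c * \<sigma> a a)"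
        using mult_left_mono[OF sigma_diag(1)[OF that], of c] c_pos s by (intro mult_left_mono) auto
      then show ?thesis using close[OF that that] by (simp add: k_def power2_eq_square abs_le_iff algebra_simps)
    qed
    have k1: "0 < 1 - k" "0 \<le> k"
    proof -
      show "0 < 1 - k" using Ks2 unfolding k_def by linarith
      show "0 \<le> k" using s by (simp add: k_def)
    qed
    have lt: "1 - inverse (c\<^sup>2) + k < 1 - k"
    proof -
      have "2 * k * c\<^sup>2 = 60 * c ^ 4 * s" by (simp add: k_def power2_eq_square power4_eq_xxxx)
      then have "2 * k * c\<^sup>2 < 1" using Ks by linarith
      then have "2 * k < inverse (c\<^sup>2)" using c_pos by (simp add: field_simps)
      then show ?thesis by simp
    qed
    have g0: "0 \<le> 1 - inverse (c\<^sup>2)" using c2 by (simp add: inverse_le_1_iff)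
    have "(sigma_hat (X \<omega>) a b)\<^sup>2 \<le> ((1 - inverse (c\<^sup>2) + k) * q)\<^sup>2"
      using power_mono[OF up abs_ge_zero, of 2] by simp
    also have "\<dots> < ((1 - k) * q)\<^sup>2" using lt g0 k1 q0 by (intro power_strict_mono mult_strict_right_mono) auto
    also have "\<dots> = ((1 - k) * \<sigma> a a) * ((1 - k) * \<sigma> b b)"
    proof -
      have q2: "q\<^sup>2 = \<sigma> a a * \<sigma> b b" using sigma_diag_pos[OF ab(1)] sigma_diag_pos[OF ab(2)] by (simp add: q_def)
      show ?thesis by (simp only: power_mult_distrib q2) (simp only: power2_eq_square mult_ac)
    qed
    also have "\<dots> \<le> sigma_hat (X \<omega>) a a * sigma_hat (X \<omega>) b b"
      using low ab k1 sigma_diag_pos pos by (intro mult_mono) (auto simp: less_imp_le)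
    finally show ?thesis .
  qed
  \<comment> \<open>Every tiny entry that is kept shows a large deviation of the sample covariance,
    so the count in the good event applies.\<close>
  have sub: "{(a, b). a < p \<and> b < p \<and> a \<noteq> b \<and> \<bar>\<sigma> a b\<bar> \<le> \<eta>6 * s \<and> cd.kept \<delta>0 a b} \<subseteq> exceed h y \<omega>"
  proof safe
    fix a b assume ab: "a < p" "b < p" "a \<noteq> b" "\<bar>\<sigma> a b\<bar> \<le> \<eta>6 * s" "cd.kept \<delta>0 a b"
    have Kc: "c * (30 * c) * s < 1" using Ks2 s by (simp add: power2_eq_square mult_ac)
    have "\<delta>4 * s * real n * sqrt (\<sigma> a a * \<sigma> b b) \<le> \<bar>cd.S a b - real n * \<sigma> a b\<bar>"
      by (rule cd.kept_small_exceeds[OF ab(1,2,5,4) rs[OF ab(1,1)] rs[OF ab(2,2)] close sigma_diag(1) c_pos s(1,4) B(1,2) \<delta>1 Kc A(1) A(2,3) \<delta>4 less_imp_le[OF \<eta>6]])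
    then show "(a, b) \<in> exceed h y \<omega>" using ab by (simp add: exceed_def h y cd.S_def)
  qed
  have "finite (exceed h y \<omega>)" by (rule finite_subset[of _ "{..<p} \<times> {..<p}"]) (auto simp: exceed_def)
  then have "card {(a, b). a < p \<and> b < p \<and> a \<noteq> b \<and> \<bar>\<sigma> a b\<bar> \<le> \<eta>6 * s \<and> cd.kept \<delta>0 a b} \<le> card (exceed h y \<omega>)"
    by (rule card_mono[OF _ sub])
  then have cm: "real (card {(a, b). a < p \<and> b < p \<and> a \<noteq> b \<and> \<bar>\<sigma> a b\<bar> \<le> \<eta>6 * s \<and> cd.kept \<delta>0 a b}) \<le> m"
    using good by (simp add: good_def)
  have K: "K > 0" using c_pos by (simp add: K_def)
  have dg: "0 < \<sigma> a a \<and> \<sigma> a a \<le> c" if "a < p" for a using sigma_diag_pos[OF that] sigma_diag(2)[OF that] by simp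
  show ?thesis
    using cd.thresholded_norm_close[OF close[folded K_def] s(1,2,4) K c_pos \<delta>0 dg pos rho B(1,3) \<eta>6 cm \<tau> C]
    unfolding whitening_frobenius[OF whitening] by simp
qed

end

end

section \<open>Assembling the limit\<close>

text \<open>No sigma-algebra is put on matrices; the statistic is rewritten on the sample space,
  where the dimensions are fixed, as a real expression in the entries.\<close>

lemma T_hat_measurable:
  assumes X: "\<And>\<omega>. \<omega> \<in> space M \<Longrightarrow> X \<omega> \<in> carrier_mat p n"
    and m: "\<And>k i. k < p \<Longrightarrow> i < n \<Longrightarrow> (\<lambda>\<omega>. X \<omega> $$ (k, i)) \<in> borel_measurable M"
  shows "(\<lambda>\<omega>. T_hat \<delta> (X \<omega>)) \<in> borel_measurable M"
proof -
  have dims: "dim_row (X \<omega>) = p" "dim_col (X \<omega>) = n" if "\<omega> \<in> space M" for \<omega> using X[OF that] by auto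
  have sm: "(\<lambda>\<omega>. sample_mean (X \<omega>) k) \<in> borel_measurable M" if k: "k < p" for k
  proof (subst measurable_cong)
    show "sample_mean (X \<omega>) k = (\<Sum>i<n. X \<omega> $$ (k, i)) / real n" if "\<omega> \<in> space M" for \<omega>
      using dims[OF that] by (simp add: sample_mean_def)
    show "(\<lambda>\<omega>. (\<Sum>i<n. X \<omega> $$ (k, i)) / real n) \<in> borel_measurable M"
      by (intro borel_measurable_divide borel_measurable_sum m k) auto
  qed
  have ph: "(\<lambda>\<omega>. psi_hat (X \<omega>) i j) \<in> borel_measurable M" if ij: "i < n" "j < n" for i j
  proof (subst measurable_cong)
    show "psi_hat (X \<omega>) i j = (\<Sum>k<p. (X \<omega> $$ (k, i) - sample_mean (X \<omega>) k) * (X \<omega> $$ (k, j) - sample_mean (X \<omega>) k)) / real p"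
      if "\<omega> \<in> space M" for \<omega> using dims[OF that] by (simp add: psi_hat_def)
    show "(\<lambda>\<omega>. (\<Sum>k<p. (X \<omega> $$ (k, i) - sample_mean (X \<omega>) k) * (X \<omega> $$ (k, j) - sample_mean (X \<omega>) k)) / real p) \<in> borel_measurable M"
      by (intro borel_measurable_divide borel_measurable_sum borel_measurable_times borel_measurable_diff m sm ij) auto
  qed
  have sh: "(\<lambda>\<omega>. sigma_hat (X \<omega>) a b) \<in> borel_measurable M" if ab: "a < p" "b < p" for a b
  proof (subst measurable_cong)
    show "sigma_hat (X \<omega>) a b = (\<Sum>k<n. (X \<omega> $$ (a, k) - sample_mean (X \<omega>) a) * (X \<omega> $$ (b, k) - sample_mean (X \<omega>) b)) / (real n - 1)"
      if "\<omega> \<in> space M" for \<omega> using dims[OF that] by (simp add: sigma_hat_def)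
    show "(\<lambda>\<omega>. (\<Sum>k<n. (X \<omega> $$ (a, k) - sample_mean (X \<omega>) a) * (X \<omega> $$ (b, k) - sample_mean (X \<omega>) b)) / (real n - 1)) \<in> borel_measurable M"
      by (intro borel_measurable_divide borel_measurable_sum borel_measurable_times borel_measurable_diff m sm ab) (auto simp: ab)
  qed
  have rh: "(\<lambda>\<omega>. rho_hat (X \<omega>) a b) \<in> borel_measurable M" if ab: "a < p" "b < p" for a b
    unfolding rho_hat_def
    by (intro borel_measurable_divide measurable_compose[OF _ borel_measurable_sqrt] borel_measurable_times sh ab)
  define tS where "tS \<omega> = (\<Sum>a<p. sigma_hat (X \<omega>) a a)" for \<omega>
  have tS: "tS \<in> borel_measurable M" unfolding tS_def by (intro borel_measurable_sum sh) auto
  have B: "(\<lambda>\<omega>. B_hat (X \<omega>)) \<in> borel_measurable M"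
  proof (subst measurable_cong)
    show "B_hat (X \<omega>) = ((\<Sum>i<n. \<Sum>j<n. (real p / tS \<omega> * psi_hat (X \<omega>) i j)\<^sup>2) - (\<Sum>i<n. real p / tS \<omega> * psi_hat (X \<omega>) i i)\<^sup>2 / real p) / real n"
      if "\<omega> \<in> space M" for \<omega>
      using dims[OF that] by (simp add: B_hat_def frobenius_norm_def Psi_hat_def mat_trace_def Sigma_hat_def tS_def sum_nonneg)
    show "(\<lambda>\<omega>. ((\<Sum>i<n. \<Sum>j<n. (real p / tS \<omega> * psi_hat (X \<omega>) i j)\<^sup>2) - (\<Sum>i<n. real p / tS \<omega> * psi_hat (X \<omega>) i i)\<^sup>2 / real p) / real n) \<in> borel_measurable M"
      by (intro borel_measurable_divide borel_measurable_diff borel_measurable_sum borel_measurable_power borel_measurable_times borel_measurable_const tS ph) auto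
  qed
  define t where "t a b \<omega> = (if a = b \<or> \<delta> * sqrt (B_hat (X \<omega>) * ln (real p) / real n) \<le> \<bar>rho_hat (X \<omega>) a b\<bar> / (1 - (rho_hat (X \<omega>) a b)\<^sup>2)
    then sigma_hat (X \<omega>) a b else 0)" for a b \<omega>
  have t: "t a b \<in> borel_measurable M" if ab: "a < p" "b < p" for a b
  proof -
    note [measurable] = B rh[OF ab] sh[OF ab]
    show ?thesis unfolding t_def by measurable
  qed
  define T where "T i j \<omega> = psi_hat (X \<omega>) i j + tS \<omega> / (real n * real p)" for i j \<omega>
  have T: "T i j \<in> borel_measurable M" if "i < n" "j < n" for i j
    unfolding T_def using that by (intro borel_measurable_add borel_measurable_divide tS ph) auto
  define I where "I = {(i, j). i < j \<and> j < n}"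
  have I: "finite I" by (rule finite_subset[of _ "{..<n} \<times> {..<n}"]) (auto simp: I_def)
  define f where "f q \<omega> = (T (fst q) (snd q) \<omega>)\<^sup>2 / (psi_hat (X \<omega>) (fst q) (fst q) * psi_hat (X \<omega>) (snd q) (snd q))" for q \<omega>
  have f: "f q \<in> borel_measurable M" if "q \<in> I" for q
    unfolding f_def using that
    by (intro borel_measurable_divide borel_measurable_power borel_measurable_times T ph) (auto simp: I_def)
  show ?thesis
  proof (subst measurable_cong)
    fix \<omega> assume w: "\<omega> \<in> space M"
    have thr: "Sigma_hat_thr \<delta> (X \<omega>) $$ (a, b) = t a b \<omega>" if "a < p" "b < p" for a b
      using that dims[OF w] by (simp add: Sigma_hat_thr_def t_def)
    have d: "dim_row (Sigma_hat_thr \<delta> (X \<omega>)) = p" "dim_col (Sigma_hat_thr \<delta> (X \<omega>)) = p"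
      using dims[OF w] by (simp_all add: Sigma_hat_thr_def)
    have A: "A_hat \<delta> (X \<omega>) = real p * (\<Sum>a<p. \<Sum>b<p. (t a b \<omega>)\<^sup>2) / (\<Sum>a<p. t a a \<omega>)\<^sup>2"
      using dims[OF w] by (simp add: A_hat_def frobenius_norm_def mat_trace_def d thr sum_nonneg)
    have "(\<lambda>(i, j). (T_entry (X \<omega>) i j)\<^sup>2 / (psi_hat (X \<omega>) i i * psi_hat (X \<omega>) j j)) = (\<lambda>q. f q \<omega>)"
      using dims[OF w] by (auto simp: f_def T_def T_entry_def tS_def)
    then show "T_hat \<delta> (X \<omega>) = real p / (real p * (\<Sum>a<p. \<Sum>b<p. (t a b \<omega>)\<^sup>2) / (\<Sum>a<p. t a a \<omega>)\<^sup>2) * Max ((\<lambda>q. f q \<omega>) ` I)"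
      using dims[OF w] by (simp add: T_hat_def A I_def)
  next
    show "(\<lambda>\<omega>. real p / (real p * (\<Sum>a<p. \<Sum>b<p. (t a b \<omega>)\<^sup>2) / (\<Sum>a<p. t a a \<omega>)\<^sup>2) * Max ((\<lambda>q. f q \<omega>) ` I)) \<in> borel_measurable M"
      by (intro borel_measurable_times borel_measurable_divide borel_measurable_const borel_measurable_sum borel_measurable_power borel_measurable_Max I f t) auto
  qed
qed

text \<open>A shift of the level by \<xi> absorbs the multiplicative errors for large n; continuity
  of the limit in the level then lets \<xi> go to 0 after n has gone to infinity.\<close>

lemma tendsto_sandwich_shift:
  fixes x e :: "nat \<Rightarrow> real" and a :: "real \<Rightarrow> nat \<Rightarrow> real" and F :: "real \<Rightarrow> real"
  assumes a: "\<And>t. a t \<longlonglongrightarrow> F t" and F: "isCont F t" and e: "e \<longlonglongrightarrow> 0"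
    and lo: "\<And>\<xi>. \<xi> > 0 \<Longrightarrow> eventually (\<lambda>n. a (t - \<xi>) n - e n \<le> x n) sequentially"
    and hi: "\<And>\<xi>. \<xi> > 0 \<Longrightarrow> eventually (\<lambda>n. x n \<le> a (t + \<xi>) n + e n) sequentially"
  shows "x \<longlonglongrightarrow> F t"
proof (rule tendstoI)
  fix \<epsilon> :: real assume eps: "\<epsilon> > 0"
  then obtain r where r: "r > 0" "\<And>y. dist y t < r \<Longrightarrow> dist (F y) (F t) < \<epsilon> / 3"
    using F unfolding continuous_at_eps_delta by (metis zero_less_divide_iff zero_less_numeral)
  define \<xi> where "\<xi> = r / 2"
  have xi: "\<xi> > 0" "dist (F (t - \<xi>)) (F t) < \<epsilon> / 3" "dist (F (t + \<xi>)) (F t) < \<epsilon> / 3"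
    using r by (auto simp: \<xi>_def dist_real_def)
  have "eventually (\<lambda>n. dist (a (t - \<xi>) n) (F (t - \<xi>)) < \<epsilon> / 3) sequentially"
    "eventually (\<lambda>n. dist (a (t + \<xi>) n) (F (t + \<xi>)) < \<epsilon> / 3) sequentially"
    "eventually (\<lambda>n. dist (e n) 0 < \<epsilon> / 3) sequentially"
    by (rule tendstoD[OF a], use eps in simp)+ (rule tendstoD[OF e], use eps in simp)
  then show "eventually (\<lambda>n. dist (x n) (F t) < \<epsilon>) sequentially"
    using lo[OF xi(1)] hi[OF xi(1)]
    by eventually_elim (use xi(2,3) in \<open>simp only: dist_real_def abs_less_iff; linarith\<close>)
qed

text \<open>All relative errors are negative powers of n while the level grows like 4 log n, so the
  difference of the two sides tends to -\<xi>.\<close>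

lemma stat_upper_eventually:
  fixes K Kf c a t \<xi> :: real assumes "a > 0" "\<xi> > 0" "K > 0" "Kf > 0" "c > 0"
  shows "eventually (\<lambda>n. ((1 + K * real n powr (-1/4)) / (1 - K * real n powr (-1/4)))\<^sup>2 / (1 - Kf * real n powr (-a)) *
    (sqrt (4 * ln (real n) - ln (ln (real n)) + (t - \<xi>)) + 7 * c * real n powr (-3/8))\<^sup>2 \<le> 4 * ln (real n) - ln (ln (real n)) + t) sequentially"
proof -
  have "(\<lambda>n. ((1 + K * real n powr (-1/4)) / (1 - K * real n powr (-1/4)))\<^sup>2 / (1 - Kf * real n powr (-a)) *
    (sqrt (4 * ln (real n) - ln (ln (real n)) + (t - \<xi>)) + 7 * c * real n powr (-3/8))\<^sup>2 - (4 * ln (real n) - ln (ln (real n)) + t)) \<longlonglongrightarrow> - \<xi>"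
    using assms by real_asymp (simp add: field_simps)
  then have "eventually (\<lambda>n. ((1 + K * real n powr (-1/4)) / (1 - K * real n powr (-1/4)))\<^sup>2 / (1 - Kf * real n powr (-a)) *
    (sqrt (4 * ln (real n) - ln (ln (real n)) + (t - \<xi>)) + 7 * c * real n powr (-3/8))\<^sup>2 - (4 * ln (real n) - ln (ln (real n)) + t) < 0) sequentially"
    using assms by (intro order_tendstoD(2)[of _ "- \<xi>"]) auto
  then show ?thesis by eventually_elim simp
qed

text \<open>Mirror image of \<open>stat_upper_eventually\<close>, compared after squaring.\<close>

lemma stat_lower_eventually:
  fixes K Kf c a t \<xi> :: real assumes "a > 0" "\<xi> > 0" "K > 0" "Kf > 0" "c > 0"
  shows "eventually (\<lambda>n. 7 * c * real n powr (-3/8) + sqrt ((4 * ln (real n) - ln (ln (real n)) + t) * (1 + Kf * real n powr (-a))) *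
    ((1 + K * real n powr (-1/4)) / (1 - K * real n powr (-1/4))) \<le> sqrt (4 * ln (real n) - ln (ln (real n)) + (t + \<xi>))) sequentially"
proof -
  have "(\<lambda>n. (7 * c * real n powr (-3/8) + sqrt ((4 * ln (real n) - ln (ln (real n)) + t) * (1 + Kf * real n powr (-a))) *
    ((1 + K * real n powr (-1/4)) / (1 - K * real n powr (-1/4))))\<^sup>2 - (4 * ln (real n) - ln (ln (real n)) + (t + \<xi>))) \<longlonglongrightarrow> - \<xi>"
    using assms by real_asymp
  then have "eventually (\<lambda>n. (7 * c * real n powr (-3/8) + sqrt ((4 * ln (real n) - ln (ln (real n)) + t) * (1 + Kf * real n powr (-a))) *
    ((1 + K * real n powr (-1/4)) / (1 - K * real n powr (-1/4))))\<^sup>2 - (4 * ln (real n) - ln (ln (real n)) + (t + \<xi>)) < 0) sequentially"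
    using assms by (intro order_tendstoD(2)[of _ "- \<xi>"]) auto
  then show ?thesis by eventually_elim (rule real_le_rsqrt, simp)
qed

text \<open>Choice of the error scales. The diagonal entries and conditional variances fluctuate on
  the scale sqrt p, and \<nu> allows the factor n^(1/4); relative to a trace of order p > c' n this
  is n^(-1/4), whence \<kappa>. Row sums have standard deviation of order sqrt(n p), and \<rho>
  allows a further n^(1/8); division by n and by sqrt p leaves the n^(-3/8) of
  \<open>e\<close>.\<close>

lemma normal_model_numeric:
  fixes p n :: nat and c c' tr t0 :: real
  assumes c: "c \<ge> 1" and c': "c' > 0" "c' * real n < real p" and n: "n \<ge> 2" and p: "p \<ge> 1"
    and tr: "real p / c \<le> tr" and t0: "real p / c\<^sup>2 \<le> t0"
  defines "\<nu> \<equiv> sqrt (real p) * real n powr (1/4)" and "\<rho> \<equiv> sqrt (real p) * real n powr (5/8)"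
    and "\<kappa> \<equiv> (7 * c\<^sup>2 / sqrt c' + 3) * real n powr (-1/4)" and "e \<equiv> 7 * c * real n powr (-3/8)"
  shows "4 * \<nu> + 3 * (tr + \<rho>) / real n \<le> \<kappa> * tr" "\<nu> + 2 * \<rho> / real n \<le> \<kappa> * tr" "\<nu> \<le> \<kappa> * t0"
    "(4 * \<nu> + 3 * \<rho>) / real n \<le> e * sqrt t0"
proof -
  let ?n = "real n"
  define q where "q = ?n powr (-1/4)"
  have n0: "?n > 0" "?n \<ge> 1" using n by auto
  have p0: "real p > 0" using p by simp
  have q0: "q > 0" using n0 by (simp add: q_def)
  have tr0: "tr > 0" using tr p0 c by (intro less_le_trans[OF _ tr]) auto
  have t00: "t0 > 0" using t0 p0 c by (intro less_le_trans[OF _ t0]) auto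
  have sq: "sqrt c' * sqrt ?n \<le> sqrt (real p)" using c' by (simp add: real_sqrt_mult[symmetric])
  have nu: "\<nu> \<le> real p / sqrt c' * q"
  proof -
    have pw: "?n powr (1/4) = q * sqrt ?n" using n0 by (simp add: q_def powr_half_sqrt[symmetric] powr_add[symmetric])
    have "\<nu> = sqrt (real p) * q * (sqrt c' * sqrt ?n) / sqrt c'" using c' by (simp add: \<nu>_def pw)
    also have "\<dots> \<le> sqrt (real p) * q * sqrt (real p) / sqrt c'" using sq q0 c' by (intro divide_right_mono mult_left_mono) auto
    also have "\<dots> = (sqrt (real p) * sqrt (real p)) * q / sqrt c'" by (simp only: mult_ac)
    finally show ?thesis by simp
  qed
  have rho: "\<rho> / ?n \<le> \<nu>"
  proof -
    have "?n powr (5/8) / ?n = ?n powr (5/8 - 1)" using powr_diff[of ?n "5/8" 1] n0 by simp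
    also have "\<dots> \<le> ?n powr (1/4)" using n0 by (intro powr_mono) auto
    finally have "sqrt (real p) * (?n powr (5/8) / ?n) \<le> sqrt (real p) * ?n powr (1/4)" by (intro mult_left_mono) auto
    then show ?thesis by (simp add: \<rho>_def \<nu>_def)
  qed
  have nu_tr: "\<nu> \<le> c / sqrt c' * q * tr"
  proof -
    have "real p \<le> c * tr" using tr c by (simp add: field_simps)
    then have "real p / sqrt c' * q \<le> (c * tr) / sqrt c' * q" using q0 c' by (intro mult_right_mono divide_right_mono) auto
    then show ?thesis using nu by (simp add: mult_ac)
  qed
  have n1: "1 / ?n \<le> q"
  proof -
    have "?n powr (-1) \<le> q" unfolding q_def using n0 by (intro powr_mono) auto
    then show ?thesis using n0 by (simp add: powr_minus_divide)
  qed
  have cc: "c \<le> c\<^sup>2" using c by (simp add: power2_eq_square)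
  have nn: "7 * \<nu> + 3 * q * tr \<le> \<kappa> * tr"
  proof -
    have "7 * \<nu> \<le> 7 * (c / sqrt c' * q * tr)" using nu_tr by simp
    also have "\<dots> \<le> 7 * (c\<^sup>2 / sqrt c' * q * tr)" using cc c' q0 tr0 by (intro mult_left_mono mult_right_mono divide_right_mono) auto
    finally show ?thesis by (simp add: \<kappa>_def q_def algebra_simps)
  qed
  have tn: "tr / ?n \<le> q * tr" using mult_right_mono[OF n1, of tr] tr0 by simp
  show "4 * \<nu> + 3 * (tr + \<rho>) / ?n \<le> \<kappa> * tr"
    using nn rho tn by (simp add: add_divide_distrib)
  have qt: "0 \<le> q * tr" "0 \<le> \<nu>" using q0 tr0 by (auto simp: \<nu>_def)
  show "\<nu> + 2 * \<rho> / ?n \<le> \<kappa> * tr" using nn rho qt by simp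
  show "\<nu> \<le> \<kappa> * t0"
  proof -
    have "real p \<le> c\<^sup>2 * t0" using t0 c by (simp add: field_simps)
    then have "real p / sqrt c' * q \<le> (c\<^sup>2 * t0) / sqrt c' * q" using q0 c' by (intro mult_right_mono divide_right_mono) auto
    also have "\<dots> = (c\<^sup>2 / sqrt c') * q * t0" by simp
    also have "\<dots> \<le> (7 * c\<^sup>2 / sqrt c' + 3) * q * t0" using q0 t00 c' c by (intro mult_right_mono) (auto simp: add_increasing2 divide_right_mono)
    finally show ?thesis using nu by (simp add: \<kappa>_def q_def)
  qed
  have "(4 * \<nu> + 3 * \<rho>) / ?n \<le> 7 * \<rho> / ?n"
  proof -
    have "?n powr (1/4) \<le> ?n powr (5/8)" using n0 by (intro powr_mono) auto
    then have "\<nu> \<le> \<rho>" unfolding \<nu>_def \<rho>_def by (intro mult_left_mono) auto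
    then show ?thesis using n0 by (intro divide_right_mono) auto
  qed
  also have "\<dots> = 7 * sqrt (real p) * ?n powr (-3/8)"
  proof -
    have eq: "?n powr (5/8) / ?n = ?n powr (-3/8)" using powr_diff[of ?n "5/8" 1] n0 by simp
    have "7 * \<rho> / ?n = 7 * sqrt (real p) * (?n powr (5/8) / ?n)" by (simp add: \<rho>_def)
    then show ?thesis unfolding eq .
  qed
  also have "\<dots> \<le> 7 * (c * sqrt t0) * ?n powr (-3/8)"
  proof -
    have "real p \<le> c\<^sup>2 * t0" using t0 c by (simp add: field_simps)
    then have "sqrt (real p) \<le> sqrt (c\<^sup>2 * t0)" by (rule real_sqrt_le_mono)
    then have "sqrt (real p) \<le> c * sqrt t0" using c by (simp add: real_sqrt_mult)
    then show ?thesis by (intro mult_right_mono mult_left_mono) auto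
  qed
  finally show "(4 * \<nu> + 3 * \<rho>) / ?n \<le> e * sqrt t0" by (simp add: e_def mult_ac)
qed

lemma (in gaussian_columns) no_exceed_measurable: "no_exceed x n \<in> events"
proof -
  have "no_exceed x n = {\<omega>\<in>space M. \<forall>b\<in>{..<n}. \<forall>a\<in>{..<b}. \<bar>gram p d (Gs \<omega>) a b\<bar> \<le> x}"
    by (auto simp: no_exceed_def)
  also have "\<dots> \<in> events"
  proof (intro sets.sets_Collect_finite_All finite_lessThan)
    fix b a assume "b \<in> {..<n}" "a \<in> {..<b}"
    then have "(\<lambda>\<omega>. gram p d (Gs \<omega>) a b) \<in> borel_measurable M" by (intro gram_measurable) auto
    then show "{\<omega>\<in>space M. \<bar>gram p d (Gs \<omega>) a b\<bar> \<le> x} \<in> events" by measurable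
  qed
  finally show ?thesis .
qed

lemma (in prob_space) prob_le_intersect_good:
  assumes "A \<in> events" "E \<in> events" "D \<in> events" "A \<inter> E \<subseteq> D"
  shows "prob A \<le> prob D + (1 - prob E)"
proof -
  have "prob A \<le> prob (D \<union> (space M - E))"
    using assms sets.sets_into_space by (intro finite_measure_mono) blast+
  also have "\<dots> \<le> prob D + prob (space M - E)" using assms by (intro measure_Un_le) auto
  finally show ?thesis using assms by (simp add: prob_compl)
qed

context normal_model
begin

context
  fixes \<nu> \<rho> \<eta> s h y m c' \<kappa> e f \<delta>0 :: real and \<omega>
  assumes good: "\<omega> \<in> good \<nu> \<rho> \<eta> s h y m" and c': "c' > 0" "c' * real n < real p"
    and \<eta>: "0 < \<eta>" "\<eta> \<le> 1 / 2" and \<kappa>: "0 \<le> \<kappa>" "\<kappa> \<le> 1 / 2" and e: "0 \<le> e"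
    and k1: "4 * \<nu> + 3 * (trd + \<rho>) / real n \<le> \<kappa> * trd" and k2: "\<nu> + 2 * \<rho> / real n \<le> \<kappa> * trd"
    and k4: "\<nu> \<le> \<kappa> * tau2" and ke: "(4 * \<nu> + 3 * \<rho>) / real n \<le> e * sqrt tau2"
    and f: "0 \<le> f" "f \<le> 1 / 2" and N: "\<bar>centred_data.N2 p (X \<omega>) \<delta>0 - tau2\<bar> \<le> f * tau2"
begin

text \<open>With \<open>good_gram_le\<close> this encloses the event for \<open>T_hat\<close>, on
  the good event, between two no-exceedance events at slightly shifted levels.\<close>

lemma good_T_hat_le:
  assumes small: "\<And>a b. a < b \<Longrightarrow> b < n \<Longrightarrow> \<bar>gram p d (Gs \<omega>) a b\<bar> \<le> sqrt (Yl * tau2)" and Yl: "0 \<le> Yl"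
    and le: "((1 + \<kappa>) / (1 - \<kappa>))\<^sup>2 / (1 - f) * (sqrt Yl + e)\<^sup>2 \<le> Yt"
  shows "T_hat \<delta>0 (X \<omega>) \<le> Yt"
proof -
  note ctx = good c' \<eta> \<kappa> e k1 k2 k4 ke
  interpret cd: centred_data p n "X \<omega>" \<mu> "Z \<omega>" by (rule centred_data_X) (use good in \<open>simp add: good_def\<close>)
  have W: "cd.W i j = gram p d (Gs \<omega>) i j" for i j by (rule good_W[OF ctx])
  have "cd.stat \<delta>0 i j \<le> Yt" if ij: "j < n" "i < j" for i j
  proof (rule order_trans[OF _ le])
    have i: "i < n" using ij by simp
    show "cd.stat \<delta>0 i j \<le> ((1 + \<kappa>) / (1 - \<kappa>))\<^sup>2 / (1 - f) * (sqrt Yl + e)\<^sup>2"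
      by (rule cd.stat_bounds(1)[OF trd_pos tau2_pos \<kappa> f e good_P[OF ctx] good_trS[OF ctx] N i ij(1)])
        (use good_T[OF ctx i ij(1)] small[OF ij(2,1)] Yl in \<open>auto simp: W real_sqrt_mult\<close>)
  qed
  then show ?thesis by (simp add: cd.T_hat_le_iff)
qed

lemma good_gram_le:
  assumes T: "T_hat \<delta>0 (X \<omega>) \<le> Yt" and Yt: "0 \<le> Yt"
    and le: "e + sqrt (Yt * (1 + f)) * ((1 + \<kappa>) / (1 - \<kappa>)) \<le> sqrt Yu" and ab: "a < b" "b < n"
  shows "\<bar>gram p d (Gs \<omega>) a b\<bar> \<le> sqrt (Yu * tau2)"
proof -
  note ctx = good c' \<eta> \<kappa> e k1 k2 k4 ke
  interpret cd: centred_data p n "X \<omega>" \<mu> "Z \<omega>" by (rule centred_data_X) (use good in \<open>simp add: good_def\<close>)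
  have W: "cd.W i j = gram p d (Gs \<omega>) i j" for i j by (rule good_W[OF ctx])
  have a: "a < n" using ab by simp
  have "\<bar>cd.W a b\<bar> \<le> (e + sqrt (Yt * (1 + f)) * ((1 + \<kappa>) / (1 - \<kappa>))) * sqrt tau2"
    by (rule cd.stat_bounds(2)[OF trd_pos tau2_pos \<kappa> f e good_P[OF ctx] good_trS[OF ctx] N a ab(2)])
      (use good_T[OF ctx a ab(2)] T ab Yt in \<open>auto simp: W cd.T_hat_le_iff\<close>)
  also have "\<dots> \<le> sqrt Yu * sqrt tau2" using le tau2_pos by (intro mult_right_mono) auto
  finally show ?thesis by (simp add: W real_sqrt_mult)
qed

end

end

theorem T_hat_limit_model:
  fixes M :: "nat \<Rightarrow> 'a measure" and p :: "nat \<Rightarrow> nat"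
  assumes nm: "\<And>n. n \<ge> 2 \<Longrightarrow> normal_model (M n) (p n) n (d n) (G n) (\<sigma> n) (u n) (X n) (\<mu> n) c"
    and c': "c' > 0" "\<And>n. n \<ge> 2 \<Longrightarrow> c' * real n < real (p n)"
    and \<tau>: "1 \<le> \<tau>" "\<tau> < 2" and C: "\<And>n a. n \<ge> 2 \<Longrightarrow> a < p n \<Longrightarrow> (\<Sum>b<p n. \<bar>\<sigma> n a b\<bar> powr \<tau>) \<le> C"
    and \<epsilon>: "\<epsilon> > 0" "eventually (\<lambda>n. ln (real (p n)) / real n \<le> real n powr (-\<epsilon>)) sequentially"
    and \<delta>0: "\<delta>0 > sqrt 2"
    and meas: "\<And>n. n \<ge> 2 \<Longrightarrow> (\<lambda>\<omega>. T_hat \<delta>0 (X n \<omega>)) \<in> borel_measurable (M n)"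
  shows "(\<lambda>n. measure (M n) {\<omega>\<in>space (M n). T_hat \<delta>0 (X n \<omega>) \<le> 4 * ln (real n) - ln (ln (real n)) + t})
    \<longlonglongrightarrow> exp (- (1 / sqrt (8 * pi)) * exp (- t / 2))"
proof -
  have c1: "c \<ge> 1" using nm[of 2] by (simp add: normal_model_def normal_model_axioms_def)
  then have c0: "c > 0" by simp
  \<comment> \<open>The gap between sqrt 2 and \<delta>0 is spent in three places: \<delta>1 <
    \<delta>0 allows \<open>B_hat\<close> to fall slightly below 1, \<delta>4 < \<delta>1 allows for
    small population entries and estimation errors, and sqrt 2 < \<delta>4 pays for the constants in
    the tail bound.\<close>
  define \<delta>1 where "\<delta>1 = (sqrt 2 + \<delta>0) / 2"
  define \<delta>4 where "\<delta>4 = (sqrt 2 + \<delta>1) / 2"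
  have ds: "sqrt 2 < \<delta>4" "\<delta>4 < \<delta>1" "\<delta>1 < \<delta>0" using \<delta>0 by (auto simp: \<delta>1_def \<delta>4_def)
  have s2: "sqrt 2 > 0" by simp
  have dpos: "\<delta>4 > 0" "\<delta>1 > 0" "\<delta>0 > 0" using ds s2 by linarith+
  \<comment> \<open>Entries up to \<eta>6 s count as tiny; they use half of the gap between
    \<delta>4 and \<delta>1.\<close>
  define \<eta>6 where "\<eta>6 = (\<delta>1 - \<delta>4) / (2 * c)"
  have c\<eta>6: "c * \<eta>6 = (\<delta>1 - \<delta>4) / 2" using c0 by (simp add: \<eta>6_def)
  have \<eta>6: "\<eta>6 > 0" "\<delta>4 + c * \<eta>6 < \<delta>1" using ds c0 by (simp_all add: c\<eta>6) (simp_all add: \<eta>6_def field_simps)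
  \<comment> \<open>The lower bound demanded of \<open>B_hat\<close>, so that \<delta>0 sqrt b1 =
    \<delta>1.\<close>
  define b1 where "b1 = (\<delta>1 / \<delta>0)\<^sup>2"
  have b1: "0 < b1" "b1 < 1" using dpos ds by (auto simp: b1_def power_less_one_iff)
  \<comment> \<open>Makes the loss (1 - (1 - \<eta>)^2)/c' \<le> 2\<eta>/c' in the lower bound for
    \<open>B_hat\<close> smaller than 1 - b1.\<close>
  define \<eta> where "\<eta> = min (1 / 2) ((1 - b1) * c' / 4)"
  have \<eta>: "0 < \<eta>" "\<eta> \<le> 1 / 2" "4 * \<eta> \<le> (1 - b1) * c'" using b1 c'(1) by (auto simp: \<eta>_def)
  \<comment> \<open>The reserve \<delta>4^2/2 > 1 in the exponent is split into two equal factors: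
    one for the Chernoff loss 1 + 4\<delta>, one for 1 + r^2.\<close>
  define g where "g = \<delta>4 / sqrt 2"
  have g: "g > 1" "g * g = \<delta>4\<^sup>2 / 2" using ds by (auto simp: g_def power2_eq_square)
  define \<delta> where "\<delta> = min (1 / 4) ((g - 1) / 4)"
  have "\<delta> \<le> (g - 1) / 4" unfolding \<delta>_def by (rule min.cobounded2)
  then have "1 + 4 * \<delta> \<le> g" by (simp add: field_simps)
  then have \<delta>: "0 < \<delta>" "\<delta> \<le> 1 / 4" "1 + 4 * \<delta> \<le> g" using g by (auto simp: \<delta>_def)
  \<comment> \<open>With this value the exponent n (\<delta>4 s)^2 / (2 L) is exactly ln p, so a
    tiny entry is kept with probability at most 2/p.\<close>
  define L where "L = \<delta>4\<^sup>2 / 2"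
  have L: "L > 0" using dpos by (simp add: L_def)
  define s where "s n = sqrt (ln (real (p n)) / real n)" for n
  define \<nu> where "\<nu> n = sqrt (real (p n)) * real n powr (1/4)" for n
  define \<rho> where "\<rho> n = sqrt (real (p n)) * real n powr (5/8)" for n
  define K\<kappa> where "K\<kappa> = 7 * c\<^sup>2 / sqrt c' + 3"
  define \<kappa> where "\<kappa> n = K\<kappa> * real n powr (-1/4)" for n
  define e where "e n = 7 * c * real n powr (-3/8)" for n
  \<comment> \<open>The upper bound of \<open>good_B_hat\<close>, with the vanishing term 8 w
    replaced by 1.\<close>
  define b2 where "b2 = 10 + 32 * c ^ 4 / c'"
  define K where "K = 30 * c"
  define Lc where "Lc = K * (K + 2 * c) + ((K * (K / \<eta>6 + 2)) * \<eta>6 powr (1 - \<tau>) + (\<delta>0 * sqrt b2 * (c + K) + K) powr (2 - \<tau>)) * C"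
  \<comment> \<open>From s \<le> n^(-\<epsilon>/2) follows s^(2-\<tau>) \<le> n^(-a). Also a \<le>
    \<epsilon>/2, as \<tau> \<ge> 1, so the contribution of the kept tiny entries is of no larger
    order.\<close>
  define a where "a = \<epsilon> * (2 - \<tau>) / 2"
  have apos: "a > 0" using \<epsilon> \<tau> by (simp add: a_def)
  define Kf where "Kf = c\<^sup>2 * (\<bar>Lc\<bar> + K * (K + 2 * \<eta>6))"
  have Kpos: "K > 0" "Kf > 0" "K\<kappa> > 0"
  proof -
    show K: "K > 0" using c0 by (simp add: K_def)
    show "Kf > 0" unfolding Kf_def using K c0 \<eta>6 by (intro mult_pos_pos add_nonneg_pos) auto
    show "K\<kappa> > 0" unfolding K\<kappa>_def using c0 c'(1) by (intro add_nonneg_pos) auto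
  qed
  define f where "f n = Kf * real n powr (-a)" for n
  \<comment> \<open>Larger than the expected count, at most 2p, by n^(\<epsilon>/2), which makes
    Markov's bound vanish; yet m s^2 is at most p n^(-\<epsilon>/2), negligible against a squared
    Frobenius norm of order p.\<close>
  define m where "m n = real (p n) * real n powr (\<epsilon> / 2)" for n
  define A where "A n = (real n / (real n - 1)) * (\<delta>4 + c * \<eta>6 + c * (3 * sqrt c)\<^sup>2 * s n) / (1 - c * (30 * c) * s n)" for n
  define E where "E n = normal_model.good (M n) (p n) n (d n) (G n) (\<sigma> n) (u n) (\<nu> n) (\<rho> n) \<eta> (s n) (\<eta>6 * s n) (\<delta>4 * s n) (m n)" for n
  define w where "w n = 2 * (e n)\<^sup>2 * c ^ 4 / c' + 8 / real n" for n
  have pbig: "eventually (\<lambda>n. real (p n) > B) sequentially" for B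
  proof -
    have "eventually (\<lambda>n. c' * real n > B) sequentially" using c'(1) by real_asymp
    then show ?thesis using eventually_ge_at_top[of 2] by eventually_elim (use c'(2) in \<open>auto intro: less_trans\<close>)
  qed
  have s0: "s \<longlonglongrightarrow> 0"
  proof (rule tendsto_sandwich)
    show "eventually (\<lambda>n. 0 \<le> s n) sequentially"
      using pbig[of 1] by eventually_elim (simp add: s_def)
    show "eventually (\<lambda>n. s n \<le> sqrt (real n powr (-\<epsilon>))) sequentially"
      using \<epsilon>(2) by eventually_elim (simp add: s_def)
    show "(\<lambda>n. sqrt (real n powr (-\<epsilon>))) \<longlonglongrightarrow> 0" using \<epsilon>(1) by real_asymp
  qed simp
  have nn1: "(\<lambda>n. real n / (real n - 1)) \<longlonglongrightarrow> 1" by real_asymp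
  have A0: "A \<longlonglongrightarrow> \<delta>4 + c * \<eta>6"
  proof -
    have "A \<longlonglongrightarrow> 1 * (\<delta>4 + c * \<eta>6 + c * (3 * sqrt c)\<^sup>2 * 0) / (1 - c * (30 * c) * 0)"
      unfolding A_def[abs_def] by (intro tendsto_intros nn1 s0) auto
    then show ?thesis by simp
  qed
  have sA: "(\<lambda>n. s n * A n) \<longlonglongrightarrow> 0" using tendsto_mult[OF s0 A0] by simp
  have evA: "eventually (\<lambda>n. s n * A n < 1) sequentially" "eventually (\<lambda>n. A n < \<delta>1 * (1 - (s n * A n)\<^sup>2)) sequentially"
  proof -
    show "eventually (\<lambda>n. s n * A n < 1) sequentially" by (rule order_tendstoD(2)[OF sA]) simp
    have "(\<lambda>n. \<delta>1 * (1 - (s n * A n)\<^sup>2) - A n) \<longlonglongrightarrow> \<delta>1 * (1 - 0\<^sup>2) - (\<delta>4 + c * \<eta>6)"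
      by (intro tendsto_intros sA A0)
    then have "eventually (\<lambda>n. \<delta>1 * (1 - (s n * A n)\<^sup>2) - A n > 0) sequentially"
      by (rule order_tendstoD(1)) (use \<eta>6 in simp)
    then show "eventually (\<lambda>n. A n < \<delta>1 * (1 - (s n * A n)\<^sup>2)) sequentially" by eventually_elim simp
  qed
  have evs: "eventually (\<lambda>n. s n < B) sequentially" if "B > 0" for B by (rule order_tendstoD(2)[OF s0 that])
  have evr: "eventually (\<lambda>n. 1 + (c * (\<eta>6 * s n))\<^sup>2 < g) sequentially"
  proof -
    have "(\<lambda>n. 1 + (c * (\<eta>6 * s n))\<^sup>2) \<longlonglongrightarrow> 1 + (c * (\<eta>6 * 0))\<^sup>2" by (intro tendsto_intros s0)
    then show ?thesis by (rule order_tendstoD(2)) (use g in simp)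
  qed
  have \<kappa>0: "\<kappa> \<longlonglongrightarrow> 0" unfolding \<kappa>_def[abs_def] by real_asymp
  have e0: "e \<longlonglongrightarrow> 0" unfolding e_def[abs_def] by real_asymp
  have f0: "f \<longlonglongrightarrow> 0" unfolding f_def[abs_def] using apos by real_asymp
  have w0: "w \<longlonglongrightarrow> 0"
  proof -
    have "(\<lambda>n. 8 / real n) \<longlonglongrightarrow> 0" by real_asymp
    then have "w \<longlonglongrightarrow> 2 * 0\<^sup>2 * c ^ 4 / c' + 0" unfolding w_def[abs_def] by (intro tendsto_intros e0) (use c' in auto)
    then show ?thesis by simp
  qed
  have ev\<kappa>: "eventually (\<lambda>n. \<kappa> n < 1 / 2) sequentially" by (rule order_tendstoD(2)[OF \<kappa>0]) simp
  have evf: "eventually (\<lambda>n. f n < 1 / 2) sequentially" by (rule order_tendstoD(2)[OF f0]) simp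
  have evw: "eventually (\<lambda>n. 8 * w n < 1) sequentially"
    using order_tendstoD(2)[OF w0, of "1 / 8"] by (auto elim: eventually_mono)
  have evB: "eventually (\<lambda>n. b1 < (1 - \<kappa> n)\<^sup>2 / (1 + \<kappa> n)\<^sup>2 - (1 - (1 - \<eta>)\<^sup>2 * (1 - \<kappa> n) / (1 + \<kappa> n)\<^sup>2) / c' - w n / \<eta>) sequentially"
  proof -
    have "(\<lambda>n. (1 - \<kappa> n)\<^sup>2 / (1 + \<kappa> n)\<^sup>2 - (1 - (1 - \<eta>)\<^sup>2 * (1 - \<kappa> n) / (1 + \<kappa> n)\<^sup>2) / c' - w n / \<eta>)
      \<longlonglongrightarrow> (1 - 0)\<^sup>2 / (1 + 0)\<^sup>2 - (1 - (1 - \<eta>)\<^sup>2 * (1 - 0) / (1 + 0)\<^sup>2) / c' - 0 / \<eta>"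
      by (intro tendsto_intros \<kappa>0 w0) (use c' \<eta> in auto)
    \<comment> \<open>The limit of the lower bound for \<open>B_hat\<close>; the choice of \<eta>
      makes it exceed b1.\<close>
    moreover have "b1 < 1 - (1 - (1 - \<eta>)\<^sup>2) / c'"
    proof -
      have "1 - (1 - \<eta>)\<^sup>2 \<le> 2 * \<eta>" by (simp add: power2_eq_square algebra_simps)
      also have "2 * \<eta> < (1 - b1) * c'" using \<eta> by linarith
      finally show ?thesis using c'(1) by (simp add: field_simps)
    qed
    ultimately show ?thesis by (intro order_tendstoD(1)) auto
  qed
  have ev\<nu>: "eventually (\<lambda>n. 2 * \<nu> n \<le> real (p n)) sequentially"
  proof -
    have "eventually (\<lambda>n. 2 * real n powr (1/4) \<le> sqrt (c' * real n)) sequentially" using c'(1) by real_asymp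
    then show ?thesis using eventually_ge_at_top[of 2]
    proof eventually_elim
      case (elim n)
      have "sqrt (c' * real n) \<le> sqrt (real (p n))" using c'(2)[OF elim(2)] by (intro real_sqrt_le_mono) simp
      with elim(1) have "2 * real n powr (1/4) \<le> sqrt (real (p n))" by (rule order_trans)
      then have "sqrt (real (p n)) * (2 * real n powr (1/4)) \<le> sqrt (real (p n)) * sqrt (real (p n))"
        by (intro mult_left_mono) auto
      then show ?case by (simp add: \<nu>_def mult_ac)
    qed
  qed
  have base: "eventually (\<lambda>n. n \<ge> 2 \<and> real (p n) > 3 \<and> ln (real (p n)) \<ge> 1 \<and> s n < 1 / 20 \<and> \<delta>4 * s n < \<delta> \<and>
      60 * c ^ 4 * s n < 1 \<and> s n \<le> real n powr (-\<epsilon> / 2) \<and> 2 * \<nu> n \<le> real (p n) \<and> \<kappa> n < 1 / 2) sequentially"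
  proof -
    have l: "eventually (\<lambda>n. real (p n) > exp 1) sequentially" by (rule pbig)
    have s20: "eventually (\<lambda>n. s n < 1 / 20) sequentially" by (rule evs) simp
    have s1: "eventually (\<lambda>n. s n < \<delta> / \<delta>4) sequentially" by (rule evs) (use \<delta> dpos in auto)
    have s3: "eventually (\<lambda>n. s n < 1 / (60 * c ^ 4)) sequentially" by (rule evs) (use c0 in auto)
    show ?thesis
      using eventually_ge_at_top[of 2] pbig[of 3] l s20 s1 s3 \<epsilon>(2) ev\<nu> ev\<kappa>
    proof eventually_elim
      case (elim n)
      have "ln (real (p n)) \<ge> 1" using elim by (subst ln_ge_iff) auto
      moreover have "s n \<le> real n powr (-\<epsilon> / 2)"
      proof -
        have "s n \<le> sqrt (real n powr (-\<epsilon>))" using elim by (simp add: s_def)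
        also have "\<dots> = real n powr (-\<epsilon> / 2)" by (simp add: powr_half_sqrt[symmetric] powr_powr)
        finally show ?thesis .
      qed
      moreover have "\<delta>4 * s n < \<delta>" using elim dpos by (simp add: field_simps)
      moreover have "60 * c ^ 4 * s n < 1" using elim c0 by (simp add: field_simps)
      ultimately show ?case using elim by simp
    qed
  qed
  have probE: "eventually (\<lambda>n. E n \<in> sets (M n) \<and> 1 - measure (M n) (E n) \<le>
      real n * (6 * exp (- sqrt (real n) / (8 * c ^ 4)) + exp (- (real n powr (1/4)) / (4 * c\<^sup>2)) + 2 * exp (- \<eta>\<^sup>2 * (real n - 1) / 8))
      + 3 / (c' * real n) + 2 * real n powr (-\<epsilon> / 2)) sequentially"
  proof -
    have big: "eventually (\<lambda>n. real n powr (1/8) / (sqrt 2 * c) \<ge> 1) sequentially" using c0 by real_asymp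
    show ?thesis
      using base evr big
    proof eventually_elim
      case (elim n)
      interpret normal_model "M n" "p n" n "d n" "G n" "\<sigma> n" "u n" "X n" "\<mu> n" c by (rule nm) (use elim in simp)
      have n: "n \<ge> 2" and p3: "real (p n) > 3" and lp: "ln (real (p n)) \<ge> 1" using elim by auto
      have sn: "s n > 0" using lp n by (simp add: s_def)
      have s2n: "real n * (s n)\<^sup>2 = ln (real (p n))" using lp n by (simp add: s_def)
      have pn: "c' * real n < real (p n)" by (rule c'(2)[OF n])
      have cn: "c' * real n > 0" using c'(1) n by simp
      have num: "\<nu> n \<le> \<kappa> n * tau2"
        using normal_model_numeric(3)[OF c1 c'(1) pn n dims(2) trd_bounds(1) tau2_bounds(1)]
        by (simp add: \<nu>_def \<kappa>_def K\<kappa>_def)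
      also have "\<kappa> n * tau2 \<le> 1 * tau2" using elim tau2_pos by (intro mult_right_mono) auto
      finally have nu_tau: "\<nu> n \<le> tau2" by simp
      have h: "(1 + 4 * \<delta>) * (1 + (r a b)\<^sup>2) \<le> L" if ab: "a < p n" "b < p n" "a \<noteq> b" "\<bar>\<sigma> n a b\<bar> \<le> \<eta>6 * s n" for a b
      proof -
        define q where "q = sqrt (\<sigma> n a a * \<sigma> n b b)"
        have q0: "q > 0" using sigma_diag_pos ab by (simp add: q_def)
        have "inverse c * inverse c \<le> \<sigma> n a a * \<sigma> n b b"
          using sigma_diag(1) ab c0 sigma_diag_pos by (intro mult_mono) (auto simp: less_imp_le)
        then have "inverse c \<le> q" unfolding q_def using c0 by (intro real_le_rsqrt) (simp add: power2_eq_square)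
        then have cq: "1 \<le> c * q" using mult_left_mono[of "inverse c" q c] c0 by simp
        have "\<bar>r a b\<bar> = \<bar>\<sigma> n a b\<bar> / q" using q0 by (simp add: r_def q_def abs_divide)
        also have "\<dots> \<le> \<bar>\<sigma> n a b\<bar> * c" using q0 mult_left_mono[OF cq, of "\<bar>\<sigma> n a b\<bar>"] by (simp add: divide_le_eq mult_ac)
        also have "\<dots> \<le> (\<eta>6 * s n) * c" using ab(4) c0 by (intro mult_right_mono) auto
        finally have "\<bar>r a b\<bar>\<^sup>2 \<le> (c * (\<eta>6 * s n))\<^sup>2" by (intro power_mono) (auto simp: mult.commute)
        then have "1 + (r a b)\<^sup>2 \<le> g" using elim(2) by simp
        then have "(1 + 4 * \<delta>) * (1 + (r a b)\<^sup>2) \<le> g * g" using \<delta> g by (intro mult_mono) auto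
        then show ?thesis by (simp add: g L_def)
      qed
      have m0: "m n > 0" using p3 n by (simp add: m_def)
      have gc: "E n \<in> sets (M n)" "1 - prob (E n) \<le>
          real n * (6 * exp (- (\<nu> n)\<^sup>2 / (8 * real (p n) * c ^ 4)) + normal_tail (\<rho> n / sqrt (2 * real n * tau2)) + 2 * exp (- \<eta>\<^sup>2 * real (n - 1) / 8))
          + (real (p n))\<^sup>2 * (2 * exp (- real n * (5 * s n)\<^sup>2 / 8)) + real (p n) * normal_tail (3 * (s n * sqrt (real n)))
          + (real (p n))\<^sup>2 * (2 * exp (- real n * (\<delta>4 * s n)\<^sup>2 / (2 * L))) / m n"
        unfolding E_def
        by (rule good_complement[OF _ _ nu_tau _ \<eta>(1,2) _ _ m0 _ \<delta>(1,2) _ h L];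
          use elim sn dpos in \<open>auto simp: \<nu>_def \<rho>_def\<close>)+
      have pp: "real (p n) > 0" using p3 by simp
      have t1: "(\<nu> n)\<^sup>2 / (8 * real (p n) * c ^ 4) = sqrt (real n) / (8 * c ^ 4)"
      proof -
        have "(real n powr (1/4))\<^sup>2 = sqrt (real n)" using n by (simp add: powr_power powr_half_sqrt)
        then show ?thesis using pp by (simp add: \<nu>_def power_mult_distrib)
      qed
      have t2: "normal_tail (\<rho> n / sqrt (2 * real n * tau2)) \<le> exp (- (real n powr (1/4)) / (4 * c\<^sup>2))"
      proof -
        \<comment> \<open>A lower bound for \<rho> in standard deviations of a row sum: the extra
          factor n^(1/8) in \<rho> makes the tail decay like exp(-const n^(1/4)).\<close>
        define zz where "zz = real n powr (1/8) / (sqrt 2 * c)"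
        have "sqrt (2 * real n * tau2) \<le> sqrt (2 * real n * (c\<^sup>2 * real (p n)))"
          using tau2_bounds(2) by (intro real_sqrt_le_mono mult_left_mono) auto
        also have "\<dots> = sqrt 2 * sqrt (real n) * c * sqrt (real (p n))" using c0 by (simp add: real_sqrt_mult)
        finally have sq: "sqrt (2 * real n * tau2) \<le> sqrt 2 * sqrt (real n) * c * sqrt (real (p n))" .
        have "zz = \<rho> n / (sqrt 2 * sqrt (real n) * c * sqrt (real (p n)))"
        proof -
          have "real n powr (5/8) = real n powr (1/8) * sqrt (real n)"
            using n by (simp add: powr_half_sqrt[symmetric] powr_add[symmetric])
          then show ?thesis using pp n c0 by (simp add: zz_def \<rho>_def)
        qed
        also have "\<dots> \<le> \<rho> n / sqrt (2 * real n * tau2)"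
          using sq tau2_pos n pp c0 by (intro divide_left_mono mult_pos_pos) (auto simp: \<rho>_def)
        finally have "normal_tail (\<rho> n / sqrt (2 * real n * tau2)) \<le> normal_tail zz" by (rule normal_tail_antimono)
        also have "\<dots> \<le> exp (- zz\<^sup>2 / 2)" by (rule normal_tail_le_exp) (use elim(3) in \<open>simp add: zz_def\<close>)
        also have "- zz\<^sup>2 / 2 = - (real n powr (1/4)) / (4 * c\<^sup>2)"
        proof -
          have "(real n powr (1/8))\<^sup>2 = real n powr (1/4)" using n by (simp add: powr_power)
          then show ?thesis by (simp add: zz_def power_divide power_mult_distrib)
        qed
        finally show ?thesis .
      qed
      have el: "exp (- (k * ln (real (p n)))) = 1 / real (p n) powr k" for k
        using pp by (simp add: powr_def exp_minus inverse_eq_divide)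
      have t5: "(real (p n))\<^sup>2 * (2 * exp (- real n * (5 * s n)\<^sup>2 / 8)) \<le> 2 / real (p n)"
      proof -
        have "- real n * (5 * s n)\<^sup>2 / 8 = - (25 / 8 * (real n * (s n)\<^sup>2))" by (simp add: power_mult_distrib)
        also have "\<dots> \<le> - (3 * ln (real (p n)))" using lp unfolding s2n by simp
        finally have "exp (- real n * (5 * s n)\<^sup>2 / 8) \<le> 1 / real (p n) powr 3" unfolding el[symmetric] by simp
        then have "exp (- real n * (5 * s n)\<^sup>2 / 8) \<le> 1 / real (p n) ^ 3" using pp by (simp add: powr_numeral)
        then have "(real (p n))\<^sup>2 * (2 * exp (- real n * (5 * s n)\<^sup>2 / 8)) \<le> (real (p n))\<^sup>2 * (2 * (1 / real (p n) ^ 3))"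
          by (intro mult_left_mono) auto
        then show ?thesis using pp by (simp add: power2_eq_square power3_eq_cube)
      qed
      have t6: "real (p n) * normal_tail (3 * (s n * sqrt (real n))) \<le> 1 / real (p n)"
      proof -
        define x where "x = 3 * (s n * sqrt (real n))"
        have x2: "x\<^sup>2 = 9 * ln (real (p n))" using s2n by (simp add: x_def power_mult_distrib mult.commute)
        have "1 \<le> x\<^sup>2" using lp by (simp add: x2)
        moreover have "0 \<le> x" using sn by (simp add: x_def)
        ultimately have "1 \<le> x" by (metis abs_of_nonneg abs_square_le_1 abs_square_less_1 not_le)
        then have "normal_tail x \<le> exp (- x\<^sup>2 / 2)" by (rule normal_tail_le_exp)
        also have "\<dots> \<le> exp (- (2 * ln (real (p n))))" using lp by (simp add: x2)
        also have "\<dots> = 1 / real (p n) ^ 2" unfolding el using pp by (simp add: powr_numeral)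
        finally have "real (p n) * normal_tail x \<le> real (p n) * (1 / real (p n) ^ 2)" by (intro mult_left_mono) auto
        then show ?thesis using pp by (simp add: x_def power2_eq_square)
      qed
      \<comment> \<open>The one place where the sharp constant enters: p^2 pairs with probability
        2/p each, divided by m.\<close>
      have t7: "(real (p n))\<^sup>2 * (2 * exp (- real n * (\<delta>4 * s n)\<^sup>2 / (2 * L))) / m n = 2 * real n powr (-\<epsilon> / 2)"
      proof -
        have "- real n * (\<delta>4 * s n)\<^sup>2 / (2 * L) = - (1 * (real n * (s n)\<^sup>2))"
          using dpos by (simp add: L_def power_mult_distrib)
        then have "exp (- real n * (\<delta>4 * s n)\<^sup>2 / (2 * L)) = 1 / real (p n)" unfolding s2n using el[of 1] pp by simp
        then show ?thesis using pp n by (simp add: m_def power2_eq_square powr_minus_divide)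
      qed
      have ip: "2 / real (p n) + 1 / real (p n) \<le> 3 / (c' * real n)"
      proof -
        have "2 / real (p n) + 1 / real (p n) = 3 / real (p n)" by (simp add: add_divide_distrib[symmetric])
        also have "\<dots> \<le> 3 / (c' * real n)" using pn cn pp by (intro divide_left_mono) auto
        finally show ?thesis .
      qed
      have n1: "real (n - 1) = real n - 1" using n by (simp add: of_nat_diff)
      have "real n * (6 * exp (- (\<nu> n)\<^sup>2 / (8 * real (p n) * c ^ 4)) + normal_tail (\<rho> n / sqrt (2 * real n * tau2)) + 2 * exp (- \<eta>\<^sup>2 * real (n - 1) / 8))
        \<le> real n * (6 * exp (- sqrt (real n) / (8 * c ^ 4)) + exp (- (real n powr (1/4)) / (4 * c\<^sup>2)) + 2 * exp (- \<eta>\<^sup>2 * (real n - 1) / 8))"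
        using t1 t2 n1 by (intro mult_left_mono add_mono) auto
      then show ?case using gc t5 t6 t7 ip by linarith
    qed
  qed
  have E0: "(\<lambda>n. 1 - measure (M n) (E n)) \<longlonglongrightarrow> 0"
  proof (rule tendsto_sandwich)
    show "eventually (\<lambda>n. 0 \<le> 1 - measure (M n) (E n)) sequentially"
      using eventually_ge_at_top[of 2]
    proof eventually_elim
      case (elim n)
      interpret normal_model "M n" "p n" n "d n" "G n" "\<sigma> n" "u n" "X n" "\<mu> n" c by (rule nm) (use elim in simp)
      show ?case by simp
    qed
    show "eventually (\<lambda>n. 1 - measure (M n) (E n) \<le>
      real n * (6 * exp (- sqrt (real n) / (8 * c ^ 4)) + exp (- (real n powr (1/4)) / (4 * c\<^sup>2)) + 2 * exp (- \<eta>\<^sup>2 * (real n - 1) / 8))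
      + 3 / (c' * real n) + 2 * real n powr (-\<epsilon> / 2)) sequentially"
      using probE by eventually_elim simp
    have c4: "8 * c ^ 4 > 0" "4 * c\<^sup>2 > 0" "\<eta>\<^sup>2 > 0" using c0 \<eta> by auto
    show "(\<lambda>n. real n * (6 * exp (- sqrt (real n) / (8 * c ^ 4)) + exp (- (real n powr (1/4)) / (4 * c\<^sup>2)) + 2 * exp (- \<eta>\<^sup>2 * (real n - 1) / 8))
      + 3 / (c' * real n) + 2 * real n powr (-\<epsilon> / 2)) \<longlonglongrightarrow> 0"
    proof -
      have "(\<lambda>n. real n * (6 * exp (- sqrt (real n) / k1) + exp (- (real n powr (1/4)) / k2) + 2 * exp (- k3 * (real n - 1) / 8))
        + 3 / (c' * real n) + 2 * real n powr (-\<epsilon> / 2)) \<longlonglongrightarrow> 0" if "k1 > 0" "k2 > 0" "k3 > 0" for k1 k2 k3 :: real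
      proof -
        have "(\<lambda>n. real n * (6 * exp (- sqrt (real n) / k1) + exp (- (real n powr (1/4)) / k2) + 2 * exp (- k3 * (real n - 1) / 8))) \<longlonglongrightarrow> 0"
          using that by real_asymp
        moreover have "(\<lambda>n. 3 / (c' * real n)) \<longlonglongrightarrow> 0" using c'(1) by real_asymp
        moreover have "(\<lambda>n. 2 * real n powr (-\<epsilon> / 2)) \<longlonglongrightarrow> 0" using \<epsilon>(1) by real_asymp
        ultimately show ?thesis using tendsto_add_zero by blast
      qed
      from this[OF c4] show ?thesis .
    qed
  qed simp
  define Y where "Y t n = 4 * ln (real n) - ln (ln (real n)) + t" for t n
  have Ypos: "eventually (\<lambda>n. Y t n > 0) sequentially" for t unfolding Y_def by real_asymp
  \<comment> \<open>Relative accuracy of the thresholded norm at every sample point of the good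
    event, with an error that is a negative power of n.\<close>
  have det: "eventually (\<lambda>n. \<forall>\<omega>\<in>E n. \<bar>centred_data.N2 (p n) (X n \<omega>) \<delta>0 -
      (\<Sum>k<p n. (d n k)\<^sup>2)\<bar> \<le> f n * (\<Sum>k<p n. (d n k)\<^sup>2)) sequentially"
    using base evA evB evw
  proof eventually_elim
    case (elim n)
    interpret normal_model "M n" "p n" n "d n" "G n" "\<sigma> n" "u n" "X n" "\<mu> n" c by (rule nm) (use elim in simp)
    have n: "n \<ge> 2" and lp: "ln (real (p n)) \<ge> 1" and sle: "s n \<le> real n powr (-\<epsilon> / 2)" using elim by auto
    have pn: "c' * real n < real (p n)" by (rule c'(2)[OF n])
    note num = normal_model_numeric[OF c1 c'(1) pn n dims(2) trd_bounds(1) tau2_bounds(1),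
      folded K\<kappa>_def, folded \<nu>_def \<rho>_def \<kappa>_def e_def]
    have \<kappa>n: "0 \<le> \<kappa> n" "\<kappa> n \<le> 1 / 2" using elim Kpos by (auto simp: \<kappa>_def)
    have en: "0 \<le> e n" using c0 by (simp add: e_def)
    have s2: "(s n)\<^sup>2 = ln (real (p n)) / real n" using lp by (simp add: s_def)
    have sn: "0 < s n" "s n \<le> 1" "1 / real n \<le> (s n)\<^sup>2"
    proof -
      show "0 < s n" using lp n by (simp add: s_def)
      show "s n \<le> 1" using elim by simp
      show "1 / real n \<le> (s n)\<^sup>2" unfolding s2 using lp by (intro divide_right_mono) auto
    qed
    show ?case
    proof
      fix \<omega> assume w: "\<omega> \<in> E n"
      note ctx = w[unfolded E_def] c'(1) pn \<eta>(1,2) \<kappa>n en num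
      have B1: "b1 \<le> B_hat (X n \<omega>)"
        using good_B_hat(1)[OF ctx] elim(4) unfolding w_def by linarith
      have B2: "B_hat (X n \<omega>) \<le> b2"
        using good_B_hat(2)[OF ctx] elim(5) unfolding w_def b2_def by linarith
      have B3: "\<delta>1 \<le> \<delta>0 * sqrt (B_hat (X n \<omega>))"
      proof -
        have "\<delta>1 = \<delta>0 * sqrt b1" using dpos by (simp add: b1_def)
        also have "\<dots> \<le> \<delta>0 * sqrt (B_hat (X n \<omega>))" using B1 dpos by (intro mult_left_mono) auto
        finally show ?thesis .
      qed
      have "\<bar>centred_data.N2 (p n) (X n \<omega>) \<delta>0 - tau2\<bar> \<le> real (p n) * Lc * s n powr (2 - \<tau>) + m n * (K * (K + 2 * \<eta>6) * (s n)\<^sup>2)"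
        unfolding Lc_def K_def
        by (rule good_thresholded_norm[OF ctx sn s2 dpos(3) less_imp_le[OF dpos(2)] less_imp_le[OF dpos(1)] \<eta>6(1) refl refl
              _ B3 B2 _ A_def elim(2,3) \<tau> C[OF n]])
          (use B1 b1 elim in auto)
      also have "\<dots> \<le> real (p n) * \<bar>Lc\<bar> * real n powr (-a) + real (p n) * (K * (K + 2 * \<eta>6) * real n powr (-a))"
      proof (rule add_mono)
        have sa: "s n powr (2 - \<tau>) \<le> real n powr (-a)"
        proof -
          have "s n powr (2 - \<tau>) \<le> (real n powr (-\<epsilon> / 2)) powr (2 - \<tau>)" using sle sn \<tau> by (intro powr_mono2) auto
          also have "\<dots> = real n powr (-a)" by (simp add: powr_powr a_def)
          finally show ?thesis .
        qed
        have "real (p n) * Lc * s n powr (2 - \<tau>) \<le> real (p n) * \<bar>Lc\<bar> * s n powr (2 - \<tau>)"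
          by (intro mult_right_mono mult_left_mono) auto
        also have "\<dots> \<le> real (p n) * \<bar>Lc\<bar> * real n powr (-a)" using sa by (intro mult_left_mono) auto
        finally show "real (p n) * Lc * s n powr (2 - \<tau>) \<le> real (p n) * \<bar>Lc\<bar> * real n powr (-a)" .
        have "real n powr (\<epsilon> / 2) * (s n)\<^sup>2 \<le> real n powr (\<epsilon> / 2) * (real n powr (-\<epsilon> / 2))\<^sup>2"
          using sle sn by (intro mult_left_mono power_mono) auto
        also have "\<dots> = real n powr (-\<epsilon> / 2)" using n by (simp add: powr_power powr_add[symmetric])
        also have "\<dots> \<le> real n powr (-a)"
        proof (rule powr_mono)
          show "-\<epsilon> / 2 \<le> - a" using \<epsilon>(1) \<tau> mult_left_mono[of "2 - \<tau>" 1 \<epsilon>] by (simp add: a_def)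
        qed (use n in simp)
        finally have "K * (K + 2 * \<eta>6) * (real n powr (\<epsilon> / 2) * (s n)\<^sup>2) \<le> K * (K + 2 * \<eta>6) * real n powr (-a)"
          by (rule mult_left_mono) (use Kpos \<eta>6 in auto)
        then have "real (p n) * (K * (K + 2 * \<eta>6) * (real n powr (\<epsilon> / 2) * (s n)\<^sup>2)) \<le> real (p n) * (K * (K + 2 * \<eta>6) * real n powr (-a))"
          by (rule mult_left_mono) simp
        then show "m n * (K * (K + 2 * \<eta>6) * (s n)\<^sup>2) \<le> real (p n) * (K * (K + 2 * \<eta>6) * real n powr (-a))"
          by (simp add: m_def mult_ac)
      qed
      also have "\<dots> = f n * (real (p n) / c\<^sup>2)"
        using c0 by (simp add: f_def Kf_def algebra_simps)
      also have "\<dots> \<le> f n * tau2" using tau2_bounds(1) Kpos by (intro mult_left_mono) (auto simp: f_def)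
      finally show "\<bar>centred_data.N2 (p n) (X n \<omega>) \<delta>0 - tau2\<bar> \<le> f n * tau2" .
    qed
  qed
  define NE where "NE t n = measure (M n) (gaussian_columns.no_exceed (M n) (p n) (d n) (G n) (sqrt (Y t n * (\<Sum>k<p n. (d n k)\<^sup>2))) n)" for t n
  have gcn: "gaussian_columns (M n) (p n) n (G n)" if "n \<ge> 2" for n
  proof -
    interpret normal_model "M n" "p n" n "d n" "G n" "\<sigma> n" "u n" "X n" "\<mu> n" c by (rule nm) (use that in simp)
    show ?thesis by unfold_locales
  qed
  have dn: "inverse c \<le> d n k \<and> d n k \<le> c" if "n \<ge> 2" "k < p n" for n k
  proof -
    interpret normal_model "M n" "p n" n "d n" "G n" "\<sigma> n" "u n" "X n" "\<mu> n" c by (rule nm) (use that in simp)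
    show ?thesis by (rule d_bounds) (use that in simp)
  qed
  have NE: "NE t \<longlonglongrightarrow> exp (- (1 / sqrt (8 * pi)) * exp (- t / 2))" for t
    unfolding NE_def[abs_def] Y_def by (rule no_exceed_limit[OF gcn c0 dn c'])
  define PT where "PT n = measure (M n) {\<omega>\<in>space (M n). T_hat \<delta>0 (X n \<omega>) \<le> Y t n}" for n
  have "PT \<longlonglongrightarrow> exp (- (1 / sqrt (8 * pi)) * exp (- t / 2))"
  proof (rule tendsto_sandwich_shift[where F = "\<lambda>t. exp (- (1 / sqrt (8 * pi)) * exp (- t / 2))", OF NE _ E0])
    show "isCont (\<lambda>t. exp (- (1 / sqrt (8 * pi)) * exp (- t / 2))) t" by (intro continuous_intros) auto
    fix \<xi> :: real assume xi: "\<xi> > 0"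
    show "eventually (\<lambda>n. NE (t - \<xi>) n - (1 - measure (M n) (E n)) \<le> PT n) sequentially"
      using base det evf probE Ypos[of "t - \<xi>"] stat_upper_eventually[OF apos xi Kpos(3,2) c0, of t]
    proof eventually_elim
      case (elim n)
      interpret normal_model "M n" "p n" n "d n" "G n" "\<sigma> n" "u n" "X n" "\<mu> n" c by (rule nm) (use elim in simp)
      have n: "n \<ge> 2" using elim by simp
      have pn: "c' * real n < real (p n)" by (rule c'(2)[OF n])
      note num = normal_model_numeric[OF c1 c'(1) pn n dims(2) trd_bounds(1) tau2_bounds(1),
        folded K\<kappa>_def, folded \<nu>_def \<rho>_def \<kappa>_def e_def]
      have \<kappa>n: "0 \<le> \<kappa> n" "\<kappa> n \<le> 1 / 2" using elim Kpos by (auto simp: \<kappa>_def)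
      have en: "0 \<le> e n" using c0 by (simp add: e_def)
      have fn: "0 \<le> f n" "f n \<le> 1 / 2" using elim Kpos by (auto simp: f_def)
      have "prob (no_exceed (sqrt (Y (t - \<xi>) n * tau2)) n) \<le> prob {\<omega>\<in>space (M n). T_hat \<delta>0 (X n \<omega>) \<le> Y t n} + (1 - prob (E n))"
      proof (rule prob_le_intersect_good[OF no_exceed_measurable])
        show "E n \<in> events" using elim by simp
        show "{\<omega>\<in>space (M n). T_hat \<delta>0 (X n \<omega>) \<le> Y t n} \<in> events" using meas[OF n] by measurable
        show "no_exceed (sqrt (Y (t - \<xi>) n * tau2)) n \<inter> E n \<subseteq> {\<omega>\<in>space (M n). T_hat \<delta>0 (X n \<omega>) \<le> Y t n}"
        proof
          fix \<omega> assume w: "\<omega> \<in> no_exceed (sqrt (Y (t - \<xi>) n * tau2)) n \<inter> E n"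
          then have wE: "\<omega> \<in> E n" by blast
          have N: "\<bar>centred_data.N2 (p n) (X n \<omega>) \<delta>0 - tau2\<bar> \<le> f n * tau2" using elim(2) wE by blast
          have "T_hat \<delta>0 (X n \<omega>) \<le> Y t n"
          proof (rule good_T_hat_le[OF wE[unfolded E_def] c'(1) pn \<eta>(1,2) \<kappa>n en num fn N])
            show "\<bar>gram (p n) (d n) (\<lambda>q. G n q \<omega>) a b\<bar> \<le> sqrt (Y (t - \<xi>) n * tau2)" if "a < b" "b < n" for a b
              using w that by (auto simp: no_exceed_def)
            show "0 \<le> Y (t - \<xi>) n" using elim by simp
            show "((1 + \<kappa> n) / (1 - \<kappa> n))\<^sup>2 / (1 - f n) * (sqrt (Y (t - \<xi>) n) + e n)\<^sup>2 \<le> Y t n"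
              using elim(6) by (simp add: Y_def \<kappa>_def f_def e_def)
          qed
          then show "\<omega> \<in> {\<omega>\<in>space (M n). T_hat \<delta>0 (X n \<omega>) \<le> Y t n}"
            using w by (simp add: no_exceed_def)
        qed
      qed
      then show ?case by (simp add: NE_def PT_def)
    qed
    show "eventually (\<lambda>n. PT n \<le> NE (t + \<xi>) n + (1 - measure (M n) (E n))) sequentially"
      using base det evf probE Ypos[of t] stat_lower_eventually[OF apos xi Kpos(3,2) c0, of t]
    proof eventually_elim
      case (elim n)
      interpret normal_model "M n" "p n" n "d n" "G n" "\<sigma> n" "u n" "X n" "\<mu> n" c by (rule nm) (use elim in simp)
      have n: "n \<ge> 2" using elim by simp
      have pn: "c' * real n < real (p n)" by (rule c'(2)[OF n])
      note num = normal_model_numeric[OF c1 c'(1) pn n dims(2) trd_bounds(1) tau2_bounds(1),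
        folded K\<kappa>_def, folded \<nu>_def \<rho>_def \<kappa>_def e_def]
      have \<kappa>n: "0 \<le> \<kappa> n" "\<kappa> n \<le> 1 / 2" using elim Kpos by (auto simp: \<kappa>_def)
      have en: "0 \<le> e n" using c0 by (simp add: e_def)
      have fn: "0 \<le> f n" "f n \<le> 1 / 2" using elim Kpos by (auto simp: f_def)
      have "prob {\<omega>\<in>space (M n). T_hat \<delta>0 (X n \<omega>) \<le> Y t n} \<le> prob (no_exceed (sqrt (Y (t + \<xi>) n * tau2)) n) + (1 - prob (E n))"
      proof (rule prob_le_intersect_good)
        show "no_exceed (sqrt (Y (t + \<xi>) n * tau2)) n \<in> events" by (rule no_exceed_measurable)
        show "E n \<in> events" using elim by simp
        show "{\<omega>\<in>space (M n). T_hat \<delta>0 (X n \<omega>) \<le> Y t n} \<in> events" using meas[OF n] by measurable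
        show "{\<omega>\<in>space (M n). T_hat \<delta>0 (X n \<omega>) \<le> Y t n} \<inter> E n \<subseteq> no_exceed (sqrt (Y (t + \<xi>) n * tau2)) n"
        proof
          fix \<omega> assume w: "\<omega> \<in> {\<omega>\<in>space (M n). T_hat \<delta>0 (X n \<omega>) \<le> Y t n} \<inter> E n"
          then have wE: "\<omega> \<in> E n" and T: "T_hat \<delta>0 (X n \<omega>) \<le> Y t n" by auto
          have N: "\<bar>centred_data.N2 (p n) (X n \<omega>) \<delta>0 - tau2\<bar> \<le> f n * tau2" using elim(2) wE by blast
          have le: "e n + sqrt (Y t n * (1 + f n)) * ((1 + \<kappa> n) / (1 - \<kappa> n)) \<le> sqrt (Y (t + \<xi>) n)"
            using elim(6) by (simp add: Y_def \<kappa>_def f_def e_def)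
          have Y0: "0 \<le> Y t n" using elim by simp
          show "\<omega> \<in> no_exceed (sqrt (Y (t + \<xi>) n * tau2)) n"
            using w good_gram_le[OF wE[unfolded E_def] c'(1) pn \<eta>(1,2) \<kappa>n en num fn N T Y0 le]
            by (simp add: no_exceed_def)
        qed
      qed
      then show ?case by (simp add: NE_def PT_def)
    qed
  qed
  then show ?thesis by (simp add: PT_def[abs_def] Y_def)
qed

section \<open>From the hypotheses on the matrix-normal data to the model\<close>

lemma matrix_normal_model:
  assumes M: "prob_space M" and X: "matrix_normal M p n X \<mu> \<Sigma> \<Psi>"
    and \<Psi>: "\<And>i j. i < n \<Longrightarrow> j < n \<Longrightarrow> \<Psi> $$ (i, j) = (if i = j then 1 else 0)"
    and w: "whitening p (\<lambda>a b. \<Sigma> $$ (a, b)) u d" and d: "\<And>m. m < p \<Longrightarrow> inverse c \<le> d m \<and> d m \<le> c"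
    and dims: "n \<ge> 2" "p \<ge> 1" and c: "c > 0"
  shows "normal_model M p n d (\<lambda>(m, i) \<omega>. (\<Sum>a<p. u m a * (X \<omega> $$ (a, i) - \<mu> a)) / sqrt (d m))
    (\<lambda>a b. \<Sigma> $$ (a, b)) u X \<mu> c"
proof -
  interpret prob_space M by (rule M)
  define G where "G = (\<lambda>(m, i) \<omega>. (\<Sum>a<p. u m a * (X \<omega> $$ (a, i) - \<mu> a)) / sqrt (d m))"
  have u: "orthonormal p p u" using w by (simp add: whitening_def)
  have d0: "d m > 0" if "m < p" for m
  proof -
    have "0 < inverse c" using c by simp
    then show ?thesis using d[OF that] by linarith
  qed
  \<comment> \<open>The eigenvalue d 0 exists as p \<ge> 1 and lies between 1/c and c.\<close>
  have c1: "1 \<le> c"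
  proof (rule power2_le_imp_le[of 1 c])
    have "inverse c \<le> c" using d[of 0] dims by simp
    then show "1\<^sup>2 \<le> c\<^sup>2" using c mult_left_mono[of "inverse c" c c] by (simp add: power2_eq_square)
  qed (use c in simp)
  have "std_gauss ({..<p} \<times> {..<n}) G"
    unfolding G_def
  proof (rule whitened_std_gauss[where Y = "\<lambda>q \<omega>. X \<omega> $$ q", OF _ _ _ u d0])
    show "jointly_gaussian M ({..<p} \<times> {..<n}) (\<lambda>q \<omega>. X \<omega> $$ q)" using X by (simp add: matrix_normal_def)
    show "expectation (\<lambda>\<omega>. X \<omega> $$ (k, i)) = \<mu> k" if "k < p" "i < n" for k i
      using X that by (simp add: matrix_normal_def)
    show "covariance M (\<lambda>\<omega>. X \<omega> $$ (k, i)) (\<lambda>\<omega>. X \<omega> $$ (l, j)) = (if i = j then \<Sum>m<p. d m * u m k * u m l else 0)"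
      if "k < p" "l < p" "i < n" "j < n" for k l i j
    proof -
      have "covariance M (\<lambda>\<omega>. X \<omega> $$ (k, i)) (\<lambda>\<omega>. X \<omega> $$ (l, j)) = \<Psi> $$ (i, j) * \<Sigma> $$ (k, l)"
        using X that unfolding matrix_normal_def by blast
      then show ?thesis using w that by (simp add: \<Psi> whitening_def)
    qed
  qed
  then have "normal_model M p n d G (\<lambda>a b. \<Sigma> $$ (a, b)) u X \<mu> c"
  proof unfold_locales
    fix \<omega> a i assume w: "\<omega> \<in> space M" "a < p" "i < n"
    have "(\<Sum>m<p. sqrt (d m) * u m a * G (m, i) \<omega>) = (\<Sum>m<p. u m a * (\<Sum>b<p. u m b * (X \<omega> $$ (b, i) - \<mu> b)))"
    proof (intro sum.cong refl)
      fix m assume "m \<in> {..<p}"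
      then have "sqrt (d m) \<noteq> 0" using d0[of m] by simp
      then show "sqrt (d m) * u m a * G (m, i) \<omega> = u m a * (\<Sum>b<p. u m b * (X \<omega> $$ (b, i) - \<mu> b))" by (simp add: G_def)
    qed
    then show "X \<omega> $$ (a, i) = \<mu> a + (\<Sum>m<p. sqrt (d m) * u m a * G (m, i) \<omega>)"
      using orthonormal_expand[OF u w(2), of "\<lambda>b. X \<omega> $$ (b, i) - \<mu> b"] by simp
  next
    fix \<omega> assume "\<omega> \<in> space M" then show "X \<omega> \<in> carrier_mat p n" using X by (simp add: matrix_normal_def)
  qed (use w c1 d dims in auto)
  then show ?thesis by (simp add: G_def)
qed

lemma (in normal_model) X_entry_measurable: "a < p \<Longrightarrow> i < n \<Longrightarrow> (\<lambda>\<omega>. X \<omega> $$ (a, i)) \<in> borel_measurable M"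
proof (subst measurable_cong)
  assume ai: "a < p" "i < n"
  show "X \<omega> $$ (a, i) = \<mu> a + (\<Sum>m<p. sqrt (d m) * u m a * G (m, i) \<omega>)" if "\<omega> \<in> space M" for \<omega>
    by (rule X_entry[OF that ai])
  show "(\<lambda>\<omega>. \<mu> a + (\<Sum>m<p. sqrt (d m) * u m a * G (m, i) \<omega>)) \<in> borel_measurable M"
    using ai by (intro borel_measurable_add borel_measurable_sum borel_measurable_times borel_measurable_const G_measurable) auto
qed

theorem theorem2p4:
  fixes M :: "nat \<Rightarrow> 'w measure"
    and X :: "nat \<Rightarrow> 'w \<Rightarrow> real mat"
    and p :: "nat \<Rightarrow> nat"
    and \<mu> :: "nat \<Rightarrow> nat \<Rightarrow> real"
    and \<Sigma> \<Psi> :: "nat \<Rightarrow> real mat"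
    and \<tau> \<epsilon> \<delta>\<^sub>0 t :: real
  assumes "\<And>n. n \<ge> 2 \<Longrightarrow> prob_space (M n)"
    and "\<And>n. n \<ge> 2 \<Longrightarrow> covariance_matrix (p n) (\<Sigma> n)"
    and "\<And>n. n \<ge> 2 \<Longrightarrow> covariance_matrix n (\<Psi> n)"
    and "\<And>n i. n \<ge> 2 \<Longrightarrow> i < n \<Longrightarrow> \<Psi> n $$ (i, i) = 1"
    and "\<And>n. n \<ge> 2 \<Longrightarrow> matrix_normal (M n) (p n) n (X n) (\<mu> n) (\<Sigma> n) (\<Psi> n)"
    and C1: "\<exists>c>0. \<forall>n\<ge>2.
        inverse c \<le> lambda_min (\<Sigma> n) \<and> lambda_min (\<Sigma> n) \<le> lambda_max (\<Sigma> n) \<and> lambda_max (\<Sigma> n) \<le> c \<and>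
        inverse c \<le> lambda_min (\<Psi> n) \<and> lambda_min (\<Psi> n) \<le> lambda_max (\<Psi> n) \<and> lambda_max (\<Psi> n) \<le> c"
    and C2: "0 < \<tau>" "\<tau> < 2"
      "\<exists>C. \<forall>n\<ge>2. (\<forall>i<n. (\<Sum>k<n. \<bar>\<Psi> n $$ (i, k)\<bar> powr \<tau>) \<le> C) \<and>
                   (\<forall>j<p n. (\<Sum>k<p n. \<bar>\<Sigma> n $$ (j, k)\<bar> powr \<tau>) \<le> C)"
    and C3: "\<exists>c>0. \<forall>n\<ge>2. real (p n) > c * real n"
      "0 < \<epsilon>"
      "(\<lambda>n. ln (real (p n))) \<in> o(\<lambda>n. real n powr min (1 - \<epsilon>) (2 / \<tau> - 1))"
    and "\<delta>\<^sub>0 > sqrt 2"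
    and H0: "\<And>n i j. n \<ge> 2 \<Longrightarrow> i < j \<Longrightarrow> j < n \<Longrightarrow> \<Psi> n $$ (i, j) = 0"
  shows "(\<lambda>n. \<P>(\<omega> in M n. T_hat \<delta>\<^sub>0 (X n \<omega>) - 4 * ln (real n) + ln (ln (real n)) \<le> t))
           \<longlonglongrightarrow> exp (- (1 / sqrt (8 * pi)) * exp (- t / 2))"
proof -
  obtain c where c: "c > 0" and cb: "\<And>n. n \<ge> 2 \<Longrightarrow> inverse c \<le> lambda_min (\<Sigma> n) \<and> lambda_max (\<Sigma> n) \<le> c"
    using C1 by blast
  obtain c' where c': "c' > 0" "\<And>n. n \<ge> 2 \<Longrightarrow> c' * real n < real (p n)" using C3(1) by blast
  obtain C where C: "\<And>n j. n \<ge> 2 \<Longrightarrow> j < p n \<Longrightarrow> (\<Sum>k<p n. \<bar>\<Sigma> n $$ (j, k)\<bar> powr \<tau>) \<le> C" using C2(3) by blast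
  have pn: "p n \<ge> 1" if n: "n \<ge> 2" for n
  proof -
    have "0 < c' * real n" using c'(1) n by simp
    then have "0 < real (p n)" using c'(2)[OF n] by linarith
    then show ?thesis by simp
  qed
  have "\<exists>ud. n \<ge> 2 \<longrightarrow> whitening (p n) (\<lambda>a b. \<Sigma> n $$ (a, b)) (fst ud) (snd ud) \<and>
      (\<forall>m<p n. inverse c \<le> snd ud m \<and> snd ud m \<le> c)" for n
  proof (cases "n \<ge> 2")
    case True
    show ?thesis
    proof (rule whitening_exists[OF assms(2)[OF True]])
      fix u d assume "whitening (p n) (\<lambda>a b. \<Sigma> n $$ (a, b)) u d"
        and "\<And>m. m < p n \<Longrightarrow> lambda_min (\<Sigma> n) \<le> d m \<and> d m \<le> lambda_max (\<Sigma> n)"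
      then show ?thesis using cb[OF True] by (intro exI[of _ "(u, d)"]) (auto intro: order_trans)
    qed
  qed simp
  then obtain ud where ud: "\<And>n. n \<ge> 2 \<longrightarrow> whitening (p n) (\<lambda>a b. \<Sigma> n $$ (a, b)) (fst (ud n)) (snd (ud n)) \<and>
      (\<forall>m<p n. inverse c \<le> snd (ud n) m \<and> snd (ud n) m \<le> c)" by metis
  define u where "u n = fst (ud n)" for n
  define d where "d n = snd (ud n)" for n
  have w: "whitening (p n) (\<lambda>a b. \<Sigma> n $$ (a, b)) (u n) (d n)" if "n \<ge> 2" for n
    using ud[of n] that by (simp add: u_def d_def)
  have d: "inverse c \<le> d n m \<and> d n m \<le> c" if "n \<ge> 2" "m < p n" for n m
    using ud[of n] that by (simp add: d_def)
  define G where "G n = (\<lambda>(m, i) \<omega>. (\<Sum>a<p n. u n m a * (X n \<omega> $$ (a, i) - \<mu> n a)) / sqrt (d n m))" for n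
  \<comment> \<open>The null hypothesis gives the entries above the diagonal and symmetry those
    below, so the matrix is the identity and the columns are independent.\<close>
  have \<Psi>: "\<Psi> n $$ (i, j) = (if i = j then 1 else 0)" if n: "n \<ge> 2" and ij: "i < n" "j < n" for n i j
  proof -
    have carr: "\<Psi> n \<in> carrier_mat n n" and tr: "transpose_mat (\<Psi> n) = \<Psi> n"
      using assms(3)[OF n] by (auto simp: covariance_matrix_def)
    have "\<Psi> n $$ (i, j) = \<Psi> n $$ (j, i)" using arg_cong[OF tr, of "\<lambda>A. A $$ (i, j)"] ij carr by simp
    then show ?thesis using assms(4)[OF n ij(1)] H0[OF n, of i j] H0[OF n, of j i] ij by (cases i j rule: linorder_cases) auto
  qed
  have nm: "normal_model (M n) (p n) n (d n) (G n) (\<lambda>a b. \<Sigma> n $$ (a, b)) (u n) (X n) (\<mu> n) c" if n: "n \<ge> 2" for n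
    unfolding G_def using matrix_normal_model[OF assms(1)[OF n] assms(5)[OF n] \<Psi>[OF n] w[OF n] d[OF n] n pn[OF n] c] by simp
  \<comment> \<open>The estimate for kept entries that are not tiny uses 1 - \<tau> \<le> 0, so a
    smaller exponent is raised to 1. As entries are at most c in modulus, this costs the factor
    c^(\<tau>1 - \<tau>) in the row sums.\<close>
  define \<tau>1 where "\<tau>1 = max \<tau> 1"
  have \<tau>1: "1 \<le> \<tau>1" "\<tau>1 < 2" "\<tau> \<le> \<tau>1" using C2(2) by (auto simp: \<tau>1_def)
  have C': "(\<Sum>b<p n. \<bar>\<Sigma> n $$ (a, b)\<bar> powr \<tau>1) \<le> c powr (\<tau>1 - \<tau>) * C" if n: "n \<ge> 2" and a: "a < p n" for n a
  proof -
    interpret normal_model "M n" "p n" n "d n" "G n" "\<lambda>a b. \<Sigma> n $$ (a, b)" "u n" "X n" "\<mu> n" c by (rule nm[OF n])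
    have "\<bar>\<Sigma> n $$ (a, b)\<bar> powr \<tau>1 \<le> c powr (\<tau>1 - \<tau>) * \<bar>\<Sigma> n $$ (a, b)\<bar> powr \<tau>" if b: "b < p n" for b
    proof -
      have "\<bar>\<Sigma> n $$ (a, b)\<bar> powr \<tau>1 = \<bar>\<Sigma> n $$ (a, b)\<bar> powr (\<tau>1 - \<tau>) * \<bar>\<Sigma> n $$ (a, b)\<bar> powr \<tau>"
        by (simp add: powr_add[symmetric])
      also have "\<dots> \<le> c powr (\<tau>1 - \<tau>) * \<bar>\<Sigma> n $$ (a, b)\<bar> powr \<tau>"
        using sigma_abs_le[OF a b] \<tau>1 by (intro mult_right_mono powr_mono2) auto
      finally show ?thesis .
    qed
    then have "(\<Sum>b<p n. \<bar>\<Sigma> n $$ (a, b)\<bar> powr \<tau>1) \<le> (\<Sum>b<p n. c powr (\<tau>1 - \<tau>) * \<bar>\<Sigma> n $$ (a, b)\<bar> powr \<tau>)"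
      by (intro sum_mono) simp
    also have "\<dots> \<le> c powr (\<tau>1 - \<tau>) * C"
      unfolding sum_distrib_left[symmetric] using C[OF n a] by (intro mult_left_mono) auto
    finally show ?thesis .
  qed
  \<comment> \<open>Little-o with constant 1: ln p is eventually at most the comparison power, hence
    at most n^(1-\<epsilon>), so s^2 = ln p / n \<le> n^(-\<epsilon>).\<close>
  have "eventually (\<lambda>n. norm (ln (real (p n))) \<le> 1 * norm (real n powr min (1 - \<epsilon>) (2 / \<tau> - 1))) sequentially"
    by (rule landau_o.smallD[OF C3(3)]) simp
  then have ev: "eventually (\<lambda>n. ln (real (p n)) / real n \<le> real n powr (-\<epsilon>)) sequentially"
    using eventually_ge_at_top[of 1]
  proof eventually_elim
    case (elim n)
    have "ln (real (p n)) \<le> real n powr min (1 - \<epsilon>) (2 / \<tau> - 1)" using elim by simp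
    also have "\<dots> \<le> real n powr (1 - \<epsilon>)" using elim by (intro powr_mono) auto
    finally have "ln (real (p n)) / real n \<le> real n powr (1 - \<epsilon>) / real n" by (intro divide_right_mono) auto
    also have "\<dots> = real n powr (-\<epsilon>)" using elim powr_diff[of "real n" "1 - \<epsilon>" 1] by simp
    finally show ?case .
  qed
  have meas: "(\<lambda>\<omega>. T_hat \<delta>\<^sub>0 (X n \<omega>)) \<in> borel_measurable (M n)" if n: "n \<ge> 2" for n
  proof -
    interpret normal_model "M n" "p n" n "d n" "G n" "\<lambda>a b. \<Sigma> n $$ (a, b)" "u n" "X n" "\<mu> n" c by (rule nm[OF n])
    show ?thesis by (rule T_hat_measurable[OF X_carrier X_entry_measurable])
  qed
  have "{\<omega>\<in>space (M n). T_hat \<delta>\<^sub>0 (X n \<omega>) - 4 * ln (real n) + ln (ln (real n)) \<le> t} =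
      {\<omega>\<in>space (M n). T_hat \<delta>\<^sub>0 (X n \<omega>) \<le> 4 * ln (real n) - ln (ln (real n)) + t}" for n by auto
  then show ?thesis
    using T_hat_limit_model[OF nm c' \<tau>1(1,2) C' C3(2) ev \<open>\<delta>\<^sub>0 > sqrt 2\<close> meas, of t] by simp
qed

end
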